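(* Let $X$ be a smooth projective variety over an algebraically closed field $k$ (or over $\mathbb{C}$), $D$ a normal crossing divisor on $X$ with smooth components, $\mathcal{E}$ a vector bundle on $X$, and $\nabla:\mathcal{E}\to\mathcal{E}\otimes\Omega^1_X(\log D)$ an integrable logarithmic connection on $\mathcal{E}$. Let $\mathcal{L}^\bullet=(\mathcal{E}nd(\mathcal{E})\otimes\Omega^\bullet_X(\log D),\nabla_{\mathcal{E}nd(\mathcal{E})})$ be the logarithmic de Rham complex associated to $\mathcal{E}nd(\mathcal{E})$, let $W=\mathbb{H}^1(X,\mathcal{L}^\bullet)$, let $(\delta_1,\dots,\delta_N)$ be a basis of $W$ and $(t_1,\dots,t_N)$ the dual coordinates on $W$. For $m\ge1$ let $W_m=\operatorname{Spec}k[t_1,\dots,t_N]/(t_1,\dots,t_N)^{m+1}$ be the $m$-th infinitesimal neighborhood of $0$ in $W$, and let $(\mathcal{E}_1,\nabla_1)$ be the universal first order deformation of $(\mathcal{E},\nabla)$ over $X\times W_1$ in the class of integrable logarithmic connections with fixed divisor of poles $D$. Then there exists a formal power series $$f(t_1,\dots,t_N)=\sum_{m=2}^{\infty}f_m(t_1,\dots,t_N)\in\mathbb{H}^2(X,\mathcal{L}^\bullet)[[t_1,\dots,t_N]],$$ where $f_m$ is homogeneous of degree $m$ ($m\ge2$), with the following property. Let $I$ be the ideal of $k[[t_1,\dots,t_N]]$ generated by the image of the map $f^*:\mathbb{H}^2(X,\mathcal{L}^\bullet)^*\to k[[t_1,\dots,t_N]]$ adjoint to $f$. Then for every $m\ge2$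 the pair $(\mathcal{E}_1,\nabla_1)$ extends to an integrable logarithmic connection $(\mathcal{E}_m,\nabla_m)$ on $X\times V_m$, where $V_m$ is the closed subscheme of $W_m$ defined by the ideal $I\otimes k[[t_1,\dots,t_N]]/(t_1,\dots,t_N)^{m+1}$, i.e. the image of $I$ in $k[t_1,\dots,t_N]/(t_1,\dots,t_N)^{m+1}$.
   Context: An integrable logarithmic connection on $\mathcal{E}$ is a $k$-linear map $\nabla:\mathcal{E}\to\mathcal{E}\otimes\Omega^1_X(\log D)$ satisfying $\nabla(fs)=f\nabla s+s\otimes df$ and $\nabla^2=0$ (with $\nabla$ extended to $\mathcal{E}\otimes\Omega^i_X(\log D)$ by $\nabla(s\otimes\omega)=\nabla s\wedge\omega+s\otimes d\omega$). The induced connection on $\mathcal{E}nd(\mathcal{E})$ is $\nabla_{\mathcal{E}nd(\mathcal{E})}(\phi)=\nabla\circ\phi-\phi\circ\nabla$, extended in the same way to $\mathcal{E}nd(\mathcal{E})\otimes\Omega^\bullet_X(\log D)$. $\mathbb{H}^i$ denotes hypercohomology, computed as the cohomology of the total complex of the Čech double complex $(\check{C}^p(\mathfrak{U},K^q),\check d,(-1)^pd_K)$ of a sufficiently fine open covering $\mathfrak{U}=(U_\alpha)$. For a finite local scheme $V$ over $k$ with residue field $k$, an integrable logarithmic connection on $X\times V$ (with fixed divisor of poles $D$) is a vector bundle $\mathcal{E}_V$ on $X\times V$ with an $\mathcal{O}_V$-linear map $\nabla_V:\mathcal{E}_V\to\mathcal{E}_V\otimes\mathrm{pr}_1^*\Omega^1_X(\log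 D)$ satisfying the Leibniz rule (relative differential over $V$) and $\nabla_V^2=0$. "Extends" means that the restriction to $X\times W_1$ is isomorphic to $(\mathcal{E}_1,\nabla_1)$ (note $W_1\subset V_m$ since $f$ has no terms of degree $<2$). A 1-cocycle of $\mathcal{L}^\bullet$ is a pair $(a,\mathcal{A})$, $a=(a_{\alpha\beta})\in\check{C}^1(\mathfrak{U},\mathcal{E}nd(\mathcal{E}))$, $\mathcal{A}=(\mathcal{A}_\alpha)\in\check{C}^0(\mathfrak{U},\mathcal{E}nd(\mathcal{E})\otimes\Omega^1_X(\log D))$ with $\check d a=0$, $\mathcal{A}_\beta-\mathcal{A}_\alpha=\nabla_{\mathcal{E}nd(\mathcal{E})}(a_{\alpha\beta})$ and $\nabla_{\mathcal{E}nd(\mathcal{E})}(\mathcal{A}_\alpha)=0$. Universal first order deformation: choose cocycles $(a^{(i)},\mathcal{A}^{(i)})$ representing $\delta_i$; $(\mathcal{E}_1,\nabla_1)$ is obtained by gluing the pullbacks of $(\mathcal{E}|_{U_\alpha},\nabla+\sum_i t_i\mathcal{A}^{(i)}_\alpha)$ to $U_\alpha\times W_1$ along $U_{\alpha\beta}\times W_1$ by the automorphisms $1+\sum_i t_ia^{(i)}_{\alpha\beta}$ (from the $\beta$-chart to the $\alpha$-chart). The adjoint map $f^*$ sends a linear form $\ell$ on $\mathbb{H}^2(X,\mathcal{L}^\bullet)$ to $\ell(f)$ (applied coefficientwise). *)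

theory Defs
  imports
    "HOL-Library.Poly_Mapping"
    "HOL-Library.Function_Algebras"
    "HOL-Library.Set_Algebras"
    "HOL-Computational_Algebra.Polynomial"
begin

text \<open>
  All sheaves below are subsheaves of constant sheaves. On a variety \<open>X\<close> with function field
  \<open>K\<close>, a locally free sheaf of rank \<open>r\<close> embeds into its generic stalk \<open>K\<^sup>r\<close>, so it is given by
  its stalks at the closed points of \<open>X\<close>, which are lattices in \<open>K\<^sup>r\<close>; its sections over a nonempty
  open \<open>U\<close> form the intersection of the stalks at the points of \<open>U\<close>. The same holds on
  \<open>X \<times> Spec A\<close> for a finite local \<open>k\<close>-algebra \<open>A\<close> with residue field \<open>k\<close>: its generic local ring
  is \<open>K \<otimes> A\<close>, over which the generic stalk of a vector bundle is free. Sums, zeros and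
  differences of functions (sections, forms, matrices, cochains) are pointwise.
\<close>

section \<open>Projective varieties\<close>

type_synonym 'a mpoly = "(nat \<Rightarrow>\<^sub>0 nat) \<Rightarrow>\<^sub>0 'a"

definition mdeg :: "(nat \<Rightarrow>\<^sub>0 nat) \<Rightarrow> nat" where
  "mdeg c = (\<Sum>i\<in>Poly_Mapping.keys c. Poly_Mapping.lookup c i)"

definition peval :: "('k::zero \<Rightarrow> 'f::comm_ring_1) \<Rightarrow> (nat \<Rightarrow> 'f) \<Rightarrow> 'k mpoly \<Rightarrow> 'f" where
  "peval h x P = (\<Sum>c\<in>Poly_Mapping.keys P. h (Poly_Mapping.lookup P c) * (\<Prod>i\<in>Poly_Mapping.keys c. x i ^ Poly_Mapping.lookup c i))"

definition homog :: "nat \<Rightarrow> nat \<Rightarrow> 'k::zero mpoly set" where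
  "homog n d = {F. \<forall>c\<in>Poly_Mapping.keys F. mdeg c = d \<and> Poly_Mapping.keys c \<subseteq> {..n}}"

text \<open>
  A point of \<open>P\<^sup>n\<close> is represented by all its vectors of homogeneous coordinates
  \<open>(p 0, \<dots>, p n)\<close>; subsets defined by homogeneous polynomials are stable under rescaling, and
  everything attached to a point below depends on the line only.
\<close>

definition pspace :: "nat \<Rightarrow> (nat \<Rightarrow> 'k::field) set" where
  "pspace n = {p. p \<noteq> 0 \<and> (\<forall>i>n. p i = 0)}"

definition zero_locus :: "nat \<Rightarrow> 'k::field mpoly set \<Rightarrow> (nat \<Rightarrow> 'k) set" where
  "zero_locus n T = {p \<in> pspace n. \<forall>F\<in>T. peval id p F = 0}"

definition zclosed :: "nat \<Rightarrow> (nat \<Rightarrow> 'k::field) set \<Rightarrow> bool" where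
  "zclosed n Z \<longleftrightarrow> (\<exists>T \<subseteq> (\<Union>d. homog n d). Z = zero_locus n T)"

definition zirreducible :: "nat \<Rightarrow> (nat \<Rightarrow> 'k::field) set \<Rightarrow> bool" where
  "zirreducible n Z \<longleftrightarrow> Z \<noteq> {} \<and>
     (\<forall>Z1 Z2. zclosed n Z1 \<and> zclosed n Z2 \<and> Z \<subseteq> Z1 \<union> Z2 \<longrightarrow> Z \<subseteq> Z1 \<or> Z \<subseteq> Z2)"

definition zdim :: "nat \<Rightarrow> (nat \<Rightarrow> 'k::field) set \<Rightarrow> nat" where
  "zdim n X = (GREATEST d. \<exists>Z :: nat \<Rightarrow> (nat \<Rightarrow> 'k) set.
     (\<forall>i\<le>d. zclosed n (Z i) \<and> zirreducible n (Z i) \<and> Z i \<subseteq> X) \<and> (\<forall>i<d. Z i \<subset> Z (Suc i)))"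

text \<open>
  A projective variety \<open>X \<subseteq> P\<^sup>n\<close> together with its function field: the field \<open>'f\<close>, as an extension
  of \<open>'k\<close> by \<open>emb\<close>, and homogeneous coordinates \<open>gen\<close> of the generic point of \<open>X\<close> in \<open>'f\<close>.
  The two conditions on \<open>gen\<close> say that \<open>'f\<close> is the field of fractions \<open>F/G\<close> of homogeneous
  elements of the same degree of the homogeneous coordinate ring of \<open>X\<close>.
\<close>

record ('k, 'f) pvariety =
  amb :: nat
  points :: "(nat \<Rightarrow> 'k) set"
  emb :: "'k \<Rightarrow> 'f"
  gen :: "nat \<Rightarrow> 'f"

definition projective_variety :: "('k::field, 'f::field) pvariety \<Rightarrow> bool" where
  "projective_variety X \<longleftrightarrow>
     zclosed (amb X) (points X) \<and> zirreducible (amb X) (points X) \<and>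
     emb X 1 = 1 \<and> (\<forall>a b. emb X (a + b) = emb X a + emb X b) \<and>
     (\<forall>a b. emb X (a * b) = emb X a * emb X b) \<and>
     (\<forall>d. \<forall>F\<in>homog (amb X) d.
        peval (emb X) (gen X) F = 0 \<longleftrightarrow> (\<forall>p\<in>points X. peval id p F = 0)) \<and>
     (\<forall>g. \<exists>d. \<exists>F\<in>homog (amb X) d. \<exists>G\<in>homog (amb X) d.
        peval (emb X) (gen X) G \<noteq> 0 \<and>
        g = peval (emb X) (gen X) F / peval (emb X) (gen X) G)"

definition zopen :: "('k::field, 'f::field) pvariety \<Rightarrow> (nat \<Rightarrow> 'k) set \<Rightarrow> bool" where
  "zopen X U \<longleftrightarrow> U \<noteq> {} \<and> (\<exists>Z. zclosed (amb X) Z \<and> U = points X - Z)"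

definition local_ring :: "('k::field, 'f::field) pvariety \<Rightarrow> (nat \<Rightarrow> 'k) \<Rightarrow> 'f set" where
  "local_ring X p = {peval (emb X) (gen X) F / peval (emb X) (gen X) G | F G.
     \<exists>d. F \<in> homog (amb X) d \<and> G \<in> homog (amb X) d \<and> peval id p G \<noteq> 0}"

text \<open>The ideal of \<open>Z\<close> in the local ring at \<open>p\<close>; for \<open>Z = {p}\<close> this is the maximal ideal.\<close>

definition local_ideal ::
    "('k::field, 'f::field) pvariety \<Rightarrow> (nat \<Rightarrow> 'k) set \<Rightarrow> (nat \<Rightarrow> 'k) \<Rightarrow> 'f set" where
  "local_ideal X Z p = {peval (emb X) (gen X) F / peval (emb X) (gen X) G | F G.
     \<exists>d. F \<in> homog (amb X) d \<and> G \<in> homog (amb X) d \<and> peval id p G \<noteq> 0 \<and>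
         (\<forall>q\<in>Z. peval id q F = 0)}"

text \<open>\<open>z 0, \<dots>, z (dim X - 1)\<close> generate the maximal ideal at the closed point \<open>p\<close>.\<close>

definition regular_params ::
    "('k::field, 'f::field) pvariety \<Rightarrow> (nat \<Rightarrow> 'k) \<Rightarrow> (nat \<Rightarrow> 'f) \<Rightarrow> bool" where
  "regular_params X p z \<longleftrightarrow>
     local_ideal X {p} p =
       {\<Sum>j<zdim (amb X) (points X). c j * z j | c. \<forall>j. c j \<in> local_ring X p}"

text \<open>Smoothness over an algebraically closed field is regularity at the closed points.\<close>

definition smooth :: "('k::field, 'f::field) pvariety \<Rightarrow> bool" where
  "smooth X \<longleftrightarrow> (\<forall>p\<in>points X. \<exists>z. regular_params X p z)"

definition local_equation ::
    "('k::field, 'f::field) pvariety \<Rightarrow> (nat \<Rightarrow> 'k) set \<Rightarrow> (nat \<Rightarrow> 'k) \<Rightarrow> 'f \<Rightarrow> bool" where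
  "local_equation X Z p z \<longleftrightarrow> local_ideal X Z p = {c * z | c. c \<in> local_ring X p}"

text \<open>
  A (reduced) divisor is the finite set of its irreducible components. It has normal crossings and
  smooth components iff at every point the components through that point have local equations
  that form part of a regular system of parameters.
\<close>

definition snc_divisor ::
    "('k::field, 'f::field) pvariety \<Rightarrow> (nat \<Rightarrow> 'k) set set \<Rightarrow> bool" where
  "snc_divisor X D \<longleftrightarrow> finite D \<and>
     (\<forall>Z\<in>D. zclosed (amb X) Z \<and> zirreducible (amb X) Z \<and> Z \<subseteq> points X \<and>
             Suc (zdim (amb X) Z) = zdim (amb X) (points X)) \<and>
     (\<forall>p\<in>points X. \<exists>z j. regular_params X p z \<and> inj_on j {Z\<in>D. p \<in> Z} \<and>
        (\<forall>Z\<in>D. p \<in> Z \<longrightarrow> j Z < zdim (amb X) (points X) \<and> local_equation X Z p (z (j Z))))"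

section \<open>Differential forms\<close>

definition derivations :: "('k \<Rightarrow> 'f::field) \<Rightarrow> ('f \<Rightarrow> 'f) set" where
  "derivations h = {v. (\<forall>a b. v (a + b) = v a + v b) \<and>
     (\<forall>a b. v (a * b) = a * v b + v a * b) \<and> (\<forall>c. v (h c) = 0)}"

text \<open>
  The rational forms \<open>\<Lambda>\<^sup>q \<Omega>\<^sub>K\<^sub>/\<^sub>k\<close> are identified with the alternating \<open>q\<close>-linear functions
  on derivations of \<open>K\<close> over \<open>k\<close> (\<open>\<Omega>\<^sub>K\<^sub>/\<^sub>k\<close> is a finite-dimensional vector space and the derivations
  form its dual), and the relative rational forms on \<open>X \<times> Spec A\<close> over \<open>A\<close> with those having values
  in \<open>K \<otimes> A\<close>. A form takes the list of its arguments, and is zero on lists that do not consist of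
  \<open>q\<close> derivations.

  Both \<open>X\<close> and \<open>X \<times> Spec A\<close> are given by the following data, with values in a ring \<open>'r\<close>: for \<open>X\<close> it
  is \<open>K\<close>; for \<open>A = k[t]/J\<close> it is \<open>K[t]\<close>, and \<open>K \<otimes> A\<close> is the quotient of \<open>K[t]\<close> by the ideal
  \<open>nul = J K[t]\<close>. Equality of sections or forms is therefore congruence modulo \<open>nul\<close>.
  \<open>lift\<close> is the action of derivations of \<open>K\<close> on \<open>'r\<close>, \<open>base\<close> the ring of relative constants,
  \<open>stalk\<close> the local rings, and \<open>logeq\<close> the local equations of the components of \<open>D\<close> at a point.
\<close>

type_synonym ('f, 'r) dform = "('f \<Rightarrow> 'f) list \<Rightarrow> 'r"

record ('p, 'f, 'r) space =
  pts :: "'p set"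
  opens :: "'p set set"
  ders :: "('f \<Rightarrow> 'f) set"
  lift :: "('f \<Rightarrow> 'f) \<Rightarrow> 'r \<Rightarrow> 'r"
  base :: "'r set"
  nul :: "'r set"
  stalk :: "'p \<Rightarrow> 'r set"
  logeq :: "'p \<Rightarrow> 'r set"

definition log_space ::
    "('k::field, 'f::field) pvariety \<Rightarrow> (nat \<Rightarrow> 'k) set set \<Rightarrow> (nat \<Rightarrow> 'k, 'f, 'f) space" where
  "log_space X D = \<lparr>
     pts = points X,
     opens = Collect (zopen X),
     ders = derivations (emb X),
     lift = (\<lambda>v. v),
     base = range (emb X),
     nul = {0},
     stalk = local_ring X,
     logeq = (\<lambda>p. {z. \<exists>Z\<in>D. p \<in> Z \<and> local_equation X Z p z}) \<rparr>"

text \<open>\<open>X \<times> Spec (k[t]/J)\<close> with the log structure pulled back from \<open>X\<close>.\<close>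

definition log_space_times ::
    "('k::field, 'f::field) pvariety \<Rightarrow> (nat \<Rightarrow> 'k) set set \<Rightarrow> 'k mpoly set
      \<Rightarrow> (nat \<Rightarrow> 'k, 'f, 'f mpoly) space" where
  "log_space_times X D J = \<lparr>
     pts = points X,
     opens = Collect (zopen X),
     ders = derivations (emb X),
     lift = Poly_Mapping.map,
     base = range (Poly_Mapping.map (emb X)),
     nul = {\<Sum>j\<in>T. h j * Poly_Mapping.map (emb X) j | T h. finite T \<and> T \<subseteq> J},
     stalk = (\<lambda>p. {P. \<forall>c. Poly_Mapping.lookup P c \<in> local_ring X p}),
     logeq = (\<lambda>p. Poly_Mapping.single 0 ` logeq (log_space X D) p) \<rparr>"

definition fn_form :: "'r::zero \<Rightarrow> ('f, 'r) dform" where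
  "fn_form a = (\<lambda>vs. if vs = [] then a else 0)"

text \<open>
  The recursion is the antiderivation rule
  \<open>\<iota>\<^sub>v (a \<and> b) = \<iota>\<^sub>v a \<and> b + (-1)\<^sup>q a \<and> \<iota>\<^sub>v b\<close>, \<open>q = deg a\<close>, for the contraction
  \<open>\<iota>\<^sub>v a = (\<lambda>us. a (v # us))\<close>.
\<close>

fun wedge :: "('f, 'r::comm_ring_1) dform \<Rightarrow> ('f, 'r) dform \<Rightarrow> ('f, 'r) dform" where
  "wedge a b [] = a [] * b []"
| "wedge a b (v # vs) =
     wedge (\<lambda>us. a (v # us)) b vs + wedge (\<lambda>us. (-1) ^ length us * a us) (\<lambda>us. b (v # us)) vs"

text \<open>
  The exterior derivative, by Cartan's formula \<open>\<iota>\<^sub>v d a = L\<^sub>v a - d \<iota>\<^sub>v a\<close>; unfolding the recursion gives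
  the usual alternating sum with commutators.
\<close>

fun cartan ::
    "(('f \<Rightarrow> 'f::ab_group_add) \<Rightarrow> 'r \<Rightarrow> 'r) \<Rightarrow> ('f, 'r::comm_ring_1) dform \<Rightarrow> ('f, 'r) dform" where
  "cartan l a [] = 0"
| "cartan l a (v # vs) =
     l v (a vs) - (\<Sum>i<length vs. a (vs[i := (\<lambda>x. v ((vs ! i) x) - (vs ! i) (v x))]))
     - cartan l (\<lambda>us. a (v # us)) vs"

definition ext_d ::
    "('p, 'f::ab_group_add, 'r::comm_ring_1) space \<Rightarrow> ('f, 'r) dform \<Rightarrow> ('f, 'r) dform" where
  "ext_d S a = (\<lambda>vs. if set vs \<subseteq> ders S then cartan (lift S) a vs else 0)"

text \<open>
  \<open>log_form S p q\<close>: the stalk at \<open>p\<close> of \<open>\<Omega>\<^sup>q(log D)\<close>, generated over the local ring by the products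
  of \<open>q\<close> forms \<open>df\<close> (\<open>f\<close> regular at \<open>p\<close>) and \<open>dz/z\<close> (\<open>z\<close> a local equation of a component
  of \<open>D\<close> through \<open>p\<close>).
\<close>

inductive log_form ::
    "('p, 'f::ab_group_add, 'r::comm_ring_1) space \<Rightarrow> 'p \<Rightarrow> nat \<Rightarrow> ('f, 'r) dform \<Rightarrow> bool"
  for S p where
  "f \<in> stalk S p \<Longrightarrow> log_form S p 0 (fn_form f)"
| "log_form S p q a \<Longrightarrow> log_form S p q b \<Longrightarrow> log_form S p q (a + b)"
| "f \<in> stalk S p \<Longrightarrow> log_form S p q a \<Longrightarrow>
     log_form S p (Suc q) (wedge (ext_d S (fn_form f)) a)"
| "z \<in> logeq S p \<Longrightarrow> (\<forall>vs. z * w vs = ext_d S (fn_form z) vs) \<Longrightarrow> log_form S p q a \<Longrightarrow>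
     log_form S p (Suc q) (wedge w a)"

section \<open>Vector bundles and integrable logarithmic connections\<close>

definition vecs :: "nat \<Rightarrow> (nat \<Rightarrow> 'r::zero) set" where
  "vecs r = {s. \<forall>i\<ge>r. s i = 0}"

definition unit_vec :: "nat \<Rightarrow> nat \<Rightarrow> nat \<Rightarrow> 'r::zero_neq_one" where
  "unit_vec r j = (\<lambda>i. if i = j \<and> j < r then 1 else 0)"

definition mat_vec :: "nat \<Rightarrow> (nat \<Rightarrow> nat \<Rightarrow> 'r::comm_ring_1) \<Rightarrow> (nat \<Rightarrow> 'r) \<Rightarrow> nat \<Rightarrow> 'r" where
  "mat_vec r M s = (\<lambda>i. if i < r then \<Sum>j<r. M i j * s j else 0)"

definition mat_inverses ::
    "('p, 'f, 'r::comm_ring_1) space \<Rightarrow> nat \<Rightarrow> (nat \<Rightarrow> nat \<Rightarrow> 'r) \<Rightarrow> (nat \<Rightarrow> nat \<Rightarrow> 'r) \<Rightarrow> bool" where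
  "mat_inverses S r M M' \<longleftrightarrow> (\<forall>i<r. \<forall>j<r.
     (\<Sum>l<r. M i l * M' l j) - (if i = j then 1 else 0) \<in> nul S \<and>
     (\<Sum>l<r. M' i l * M l j) - (if i = j then 1 else 0) \<in> nul S)"

text \<open>
  A vector bundle of rank \<open>r\<close>: a locally free subsheaf \<open>E\<close> of the constant sheaf of vectors with
  entries in \<open>'r\<close> modulo \<open>nul\<close>. The stalks \<open>E p\<close> are unions of residue classes; the columns
  \<open>\<lambda>i. b i j\<close> form a local frame on \<open>U\<close>.
\<close>

definition vector_bundle ::
    "('p, 'f, 'r::comm_ring_1) space \<Rightarrow> nat \<Rightarrow> ('p \<Rightarrow> (nat \<Rightarrow> 'r) set) \<Rightarrow> bool" where
  "vector_bundle S r E \<longleftrightarrow> (\<forall>p\<in>pts S. \<exists>U\<in>opens S. p \<in> U \<and>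
     (\<exists>b b'. mat_inverses S r b b' \<and>
       (\<forall>y\<in>U. E y = {s \<in> vecs r. \<exists>c. (\<forall>j. c j \<in> stalk S y) \<and>
                        (\<forall>i. s i - mat_vec r b c i \<in> nul S)})))"

text \<open>The stalk at \<open>p\<close> of \<open>E \<otimes> \<Omega>\<^sup>q(log D)\<close>.\<close>

inductive bundle_form ::
    "('p, 'f::ab_group_add, 'r::comm_ring_1) space \<Rightarrow> ('p \<Rightarrow> (nat \<Rightarrow> 'r) set) \<Rightarrow> 'p \<Rightarrow> nat
      \<Rightarrow> (nat \<Rightarrow> ('f, 'r) dform) \<Rightarrow> bool"
  for S E p q where
  "s \<in> E p \<Longrightarrow> log_form S p q w \<Longrightarrow> bundle_form S E p q (\<lambda>i vs. s i * w vs)"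
| "bundle_form S E p q \<eta> \<Longrightarrow> bundle_form S E p q \<eta>' \<Longrightarrow> bundle_form S E p q (\<eta> + \<eta>')"
| "bundle_form S E p q \<eta> \<Longrightarrow> (\<forall>i vs. \<eta>' i vs - \<eta> i vs \<in> nul S) \<Longrightarrow> bundle_form S E p q \<eta>'"

text \<open>
  A logarithmic connection, given by its unique extension \<open>nab\<close> to the generic stalk; it has to map
  \<open>E\<close> to \<open>E \<otimes> \<Omega>\<^sup>1(log D)\<close>.
\<close>

type_synonym ('f, 'r) conn = "(nat \<Rightarrow> 'r) \<Rightarrow> nat \<Rightarrow> ('f, 'r) dform"

definition connection ::
    "('p, 'f::ab_group_add, 'r::comm_ring_1) space \<Rightarrow> nat \<Rightarrow> ('p \<Rightarrow> (nat \<Rightarrow> 'r) set)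
      \<Rightarrow> ('f, 'r) conn \<Rightarrow> bool" where
  "connection S r E nab \<longleftrightarrow>
     (\<forall>s\<in>vecs r. (\<forall>i. s i \<in> nul S) \<longrightarrow> (\<forall>i vs. nab s i vs \<in> nul S)) \<and>
     (\<forall>s\<in>vecs r. \<forall>s'\<in>vecs r. \<forall>i vs. nab (s + s') i vs - (nab s i vs + nab s' i vs) \<in> nul S) \<and>
     (\<forall>c\<in>base S. \<forall>s\<in>vecs r. \<forall>i vs. nab (\<lambda>j. c * s j) i vs - c * nab s i vs \<in> nul S) \<and>
     (\<forall>f. \<forall>s\<in>vecs r. \<forall>i vs.
        nab (\<lambda>j. f * s j) i vs - (f * nab s i vs + s i * ext_d S (fn_form f) vs) \<in> nul S) \<and>
     (\<forall>p\<in>pts S. \<forall>s\<in>E p. bundle_form S E p 1 (nab s))"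

text \<open>
  The extension of \<open>nab\<close> to forms, by \<open>\<nabla>(s \<otimes> \<omega>) = \<nabla> s \<and> \<omega> + s \<otimes> d\<omega>\<close> applied to
  \<open>\<eta> = \<Sum>\<^sub>j e\<^sub>j \<otimes> \<eta>\<^sub>j\<close>.
\<close>

definition conn_ext ::
    "('p, 'f::ab_group_add, 'r::comm_ring_1) space \<Rightarrow> nat \<Rightarrow> ('f, 'r) conn
      \<Rightarrow> (nat \<Rightarrow> ('f, 'r) dform) \<Rightarrow> nat \<Rightarrow> ('f, 'r) dform" where
  "conn_ext S r nab \<eta> = (\<lambda>i vs.
     (\<Sum>j<r. wedge (nab (unit_vec r j) i) (\<eta> j) vs) + ext_d S (\<eta> i) vs)"

definition integrable_log_connection ::
    "('p, 'f::ab_group_add, 'r::comm_ring_1) space \<Rightarrow> nat \<Rightarrow> ('p \<Rightarrow> (nat \<Rightarrow> 'r) set)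
      \<Rightarrow> ('f, 'r) conn \<Rightarrow> bool" where
  "integrable_log_connection S r E nab \<longleftrightarrow> vector_bundle S r E \<and> connection S r E nab \<and>
     (\<forall>s\<in>vecs r. \<forall>i vs. conn_ext S r nab (nab s) i vs \<in> nul S)"

text \<open>
  Isomorphism over the open set \<open>U\<close>. An isomorphism of bundles is an invertible matrix over the generic
  local ring that maps stalks onto stalks.
\<close>

definition conn_iso ::
    "('p, 'f, 'r::comm_ring_1) space \<Rightarrow> nat \<Rightarrow> 'p set
      \<Rightarrow> ('p \<Rightarrow> (nat \<Rightarrow> 'r) set) \<Rightarrow> ('f, 'r) conn \<Rightarrow> ('p \<Rightarrow> (nat \<Rightarrow> 'r) set) \<Rightarrow> ('f, 'r) conn
      \<Rightarrow> (nat \<Rightarrow> nat \<Rightarrow> 'r) \<Rightarrow> bool" where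
  "conn_iso S r U E nab E' nab' \<theta> \<longleftrightarrow> (\<exists>\<theta>'. mat_inverses S r \<theta> \<theta>') \<and>
     (\<forall>p\<in>U. \<forall>s\<in>vecs r. s \<in> E p \<longleftrightarrow> mat_vec r \<theta> s \<in> E' p) \<and>
     (\<forall>s\<in>vecs r. \<forall>i<r. \<forall>vs.
        nab' (mat_vec r \<theta> s) i vs - (\<Sum>j<r. \<theta> i j * nab s j vs) \<in> nul S)"

section \<open>The logarithmic de Rham complex of the endomorphism bundle\<close>

definition End_stalk :: "nat \<Rightarrow> ('p \<Rightarrow> (nat \<Rightarrow> 'r::comm_ring_1) set) \<Rightarrow> 'p \<Rightarrow> (nat \<Rightarrow> nat \<Rightarrow> 'r) set"
  where
  "End_stalk r E p = {M. (\<forall>i j. i \<ge> r \<or> j \<ge> r \<longrightarrow> M i j = 0) \<and> (\<forall>s\<in>E p. mat_vec r M s \<in> E p)}"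

type_synonym 'f mform = "nat \<Rightarrow> nat \<Rightarrow> ('f, 'f) dform"

text \<open>The stalk at \<open>p\<close> of \<open>\<E>nd(E) \<otimes> \<Omega>\<^sup>q(log D)\<close> on \<open>X\<close>.\<close>

inductive End_form ::
    "('p, 'f::comm_ring_1, 'f) space \<Rightarrow> nat \<Rightarrow> ('p \<Rightarrow> (nat \<Rightarrow> 'f) set) \<Rightarrow> 'p \<Rightarrow> nat
      \<Rightarrow> 'f mform \<Rightarrow> bool"
  for S r E p q where
  "M \<in> End_stalk r E p \<Longrightarrow> log_form S p q w \<Longrightarrow> End_form S r E p q (\<lambda>i j vs. M i j * w vs)"
| "End_form S r E p q \<Phi> \<Longrightarrow> End_form S r E p q \<Phi>' \<Longrightarrow> End_form S r E p q (\<Phi> + \<Phi>')"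

text \<open>
  The matrix of \<open>\<nabla> \<circ> M - M \<circ> \<nabla>\<close>, and the extension of this connection to forms by the rule for
  \<open>conn_ext\<close>, with the elementary matrices \<open>E\<^sub>a\<^sub>b\<close> as a basis.
\<close>

definition End_nabla0 ::
    "nat \<Rightarrow> ('f::comm_ring_1, 'f) conn \<Rightarrow> (nat \<Rightarrow> nat \<Rightarrow> 'f) \<Rightarrow> 'f mform" where
  "End_nabla0 r nab M = (\<lambda>i l vs.
     nab (\<lambda>j. M j l) i vs - (\<Sum>j<r. M i j * nab (unit_vec r l) j vs))"

definition End_nabla ::
    "('p, 'f::comm_ring_1, 'f) space \<Rightarrow> nat \<Rightarrow> ('f, 'f) conn \<Rightarrow> 'f mform \<Rightarrow> 'f mform" where
  "End_nabla S r nab \<Phi> = (\<lambda>i l vs.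
     (\<Sum>a<r. \<Sum>b<r.
        wedge (End_nabla0 r nab (\<lambda>i j. if i = a \<and> j = b then 1 else 0) i l) (\<Phi> a b) vs)
     + ext_d S (\<Phi> i l) vs)"

section \<open>Hypercohomology\<close>

text \<open>
  Sufficiently fine coverings: coverings by nonempty principal affine open sets
  \<open>{F \<noteq> 0}\<close>, \<open>deg F > 0\<close>. All finite intersections are again such sets.
\<close>

definition fine_cover ::
    "('k::field, 'f::field) pvariety \<Rightarrow> 'i set \<Rightarrow> ('i \<Rightarrow> (nat \<Rightarrow> 'k) set) \<Rightarrow> bool" where
  "fine_cover X I U \<longleftrightarrow> (\<Union>\<alpha>\<in>I. U \<alpha>) = points X \<and>
     (\<forall>\<alpha>\<in>I. U \<alpha> \<noteq> {} \<and> (\<exists>d>0. \<exists>F\<in>homog (amb X) d. U \<alpha> = {p \<in> points X. peval id p F \<noteq> 0}))"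

text \<open>
  An \<open>n\<close>-cochain of the total complex assigns to \<open>\<alpha>\<^sub>0, \<dots>, \<alpha>\<^sub>p\<close> a section of
  \<open>\<E>nd(E) \<otimes> \<Omega>\<^sup>n\<^sup>-\<^sup>p(log D)\<close> on the intersection of the \<open>U \<alpha>\<^sub>i\<close>. These are all (not only the
  alternating) Cech cochains, which have the same cohomology.
\<close>

type_synonym ('i, 'f) cochain = "'i list \<Rightarrow> 'f mform"

definition cochains ::
    "('p, 'f::comm_ring_1, 'f) space \<Rightarrow> nat \<Rightarrow> ('p \<Rightarrow> (nat \<Rightarrow> 'f) set) \<Rightarrow> 'i set \<Rightarrow> ('i \<Rightarrow> 'p set)
      \<Rightarrow> nat \<Rightarrow> ('i, 'f) cochain set" where
  "cochains S r E I U n = {c. \<forall>l.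
     if l \<noteq> [] \<and> set l \<subseteq> I \<and> length l \<le> Suc n
     then \<forall>p\<in>(\<Inter>\<alpha>\<in>set l. U \<alpha>). End_form S r E p (Suc n - length l) (c l)
     else c l = 0}"

definition total_d ::
    "('p, 'f::comm_ring_1, 'f) space \<Rightarrow> nat \<Rightarrow> ('f, 'f) conn \<Rightarrow> 'i set
      \<Rightarrow> ('i, 'f) cochain \<Rightarrow> ('i, 'f) cochain" where
  "total_d S r nab I c = (\<lambda>l i j vs.
     if l \<noteq> [] \<and> set l \<subseteq> I
     then (\<Sum>m<length l. (-1) ^ m * c (take m l @ drop (Suc m) l) i j vs)
          + (-1) ^ (length l - 1) * End_nabla S r nab (c l) i j vs
     else 0)"

definition cocycles ::
    "('p, 'f::comm_ring_1, 'f) space \<Rightarrow> nat \<Rightarrow> ('p \<Rightarrow> (nat \<Rightarrow> 'f) set) \<Rightarrow> ('f, 'f) conn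
      \<Rightarrow> 'i set \<Rightarrow> ('i \<Rightarrow> 'p set) \<Rightarrow> nat \<Rightarrow> ('i, 'f) cochain set" where
  "cocycles S r E nab I U n = {c \<in> cochains S r E I U n. total_d S r nab I c = 0}"

definition coboundaries ::
    "('p, 'f::comm_ring_1, 'f) space \<Rightarrow> nat \<Rightarrow> ('p \<Rightarrow> (nat \<Rightarrow> 'f) set) \<Rightarrow> ('f, 'f) conn
      \<Rightarrow> 'i set \<Rightarrow> ('i \<Rightarrow> 'p set) \<Rightarrow> nat \<Rightarrow> ('i, 'f) cochain set" where
  "coboundaries S r E nab I U n =
     (case n of 0 \<Rightarrow> {0} | Suc n' \<Rightarrow> total_d S r nab I ` cochains S r E I U n')"

text \<open>
  Hypercohomology classes are cosets of the space \<open>B\<close> of coboundaries. The sum of two classes is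
  the elementwise sum of sets from \<^theory>\<open>HOL-Library.Set_Algebras\<close>, so \<open>B\<close> is the zero class.
\<close>

definition hypercoh ::
    "('p, 'f::comm_ring_1, 'f) space \<Rightarrow> nat \<Rightarrow> ('p \<Rightarrow> (nat \<Rightarrow> 'f) set) \<Rightarrow> ('f, 'f) conn
      \<Rightarrow> 'i set \<Rightarrow> ('i \<Rightarrow> 'p set) \<Rightarrow> nat \<Rightarrow> ('i, 'f) cochain set set" where
  "hypercoh S r E nab I U n =
     {{z} + coboundaries S r E nab I U n | z. z \<in> cocycles S r E nab I U n}"

definition class_scale ::
    "('k \<Rightarrow> 'f::comm_ring_1) \<Rightarrow> ('i, 'f) cochain set \<Rightarrow> 'k \<Rightarrow> ('i, 'f) cochain set
      \<Rightarrow> ('i, 'f) cochain set" where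
  "class_scale h B a w = (\<lambda>z l i j vs. h a * z l i j vs) ` w + B"

definition class_basis ::
    "('k::zero \<Rightarrow> 'f::comm_ring_1) \<Rightarrow> ('i, 'f) cochain set \<Rightarrow> ('i, 'f) cochain set set
      \<Rightarrow> nat \<Rightarrow> (nat \<Rightarrow> ('i, 'f) cochain set) \<Rightarrow> bool" where
  "class_basis h B H N \<delta> \<longleftrightarrow> (\<forall>i<N. \<delta> i \<in> H) \<and>
     (\<forall>w\<in>H. \<exists>!a. (\<forall>i\<ge>N. a i = 0) \<and> w = (\<Sum>i<N. class_scale h B (a i) (\<delta> i)) + B)"

definition class_functionals ::
    "('k::comm_ring_1 \<Rightarrow> 'f::comm_ring_1) \<Rightarrow> ('i, 'f) cochain set \<Rightarrow> ('i, 'f) cochain set set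
      \<Rightarrow> (('i, 'f) cochain set \<Rightarrow> 'k) set" where
  "class_functionals h B H = {\<phi>. (\<forall>w\<in>H. \<forall>w'\<in>H. \<phi> (w + w') = \<phi> w + \<phi> w') \<and>
     (\<forall>a. \<forall>w\<in>H. \<phi> (class_scale h B a w) = a * \<phi> w)}"

section \<open>Power series and infinitesimal neighbourhoods\<close>

definition power_series :: "nat \<Rightarrow> ((nat \<Rightarrow>\<^sub>0 nat) \<Rightarrow> 'k::zero) set" where
  "power_series N = {g. \<forall>c. \<not> Poly_Mapping.keys c \<subseteq> {..<N} \<longrightarrow> g c = 0}"

definition series_mult ::
    "((nat \<Rightarrow>\<^sub>0 nat) \<Rightarrow> 'k::comm_ring_1) \<Rightarrow> ((nat \<Rightarrow>\<^sub>0 nat) \<Rightarrow> 'k) \<Rightarrow> (nat \<Rightarrow>\<^sub>0 nat) \<Rightarrow> 'k" where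
  "series_mult g h c = (\<Sum>(a, b)\<in>{(a, b). a + b = c}. g a * h b)"

definition series_ideal ::
    "nat \<Rightarrow> ((nat \<Rightarrow>\<^sub>0 nat) \<Rightarrow> 'k::comm_ring_1) set \<Rightarrow> ((nat \<Rightarrow>\<^sub>0 nat) \<Rightarrow> 'k) set" where
  "series_ideal N G = {\<Sum>g\<in>T. series_mult (h g) g | T h.
     finite T \<and> T \<subseteq> G \<and> (\<forall>g\<in>T. h g \<in> power_series N)}"

text \<open>
  The preimage, in the polynomial ring in all variables \<open>t 0, t 1, \<dots>\<close>, of the image of \<open>I\<close> in
  \<open>k[t 0, \<dots>, t (N - 1)]/(t 0, \<dots>, t (N - 1))\<^sup>m\<^sup>+\<^sup>1\<close>: it contains the superfluous variables \<open>t i\<close>,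
  \<open>i \<ge> N\<close>, and the \<open>(m + 1)\<close>-st power of the maximal ideal. Hence its quotient is the ring of
  the closed subscheme of \<open>W\<^sub>m\<close> defined by \<open>I\<close>, and \<open>W\<^sub>m\<close> itself is the case \<open>I = {0}\<close>.
\<close>

definition nbhd_ideal :: "nat \<Rightarrow> nat \<Rightarrow> ((nat \<Rightarrow>\<^sub>0 nat) \<Rightarrow> 'k::zero) set \<Rightarrow> 'k mpoly set" where
  "nbhd_ideal N m I =
     {P. \<exists>g\<in>I. \<forall>c. Poly_Mapping.keys c \<subseteq> {..<N} \<and> mdeg c \<le> m \<longrightarrow> Poly_Mapping.lookup P c = g c}"

section \<open>The universal first order deformation\<close>

text \<open>
  Pullback of a bundle and of a connection from \<open>X\<close> to \<open>X \<times> Spec (k[t]/J)\<close> (\<open>S\<close> below),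
  coefficientwise, and restriction of a bundle to a closed subscheme given by a larger ideal
  (the connection is restricted by using the same representatives).
\<close>

definition pull_bundle ::
    "('p, 'f, 'f::comm_ring_1 mpoly) space \<Rightarrow> nat \<Rightarrow> ('p \<Rightarrow> (nat \<Rightarrow> 'f) set)
      \<Rightarrow> 'p \<Rightarrow> (nat \<Rightarrow> 'f mpoly) set" where
  "pull_bundle S r E p = {s \<in> vecs r. \<exists>s'\<in>vecs r.
     (\<forall>c. (\<lambda>i. Poly_Mapping.lookup (s' i) c) \<in> E p) \<and> (\<forall>i. s i - s' i \<in> nul S)}"

definition pull_conn :: "nat \<Rightarrow> ('f, 'f::comm_ring_1) conn \<Rightarrow> ('f, 'f mpoly) conn" where
  "pull_conn r nab s = (\<lambda>i vs.
     \<Sum>c\<in>(\<Union>j<r. Poly_Mapping.keys (s j)). Poly_Mapping.single c (nab (\<lambda>j. Poly_Mapping.lookup (s j) c) i vs))"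

definition restrict_bundle ::
    "('p, 'f, 'r::comm_ring_1) space \<Rightarrow> nat \<Rightarrow> ('p \<Rightarrow> (nat \<Rightarrow> 'r) set) \<Rightarrow> 'p \<Rightarrow> (nat \<Rightarrow> 'r) set" where
  "restrict_bundle S r E p = {s \<in> vecs r. \<exists>s'\<in>E p. \<forall>i. s i - s' i \<in> nul S}"

text \<open>\<open>\<Sum>\<^sub>l t\<^sub>l a\<^sub>l\<close>\<close>

definition lin_poly :: "nat \<Rightarrow> (nat \<Rightarrow> 'f::comm_ring_1) \<Rightarrow> 'f mpoly" where
  "lin_poly N a = (\<Sum>l<N. Poly_Mapping.single (Poly_Mapping.single l 1) (a l))"

text \<open>
  \<open>(E1, nab1)\<close> is obtained by gluing the pullbacks of \<open>(E|U \<alpha>, nab + \<Sum> t\<^sub>l z l [\<alpha>])\<close> along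
  \<open>1 + \<Sum> t\<^sub>l z l [\<alpha>, \<beta>]\<close>: there are trivialisations \<open>\<theta> \<alpha>\<close> over \<open>U \<alpha>\<close> onto these pullbacks with
  \<open>\<theta> \<alpha> = (1 + \<Sum> t\<^sub>l z l [\<alpha>, \<beta>]) \<circ> \<theta> \<beta>\<close>. The cochains \<open>z l\<close> are the pairs \<open>(a, \<A>)\<close> with
  \<open>a\<^sub>\<alpha>\<^sub>\<beta> = z l [\<alpha>, \<beta>]\<close> and \<open>\<A>\<^sub>\<alpha> = z l [\<alpha>]\<close>.
\<close>

definition first_order_deformation ::
    "('p, 'f::comm_ring_1, 'f mpoly) space \<Rightarrow> nat \<Rightarrow> ('p \<Rightarrow> (nat \<Rightarrow> 'f) set) \<Rightarrow> ('f, 'f) conn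
      \<Rightarrow> 'i set \<Rightarrow> ('i \<Rightarrow> 'p set) \<Rightarrow> nat \<Rightarrow> (nat \<Rightarrow> ('i, 'f) cochain)
      \<Rightarrow> ('p \<Rightarrow> (nat \<Rightarrow> 'f mpoly) set) \<Rightarrow> ('f, 'f mpoly) conn \<Rightarrow> bool" where
  "first_order_deformation S r E nab I U N z E1 nab1 \<longleftrightarrow>
     integrable_log_connection S r E1 nab1 \<and>
     (\<exists>\<theta>. (\<forall>\<alpha>\<in>I. conn_iso S r (U \<alpha>) E1 nab1 (pull_bundle S r E)
              (\<lambda>s i vs. pull_conn r nab s i vs
                 + (\<Sum>j<r. lin_poly N (\<lambda>l. z l [\<alpha>] i j vs) * s j)) (\<theta> \<alpha>)) \<and>
          (\<forall>\<alpha>\<in>I. \<forall>\<beta>\<in>I. \<forall>i<r. \<forall>j<r.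
              \<theta> \<alpha> i j - (\<theta> \<beta> i j + (\<Sum>h<r. lin_poly N (\<lambda>l. z l [\<alpha>, \<beta>] i h []) * \<theta> \<beta> h j)) \<in> nul S))"

end

theory Submission
  imports Defs
begin

text \<open>
  Cech cochains with values in \<open>End E\<close>-valued logarithmic forms are a differential
  graded algebra under the cup product, and a pair of gluing matrices and connection matrices
  over an infinitesimal base is a flat connection on a bundle exactly when the corresponding
  element of degree 1 solves the Maurer-Cartan equation \<open>D \<gamma> + \<gamma> \<union> \<gamma> = 0\<close>.
  One solves it degree by degree in \<open>t\<close>, starting from \<open>\<Sum>\<^sub>l t\<^sub>l z\<^sub>l\<close>: the cocycle part of the
  coefficient of \<open>t\<^sup>c\<close> in \<open>\<gamma> \<union> \<gamma>\<close> has a class \<open>f\<^sub>c\<close>, and \<open>\<gamma>\<^sub>c\<close> is chosen so as to cancel the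
  part of it that is a coboundary. If a functional \<open>\<lambda>\<close> on \<open>k[t]\<close> vanishes on the ideal generated by
  \<open>f\<close>, then \<open>\<lambda> (\<psi> \<circ> f) = 0\<close> for every linear form \<open>\<psi>\<close> on the second hypercohomology, so \<open>\<lambda>\<close>
  maps \<open>f\<close> to \<open>0\<close>; by induction it sees no failure of the Maurer-Cartan equation. As such
  functionals detect the ideal, the equation holds modulo the ideal.
\<close>

section \<open>The algebra of differential forms\<close>

text \<open>The obstruction ideal is generated over \<open>k\<close>, while cochains have entries in
  the function field, so the equation must hold modulo the extended ideal. Testing with functionals
  on \<open>k[t]\<close> bridges the two: they form a \<open>k[t]\<close>-module, and the finitely
  many coefficients of a truncated series span a finite-dimensional space over \<open>k\<close>. The
  induction closes because of the Bianchi identity. The defect \<open>Om\<close> of the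
  Maurer-Cartan equation satisfies \<open>D Om = Om gam - gam Om\<close>, so whatever the
  obstruction class does not control is multiplied by \<open>gam\<close>, which has no constant
  term. Under a functional, such a product turns into shifted functionals of smaller support. The
  series \<open>gam\<close> is chosen once, before \<open>m\<close>; only its defect is examined
  modulo each ideal. Two features of the encoding need their own arguments. Cochains need not be
  alternating, so the transition matrix of a chart with itself has to be shown trivial. And bundles
  are subsheaves of a constant sheaf, so gluing means transporting all charts into a single one, by
  matrices that are invertible generically and not only on an overlap.\<close>

definition eps :: "('f, 'r::comm_ring_1) dform \<Rightarrow> ('f, 'r) dform" where
  "eps a = (\<lambda>vs. (-1) ^ length vs * a vs)"

definition iota :: "('f \<Rightarrow> 'f) \<Rightarrow> ('f, 'r) dform \<Rightarrow> ('f, 'r) dform" where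
  "iota v a = (\<lambda>vs. a (v # vs))"

lemma iota_apply: "iota v a vs = a (v # vs)"
  by (simp add: iota_def)

text \<open>The sign is attached to the length of the argument list, so \<open>eps\<close> is
  defined on forms of mixed or unknown degree. In this shape the recursion is the antiderivation
  rule for contraction, and it replaces the original equation in all later inductions.\<close>

lemma wedge_Cons: "wedge a b (v # vs) = wedge (iota v a) b vs + wedge (eps a) (iota v b) vs"
  by (simp add: iota_def eps_def)

declare wedge.simps(2) [simp del]

lemma iota_wedge: "iota v (wedge a b) = wedge (iota v a) b + wedge (eps a) (iota v b)"
  by (rule ext) (simp add: iota_apply wedge_Cons)

lemma iota_add [simp]: "iota v (a + b) = iota v a + iota v b"
  and iota_minus [simp]: "iota v (- a) = - iota v (a::('f,'r::comm_ring_1) dform)"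
  and iota_diff [simp]: "iota v (a' - b') = iota v a' - iota v (b'::('f,'r::comm_ring_1) dform)"
  and iota_zero [simp]: "iota v 0 = 0"
  by (auto simp: iota_def)

lemma eps_add [simp]: "eps (a + b) = eps a + eps b"
  and eps_minus [simp]: "eps (- a) = - eps a"
  and eps_diff [simp]: "eps (a - b) = eps a - eps b"
  and eps_zero [simp]: "eps 0 = 0"
  by (auto simp: eps_def algebra_simps)

lemma eps_eps [simp]: "eps (eps a) = a"
  by (rule ext) (simp add: eps_def mult.assoc [symmetric] power_add [symmetric] flip: mult_2)

lemma iota_eps: "iota v (eps a) = - eps (iota v a)"
  by (rule ext) (simp add: eps_def iota_def)

lemma wedge_zero_left [simp]: "wedge 0 b = 0"
proof
  show "wedge 0 b vs = 0 vs" for vs by (induction vs arbitrary: b) (auto simp: wedge_Cons)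
qed

lemma wedge_zero_right [simp]: "wedge a 0 = 0"
proof
  show "wedge a 0 vs = 0 vs" for vs by (induction vs arbitrary: a) (auto simp: wedge_Cons)
qed

lemma wedge_add_left: "wedge (a + a') b = wedge a b + wedge a' b"
proof
  show "wedge (a + a') b vs = (wedge a b + wedge a' b) vs" for vs
    by (induction vs arbitrary: a a' b) (auto simp: wedge_Cons algebra_simps)
qed

lemma wedge_add_right: "wedge a (b + b') = wedge a b + wedge a b'"
proof
  show "wedge a (b + b') vs = (wedge a b + wedge a b') vs" for vs
    by (induction vs arbitrary: a b b') (auto simp: wedge_Cons algebra_simps)
qed

lemma wedge_minus_left: "wedge (- a) b = - wedge a b"
  using wedge_add_left [of a "- a" b] by (simp add: eq_neg_iff_add_eq_0 add.commute)

lemma wedge_minus_right: "wedge a (- b) = - wedge a b"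
  using wedge_add_right [of a b "- b"] by (simp add: eq_neg_iff_add_eq_0 add.commute)

lemma wedge_diff_left: "wedge (a - a') b = wedge a b - wedge a' b"
  using wedge_add_left [of a "- a'" b] by (simp add: wedge_minus_left)

lemma wedge_diff_right: "wedge a (b - b') = wedge a b - wedge a b'"
  using wedge_add_right [of a b "- b'"] by (simp add: wedge_minus_right)

lemma wedge_sum_left: "wedge (\<Sum>i\<in>A. a i) b = (\<Sum>i\<in>A. wedge (a i) b)"
  by (induction A rule: infinite_finite_induct)
    (simp_all only: sum.infinite sum.empty sum.insert wedge_zero_left wedge_add_left not_False_eq_True)

lemma wedge_sum_right: "wedge a (\<Sum>i\<in>A. b i) = (\<Sum>i\<in>A. wedge a (b i))"
  by (induction A rule: infinite_finite_induct)
    (simp_all only: sum.infinite sum.empty sum.insert wedge_zero_right wedge_add_right not_False_eq_True)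

definition scl :: "'r::comm_ring_1 \<Rightarrow> ('f, 'r) dform \<Rightarrow> ('f, 'r) dform" where
  "scl c a = (\<lambda>vs. c * a vs)"

lemma scl_apply: "scl c a vs = c * a vs"
  by (simp add: scl_def)

lemma iota_scl: "iota v (scl c a) = scl c (iota v a)"
  and eps_scl: "eps (scl c a) = scl c (eps a)"
  by (auto simp: iota_def scl_def eps_def mult_ac)

lemma wedge_scl_left: "wedge (scl c a) b = scl c (wedge a b)"
proof
  show "wedge (scl c a) b vs = scl c (wedge a b) vs" for vs
    by (induction vs arbitrary: a b) (auto simp: wedge_Cons scl_apply iota_scl eps_scl algebra_simps)
qed

lemma wedge_scl_right: "wedge a (scl c b) = scl c (wedge a b)"
proof
  show "wedge a (scl c b) vs = scl c (wedge a b) vs" for vs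
    by (induction vs arbitrary: a b) (auto simp: wedge_Cons scl_apply iota_scl eps_scl algebra_simps)
qed

lemma eps_wedge: "eps (wedge a b) = wedge (eps a) (eps b)"
proof
  have "(-1) ^ length vs * wedge a b vs = wedge (eps a) (eps b) vs" for vs
  proof (induction vs arbitrary: a b)
    case Nil then show ?case by (simp add: eps_def)
  next
    case (Cons v vs)
    show ?case
      using Cons.IH [of "iota v a" b] Cons.IH [of "eps a" "iota v b"]
      by (simp add: wedge_Cons iota_eps wedge_minus_left wedge_minus_right distrib_left)
  qed
  then show "eps (wedge a b) vs = wedge (eps a) (eps b) vs" for vs by (simp add: eps_def)
qed

text \<open>Both sides have the same contractions, since contraction is an antiderivation and
  \<open>eps\<close> is multiplicative. The induction must generalise over all three forms, because
  contracting changes them.\<close>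

lemma wedge_assoc: "wedge (wedge a b) c = wedge a (wedge b c)"
proof
  show "wedge (wedge a b) c vs = wedge a (wedge b c) vs" for vs
  proof (induction vs arbitrary: a b c)
    case Nil then show ?case by (simp add: mult_ac)
  next
    case (Cons v vs)
    show ?case
      by (simp add: wedge_Cons iota_wedge wedge_add_left wedge_add_right eps_wedge Cons.IH algebra_simps)
  qed
qed

lemma iota_fn_form [simp]: "iota v (fn_form f) = 0"
  by (rule ext) (simp add: iota_def fn_form_def)

lemma eps_fn_form [simp]: "eps (fn_form f) = fn_form f"
  by (rule ext) (simp add: eps_def fn_form_def)

lemma wedge_fn_left: "wedge (fn_form f) b = scl f b"
proof
  show "wedge (fn_form f) b vs = scl f b vs" for vs
    by (induction vs arbitrary: b) (simp_all add: wedge_Cons iota_apply scl_apply, simp add: fn_form_def)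
qed

lemma wedge_fn_right: "wedge b (fn_form f) = scl f b"
proof
  show "wedge b (fn_form f) vs = scl f b vs" for vs
    by (induction vs arbitrary: b)
      (simp_all add: wedge_Cons iota_apply scl_apply, simp_all add: fn_form_def eps_def)
qed

lemma fn_form_zero [simp]: "fn_form 0 = 0"
  by (rule ext) (simp add: fn_form_def)

lemma fn_form_add: "fn_form (f + g :: 'r::comm_ring_1) = fn_form f + fn_form g"
  by (rule ext) (simp add: fn_form_def)

text \<open>Homogeneity of degree \<open>q\<close> together with support on lists from
  \<open>V\<close>. The support condition is what extends identities proved for lists of derivations
  to all argument lists.\<close>

definition pure :: "('f \<Rightarrow> 'f) set \<Rightarrow> nat \<Rightarrow> ('f, 'r::zero) dform \<Rightarrow> bool" where
  "pure V q a \<longleftrightarrow> (\<forall>vs. a vs \<noteq> 0 \<longrightarrow> length vs = q \<and> set vs \<subseteq> V)"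

lemma pure_add: "pure V q a \<Longrightarrow> pure V q b \<Longrightarrow> pure V q (a + b :: ('f, 'r::comm_ring_1) dform)"
  and pure_minus: "pure V q a' \<Longrightarrow> pure V q (- a' :: ('f, 'r::comm_ring_1) dform)"
  and pure_diff: "pure V q a \<Longrightarrow> pure V q b \<Longrightarrow> pure V q (a - b :: ('f, 'r::comm_ring_1) dform)"
  and pure_zero [simp]: "pure V q 0"
  and pure_scl: "pure V q a' \<Longrightarrow> pure V q (scl c a')"
  unfolding pure_def scl_def plus_fun_apply zero_fun_apply minus_apply uminus_apply
  by (metis add_0, simp, metis diff_0_right, simp, metis mult_zero_right)

lemma pure_sum: "(\<And>i. i \<in> A \<Longrightarrow> pure V q (a i)) \<Longrightarrow> pure V q (\<Sum>i\<in>A. a i :: ('f, 'r::comm_ring_1) dform)"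
  by (induction A rule: infinite_finite_induct) (auto intro: pure_add)

lemma pure_fn_form [simp]: "pure V 0 (fn_form f)"
  by (simp add: pure_def fn_form_def)

lemma pure_0_imp: "pure V 0 a \<Longrightarrow> a = fn_form (a [])"
  by (rule ext) (auto simp: pure_def fn_form_def)

lemma eps_pure: "pure V q a \<Longrightarrow> eps a = scl ((-1) ^ q) a"
  by (rule ext) (force simp: eps_def pure_def scl_apply)

lemma pure_eps: "pure V q a \<Longrightarrow> pure V q (eps a)"
  unfolding pure_def eps_def by (metis mult_zero_right)

lemma pure_iota: "pure V (Suc q) a \<Longrightarrow> pure V q (iota v a)"
  by (force simp: pure_def iota_def)

lemma pure_iota_0: "pure V 0 a \<Longrightarrow> iota v a = 0"
  by (rule ext) (force simp: pure_def iota_def)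

lemma pure_iota_notin: "pure V q a \<Longrightarrow> v \<notin> V \<Longrightarrow> iota v a = 0"
  by (rule ext) (force simp: pure_def iota_def)

lemma pure_wedge:
  assumes "pure V p a" "pure V q b"
  shows "pure V (p + q) (wedge a b)"
proof -
  have "length vs = p + q \<and> set vs \<subseteq> V" if "wedge a b vs \<noteq> 0" for vs
    using that assms
  proof (induction vs arbitrary: a b p q)
    case Nil
    then have "a [] \<noteq> 0" "b [] \<noteq> 0" by auto
    with Nil show ?case by (force simp: pure_def)
  next
    case (Cons v vs)
    from Cons.prems(1) consider "wedge (iota v a) b vs \<noteq> 0" | "wedge (eps a) (iota v b) vs \<noteq> 0"
      by (metis add_0 wedge_Cons)
    then show ?case
    proof cases
      case 1
      then have "iota v a \<noteq> 0" by auto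
      then obtain p' where p: "p = Suc p'" and v: "v \<in> V"
        using Cons.prems(2) pure_iota_0 pure_iota_notin by (metis old.nat.exhaust)
      from Cons.IH [OF 1 pure_iota [of V p' a v] Cons.prems(3)] Cons.prems(2) p v show ?thesis by auto
    next
      case 2
      then have "iota v b \<noteq> 0" by auto
      then obtain q' where q: "q = Suc q'" and v: "v \<in> V"
        using Cons.prems(3) pure_iota_0 pure_iota_notin by (metis old.nat.exhaust)
      have "pure V p (eps a)"
        using Cons.prems(2) by (rule pure_eps)
      from Cons.IH [OF 2 this pure_iota [of V q' b v]] Cons.prems(3) q v show ?thesis by auto
    qed
  qed
  then show ?thesis by (auto simp: pure_def)
qed

text \<open>Graded commutativity with one factor of degree 1, the case needed to move a connection
  matrix past a form. A contraction of \<open>a\<close> is a function, so only \<open>b\<close>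
  changes in the induction.\<close>

lemma wedge_1_comm:
  assumes "pure V 1 a"
  shows "wedge a b = wedge (eps b) a"
proof
  have ea: "eps a = - a" using eps_pure [OF assms] by (auto simp: scl_def)
  have ia: "iota v a = fn_form (a [v])" for v
    using pure_0_imp [of V "iota v a"] pure_iota [of V 0 a v] assms by (simp add: iota_apply)
  show "wedge a b vs = wedge (eps b) a vs" for vs
  proof (induction vs arbitrary: b)
    case Nil
    have "a [] = 0" using assms by (force simp: pure_def)
    then show ?case by simp
  next
    case (Cons v vs)
    have "wedge a b (v # vs) = (a [v]) * b vs - wedge a (iota v b) vs"
      by (simp add: wedge_Cons ea ia wedge_fn_left scl_apply wedge_minus_left)
    also have "\<dots> = wedge (eps b) a (v # vs)"
      by (simp add: wedge_Cons ia wedge_fn_right scl_apply iota_eps wedge_minus_left Cons.IH)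
    finally show ?case .
  qed
qed

lemma pure_2_apply:
  assumes "pure V 1 a" "pure V 1 b"
  shows "wedge a b [v, w] = a [v] * b [w] - a [w] * b [v]"
proof -
  have "a [] = 0" "b [] = 0" using assms by (force simp: pure_def)+
  then show ?thesis by (simp add: wedge_Cons eps_def iota_apply)
qed

text \<open>
  A form is determined by its contractions, which lower the degree; this reduces the identities
  of Cartan calculus to inductions on the list of arguments.
\<close>

definition brk :: "('f::ab_group_add \<Rightarrow> 'f) \<Rightarrow> ('f \<Rightarrow> 'f) \<Rightarrow> 'f \<Rightarrow> 'f" where
  "brk v w = (\<lambda>x. v (w x) - w (v x))"

definition lie ::
    "(('f \<Rightarrow> 'f::ab_group_add) \<Rightarrow> 'r \<Rightarrow> 'r) \<Rightarrow> ('f \<Rightarrow> 'f) \<Rightarrow> ('f, 'r::comm_ring_1) dform \<Rightarrow> ('f, 'r) dform"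
  where "lie l v a = (\<lambda>vs. l v (a vs) - (\<Sum>i<length vs. a (vs[i := brk v (vs ! i)])))"

lemma cartan_Cons: "cartan l a (v # vs) = lie l v a vs - cartan l (iota v a) vs"
  by (simp add: lie_def brk_def iota_def)

declare cartan.simps(2) [simp del]

lemma iota_cartan: "iota v (cartan l a) = lie l v a - cartan l (iota v a)"
  by (rule ext) (simp add: iota_apply cartan_Cons)

text \<open>The commutator rule for contraction and Lie derivative. The extra term is the summand of
  \<open>lie\<close> in which the bracket hits the contracted argument itself.\<close>

lemma iota_lie: "iota w (lie l v a) = lie l v (iota w a) - iota (brk v w) a"
  by (rule ext)
    (simp add: iota_def lie_def sum.lessThan_Suc_shift del: sum.lessThan_Suc)

text \<open>The rules for \<open>cartan\<close> hold only on lists from \<open>V\<close>. A wedge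
  product evaluated on such a list uses only sublists of it, so these rules may be applied inside
  the product.\<close>

lemma wedge_cong_on:
  assumes "set vs \<subseteq> V" "\<And>us. set us \<subseteq> V \<Longrightarrow> a us = a' us" "\<And>us. set us \<subseteq> V \<Longrightarrow> b us = b' us"
  shows "wedge a b vs = wedge a' b' vs"
  using assms
proof (induction vs arbitrary: a a' b b')
  case Nil then show ?case by simp
next
  case (Cons v vs)
  then have vs: "set vs \<subseteq> V" by auto
  have "wedge (iota v a) b vs = wedge (iota v a') b' vs"
    by (rule Cons.IH [OF vs]) (use Cons.prems in \<open>auto simp: iota_def\<close>)
  moreover have "wedge (eps a) (iota v b) vs = wedge (eps a') (iota v b') vs"
    by (rule Cons.IH [OF vs]) (use Cons.prems in \<open>auto simp: iota_def eps_def\<close>)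
  ultimately show ?case by (simp add: wedge_Cons)
qed

text \<open>The common ground of derivations acting on the function field and of their
  coefficientwise action on polynomials over it. Cartan calculus is thus developed once for
  \<open>X\<close> and for its thickenings. The rule \<open>der_diff\<close> concerns the action on
  the field itself, where the Jacobi identity for \<open>brk\<close> is computed.\<close>

locale lifted_derivations =
  fixes l :: "('f \<Rightarrow> 'f::ab_group_add) \<Rightarrow> 'r \<Rightarrow> 'r::comm_ring_1" and V :: "('f \<Rightarrow> 'f) set"
  assumes lift_add: "v \<in> V \<Longrightarrow> l v (a + b) = l v a + l v b"
    and lift_mult: "v \<in> V \<Longrightarrow> l v (a * b) = a * l v b + l v a * b"
    and brk_in: "v \<in> V \<Longrightarrow> w \<in> V \<Longrightarrow> brk v w \<in> V"
    and lift_brk: "v \<in> V \<Longrightarrow> w \<in> V \<Longrightarrow> l (brk v w) a = l v (l w a) - l w (l v a)"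
    and der_diff: "v \<in> V \<Longrightarrow> v (x - y) = v x - v y"
begin

lemma lift_zero [simp]: "v \<in> V \<Longrightarrow> l v 0 = 0"
  using lift_add [of v 0 0] by simp

lemma lift_minus: "v \<in> V \<Longrightarrow> l v (- a) = - l v a"
  using lift_add [of v a "- a"] by (simp add: eq_neg_iff_add_eq_0 add.commute)

lemma lift_diff: "v \<in> V \<Longrightarrow> l v (a - b) = l v a - l v b"
  using lift_add [of v a "- b"] by (simp add: lift_minus)

lemma lift_one [simp]: "v \<in> V \<Longrightarrow> l v 1 = 0"
  using lift_mult [of v 1 1] by simp

lemma lift_sign: "v \<in> V \<Longrightarrow> l v ((-1) ^ n * a) = (-1) ^ n * l v a"
  by (cases "even n") (auto simp: lift_minus)

lemma lie_add: "v \<in> V \<Longrightarrow> lie l v (a + b) = lie l v a + lie l v b"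
  by (rule ext) (simp add: lie_def lift_add sum.distrib)

lemma lie_eps: "v \<in> V \<Longrightarrow> lie l v (eps a) = eps (lie l v a)"
  by (rule ext) (simp add: lie_def eps_def lift_sign right_diff_distrib sum_distrib_left)

text \<open>Contract both sides: the bracket terms produced by \<open>iota_lie\<close> recombine by
  the antiderivation rule, and the rest is the statement for a shorter list.\<close>

lemma lie_wedge:
  assumes "v \<in> V"
  shows "lie l v (wedge a b) = wedge (lie l v a) b + wedge a (lie l v b)"
proof
  show "lie l v (wedge a b) vs = (wedge (lie l v a) b + wedge a (lie l v b)) vs" for vs
  proof (induction vs arbitrary: a b)
    case Nil show ?case by (simp add: lie_def lift_mult [OF assms])
  next
    case (Cons w vs)
    have "lie l v (wedge a b) (w # vs) = iota w (lie l v (wedge a b)) vs"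
      by (simp add: iota_apply)
    also have "\<dots> = lie l v (wedge (iota w a) b) vs + lie l v (wedge (eps a) (iota w b)) vs
        - (wedge (iota (brk v w) a) b + wedge (eps a) (iota (brk v w) b)) vs"
      by (simp add: iota_lie iota_wedge lie_add [OF assms])
    also have "\<dots> = (wedge (lie l v a) b + wedge a (lie l v b)) (w # vs)"
      by (simp add: Cons.IH wedge_Cons iota_lie wedge_diff_left wedge_diff_right lie_eps [OF assms])
    finally show ?case .
  qed
qed

lemma cartan_add: "set vs \<subseteq> V \<Longrightarrow> cartan l (a + b) vs = cartan l a vs + cartan l b vs"
  by (induction vs arbitrary: a b) (auto simp: cartan_Cons lie_add)

lemma cartan_zero: "set vs \<subseteq> V \<Longrightarrow> cartan l 0 vs = 0"
  using cartan_add [of vs 0 0] by simp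

lemma cartan_minus: "set vs \<subseteq> V \<Longrightarrow> cartan l (- a) vs = - cartan l a vs"
  using cartan_add [of vs a "- a"] cartan_zero [of vs] by (simp add: eq_neg_iff_add_eq_0 add.commute)

lemma cartan_eps: "set vs \<subseteq> V \<Longrightarrow> cartan l (eps a) vs = - eps (cartan l a) vs"
proof (induction vs arbitrary: a)
  case Nil then show ?case by (simp add: eps_def)
next
  case (Cons v vs)
  then show ?case
    by (simp add: cartan_Cons lie_eps iota_eps cartan_minus) (simp add: eps_def cartan_Cons algebra_simps)
qed

lemma cartan_diff: "set vs \<subseteq> V \<Longrightarrow> cartan l (a - b) vs = cartan l a vs - cartan l b vs"
  using cartan_add [of vs a "- b"] by (simp add: cartan_minus)

text \<open>Cartan's formula trades the contraction of a differential for a Lie derivative, which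
  obeys Leibniz, and the differential of a contraction, which is covered by induction. The auxiliary
  fact \<open>ec\<close> exchanges \<open>eps\<close> and the differential under the wedge.\<close>

lemma cartan_wedge:
  "set vs \<subseteq> V \<Longrightarrow> cartan l (wedge a b) vs = wedge (cartan l a) b vs + wedge (eps a) (cartan l b) vs"
proof (induction vs arbitrary: a b)
  case Nil then show ?case by simp
next
  case (Cons v vs)
  then have v: "v \<in> V" and vs: "set vs \<subseteq> V" by auto
  have ec: "wedge (cartan l (eps a)) b' vs = - wedge (eps (cartan l a)) b' vs" for b'
    using wedge_cong_on [OF vs, of "cartan l (eps a)" "- eps (cartan l a)" b' b']
    by (simp add: cartan_eps wedge_minus_left)
  show ?case
    using v vs by (simp add: cartan_Cons wedge_Cons iota_wedge lie_wedge cartan_add Cons.IH iota_cartan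
        wedge_diff_left wedge_diff_right wedge_add_left wedge_add_right ec iota_eps wedge_minus_left lie_eps)
qed

lemma cartan_fn [simp]: "v \<in> V \<Longrightarrow> cartan l (fn_form f) [v] = l v f"
  by (simp add: cartan_Cons lie_def fn_form_def)

lemma lie_zero_length:
  assumes "v \<in> V" "pure V' q a" "length vs \<noteq> q"
  shows "lie l v a vs = 0"
proof -
  have *: "a us = 0" if "length us \<noteq> q" for us
    using assms(2) that by (auto simp: pure_def)
  show ?thesis using assms(1,3) by (simp add: lie_def *)
qed

lemma cartan_zero_length:
  "pure V q a \<Longrightarrow> set vs \<subseteq> V \<Longrightarrow> length vs \<noteq> Suc q \<Longrightarrow> cartan l a vs = 0"
proof (induction vs arbitrary: a q)
  case Nil then show ?case by simp
next
  case (Cons v vs)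
  then have v: "v \<in> V" and vs: "set vs \<subseteq> V" by auto
  have "cartan l (iota v a) vs = 0"
  proof (cases q)
    case 0
    then show ?thesis using Cons.prems(1) cartan_zero [OF vs] by (simp add: pure_iota_0)
  next
    case (Suc q')
    then show ?thesis using Cons.IH [of q' "iota v a"] Cons.prems vs by (simp add: pure_iota)
  qed
  then show ?case using lie_zero_length [OF v Cons.prems(1), of vs] Cons.prems(3) by (simp add: cartan_Cons)
qed

end

section \<open>The exterior derivative on a space\<close>

locale space_calculus = lifted_derivations "lift S" "ders S"
  for S :: "('p, 'f::ab_group_add, 'r::comm_ring_1) space"
begin

abbreviation "d \<equiv> ext_d S"
abbreviation "V \<equiv> ders S"

lemma d_apply: "set vs \<subseteq> V \<Longrightarrow> d a vs = cartan (lift S) a vs"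
  and d_apply_notin: "\<not> set vs \<subseteq> V \<Longrightarrow> d a vs = 0"
  by (auto simp: ext_d_def)

lemma d_add: "d (a + b) = d a + d b"
  and d_minus: "d (- b) = - d b"
  and d_diff: "d (a - b) = d a - d b"
  and d_zero [simp]: "d 0 = 0"
  by (auto intro!: ext simp: ext_d_def cartan_add cartan_minus cartan_diff cartan_zero)

lemma d_eps: "d (eps a) = - eps (d a)"
proof
  show "d (eps a) vs = (- eps (d a)) vs" for vs
    by (cases "set vs \<subseteq> V") (simp_all add: d_apply d_apply_notin cartan_eps, simp_all add: eps_def d_apply d_apply_notin)
qed

lemma d_sum: "d (\<Sum>i\<in>A. a i) = (\<Sum>i\<in>A. d (a i))"
  by (induction A rule: infinite_finite_induct)
    (simp_all only: sum.infinite sum.empty sum.insert d_add d_zero not_False_eq_True)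

lemma pure_d: "pure V q a \<Longrightarrow> pure V (Suc q) (d a)"
  unfolding pure_def [of _ _ "d a"] using cartan_zero_length by (auto simp: ext_d_def split: if_splits)

text \<open>Homogeneity matters on lists that leave \<open>V\<close>: there the left side is zero by
  the definition of \<open>ext_d\<close>, and the right side is zero because a wedge of pure forms
  is supported on \<open>V\<close>.\<close>

lemma d_wedge:
  assumes "pure V p a" "pure V q b"
  shows "d (wedge a b) = wedge (d a) b + wedge (eps a) (d b)"
proof
  fix vs
  show "d (wedge a b) vs = (wedge (d a) b + wedge (eps a) (d b)) vs"
  proof (cases "set vs \<subseteq> V")
    case True
    have "wedge (cartan (lift S) a) b vs = wedge (d a) b vs"
      by (rule wedge_cong_on [OF True]) (auto simp: d_apply)
    moreover have "wedge (eps a) (cartan (lift S) b) vs = wedge (eps a) (d b) vs"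
      by (rule wedge_cong_on [OF True]) (auto simp: d_apply)
    ultimately show ?thesis by (simp add: d_apply [OF True] cartan_wedge [OF True])
  next
    case False
    have "pure V p (eps a)" using assms(1) by (rule pure_eps)
    then have "wedge (d a) b vs = 0" "wedge (eps a) (d b) vs = 0"
      using pure_wedge [OF pure_d [OF assms(1)] assms(2)] pure_wedge [OF _ pure_d [OF assms(2)]] False
      unfolding pure_def [of _ _ "wedge _ _"] by blast+
    with False show ?thesis by (simp add: d_apply_notin)
  qed
qed

lemma d_fn_apply: "d (fn_form f) [v] = (if v \<in> V then lift S v f else 0)"
  by (simp add: ext_d_def)

lemma pure_d_fn [simp]: "pure V (Suc 0) (d (fn_form f))"
  using pure_d [of 0 "fn_form f"] by simp

lemma d_scl: "pure V q a \<Longrightarrow> d (scl f a) = wedge (d (fn_form f)) a + scl f (d a)"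
  using d_wedge [of 0 "fn_form f" q a] by (simp add: wedge_fn_left)

lemma pure_1_eqI:
  assumes "pure V 1 a" "pure V 1 b" "\<And>v. v \<in> V \<Longrightarrow> a [v] = b [v]"
  shows "a = b"
proof
  fix vs show "a vs = b vs"
  proof (cases "length vs = 1 \<and> set vs \<subseteq> V")
    case True
    then obtain v where "vs = [v]" "v \<in> V" by (cases vs) auto
    then show ?thesis using assms(3) by simp
  next
    case False
    then have "a vs = 0" "b vs = 0" using assms unfolding pure_def by blast+
    then show ?thesis by simp
  qed
qed

lemma d_fn_mult: "d (fn_form (f * g)) = scl f (d (fn_form g)) + scl g (d (fn_form f))"
  by (rule pure_1_eqI) (auto intro!: pure_add pure_scl simp: d_fn_apply scl_apply lift_mult mult.commute)

lemma d_fn_one [simp]: "d (fn_form 1) = 0"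
  by (rule pure_1_eqI) (auto simp: d_fn_apply)

lemma d_d_fn [simp]: "d (d (fn_form f)) = 0"
proof
  fix vs show "d (d (fn_form f)) vs = 0 vs"
  proof (cases "length vs = 2 \<and> set vs \<subseteq> V")
    case True
    then obtain v w where vs: "vs = [v, w]" "v \<in> V" "w \<in> V"
      by (auto simp: length_Suc_conv numeral_2_eq_2)
    then show ?thesis
      by (simp add: d_apply cartan_Cons [of _ _ _ "[_]"] lie_def cartan_Cons [of _ "iota v _"] iota_apply
          d_fn_apply brk_in lift_brk)
  next
    case False
    then show ?thesis using pure_d [OF pure_d_fn, of f] unfolding pure_def by (auto simp: numeral_2_eq_2)
  qed
qed

text \<open>Forms are arbitrary functions of lists, so linearity has to be demanded. For
  \<open>d (d a) = 0\<close> in degree 1, compatibility with differences is the right amount: it is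
  what the Jacobi identity feeds into \<open>a\<close>.\<close>

definition lin1 :: "('f, 'r) dform \<Rightarrow> bool" where
  "lin1 a \<longleftrightarrow> pure V 1 a \<and> (\<forall>v\<in>V. \<forall>w\<in>V. a [\<lambda>x. v x - w x] = a [v] - a [w])"

text \<open>Degrees 0 and 1 are the ones that occur: the differential is squared on cochains of
  total degree at most 1, whose components have form degree at most 1.\<close>

lemma d_d_1:
  assumes "lin1 a"
  shows "d (d a) = 0"
proof
  have p: "pure V 1 a" using assms by (simp add: lin1_def)
  fix vs show "d (d a) vs = 0 vs"
  proof (cases "length vs = 3 \<and> set vs \<subseteq> V")
    case True
    then obtain u v w where vs: "vs = [u, v, w]" "u \<in> V" "v \<in> V" "w \<in> V"
      by (auto simp: length_Suc_conv numeral_3_eq_3)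
    \<comment> \<open>The Jacobi identity for \<open>brk\<close>, evaluated by \<open>a\<close>. All
      other terms of the triple expansion cancel in pairs or through
      \<open>lift_brk\<close>.\<close>
    have j: "a [brk (brk u v) w] = a [brk u (brk v w)] - a [brk v (brk u w)]" 
    proof -
      have "brk (brk u v) w = (\<lambda>x. brk u (brk v w) x - brk v (brk u w) x)"
        using vs by (simp add: brk_def fun_eq_iff der_diff)
      then show ?thesis using assms vs by (simp add: lin1_def brk_in)
    qed
    have d2: "d a [x, y] = lift S x (a [y]) - lift S y (a [x]) - a [brk x y]" if "x \<in> V" "y \<in> V" for x y
      using that by (simp add: d_apply cartan_Cons lie_def iota_apply)
    have "d (d a) vs = lie (lift S) u (d a) [v, w] - cartan (lift S) (iota u (d a)) [v, w]"
      using vs by (simp add: d_apply cartan_Cons)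
    also have "lie (lift S) u (d a) [v, w]
        = lift S u (d a [v, w]) - d a [brk u v, w] - d a [v, brk u w]"
      by (simp add: lie_def numeral_2_eq_2)
    also have "cartan (lift S) (iota u (d a)) [v, w]
        = lift S v (d a [u, w]) - d a [u, brk v w] - lift S w (d a [u, v])"
      by (simp add: cartan_Cons lie_def iota_apply)
    also have "lift S u (d a [v, w]) - d a [brk u v, w] - d a [v, brk u w] - \<dots> = 0"
      using vs by (simp add: d2 brk_in lift_diff lift_add lift_brk j algebra_simps)
    finally show ?thesis by simp
  next
    case False
    then show ?thesis using pure_d [OF pure_d [OF p]] unfolding pure_def
      by (auto simp: numeral_3_eq_3)
  qed
qed

end

section \<open>Matrices of forms\<close>

type_synonym ('f, 'r) matform = "nat \<Rightarrow> nat \<Rightarrow> ('f, 'r) dform"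

definition mw :: "nat \<Rightarrow> ('f, 'r::comm_ring_1) matform \<Rightarrow> ('f, 'r) matform \<Rightarrow> ('f, 'r) matform" where
  "mw r \<Phi> \<Psi> = (\<lambda>i l. \<Sum>j<r. wedge (\<Phi> i j) (\<Psi> j l))"

definition meps :: "('f, 'r::comm_ring_1) matform \<Rightarrow> ('f, 'r) matform" where
  "meps \<Phi> = (\<lambda>i l. eps (\<Phi> i l))"

definition md ::
    "('p, 'f::ab_group_add, 'r::comm_ring_1) space \<Rightarrow> ('f, 'r) matform \<Rightarrow> ('f, 'r) matform" where
  "md S \<Phi> = (\<lambda>i l. ext_d S (\<Phi> i l))"

definition mpure :: "('f \<Rightarrow> 'f) set \<Rightarrow> nat \<Rightarrow> ('f, 'r::zero) matform \<Rightarrow> bool" where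
  "mpure V q \<Phi> \<longleftrightarrow> (\<forall>i j. pure V q (\<Phi> i j))"

text \<open>The connection \<open>d + [\<Gamma>, -]\<close> on endomorphisms, with the graded
  commutator; \<open>meps\<close> supplies its sign in form degree \<open>q\<close>.\<close>

definition nb ::
    "('p, 'f::ab_group_add, 'r::comm_ring_1) space \<Rightarrow> nat \<Rightarrow> ('f, 'r) matform
      \<Rightarrow> ('f, 'r) matform \<Rightarrow> ('f, 'r) matform" where
  "nb S r \<Gamma> \<Phi> = md S \<Phi> + mw r \<Gamma> \<Phi> - mw r (meps \<Phi>) \<Gamma>"

lemma mw_zero_left [simp]: "mw r 0 \<Psi> = 0"
  and mw_zero_right [simp]: "mw r \<Phi> 0 = 0"
  and mw_add_left: "mw r (\<Phi> + \<Phi>') \<Psi> = mw r \<Phi> \<Psi> + mw r \<Phi>' \<Psi>"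
  and mw_add_right: "mw r \<Phi> (\<Psi> + \<Psi>') = mw r \<Phi> \<Psi> + mw r \<Phi> \<Psi>'"
  by (intro ext; simp add: mw_def wedge_add_left wedge_add_right sum.distrib)+

lemma mw_minus_left: "mw r (- \<Phi>) \<Psi> = - mw r \<Phi> \<Psi>"
  and mw_minus_right: "mw r \<Phi> (- \<Psi>) = - mw r \<Phi> \<Psi>"
  by (intro ext; simp add: mw_def wedge_minus_left wedge_minus_right sum_negf)+

lemma mw_diff_left: "mw r (\<Phi> - \<Phi>') \<Psi> = mw r \<Phi> \<Psi> - mw r \<Phi>' \<Psi>"
  and mw_diff_right: "mw r \<Phi> (\<Psi> - \<Psi>') = mw r \<Phi> \<Psi> - mw r \<Phi> \<Psi>'"
  by (simp_all only: diff_conv_add_uminus mw_add_left mw_add_right mw_minus_left mw_minus_right)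

lemma mw_sum_left: "mw r (\<Sum>i\<in>A. \<Phi> i) \<Psi> = (\<Sum>i\<in>A. mw r (\<Phi> i) \<Psi>)"
  by (induction A rule: infinite_finite_induct)
    (simp_all only: sum.infinite sum.empty sum.insert mw_zero_left mw_add_left not_False_eq_True)

lemma mw_sum_right: "mw r \<Phi> (\<Sum>i\<in>A. \<Psi> i) = (\<Sum>i\<in>A. mw r \<Phi> (\<Psi> i))"
  by (induction A rule: infinite_finite_induct)
    (simp_all only: sum.infinite sum.empty sum.insert mw_zero_right mw_add_right not_False_eq_True)

lemma mw_assoc: "mw r (mw r \<Phi> \<Psi>) \<Xi> = mw r \<Phi> (mw r \<Psi> \<Xi>)"
proof (intro ext)
  fix i l vs
  have "mw r (mw r \<Phi> \<Psi>) \<Xi> i l = (\<Sum>k<r. \<Sum>j<r. wedge (\<Phi> i j) (wedge (\<Psi> j k) (\<Xi> k l)))"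
    by (simp add: mw_def wedge_sum_left wedge_assoc)
  also have "\<dots> = mw r \<Phi> (mw r \<Psi> \<Xi>) i l"
    by (subst sum.swap) (simp add: mw_def wedge_sum_right)
  finally show "mw r (mw r \<Phi> \<Psi>) \<Xi> i l vs = mw r \<Phi> (mw r \<Psi> \<Xi>) i l vs" by simp
qed

lemma eps_sum: "eps (\<Sum>i\<in>A. a i) = (\<Sum>i\<in>A. eps (a i))"
  by (induction A rule: infinite_finite_induct)
    (simp_all only: sum.infinite sum.empty sum.insert eps_zero eps_add not_False_eq_True)

lemma meps_mw: "meps (mw r \<Phi> \<Psi>) = mw r (meps \<Phi>) (meps \<Psi>)"
  by (intro ext) (simp add: meps_def mw_def eps_sum eps_wedge)

lemma meps_add: "meps (\<Phi> + \<Psi>) = meps \<Phi> + meps \<Psi>"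
  and meps_minus: "meps (- \<Psi>) = - meps \<Psi>"
  and meps_diff: "meps (\<Phi> - \<Psi>) = meps \<Phi> - meps \<Psi>"
  and meps_zero [simp]: "meps 0 = 0"
  and meps_meps [simp]: "meps (meps \<Psi>) = \<Psi>"
  by (intro ext; simp add: meps_def)+

lemma meps_sum: "meps (\<Sum>i\<in>A. \<Phi> i) = (\<Sum>i\<in>A. meps (\<Phi> i))"
  by (induction A rule: infinite_finite_induct)
    (simp_all only: sum.infinite sum.empty sum.insert meps_zero meps_add not_False_eq_True)

lemma meps_pure:
  assumes "mpure V q \<Phi>"
  shows "meps \<Phi> = (if even q then \<Phi> else - \<Phi>)"
  by (intro ext) (use assms in \<open>auto simp: mpure_def meps_def eps_pure [of V q] scl_apply\<close>)

lemma mpure_add: "mpure V q \<Phi> \<Longrightarrow> mpure V q \<Psi> \<Longrightarrow> mpure V q (\<Phi> + \<Psi> :: ('f, 'r::comm_ring_1) matform)"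
  and mpure_diff: "mpure V q \<Phi> \<Longrightarrow> mpure V q \<Psi> \<Longrightarrow> mpure V q (\<Phi> - \<Psi> :: ('f, 'r::comm_ring_1) matform)"
  and mpure_minus: "mpure V q \<Phi> \<Longrightarrow> mpure V q (- \<Phi> :: ('f, 'r::comm_ring_1) matform)"
  and mpure_zero [simp]: "mpure V q (0 :: ('f, 'r::comm_ring_1) matform)"
  and mpure_meps: "mpure V q \<Phi>' \<Longrightarrow> mpure V q (meps \<Phi>')"
  by (auto simp: mpure_def meps_def intro: pure_add pure_diff pure_minus pure_eps)

lemma mpure_mw: "mpure V p \<Phi> \<Longrightarrow> mpure V q \<Psi> \<Longrightarrow> mpure V (p + q) (mw r \<Phi> \<Psi>)"
  by (auto simp: mpure_def mw_def intro!: pure_sum pure_wedge)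

context space_calculus
begin

lemma md_add: "md S (\<Phi> + \<Psi>) = md S \<Phi> + md S \<Psi>"
  and md_diff: "md S (\<Phi> - \<Psi>) = md S \<Phi> - md S \<Psi>"
  and md_minus: "md S (- \<Psi>) = - md S \<Psi>"
  and md_zero [simp]: "md S 0 = 0"
  and md_meps: "md S (meps \<Psi>) = - meps (md S \<Psi>)"
  by (intro ext; simp add: md_def meps_def d_add d_diff d_minus d_eps)+

lemma mpure_md: "mpure V q \<Phi> \<Longrightarrow> mpure V (Suc q) (md S \<Phi>)"
  by (auto simp: mpure_def md_def intro: pure_d)

lemma md_mw:
  "mpure V p \<Phi> \<Longrightarrow> mpure V q \<Psi> \<Longrightarrow> md S (mw r \<Phi> \<Psi>) = mw r (md S \<Phi>) \<Psi> + mw r (meps \<Phi>) (md S \<Psi>)"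
  by (intro ext) (simp add: md_def mw_def meps_def mpure_def d_sum d_wedge [of p _ q] sum.distrib)

lemma nb_add: "nb S r \<Gamma> (\<Phi> + \<Psi>) = nb S r \<Gamma> \<Phi> + nb S r \<Gamma> \<Psi>"
  and nb_diff: "nb S r \<Gamma> (\<Phi> - \<Psi>) = nb S r \<Gamma> \<Phi> - nb S r \<Gamma> \<Psi>"
  and nb_minus: "nb S r \<Gamma> (- \<Psi>) = - nb S r \<Gamma> \<Psi>"
  and nb_zero [simp]: "nb S r \<Gamma> 0 = 0"
  by (simp_all add: nb_def md_add md_diff md_minus mw_add_left mw_diff_left mw_minus_left
      mw_add_right mw_diff_right mw_minus_right meps_add meps_diff meps_minus algebra_simps)

lemma mpure_nb:
  assumes "mpure V 1 \<Gamma>" "mpure V q \<Phi>"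
  shows "mpure V (Suc q) (nb S r \<Gamma> \<Phi>)"
  using mpure_mw [OF assms(1,2)] mpure_mw [OF mpure_meps [OF assms(2)] assms(1)]
  by (auto simp: nb_def intro!: mpure_add mpure_diff mpure_md assms)

text \<open>A graded commutator is a graded derivation: the two terms with \<open>\<Gamma>\<close>
  between the factors cancel.\<close>

lemma nb_mw:
  assumes "mpure V 1 \<Gamma>" "mpure V p \<Phi>" "mpure V q \<Psi>"
  shows "nb S r \<Gamma> (mw r \<Phi> \<Psi>) = mw r (nb S r \<Gamma> \<Phi>) \<Psi> + mw r (meps \<Phi>) (nb S r \<Gamma> \<Psi>)"
  by (simp add: nb_def md_mw [OF assms(2,3)] meps_mw mw_add_left mw_diff_left mw_add_right
      mw_diff_right mw_assoc)

text \<open>The square of the connection is \<open>md S (md S \<Phi>)\<close> plus the commutator of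
  \<open>\<Phi>\<close> with the curvature
  \<open>md S \<Gamma> + mw r \<Gamma> \<Gamma>\<close>.\<close>

lemma nb_nb:
  assumes "mpure V 1 \<Gamma>" "md S \<Gamma> + mw r \<Gamma> \<Gamma> = 0" "mpure V q \<Phi>" "md S (md S \<Phi>) = 0"
  shows "nb S r \<Gamma> (nb S r \<Gamma> \<Phi>) = 0"
proof -
  have e: "meps \<Gamma> = - \<Gamma>" using meps_pure [OF assms(1)] by simp
  have f: "md S \<Gamma> = - mw r \<Gamma> \<Gamma>" using assms(2) by (simp add: eq_neg_iff_add_eq_0)
  show ?thesis
    by (simp add: nb_def md_add md_diff assms(4) md_mw [OF assms(1,3)] md_mw [OF mpure_meps [OF assms(3)] assms(1)]
        md_meps e f mw_add_left mw_diff_left mw_add_right mw_diff_right mw_minus_left mw_minus_right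
        meps_add meps_diff meps_mw mw_assoc)
qed

end

section \<open>The cup product of Cech cochains\<close>

text \<open>Front face times back face, cut at the vertex number \<open>k\<close>. The exponent of
  \<open>meps\<close> is the Cech degree of the second factor: this is the Koszul sign for moving it
  past the form degree of the first.\<close>

definition cup ::
    "nat \<Rightarrow> ('i list \<Rightarrow> ('f, 'r::comm_ring_1) matform) \<Rightarrow> ('i list \<Rightarrow> ('f, 'r) matform)
      \<Rightarrow> 'i list \<Rightarrow> ('f, 'r) matform" where
  "cup r x y l = (\<Sum>k<length l.
     mw r ((meps ^^ (length l - 1 - k)) (x (take (Suc k) l))) (y (drop k l)))"

lemma mepsn_add: "(meps ^^ n) (\<Phi> + \<Psi>) = (meps ^^ n) \<Phi> + (meps ^^ n) \<Psi>"
  and mepsn_mw: "(meps ^^ n) (mw r \<Phi> \<Psi>) = mw r ((meps ^^ n) \<Phi>) ((meps ^^ n) \<Psi>)"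
  and mepsn_zero [simp]: "(meps ^^ n) 0 = 0"
  and mepsn_sum: "(meps ^^ n) (\<Sum>i\<in>A. \<Xi> i) = (\<Sum>i\<in>A. (meps ^^ n) (\<Xi> i))"
  by (induction n) (simp_all add: meps_add meps_mw meps_sum)

lemma cup_add_left: "cup r (x + x') y = cup r x y + cup r x' y"
  and cup_add_right: "cup r x (y + y') = cup r x y + cup r x y'"
  by (rule ext; simp add: cup_def mepsn_add mw_add_left mw_add_right sum.distrib)+

text \<open>Either bracketing is a sum over pairs of cut vertices \<open>j \<le> k\<close>. The
  signs on \<open>x\<close> agree because \<open>n - 1 - j\<close> is the sum of
  \<open>n - 1 - k\<close> and \<open>k - j\<close>. Degrees play no part, so the identity holds for
  arbitrary families of matrices of forms.\<close>

lemma cup_assoc: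
  fixes x y w :: "'i list \<Rightarrow> ('f, 'r::comm_ring_1) matform"
  shows "cup r (cup r x y) w = cup r x (cup r y w)"
proof
  fix l :: "'i list"
  define n where "n = length l"
  define T where "T j k = mw r ((meps ^^ (n - 1 - j)) (x (take (Suc j) l)))
    (mw r ((meps ^^ (n - 1 - k)) (y (drop j (take (Suc k) l)))) (w (drop k l)))" for j k
  have "cup r (cup r x y) w l = (\<Sum>k<n. \<Sum>j<Suc k. T j k)"
    unfolding cup_def n_def [symmetric]
  proof (rule sum.cong [OF refl])
    fix k assume "k \<in> {..<n}"
    then have k: "length (take (Suc k) l) = Suc k" "k < n" by (auto simp: n_def)
    have "(meps ^^ (n - 1 - k)) ((meps ^^ (k - j)) (x l')) = (meps ^^ (n - 1 - j)) (x l')" if "j < Suc k" for j l'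
    proof -
      have "n - 1 - j = (n - 1 - k) + (k - j)" using that k(2) by simp
      then show ?thesis by (simp only: funpow_add comp_apply)
    qed
    moreover have "take (Suc j) (take (Suc k) l) = take (Suc j) l" if "j < Suc k" for j
      using that by (simp add: min_def)
    ultimately show "mw r ((meps ^^ (n - 1 - k)) (\<Sum>j<length (take (Suc k) l).
        mw r ((meps ^^ (length (take (Suc k) l) - 1 - j)) (x (take (Suc j) (take (Suc k) l))))
          (y (drop j (take (Suc k) l))))) (w (drop k l)) = (\<Sum>j<Suc k. T j k)"
      unfolding k mepsn_sum mw_sum_left
      by (intro sum.cong refl) (simp add: mepsn_mw mw_assoc T_def)
  qed
  \<comment> \<open>Sum over the earlier cut first; \<open>i\<close> is the position of the later
    cut relative to it, as it appears in the inner product on the right.\<close>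
  also have "\<dots> = (\<Sum>j<n. \<Sum>i<n - j. T j (j + i))"
    unfolding sum.Sigma [OF finite_lessThan ballI [OF finite_lessThan]]
    by (rule sum.reindex_bij_witness [where i = "\<lambda>(j, i). (j + i, j)" and j = "\<lambda>(k, j). (j, k - j)"]) auto
  also have "\<dots> = cup r x (cup r y w) l"
    unfolding cup_def n_def [symmetric]
    by (intro sum.cong refl) (simp add: mw_sum_right T_def n_def take_drop add.commute diff_diff_left)
  finally show "cup r (cup r x y) w l = cup r x (cup r y w) l" .
qed

lemma sum_fun_apply: "(\<Sum>i\<in>A. f i) x = (\<Sum>i\<in>A. f i x)"
  by (induction A rule: infinite_finite_induct)
    (simp_all only: sum.infinite sum.empty sum.insert zero_fun_apply plus_fun_apply not_False_eq_True)

text \<open>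
  The shape of an element of degree \<open>n\<close> of the total complex, without the conditions on stalks.
\<close>

definition coch ::
    "('f \<Rightarrow> 'f) set \<Rightarrow> nat \<Rightarrow> 'i set \<Rightarrow> nat \<Rightarrow> ('i list \<Rightarrow> ('f, 'r::comm_ring_1) matform) \<Rightarrow> bool" where
  "coch V r I n c \<longleftrightarrow>
     (\<forall>l. if l \<noteq> [] \<and> set l \<subseteq> I \<and> length l \<le> Suc n
          then mpure V (Suc n - length l) (c l) \<and> (\<forall>i j. i \<ge> r \<or> j \<ge> r \<longrightarrow> c l i j = 0)
          else c l = 0)"

lemma coch_zero: "coch V r I n c \<Longrightarrow> \<not> (l \<noteq> [] \<and> set l \<subseteq> I \<and> length l \<le> Suc n) \<Longrightarrow> c l = 0"
  unfolding coch_def by presburger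

lemma coch_pure: "coch V r I n c \<Longrightarrow> mpure V (Suc n - length l) (c l)"
  unfolding coch_def by (metis mpure_zero)

lemma coch_outside: "coch V r I n c \<Longrightarrow> i \<ge> r \<or> j \<ge> r \<Longrightarrow> c l i j = 0"
  unfolding coch_def by (metis zero_fun_apply)

locale flat_matrix = space_calculus S
  for S :: "('p, 'f::comm_ring_1, 'f) space" +
  fixes r :: nat and nab :: "('f, 'f) conn" and \<Gamma> :: "('f, 'f) matform"
  assumes nab_unit: "nab (unit_vec r l) i = \<Gamma> i l"
    and nab_zero: "nab (\<lambda>j. 0) i = 0"
    and \<Gamma>_outside: "i \<ge> r \<or> l \<ge> r \<Longrightarrow> \<Gamma> i l = 0"
    and \<Gamma>_pure: "mpure (ders S) 1 \<Gamma>"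
    and flat: "md S \<Gamma> + mw r \<Gamma> \<Gamma> = 0"
begin

lemma End_nabla0_elementary:
  assumes "a < r" "b < r"
  shows "End_nabla0 r nab (\<lambda>i j. if i = a \<and> j = b then 1 else 0) i l
    = (if l = b then \<Gamma> i a else 0) - (if i = a then \<Gamma> b l else 0)"
proof
  fix vs
  have "(\<lambda>j. if j = a \<and> l = b then 1 else 0) = (if l = b then unit_vec r a else (\<lambda>j. 0))"
    using assms by (auto simp: unit_vec_def)
  then have "nab (\<lambda>j. if j = a \<and> l = b then 1 else 0) i = (if l = b then \<Gamma> i a else 0)"
    by (metis nab_unit nab_zero)
  moreover have "(\<Sum>j<r. (if i = a \<and> j = b then 1 else 0) * \<Gamma> j l vs) = (if i = a then \<Gamma> b l vs else 0)"
    using assms by (simp add: if_distrib [of "\<lambda>x. x * _"] sum.delta' cong: if_cong)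
  ultimately show "End_nabla0 r nab (\<lambda>i j. if i = a \<and> j = b then 1 else 0) i l vs
    = ((if l = b then \<Gamma> i a else 0) - (if i = a then \<Gamma> b l else 0)) vs"
    unfolding End_nabla0_def nab_unit by simp
qed

text \<open>The derivative of an elementary matrix is a column of \<open>\<Gamma>\<close> minus a
  row of \<open>\<Gamma>\<close>. In the resulting second sum the connection form stands on the left
  of \<open>\<Phi>\<close>; moving it to the right produces \<open>meps\<close>.\<close>

lemma End_nabla_eq:
  assumes "mpure V q \<Phi>" and out: "\<And>i j. i \<ge> r \<or> j \<ge> r \<Longrightarrow> \<Phi> i j = 0"
  shows "End_nabla S r nab \<Phi> = nb S r \<Gamma> \<Phi>"
proof (intro ext)
  fix i l vs
  have 1: "(\<Sum>a<r. \<Sum>b<r. wedge (if l = b then \<Gamma> i a else 0) (\<Phi> a b)) = mw r \<Gamma> \<Phi> i l"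
  proof -
    have "(\<Sum>b<r. wedge (if l = b then \<Gamma> i a else 0) (\<Phi> a b)) = wedge (\<Gamma> i a) (\<Phi> a l)" for a
    proof (cases "l < r")
      case True
      then show ?thesis by (simp add: if_distrib [of "\<lambda>x. wedge x _"] sum.delta cong: if_cong)
    next
      case False
      then show ?thesis using out [of a l] by (auto intro!: sum.neutral)
    qed
    then show ?thesis by (simp add: mw_def)
  qed
  have 2: "(\<Sum>a<r. \<Sum>b<r. wedge (if i = a then \<Gamma> b l else 0) (\<Phi> a b)) = mw r (meps \<Phi>) \<Gamma> i l"
  proof -
    have "(\<Sum>a<r. wedge (if i = a then \<Gamma> b l else 0) (\<Phi> a b)) = wedge (\<Gamma> b l) (\<Phi> i b)" for b
    proof (cases "i < r")
      case True
      then show ?thesis by (simp add: if_distrib [of "\<lambda>x. wedge x _"] sum.delta cong: if_cong)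
    next
      case False
      then show ?thesis using out [of i b] by (auto intro!: sum.neutral)
    qed
    moreover have "wedge (\<Gamma> b l) (\<Phi> i b) = wedge (eps (\<Phi> i b)) (\<Gamma> b l)" for b
      using \<Gamma>_pure by (intro wedge_1_comm [of V]) (simp add: mpure_def)
    ultimately show ?thesis by (subst sum.swap) (simp add: mw_def meps_def)
  qed
  have "End_nabla S r nab \<Phi> i l vs = ((\<Sum>a<r. \<Sum>b<r.
      wedge ((if l = b then \<Gamma> i a else 0) - (if i = a then \<Gamma> b l else 0)) (\<Phi> a b)) + d (\<Phi> i l)) vs"
    unfolding End_nabla_def
    by (simp add: sum_fun_apply, intro sum.cong refl) (simp add: End_nabla0_elementary)
  also have "\<dots> = nb S r \<Gamma> \<Phi> i l vs"
    by (simp only: wedge_diff_left sum_subtractf 1 2) (simp add: nb_def md_def)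
  finally show "End_nabla S r nab \<Phi> i l vs = nb S r \<Gamma> \<Phi> i l vs" .
qed

abbreviation "nbl \<equiv> nb S r \<Gamma>"

lemma total_d_eq:
  assumes "coch V r I n c" "l \<noteq> []" "set l \<subseteq> I"
  shows "total_d S r nab I c l = (\<Sum>m<length l. (if even m then c (take m l @ drop (Suc m) l)
      else - c (take m l @ drop (Suc m) l))) + (if odd (length l) then nbl (c l) else - nbl (c l))"
proof (intro ext)
  fix i j vs
  have "End_nabla S r nab (c l) = nbl (c l)"
    using End_nabla_eq [OF coch_pure [OF assms(1)]] coch_outside [OF assms(1)] by blast
  moreover have "(\<Sum>m<length l. (if even m then c (take m l @ drop (Suc m) l)
      else - c (take m l @ drop (Suc m) l))) i j vs = (\<Sum>m<length l. (-1) ^ m * c (take m l @ drop (Suc m) l) i j vs)"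
    by (auto simp: sum_fun_apply intro!: sum.cong)
  ultimately show "total_d S r nab I c l i j vs = ((\<Sum>m<length l. (if even m then c (take m l @ drop (Suc m) l)
      else - c (take m l @ drop (Suc m) l))) + (if odd (length l) then nbl (c l) else - nbl (c l))) i j vs"
    using assms(2,3) by (cases l) (simp_all add: total_d_def)
qed

lemma total_d_outside: "\<not> (l \<noteq> [] \<and> set l \<subseteq> I) \<Longrightarrow> total_d S r nab I c l = 0"
  by (intro ext) (auto simp: total_d_def)

lemma total_d_1: "coch V r I n c \<Longrightarrow> \<alpha> \<in> I \<Longrightarrow> total_d S r nab I c [\<alpha>] = nbl (c [\<alpha>])"
  by (simp add: total_d_eq coch_zero flip: zero_fun_def)

lemma total_d_2: "coch V r I n c \<Longrightarrow> \<alpha> \<in> I \<Longrightarrow> \<beta> \<in> I \<Longrightarrow>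
    total_d S r nab I c [\<alpha>, \<beta>] = c [\<beta>] - c [\<alpha>] - nbl (c [\<alpha>, \<beta>])"
  by (simp add: total_d_eq)

lemma total_d_3: "coch V r I n c \<Longrightarrow> \<alpha> \<in> I \<Longrightarrow> \<beta> \<in> I \<Longrightarrow> \<gamma> \<in> I \<Longrightarrow>
    total_d S r nab I c [\<alpha>, \<beta>, \<gamma>] = c [\<beta>, \<gamma>] - c [\<alpha>, \<gamma>] + c [\<alpha>, \<beta>] + nbl (c [\<alpha>, \<beta>, \<gamma>])"
  by (simp add: total_d_eq)

lemma total_d_4: "coch V r I n c \<Longrightarrow> \<alpha> \<in> I \<Longrightarrow> \<beta> \<in> I \<Longrightarrow> \<gamma> \<in> I \<Longrightarrow> \<delta> \<in> I \<Longrightarrow>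
    total_d S r nab I c [\<alpha>, \<beta>, \<gamma>, \<delta>] = c [\<beta>, \<gamma>, \<delta>] - c [\<alpha>, \<gamma>, \<delta>] + c [\<alpha>, \<beta>, \<delta>] - c [\<alpha>, \<beta>, \<gamma>]
      - nbl (c [\<alpha>, \<beta>, \<gamma>, \<delta>])"
  by (simp add: total_d_eq)

lemma total_d_long:
  assumes "coch V r I n c" "length l > Suc (Suc n)"
  shows "total_d S r nab I c l = 0"
proof (cases "l \<noteq> [] \<and> set l \<subseteq> I")
  case True
  have "c l' = 0" if "length l' > Suc n" for l' using coch_zero [OF assms(1)] that by simp
  then show ?thesis using assms True by (auto simp: total_d_eq intro!: sum.neutral)
next
  case False then show ?thesis by (rule total_d_outside)
qed

lemma coch_total_d:
  fixes c :: "'i list \<Rightarrow> ('f, 'f) matform"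
  assumes "coch V r I n c"
  shows "coch V r I (Suc n) (total_d S r nab I c)"
  unfolding coch_def
proof (intro allI)
  fix l :: "'i list"
  note pure' = coch_pure [OF assms] and out = coch_outside [OF assms]
  show "if l \<noteq> [] \<and> set l \<subseteq> I \<and> length l \<le> Suc (Suc n)
     then mpure V (Suc (Suc n) - length l) (total_d S r nab I c l) \<and>
       (\<forall>i j. i \<ge> r \<or> j \<ge> r \<longrightarrow> total_d S r nab I c l i j = 0)
     else total_d S r nab I c l = 0"
  proof (cases "l \<noteq> [] \<and> set l \<subseteq> I \<and> length l \<le> Suc (Suc n)")
    case True
    then have l: "l \<noteq> []" "set l \<subseteq> I" by auto
    have 1: "mpure V (Suc (Suc n) - length l) (c (take m l @ drop (Suc m) l))" if "m < length l" for m
      using pure' [of "take m l @ drop (Suc m) l"] that by (simp add: Suc_diff_le)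
    have 2: "mpure V (Suc (Suc n) - length l) (nbl (c l))"
    proof (cases "length l = Suc (Suc n)")
      case True
      then show ?thesis using coch_zero [OF assms, of l] by simp
    next
      case False
      with True show ?thesis using mpure_nb [OF \<Gamma>_pure pure' [of l], of r] by (simp add: Suc_diff_le)
    qed
    have "nbl (c l) i j = 0" if "i \<ge> r \<or> j \<ge> r" for i j
    proof -
      have "mw r \<Gamma> (c l) i j = 0" "mw r (meps (c l)) \<Gamma> i j = 0"
        using that \<Gamma>_outside out by (auto simp: mw_def meps_def intro!: sum.neutral)
      then show ?thesis using out [OF that] by (simp add: nb_def md_def)
    qed
    then have "total_d S r nab I c l i j = 0" if "i \<ge> r \<or> j \<ge> r" for i j
      using that out [OF that]
      by (auto simp: total_d_eq [OF assms l] sum_fun_apply intro!: sum.neutral)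
    moreover have "mpure V (Suc (Suc n) - length l) (total_d S r nab I c l)"
      unfolding total_d_eq [OF assms l]
    proof (rule mpure_add)
      show "mpure V (Suc (Suc n) - length l) (\<Sum>m<length l. if even m then c (take m l @ drop (Suc m) l)
          else - c (take m l @ drop (Suc m) l))"
        using 1 by (auto simp: mpure_def sum_fun_apply intro!: pure_sum pure_minus)
    qed (use 2 in \<open>auto intro: mpure_minus\<close>)
    ultimately show ?thesis using True by simp
  next
    case False
    then show ?thesis using total_d_long [OF assms] total_d_outside by (metis not_le)
  qed
qed

text \<open>Total degrees up to 3 occur below, so at most four indices matter. Checking each length
  separately keeps all signs explicit.\<close>

lemma coch_cases:
  assumes "\<And>\<alpha>. \<alpha> \<in> I \<Longrightarrow> P [\<alpha>]" "\<And>\<alpha> \<beta>. \<alpha> \<in> I \<Longrightarrow> \<beta> \<in> I \<Longrightarrow> P [\<alpha>, \<beta>]"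
    "\<And>\<alpha> \<beta> \<gamma>. \<alpha> \<in> I \<Longrightarrow> \<beta> \<in> I \<Longrightarrow> \<gamma> \<in> I \<Longrightarrow> P [\<alpha>, \<beta>, \<gamma>]"
    "\<And>\<alpha> \<beta> \<gamma> \<delta>. \<alpha> \<in> I \<Longrightarrow> \<beta> \<in> I \<Longrightarrow> \<gamma> \<in> I \<Longrightarrow> \<delta> \<in> I \<Longrightarrow> P [\<alpha>, \<beta>, \<gamma>, \<delta>]"
    "\<And>l. length l > 4 \<Longrightarrow> P l" "\<And>l. \<not> (l \<noteq> [] \<and> set l \<subseteq> I) \<Longrightarrow> P l"
  shows "P l"
proof (cases "length l > 4 \<or> \<not> (l \<noteq> [] \<and> set l \<subseteq> I)")
  case False
  then have "l \<noteq> []" "set l \<subseteq> I" "length l \<le> 4" by auto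
  moreover obtain a b c e l' where "l = [] \<or> l = [a] \<or> l = [a, b] \<or> l = [a, b, c] \<or> l = a # b # c # e # l'"
    by (metis list.exhaust)
  ultimately show ?thesis using assms(1-4) by auto
qed (use assms(5,6) in auto)

text \<open>The Cech faces cancel as usual, the mixed terms cancel because the sign of the vertical
  differential alternates with the Cech degree, and the vertical square vanishes by
  flatness.\<close>

lemma total_d_total_d:
  assumes c: "coch V r I n c" "n \<le> 1" and dd: "\<And>l. md S (md S (c l)) = 0"
  shows "total_d S r nab I (total_d S r nab I c) = 0"
proof
  note c' = coch_total_d [OF c(1)]
  have nn: "nbl (nbl (c l)) = 0" for l
    by (rule nb_nb [OF \<Gamma>_pure flat coch_pure [OF c(1)] dd])
  have z: "c l = 0" if "length l > 2" for l
    using coch_zero [OF c(1), of l] c(2) that by auto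
  show "total_d S r nab I (total_d S r nab I c) l = 0 l" for l
  proof (rule coch_cases [where P = "\<lambda>l. total_d S r nab I (total_d S r nab I c) l = 0 l" and I = I])
    show "total_d S r nab I (total_d S r nab I c) l = 0 l" if "length l > 4" for l
      using total_d_long [OF c', of l] that c(2) by simp
  qed (simp_all add: total_d_outside total_d_1 [OF c'] total_d_2 [OF c'] total_d_3 [OF c'] total_d_4 [OF c']
      total_d_1 [OF c(1)] total_d_2 [OF c(1)] total_d_3 [OF c(1)] total_d_4 [OF c(1)] nn nb_add nb_diff nb_minus z)
qed

lemma cup_1: "cup r x y [\<alpha>] = mw r (x [\<alpha>]) (y [\<alpha>])"
  and cup_2: "cup r x y [\<alpha>, \<beta>] = mw r (meps (x [\<alpha>])) (y [\<alpha>, \<beta>]) + mw r (x [\<alpha>, \<beta>]) (y [\<beta>])"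
  and cup_3: "cup r x y [\<alpha>, \<beta>, \<gamma>] = mw r (x [\<alpha>]) (y [\<alpha>, \<beta>, \<gamma>]) +
    mw r (meps (x [\<alpha>, \<beta>])) (y [\<beta>, \<gamma>]) + mw r (x [\<alpha>, \<beta>, \<gamma>]) (y [\<gamma>])"
  and cup_4: "cup r x y [\<alpha>, \<beta>, \<gamma>, \<delta>] = mw r (meps (x [\<alpha>])) (y [\<alpha>, \<beta>, \<gamma>, \<delta>]) +
    mw r (x [\<alpha>, \<beta>]) (y [\<beta>, \<gamma>, \<delta>]) + mw r (meps (x [\<alpha>, \<beta>, \<gamma>])) (y [\<gamma>, \<delta>]) +
    mw r (x [\<alpha>, \<beta>, \<gamma>, \<delta>]) (y [\<delta>])"
  by (simp_all add: cup_def numeral_3_eq_3 numeral_2_eq_2)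

lemma cup_outside:
  assumes "\<And>l. \<not> (l \<noteq> [] \<and> set l \<subseteq> I) \<Longrightarrow> x l = 0" "\<And>l. \<not> (l \<noteq> [] \<and> set l \<subseteq> I) \<Longrightarrow> y l = 0"
    "\<not> (l \<noteq> [] \<and> set l \<subseteq> I)"
  shows "cup r x y l = 0"
proof (cases "l = []")
  case False
  have "mw r ((meps ^^ (length l - 1 - k)) (x (take (Suc k) l))) (y (drop k l)) = 0" if "k < length l" for k
  proof (cases "set (take (Suc k) l) \<subseteq> I")
    case True
    have "set l = set (take k l) \<union> set (drop k l)" by (metis append_take_drop_id set_append)
    moreover have "set (take k l) \<subseteq> set (take (Suc k) l)" by (simp add: set_take_subset_set_take)
    ultimately have "\<not> set (drop k l) \<subseteq> I" using True False assms(3) by blast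
    then show ?thesis using assms(2) by simp
  qed (use assms(1) in simp)
  then show ?thesis by (simp add: cup_def)
qed (simp add: cup_def)

lemma cup_long:
  assumes x: "coch V r I m x" and y: "coch V r I n y" and "length l > m + n + 1"
  shows "cup r x y l = 0"
proof -
  have "mw r ((meps ^^ (length l - 1 - k)) (x (take (Suc k) l))) (y (drop k l)) = 0" if "k < length l" for k
  proof (cases "k \<le> m")
    case True
    then have "y (drop k l) = 0" using assms(3) by (intro coch_zero [OF y]) auto
    then show ?thesis by simp
  next
    case False
    then have "x (take (Suc k) l) = 0" using assms(3) that by (intro coch_zero [OF x]) auto
    then show ?thesis by simp
  qed
  then show ?thesis by (simp add: cup_def)
qed

lemma mw_outside:
  assumes "\<And>i j. i \<ge> r \<or> j \<ge> r \<Longrightarrow> \<Phi> i j = 0" "\<And>i j. i \<ge> r \<or> j \<ge> r \<Longrightarrow> \<Psi> i j = 0" "i \<ge> r \<or> j \<ge> r"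
  shows "mw r \<Phi> \<Psi> i j = 0"
  using assms by (auto simp: mw_def intro!: sum.neutral)

lemma coch_cup:
  assumes x: "coch V r I 1 x" and y: "coch V r I 1 y"
  shows "coch V r I 2 (cup r x y)"
proof -
  have out: "mw r (meps (x l)) (y l') i j = 0" "mw r (x l) (y l') i j = 0" if "i \<ge> r \<or> j \<ge> r" for i j l l'
    using that coch_outside [OF x] coch_outside [OF y]
    by (auto intro!: mw_outside simp: meps_def)
  have p: "mpure V (4 - length l - length l') (mw r (x l) (y l'))"
     "mpure V (4 - length l - length l') (mw r (meps (x l)) (y l'))" if "length l \<le> 2" "length l' \<le> 2" for l l'
  proof -
    have e: "4 - length l - length l' = (Suc 1 - length l) + (Suc 1 - length l')"
      using that by simp
    show "mpure V (4 - length l - length l') (mw r (x l) (y l'))"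
      "mpure V (4 - length l - length l') (mw r (meps (x l)) (y l'))"
      unfolding e using mpure_mw [OF coch_pure [OF x, of l] coch_pure [OF y, of l']]
      mpure_mw [OF mpure_meps [OF coch_pure [OF x, of l]] coch_pure [OF y, of l']]
      by simp_all
  qed
  have z: "x l = 0" "y l = 0" if "length l > 2" for l
    using coch_zero [OF x, of l] coch_zero [OF y, of l] that by auto
  have "if l \<noteq> [] \<and> set l \<subseteq> I \<and> length l \<le> Suc 2
     then mpure V (Suc 2 - length l) (cup r x y l) \<and> (\<forall>i j. i \<ge> r \<or> j \<ge> r \<longrightarrow> cup r x y l i j = 0)
     else cup r x y l = 0" for l
  proof (rule coch_cases [where I = I and l = l], goal_cases)
    case (1 \<alpha>)
    then show ?case using out p(1) [of "[\<alpha>]" "[\<alpha>]"] by (simp add: cup_1 numeral_eq_Suc)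
  next
    case (2 \<alpha> \<beta>)
    then show ?case using out p(1) [of "[\<alpha>, \<beta>]" "[\<beta>]"] p(2) [of "[\<alpha>]" "[\<alpha>, \<beta>]"]
      by (simp add: cup_2 numeral_eq_Suc mpure_add)
  next
    case (3 \<alpha> \<beta> \<gamma>)
    then show ?case using out p(2) [of "[\<alpha>, \<beta>]" "[\<beta>, \<gamma>]"] by (simp add: cup_3 numeral_eq_Suc z)
  next
    case (6 l)
    have "cup r x y l = 0"
      by (rule cup_outside [OF _ _ 6]) (use coch_zero [OF x] coch_zero [OF y] in metis)+
    then show ?case using 6 by auto
  qed (simp_all add: cup_long [OF x y])
  then show ?thesis unfolding coch_def by blast
qed

text \<open>The graded Leibniz rule; the minus sign is that of total degree 1 of the first
  factor.\<close>

lemma total_d_cup: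
  assumes x: "coch V r I 1 x" and y: "coch V r I 1 y"
  shows "total_d S r nab I (cup r x y) = cup r (total_d S r nab I x) y - cup r x (total_d S r nab I y)"
proof
  note dx = coch_total_d [OF x] and dy = coch_total_d [OF y] and xy = coch_cup [OF x y]
  have z: "x l = 0" "y l = 0" if "length l > 2" for l
    using coch_zero [OF x, of l] coch_zero [OF y, of l] that by auto
  have z': "total_d S r nab I x l = 0" "total_d S r nab I y l = 0" if "length l > 3" for l
    using total_d_long [OF x, of l] total_d_long [OF y, of l] that by auto
  have n: "nbl (mw r (x l) (y l')) = mw r (nbl (x l)) (y l') + mw r (meps (x l)) (nbl (y l'))"
    "nbl (mw r (meps (x l)) (y l')) = mw r (nbl (meps (x l))) (y l') + mw r (x l) (nbl (y l'))" for l l'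
    using nb_mw [OF \<Gamma>_pure coch_pure [OF x, of l] coch_pure [OF y, of l']]
      nb_mw [OF \<Gamma>_pure mpure_meps [OF coch_pure [OF x, of l]] coch_pure [OF y, of l']] by simp_all
  \<comment> \<open>In total degree 1 the component on one index is a 1-form and the component on
    two indices a function; the derivative raises the degree by one and reverses the sign.\<close>
  have e: "meps (x [\<alpha>]) = - x [\<alpha>]" "meps (y [\<alpha>]) = - y [\<alpha>]"
    "meps (nbl (x [\<alpha>])) = nbl (x [\<alpha>])" "meps (x [\<alpha>, \<beta>]) = x [\<alpha>, \<beta>]" "meps (y [\<alpha>, \<beta>]) = y [\<alpha>, \<beta>]"
    "meps (nbl (x [\<alpha>, \<beta>])) = - nbl (x [\<alpha>, \<beta>])" for \<alpha> \<beta>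
    using meps_pure [OF coch_pure [OF x, of "[\<alpha>]"]] meps_pure [OF coch_pure [OF y, of "[\<alpha>]"]]
      meps_pure [OF mpure_nb [OF \<Gamma>_pure coch_pure [OF x, of "[\<alpha>]"], of r]]
      meps_pure [OF coch_pure [OF x, of "[\<alpha>, \<beta>]"]] meps_pure [OF coch_pure [OF y, of "[\<alpha>, \<beta>]"]]
      meps_pure [OF mpure_nb [OF \<Gamma>_pure coch_pure [OF x, of "[\<alpha>, \<beta>]"], of r]]
    by simp_all
  note rules = total_d_1 [OF x] total_d_2 [OF x] total_d_3 [OF x] total_d_1 [OF y] total_d_2 [OF y] total_d_3 [OF y]
    total_d_1 [OF xy] total_d_2 [OF xy] total_d_3 [OF xy] total_d_4 [OF xy]
    cup_1 cup_2 cup_3 cup_4 n e z z' nb_add nb_diff nb_minus meps_add meps_diff meps_minus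
    mw_add_left mw_diff_left mw_minus_left mw_add_right mw_diff_right mw_minus_right
  show "total_d S r nab I (cup r x y) l = (cup r (total_d S r nab I x) y - cup r x (total_d S r nab I y)) l" for l
  proof (rule coch_cases [where I = I and l = l], goal_cases)
    case (5 l)
    have "cup r (total_d S r nab I x) y l = 0" "cup r x (total_d S r nab I y) l = 0"
      using cup_long [OF dx y] cup_long [OF x dy] 5 by auto
    then show ?case using total_d_long [OF xy] 5 by simp
  next
    case (6 l)
    have "cup r (total_d S r nab I x) y l = 0" 
      by (rule cup_outside [OF _ _ 6]) (use total_d_outside coch_zero [OF y] in metis)+
    moreover have "cup r x (total_d S r nab I y) l = 0" 
      by (rule cup_outside [OF _ _ 6]) (use total_d_outside coch_zero [OF x] in metis)+
    ultimately show ?case by (simp only: total_d_outside [OF 6] minus_apply diff_self)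
  qed (simp_all add: rules, simp_all add: fun_eq_iff algebra_simps)
qed

end

section \<open>Local rings and stalks\<close>

definition mon :: "(nat \<Rightarrow> 'f::comm_ring_1) \<Rightarrow> (nat \<Rightarrow>\<^sub>0 nat) \<Rightarrow> 'f" where
  "mon x c = (\<Prod>i\<in>Poly_Mapping.keys c. x i ^ Poly_Mapping.lookup c i)"

lemma mon_superset:
  assumes "finite A" "Poly_Mapping.keys c \<subseteq> A"
  shows "mon x c = (\<Prod>i\<in>A. x i ^ Poly_Mapping.lookup c i)"
  unfolding mon_def using assms by (intro prod.mono_neutral_left) (auto simp: in_keys_iff)

lemma keys_add_nat: "Poly_Mapping.keys (a + b :: nat \<Rightarrow>\<^sub>0 nat) = Poly_Mapping.keys a \<union> Poly_Mapping.keys b"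
  by (auto simp: in_keys_iff lookup_add)

lemma mon_add: "mon x (a + b) = mon x a * mon x b"
proof -
  let ?A = "Poly_Mapping.keys a \<union> Poly_Mapping.keys b"
  have "mon x (a + b) = (\<Prod>i\<in>?A. x i ^ Poly_Mapping.lookup (a + b) i)"
    by (rule mon_superset) (auto simp: keys_add_nat)
  also have "\<dots> = (\<Prod>i\<in>?A. x i ^ Poly_Mapping.lookup a i) * (\<Prod>i\<in>?A. x i ^ Poly_Mapping.lookup b i)"
    by (simp add: lookup_add power_add prod.distrib)
  also have "\<dots> = mon x a * mon x b"
    by (simp add: mon_superset [of ?A])
  finally show ?thesis .
qed

lemma mon_0 [simp]: "mon x 0 = 1"
  by (simp add: mon_def)

lemma mdeg_superset:
  assumes "finite A" "Poly_Mapping.keys c \<subseteq> A"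
  shows "mdeg c = (\<Sum>i\<in>A. Poly_Mapping.lookup c i)"
  unfolding mdeg_def using assms by (intro sum.mono_neutral_left) (auto simp: in_keys_iff)

lemma mdeg_add: "mdeg (a + b) = mdeg a + mdeg b"
proof -
  let ?A = "Poly_Mapping.keys a \<union> Poly_Mapping.keys b"
  have "mdeg (a + b) = (\<Sum>i\<in>?A. Poly_Mapping.lookup (a + b) i)"
    by (rule mdeg_superset) (auto simp: keys_add_nat)
  also have "\<dots> = mdeg a + mdeg b"
    by (simp add: lookup_add sum.distrib mdeg_superset [of ?A])
  finally show ?thesis .
qed

lemma mdeg_zero [simp]: "mdeg 0 = 0"
  by (simp add: mdeg_def)

lemma mdeg_eq_0_iff: "mdeg c = 0 \<longleftrightarrow> c = 0"
  by (auto simp: mdeg_def in_keys_iff intro!: poly_mapping_eqI)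

lemma peval_superset:
  assumes "finite A" "Poly_Mapping.keys P \<subseteq> A" "h 0 = 0"
  shows "peval h x P = (\<Sum>c\<in>A. h (Poly_Mapping.lookup P c) * mon x c)"
  unfolding peval_def mon_def using assms by (intro sum.mono_neutral_left) (auto simp: in_keys_iff)

lemma poly_mapping_sum_single: "(\<Sum>c\<in>Poly_Mapping.keys P. Poly_Mapping.single c (Poly_Mapping.lookup P c)) = P"
  by (rule poly_mapping_eqI) (auto simp: lookup_sum lookup_single when_def in_keys_iff sum.delta)

locale ring_hom_fun =
  fixes h :: "'k::comm_ring_1 \<Rightarrow> 'f::comm_ring_1"
  assumes h_one: "h 1 = 1" and h_add: "h (a + b) = h a + h b" and h_mult: "h (a * b) = h a * h b"
begin

lemma h_zero [simp]: "h 0 = 0"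
  using h_add [of 0 0] by simp

lemma h_minus: "h (- a) = - h a"
  using h_add [of a "- a"] by (simp add: eq_neg_iff_add_eq_0 add.commute)

lemma h_sum: "h (\<Sum>i\<in>A. a i) = (\<Sum>i\<in>A. h (a i))"
  by (induction A rule: infinite_finite_induct) (auto simp: h_add)

lemma peval_add: "peval h x (P + Q) = peval h x P + peval h x Q"
proof -
  let ?A = "Poly_Mapping.keys P \<union> Poly_Mapping.keys Q"
  have "peval h x (P + Q) = (\<Sum>c\<in>?A. h (Poly_Mapping.lookup (P + Q) c) * mon x c)"
    by (rule peval_superset) (use Poly_Mapping.keys_add [of P Q] in auto)
  also have "\<dots> = peval h x P + peval h x Q"
    by (simp add: lookup_add h_add distrib_right sum.distrib peval_superset [of ?A])
  finally show ?thesis .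
qed

lemma peval_zero [simp]: "peval h x 0 = 0"
  by (simp add: peval_def)

lemma peval_sum: "peval h x (\<Sum>i\<in>A. P i) = (\<Sum>i\<in>A. peval h x (P i))"
  by (induction A rule: infinite_finite_induct) (auto simp: peval_add)

lemma peval_single: "peval h x (Poly_Mapping.single c a) = h a * mon x c"
  by (cases "a = 0") (auto simp: peval_def mon_def)

lemma peval_one: "peval h x 1 = 1"
  using peval_single [of x 0 1] by (simp add: h_one)

lemma peval_mult: "peval h x (P * Q) = peval h x P * peval h x Q"
proof -
  have "P * Q = (\<Sum>c\<in>Poly_Mapping.keys P. Poly_Mapping.single c (Poly_Mapping.lookup P c)) *
      (\<Sum>e\<in>Poly_Mapping.keys Q. Poly_Mapping.single e (Poly_Mapping.lookup Q e))"
    by (simp only: poly_mapping_sum_single)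
  then have "P * Q = (\<Sum>c\<in>Poly_Mapping.keys P. \<Sum>e\<in>Poly_Mapping.keys Q.
      Poly_Mapping.single (c + e) (Poly_Mapping.lookup P c * Poly_Mapping.lookup Q e))"
    by (simp only: sum_product mult_single)
  then have "peval h x (P * Q) = (\<Sum>c\<in>Poly_Mapping.keys P. \<Sum>e\<in>Poly_Mapping.keys Q.
      (h (Poly_Mapping.lookup P c) * mon x c) * (h (Poly_Mapping.lookup Q e) * mon x e))"
    by (simp add: peval_sum peval_single h_mult mon_add mult_ac)
  also have "\<dots> = peval h x P * peval h x Q"
    by (simp only: sum_product peval_def mon_def)
  finally show ?thesis .
qed

end

interpretation id_hom: ring_hom_fun "id :: 'k::comm_ring_1 \<Rightarrow> 'k"
  by standard auto

lemma homog_add: "F \<in> homog n d \<Longrightarrow> G \<in> homog n d \<Longrightarrow> F + (G :: 'k::comm_ring_1 mpoly) \<in> homog n d"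
  using Poly_Mapping.keys_add [of F G] by (auto simp: homog_def)

lemma homog_mult: "F \<in> homog n d \<Longrightarrow> G \<in> homog n e \<Longrightarrow> F * (G :: 'k::comm_ring_1 mpoly) \<in> homog n (d + e)"
  using Poly_Mapping.keys_mult [of F G] by (fastforce simp: homog_def mdeg_add keys_add_nat)

lemma homog_const: "Poly_Mapping.single 0 a \<in> homog n 0"
  by (auto simp: homog_def)

lemma homog_var:
  assumes "i \<le> n"
  shows "Poly_Mapping.single (Poly_Mapping.single i d) (1 :: 'k::comm_ring_1) \<in> homog n d"
proof -
  have "mdeg (Poly_Mapping.single i d) = d" by (cases "d = 0") (auto simp: mdeg_def)
  then show ?thesis using assms by (auto simp: homog_def split: if_splits)
qed

lemma zero_locus_Un:
  assumes "p \<in> pspace n"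
  shows "p \<in> zero_locus n {F * G | F G. F \<in> T \<and> G \<in> T'} \<longleftrightarrow> p \<in> zero_locus n T \<or> p \<in> zero_locus n T'"
proof
  assume l: "p \<in> zero_locus n {F * G | F G. F \<in> T \<and> G \<in> T'}"
  have "peval id p F * peval id p G = 0" if "F \<in> T" "G \<in> T'" for F G
  proof -
    have "peval id p (F * G) = 0" using l that by (auto simp: zero_locus_def)
    then show ?thesis by (simp add: id_hom.peval_mult)
  qed
  then show "p \<in> zero_locus n T \<or> p \<in> zero_locus n T'"
    using assms by (auto simp: zero_locus_def)
next
  assume l: "p \<in> zero_locus n T \<or> p \<in> zero_locus n T'"
  have "peval id p (F * G) = 0" if "F \<in> T" "G \<in> T'" for F G
    unfolding id_hom.peval_mult using l that by (auto simp: zero_locus_def)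
  then show "p \<in> zero_locus n {F * G | F G. F \<in> T \<and> G \<in> T'}"
    using assms unfolding zero_locus_def by blast
qed

lemma zclosed_Un:
  assumes "zclosed n Z" "zclosed n Z'"
  shows "zclosed n (Z \<union> Z')"
proof -
  obtain T T' where T: "T \<subseteq> (\<Union>d. homog n d)" "Z = zero_locus n T" "T' \<subseteq> (\<Union>d. homog n d)" "Z' = zero_locus n T'"
    using assms by (auto simp: zclosed_def)
  let ?T = "{F * G | F G. F \<in> T \<and> G \<in> T'}"
  have "F * G \<in> (\<Union>d. homog n d)" if "F \<in> T" "G \<in> T'" for F G
  proof -
    obtain d e where "F \<in> homog n d" "G \<in> homog n e" using T(1,3) \<open>F \<in> T\<close> \<open>G \<in> T'\<close> by fast
    then have "F * G \<in> homog n (d + e)" by (rule homog_mult)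
    then show ?thesis by (rule UN_I [OF UNIV_I])
  qed
  then have "?T \<subseteq> (\<Union>d. homog n d)" by blast
  moreover have "Z \<union> Z' = zero_locus n ?T"
  proof (rule set_eqI)
    show "p \<in> Z \<union> Z' \<longleftrightarrow> p \<in> zero_locus n ?T" for p
    proof (cases "p \<in> pspace n")
      case True then show ?thesis using zero_locus_Un [OF True, of T T'] T by simp
    next
      case False then show ?thesis using T by (simp add: zero_locus_def)
    qed
  qed
  ultimately show ?thesis unfolding zclosed_def by blast
qed

lemma zclosed_hypersurface: "F \<in> homog n d \<Longrightarrow> zclosed n {p \<in> pspace n. peval id p F = 0}"
  unfolding zclosed_def zero_locus_def by (intro exI [of _ "{F}"]) auto

section \<open>Local rings and logarithmic forms on a variety\<close>

locale variety =
  fixes X :: "('k::field, 'f::field) pvariety" and D :: "(nat \<Rightarrow> 'k) set set"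
  assumes pv: "projective_variety X" and snc: "snc_divisor X D"

sublocale variety \<subseteq> ring_hom_fun "emb X"
  using pv by unfold_locales (auto simp: projective_variety_def)

context variety
begin

lemma closed_X: "zclosed (amb X) (points X)"
  and irreducible_X: "zirreducible (amb X) (points X)"
  and gen_zero: "F \<in> homog (amb X) d \<Longrightarrow>
    peval (emb X) (gen X) F = 0 \<longleftrightarrow> (\<forall>p\<in>points X. peval id p F = 0)"
  using pv by (auto simp: projective_variety_def)

lemma points_pspace: "points X \<subseteq> pspace (amb X)"
  using closed_X by (auto simp: zclosed_def zero_locus_def)

lemma points_nonempty: "points X \<noteq> {}"
  using irreducible_X by (simp add: zirreducible_def)

text \<open>Since \<open>zopen\<close> demands nonemptiness, this is where irreducibility of
  \<open>X\<close> is used.\<close>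

lemma zopen_inter:
  assumes "zopen X U" "zopen X U'"
  shows "zopen X (U \<inter> U')"
proof -
  obtain Z Z' where Z: "zclosed (amb X) Z" "U = points X - Z" "zclosed (amb X) Z'" "U' = points X - Z'"
    using assms by (auto simp: zopen_def)
  have "\<not> points X \<subseteq> Z" "\<not> points X \<subseteq> Z'" using assms Z by (auto simp: zopen_def)
  then have "\<not> points X \<subseteq> Z \<union> Z'"
    using irreducible_X Z(1,3) unfolding zirreducible_def by blast
  moreover have "U \<inter> U' = points X - (Z \<union> Z')" using Z by auto
  ultimately show ?thesis using zclosed_Un [OF Z(1,3)] unfolding zopen_def by auto
qed

lemma fine_cover_zopen:
  assumes "fine_cover X I U" "\<alpha> \<in> I"
  shows "zopen X (U \<alpha>)"
proof -
  have "U \<alpha> \<noteq> {} \<and> (\<exists>d>0. \<exists>F\<in>homog (amb X) d. U \<alpha> = {p \<in> points X. peval id p F \<noteq> 0})"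
    using assms unfolding fine_cover_def by simp
  then obtain d F where F: "F \<in> homog (amb X) d" "U \<alpha> = {p \<in> points X. peval id p F \<noteq> 0}" "U \<alpha> \<noteq> {}"
    by (elim conjE exE bexE)
  have "U \<alpha> = points X - {p \<in> pspace (amb X). peval id p F = 0}"
    using points_pspace F(2) by auto
  then show ?thesis using zclosed_hypersurface [OF F(1)] F(3) unfolding zopen_def by blast
qed

lemma Inter_zopen:
  assumes "finite A" "A \<noteq> {}" "\<And>\<alpha>. \<alpha> \<in> A \<Longrightarrow> zopen X (U \<alpha>)"
  shows "zopen X (\<Inter>\<alpha>\<in>A. U \<alpha>)"
  using assms by (induction A rule: finite_ne_induct) (auto intro: zopen_inter)

lemma gen_nonzero: "G \<in> homog (amb X) d \<Longrightarrow> p \<in> points X \<Longrightarrow> peval id p G \<noteq> 0 \<Longrightarrow> peval (emb X) (gen X) G \<noteq> 0"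
  using gen_zero by auto

lemma local_ringI:
  "F \<in> homog (amb X) d \<Longrightarrow> G \<in> homog (amb X) d \<Longrightarrow> peval id p G \<noteq> 0 \<Longrightarrow>
    peval (emb X) (gen X) F / peval (emb X) (gen X) G \<in> local_ring X p"
  by (auto simp: local_ring_def)

lemma local_ringE:
  assumes "f \<in> local_ring X p"
  obtains F G d where "f = peval (emb X) (gen X) F / peval (emb X) (gen X) G"
    "F \<in> homog (amb X) d" "G \<in> homog (amb X) d" "peval id p G \<noteq> 0"
  using assms by (auto simp: local_ring_def)

lemma local_ring_add:
  assumes p: "p \<in> points X" and "f \<in> local_ring X p" "g \<in> local_ring X p"
  shows "f + g \<in> local_ring X p"
proof -
  let ?v = "peval (emb X) (gen X)"
  obtain F G d F' G' e where *: "f = ?v F / ?v G" "F \<in> homog (amb X) d" "G \<in> homog (amb X) d" "peval id p G \<noteq> 0"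
     "g = ?v F' / ?v G'" "F' \<in> homog (amb X) e" "G' \<in> homog (amb X) e" "peval id p G' \<noteq> 0"
    using assms(2,3) by (elim local_ringE)
  have "?v G \<noteq> 0" "?v G' \<noteq> 0" using gen_nonzero p * by blast+
  then have "f + g = ?v (F * G' + F' * G) / ?v (G * G')"
    by (simp add: * peval_add peval_mult add_frac_eq)
  moreover have "F * G' + F' * G \<in> homog (amb X) (d + e)"
    using homog_mult [OF *(6,3)] homog_mult [OF *(2,7)] by (intro homog_add) (simp_all add: add.commute)
  ultimately show ?thesis
    using * local_ringI [of "F * G' + F' * G" "d + e" "G * G'" p] by (simp add: homog_mult id_hom.peval_mult)
qed

lemma local_ring_mult:
  assumes "f \<in> local_ring X p" "g \<in> local_ring X p"
  shows "f * g \<in> local_ring X p"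
proof -
  let ?v = "peval (emb X) (gen X)"
  obtain F G d F' G' e where *: "f = ?v F / ?v G" "F \<in> homog (amb X) d" "G \<in> homog (amb X) d" "peval id p G \<noteq> 0"
     "g = ?v F' / ?v G'" "F' \<in> homog (amb X) e" "G' \<in> homog (amb X) e" "peval id p G' \<noteq> 0"
    using assms by (elim local_ringE)
  then show ?thesis
    using local_ringI [of "F * F'" "d + e" "G * G'" p] by (simp add: homog_mult id_hom.peval_mult peval_mult)
qed

lemma local_ring_const: "emb X a \<in> local_ring X p"
  using local_ringI [OF homog_const [of a] homog_const [of 1], of p]
  by (simp add: peval_single peval_one id_hom.peval_one)

lemma local_ring_0: "0 \<in> local_ring X p" and local_ring_1: "1 \<in> local_ring X p"
  using local_ring_const [of 0 p] local_ring_const [of 1 p] by (simp_all add: h_one)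

lemma local_ring_minus: "f \<in> local_ring X p \<Longrightarrow> - f \<in> local_ring X p"
  using local_ring_mult [OF local_ring_const [of "- 1" p], of f] by (simp add: h_minus h_one)

abbreviation "S \<equiv> log_space X D"

lemma log_space_simps [simp]: "pts S = points X" "opens S = Collect (zopen X)" "ders S = derivations (emb X)"
    "lift S = (\<lambda>v. v)" "base S = range (emb X)" "nul S = {0}" "stalk S = local_ring X"
    "logeq S p = {z. \<exists>Z\<in>D. p \<in> Z \<and> local_equation X Z p z}"
  by (simp_all add: log_space_def)

lemma derivation_diff: "v \<in> derivations h \<Longrightarrow> v (x - y) = v x - v (y :: 'f)"
  unfolding derivations_def mem_Collect_eq by (metis add_diff_cancel diff_add_cancel)

lemma derivation_zero: "v \<in> derivations h \<Longrightarrow> v (0 :: 'f) = 0"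
  using derivation_diff [of v h 0 0] by simp

lemma derivation_brk:
  assumes "v \<in> derivations h" "w \<in> derivations h"
  shows "brk v w \<in> derivations (h :: 'k \<Rightarrow> 'f)"
proof -
  have "v 0 = 0" "w 0 = 0" using assms derivation_zero by blast+
  with assms show ?thesis by (auto simp: derivations_def brk_def algebra_simps)
qed

sublocale space_calculus S
  by unfold_locales (auto simp: derivation_brk derivation_diff, auto simp: derivations_def brk_def)

text \<open>A zero local equation would make every element of the local ideal of \<open>Z\<close>
  zero. But \<open>Z\<close> has a dimension different from that of \<open>X\<close>, so it is a
  proper closed subset, and some homogeneous \<open>F\<close> of degree \<open>d\<close> vanishes on
  \<open>Z\<close> and not on \<open>X\<close>. Dividing \<open>F\<close> by the \<open>d\<close>-th
  power of a coordinate that is nonzero at \<open>p\<close> gives a nonzero element of that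
  ideal.\<close>

lemma logeq_nonzero:
  assumes "z \<in> logeq S p" "p \<in> points X"
  shows "z \<noteq> 0"
proof
  assume "z = 0"
  then obtain Z where Z: "Z \<in> D" "p \<in> Z" "local_ideal X Z p = {c * 0 | c. c \<in> local_ring X p}"
    using assms by (auto simp: local_equation_def)
  have cl: "zclosed (amb X) Z" and sub: "Z \<subseteq> points X" and dim: "zdim (amb X) Z \<noteq> zdim (amb X) (points X)"
    using snc Z(1) by (auto simp: snc_divisor_def)
  have "\<not> points X \<subseteq> Z" using sub dim by (metis subset_antisym)
  with cl obtain T where T: "T \<subseteq> (\<Union>d. homog (amb X) d)" "Z = zero_locus (amb X) T" "\<not> points X \<subseteq> Z"
    by (auto simp: zclosed_def)
  then obtain F d q where F: "F \<in> homog (amb X) d" "F \<in> T" "q \<in> points X" "peval id q F \<noteq> 0"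
    using points_pspace unfolding zero_locus_def by blast
  have FZ: "\<forall>q\<in>Z. peval id q F = 0" using F(2) T(2) by (auto simp: zero_locus_def)
  have "p \<noteq> 0" "\<forall>i>amb X. p i = 0" using assms(2) points_pspace by (auto simp: pspace_def)
  then obtain i where i: "i \<le> amb X" "p i \<noteq> 0" by (metis ext not_le zero_fun_apply)
  let ?G = "Poly_Mapping.single (Poly_Mapping.single i d) 1 :: 'k mpoly"
  have G: "?G \<in> homog (amb X) d" by (rule homog_var [OF i(1)])
  have "peval id p ?G = p i ^ d"
    unfolding id_hom.peval_single by (cases "d = 0") (simp_all add: mon_def)
  then have G0: "peval id p ?G \<noteq> 0" using i by simp
  have "peval (emb X) (gen X) F / peval (emb X) (gen X) ?G \<in> local_ideal X Z p"
    using F G G0 FZ by (auto simp: local_ideal_def)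
  then have "peval (emb X) (gen X) F / peval (emb X) (gen X) ?G = 0" using Z(3) by auto
  then have "peval (emb X) (gen X) F = 0" using gen_nonzero [OF G assms(2) G0] by simp
  then show False using gen_zero [OF F(1)] F(3,4) by blast
qed

lemma lin1_add: "lin1 a \<Longrightarrow> lin1 b \<Longrightarrow> lin1 (a + b)"
  and lin1_scl: "lin1 a \<Longrightarrow> lin1 (scl f a)"
  and lin1_zero: "lin1 0"
  unfolding lin1_def by (simp_all add: scl_apply right_diff_distrib pure_add pure_scl)

lemma lin1_d_fn: "lin1 (d (fn_form f))"
proof -
  have "(\<lambda>x. v x - w x) \<in> V" if "v \<in> V" "w \<in> V" for v w
  proof -
    have "v 0 = 0" "w 0 = 0" using that derivation_zero by auto
    with that show ?thesis by (auto simp: derivations_def algebra_simps)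
  qed
  then show ?thesis using pure_d_fn [of f] by (auto simp: lin1_def d_fn_apply)
qed

text \<open>Closedness of a logarithmic differential: apply \<open>d\<close> to the relation
  \<open>z w = dz\<close>. The term \<open>dz \<and> w\<close> is \<open>z\<close> times
  \<open>w \<and> w\<close>, hence zero, and \<open>z\<close> is invertible in the function
  field.\<close>

lemma lin1_dlog:
  assumes z: "z \<noteq> 0" "\<forall>vs. z * w vs = d (fn_form z) vs"
  shows "lin1 w" "d w = 0"
proof -
  have w: "w = scl (inverse z) (d (fn_form z))" "scl z w = d (fn_form z)"
    using z by (auto simp: scl_def fun_eq_iff field_simps)
  then show l: "lin1 w" using lin1_scl [OF lin1_d_fn] by simp
  then have p: "pure V 1 w" by (simp add: lin1_def)
  have "wedge w w = 0"
  proof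
    fix vs show "wedge w w vs = 0 vs"
    proof (cases "length vs = 2")
      case True
      then obtain u v where "vs = [u, v]" by (auto simp: length_Suc_conv numeral_2_eq_2)
      then show ?thesis using pure_2_apply [OF p p] by simp
    next
      case False
      then show ?thesis using pure_wedge [OF p p] by (auto simp: pure_def)
    qed
  qed
  moreover have "0 = wedge (d (fn_form z)) w + scl z (d w)"
    using d_scl [OF p, of z] by (simp add: w(2))
  ultimately have "scl z (d w) = 0"
    by (simp add: w(2) [symmetric] wedge_scl_left) (simp add: scl_def fun_eq_iff)
  then show "d w = 0" using z(1) by (simp add: scl_def fun_eq_iff)
qed

lemma scl_add: "scl f (a + b) = scl f a + scl f b"
  and scl_diff: "scl f (a - b) = scl f a - scl f b"
  and scl_zero [simp]: "scl f 0 = 0" "scl 0 a = 0"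
  and scl_one [simp]: "scl 1 a = a"
  and scl_scl: "scl f (scl g a) = scl (f * g) a"
  and scl_fn: "scl f (fn_form g) = fn_form (f * g)"
  and scl_minus_one: "scl (- 1) a = - a"
  by (auto simp: scl_def fn_form_def algebra_simps)

lemma scl_sum: "scl f (\<Sum>i\<in>A. a i) = (\<Sum>i\<in>A. scl f (a i))"
  by (induction A rule: infinite_finite_induct)
    (simp_all only: sum.infinite sum.empty sum.insert scl_zero scl_add not_False_eq_True)

context
  fixes p assumes p: "p \<in> points X"
begin

lemma log_form_pure: "log_form S p q a \<Longrightarrow> pure V q a"
proof (induction rule: log_form.induct)
  case (3 f q a)
  then show ?case using pure_wedge [OF pure_d_fn [of f] 3(3)] by simp
next
  case (4 z w q a)
  then show ?case using pure_wedge [of V 1 w q a] lin1_dlog(1) [of z w] logeq_nonzero p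
    by (auto simp: lin1_def)
qed (rule pure_fn_form pure_add; assumption?)+

lemma log_form_scl:
  assumes "f \<in> local_ring X p"
  shows "log_form S p q a \<Longrightarrow> log_form S p q (scl f a)"
proof (induction rule: log_form.induct)
  case (1 g)
  then show ?case using assms by (auto simp: scl_fn intro!: log_form.intros local_ring_mult)
next
  case (2 q a b)
  then show ?case by (simp only: scl_add log_form.intros)
next
  case (3 g q a)
  then show ?case unfolding wedge_scl_right [symmetric] by (intro log_form.intros)
next
  case (4 z w q a)
  then show ?case unfolding wedge_scl_right [symmetric] by (intro log_form.intros(4))
qed

lemma log_form_minus: "log_form S p q a \<Longrightarrow> log_form S p q (- a)"
  using log_form_scl [of "- 1" q a] local_ring_minus [OF local_ring_1] by (simp add: scl_minus_one)

lemma log_form_zero: "log_form S p q 0"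
proof (induction q)
  case 0
  have "log_form S p 0 (fn_form 0)" by (rule log_form.intros(1)) (simp add: local_ring_0)
  then show ?case unfolding fn_form_zero .
next
  case (Suc q)
  have "log_form S p (Suc q) (wedge (d (fn_form 0)) 0)"
    by (rule log_form.intros(3) [OF _ Suc]) (simp add: local_ring_0)
  then show ?case unfolding wedge_zero_right .
qed

lemma log_form_wedge: "log_form S p q a \<Longrightarrow> log_form S p q' b \<Longrightarrow> log_form S p (q + q') (wedge a b)"
proof (induction rule: log_form.induct)
  case (1 f)
  then show ?case by (simp add: wedge_fn_left log_form_scl)
next
  case (2 q a b)
  then show ?case unfolding wedge_add_left by (intro log_form.intros(2)) simp_all
next
  case (3 f q a)
  then show ?case unfolding wedge_assoc add_Suc by (intro log_form.intros(3)) simp_all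
next
  case (4 z w q a)
  then show ?case unfolding wedge_assoc add_Suc by (intro log_form.intros(4)) simp_all
qed

lemma log_form_d_fn: "f \<in> local_ring X p \<Longrightarrow> log_form S p 1 (d (fn_form f))"
  using log_form.intros(3) [of f S p 0 "fn_form 1"] log_form.intros(1) [of 1 S p] local_ring_1
  by (simp add: wedge_fn_right)

text \<open>The generators are products of closed 1-forms, so \<open>d\<close> passes each factor at
  the cost of a sign and never creates new poles.\<close>

lemma log_form_d: "log_form S p q a \<Longrightarrow> log_form S p (Suc q) (d a)"
proof (induction rule: log_form.induct)
  case (1 f)
  then show ?case using log_form_d_fn by simp
next
  case (2 q a b)
  then show ?case by (simp only: d_add log_form.intros)
next
  case (3 f q a)
  have "d (wedge (d (fn_form f)) a) = wedge (d (fn_form f)) (- d a)"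
    using d_wedge [OF pure_d_fn log_form_pure [OF 3(2)]] eps_pure [OF pure_d_fn]
    by (simp add: scl_minus_one wedge_minus_left wedge_minus_right)
  then show ?case using log_form.intros(3) [OF 3(1) log_form_minus [OF 3(3)]] by simp
next
  case (4 z w q a)
  have w: "lin1 w" "d w = 0" using lin1_dlog [OF logeq_nonzero [OF 4(1) p] 4(2)] by auto
  then have pw: "pure V 1 w" by (simp add: lin1_def)
  have "d (wedge w a) = wedge w (- d a)"
    using d_wedge [OF pw log_form_pure [OF 4(3)]] eps_pure [OF pw] w
    by (simp add: scl_minus_one wedge_minus_left wedge_minus_right)
  then show ?case using log_form.intros(4) [OF 4(1,2) log_form_minus [OF 4(4)]] by simp
qed

lemma log_form_lin1: "log_form S p q a \<Longrightarrow> q = 1 \<Longrightarrow> lin1 a"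
proof (induction rule: log_form.induct)
  case (2 q a b) then show ?case by (intro lin1_add) simp_all
next
  case (3 f q a)
  then have "pure V 0 a" using log_form_pure by auto
  then have "a = fn_form (a [])" by (rule pure_0_imp)
  then have "wedge (d (fn_form f)) a = scl (a []) (d (fn_form f))" by (metis wedge_fn_right)
  then show ?case using lin1_scl [OF lin1_d_fn] by simp
next
  case (4 z w q a)
  then have "pure V 0 a" using log_form_pure by auto
  then have "a = fn_form (a [])" by (rule pure_0_imp)
  then have "wedge w a = scl (a []) w" by (metis wedge_fn_right)
  then show ?case using lin1_scl [OF lin1_dlog(1) [OF logeq_nonzero [OF 4(1) p] 4(2)]] by simp
qed simp

lemma log_form_d_d: "log_form S p q a \<Longrightarrow> q \<le> 1 \<Longrightarrow> d (d a) = 0"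
proof -
  assume a: "log_form S p q a" "q \<le> 1"
  then consider "q = 0" | "q = 1" by linarith
  then show ?thesis
  proof cases
    case 1
    then have "pure V 0 a" using log_form_pure a by auto
    then have "a = fn_form (a [])" by (rule pure_0_imp)
    then show ?thesis by (metis d_d_fn)
  qed (use a log_form_lin1 d_d_1 in auto)
qed

end

end

section \<open>The endomorphism complex of a flat bundle\<close>

locale flat_bundle = variety X D
  for X :: "('k::field, 'f::field) pvariety" and D :: "(nat \<Rightarrow> 'k) set set" +
  fixes r :: nat and E :: "(nat \<Rightarrow> 'k) \<Rightarrow> (nat \<Rightarrow> 'f) set" and nab :: "('f, 'f) conn"
  assumes ilc: "integrable_log_connection S r E nab"
begin

lemma frame:
  assumes "p \<in> points X"
  obtains W b b' where "zopen X W" "p \<in> W"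
    "\<And>i j. i < r \<Longrightarrow> j < r \<Longrightarrow> (\<Sum>l<r. b i l * b' l j) = (if i = j then 1 else 0)"
    "\<And>i j. i < r \<Longrightarrow> j < r \<Longrightarrow> (\<Sum>l<r. b' i l * b l j) = (if i = j then 1 else 0)"
    "\<And>y. y \<in> W \<Longrightarrow> E y = {s \<in> vecs r. \<exists>c. (\<forall>j. c j \<in> local_ring X y) \<and> s = mat_vec r b c}"
proof -
  have "vector_bundle S r E" using ilc by (simp add: integrable_log_connection_def)
  then have "\<exists>W\<in>opens S. p \<in> W \<and> (\<exists>b b'. mat_inverses S r b b' \<and>
      (\<forall>y\<in>W. E y = {s \<in> vecs r. \<exists>c. (\<forall>j. c j \<in> stalk S y) \<and> (\<forall>i. s i - mat_vec r b c i \<in> nul S)}))"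
    unfolding vector_bundle_def using assms by simp
  then obtain W b b' where "W \<in> opens S" "p \<in> W" and b: "mat_inverses S r b b'"
    "\<forall>y\<in>W. E y = {s \<in> vecs r. \<exists>c. (\<forall>j. c j \<in> stalk S y) \<and> (\<forall>i. s i - mat_vec r b c i \<in> nul S)}"
    by (elim bexE exE conjE)
  then show ?thesis
    by (intro that [of W b b']) (simp_all add: mat_inverses_def fun_eq_iff)
qed

lemma E_vecs: "p \<in> points X \<Longrightarrow> s \<in> E p \<Longrightarrow> s \<in> vecs r"
  by (rule frame [of p]) auto

lemma E_add:
  assumes p: "p \<in> points X" and s: "s \<in> E p" "s' \<in> E p"
  shows "s + s' \<in> E p"
proof -
  obtain b where W: "E p = {s \<in> vecs r. \<exists>c. (\<forall>j. c j \<in> local_ring X p) \<and> s = mat_vec r b c}"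
    by (rule frame [OF p]) simp
  obtain c c' where c: "\<forall>j. c j \<in> local_ring X p" "s = mat_vec r b c" "\<forall>j. c' j \<in> local_ring X p" "s' = mat_vec r b c'"
    using s unfolding W mem_Collect_eq by (elim conjE exE)
  then have "s + s' = mat_vec r b (\<lambda>j. c j + c' j)" "\<forall>j. c j + c' j \<in> local_ring X p"
    using p by (auto simp: mat_vec_def fun_eq_iff distrib_left sum.distrib local_ring_add)
  moreover have "s + s' \<in> vecs r" using c by (auto simp: vecs_def mat_vec_def)
  ultimately show ?thesis unfolding W mem_Collect_eq by (intro conjI exI)
qed

lemma E_scale:
  assumes p: "p \<in> points X" and s: "s \<in> E p" "f \<in> local_ring X p"
  shows "(\<lambda>i. f * s i) \<in> E p"
proof -
  obtain b where W: "E p = {s \<in> vecs r. \<exists>c. (\<forall>j. c j \<in> local_ring X p) \<and> s = mat_vec r b c}"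
    by (rule frame [OF p]) simp
  obtain c where c: "\<forall>j. c j \<in> local_ring X p" "s = mat_vec r b c"
    using s(1) unfolding W mem_Collect_eq by (elim conjE exE)
  then have "(\<lambda>i. f * s i) = mat_vec r b (\<lambda>j. f * c j)" "\<forall>j. f * c j \<in> local_ring X p"
    using s by (auto simp: mat_vec_def fun_eq_iff sum_distrib_left mult_ac local_ring_mult)
  moreover have "(\<lambda>i. f * s i) \<in> vecs r" using c by (auto simp: vecs_def mat_vec_def)
  ultimately show ?thesis unfolding W mem_Collect_eq by (intro conjI exI)
qed

lemma E_zero:
  assumes p: "p \<in> points X"
  shows "(\<lambda>i. 0) \<in> E p"
proof -
  obtain b where W: "E p = {s \<in> vecs r. \<exists>c. (\<forall>j. c j \<in> local_ring X p) \<and> s = mat_vec r b c}"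
    by (rule frame [OF p]) simp
  have "(\<lambda>i. 0) = mat_vec r b (\<lambda>j. 0)" by (auto simp: mat_vec_def)
  then show ?thesis unfolding W mem_Collect_eq
    by (intro conjI exI [of _ "\<lambda>j. 0"]) (simp_all add: vecs_def local_ring_0)
qed

lemma E_sum:
  assumes "p \<in> points X" "\<And>j. j \<in> A \<Longrightarrow> s j \<in> E p"
  shows "(\<lambda>i. \<Sum>j\<in>A. s j i) \<in> E p"
  using assms(2)
proof (induction A rule: infinite_finite_induct)
  case (insert x A)
  then show ?case using E_add [OF assms(1), of "s x" "\<lambda>i. \<Sum>j\<in>A. s j i"] by (simp add: plus_fun_def)
qed (simp_all add: E_zero assms(1))

lemma unit_vec_vecs: "unit_vec r l \<in> vecs r"
  by (auto simp: unit_vec_def vecs_def)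

lemma nab_add: "s \<in> vecs r \<Longrightarrow> s' \<in> vecs r \<Longrightarrow> nab (s + s') i = nab s i + nab s' i"
  and nab_mult: "s \<in> vecs r \<Longrightarrow> nab (\<lambda>j. f * s j) i = scl f (nab s i) + scl (s i) (d (fn_form f))"
  and nab_form: "p \<in> points X \<Longrightarrow> s \<in> E p \<Longrightarrow> bundle_form S E p 1 (nab s)"
  using ilc by (auto simp: integrable_log_connection_def connection_def fun_eq_iff scl_apply)

lemma nab_zero: "nab (\<lambda>j. 0) i = 0"
  using nab_mult [of "\<lambda>j. 0" 0 i] by (simp add: vecs_def)

lemma nab_sum:
  assumes "finite A" "\<And>j. j \<in> A \<Longrightarrow> s j \<in> vecs r"
  shows "nab (\<lambda>i. \<Sum>j\<in>A. s j i) i = (\<Sum>j\<in>A. nab (s j) i)"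
  using assms
proof (induction A rule: finite_induct)
  case (insert x A)
  then have "(\<lambda>i. \<Sum>j\<in>A. s j i) \<in> vecs r" by (auto simp: vecs_def intro!: sum.neutral)
  then have "nab (s x + (\<lambda>i. \<Sum>j\<in>A. s j i)) i = nab (s x) i + (\<Sum>j\<in>A. nab (s j) i)"
    using insert nab_add by simp
  moreover have "(\<lambda>i. \<Sum>j\<in>insert x A. s j i) = s x + (\<lambda>i. \<Sum>j\<in>A. s j i)"
    using insert by (simp add: plus_fun_def)
  ultimately show ?case by (simp only: sum.insert [OF insert.hyps])
qed (simp add: nab_zero)

lemma bundle_form_outside: "bundle_form S E p q \<eta> \<Longrightarrow> p \<in> points X \<Longrightarrow> i \<ge> r \<Longrightarrow> \<eta> i vs = 0"
  by (induction rule: bundle_form.induct) (use E_vecs in \<open>auto simp: vecs_def\<close>)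

lemma bundle_form_lin1: "bundle_form S E p q \<eta> \<Longrightarrow> p \<in> points X \<Longrightarrow> q = 1 \<Longrightarrow> lin1 (\<eta> i)"
proof (induction rule: bundle_form.induct)
  case (1 s w)
  then have "lin1 (scl (s i) w)" using log_form_lin1 lin1_scl by blast
  then show ?case by (simp add: scl_def)
next
  case (2 \<eta> \<eta>')
  then have "lin1 (\<eta> i)" "lin1 (\<eta>' i)" by auto
  then show ?case unfolding plus_fun_apply [of \<eta>] by (rule lin1_add)
next
  case (3 \<eta> \<eta>')
  then have "\<eta> = \<eta>'" by (auto simp: fun_eq_iff)
  then show ?case using 3 by simp
qed

text \<open>The connection matrix in the constant frame of the generic stalk. This frame is in
  general not a frame of \<open>E\<close>, so the entries are rational forms whose poles may lie
  anywhere; in exchange a single matrix serves all charts.\<close>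

definition Gam :: "('f, 'f) matform" where
  "Gam i l = nab (unit_vec r l) i"

lemma nab_expand:
  assumes "s \<in> vecs r"
  shows "nab s i = (\<Sum>j<r. scl (s j) (Gam i j)) + d (fn_form (s i))"
proof -
  have "s = (\<lambda>i. \<Sum>j<r. s j * unit_vec r j i)"
  proof
    fix i
    have "(\<Sum>j<r. s j * unit_vec r j i) = (\<Sum>j<r. if i = j then s j else 0)"
      by (intro sum.cong) (auto simp: unit_vec_def)
    then show "s i = (\<Sum>j<r. s j * unit_vec r j i)"
      using assms by (simp add: vecs_def)
  qed
  then have "nab s i = nab (\<lambda>i. \<Sum>j<r. s j * unit_vec r j i) i" by simp
  also have "\<dots> = (\<Sum>j<r. nab (\<lambda>i. s j * unit_vec r j i) i)"
    by (rule nab_sum) (auto simp: vecs_def unit_vec_def)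
  also have "\<dots> = (\<Sum>j<r. scl (s j) (Gam i j)) + (\<Sum>j<r. scl (unit_vec r j i) (d (fn_form (s j))))"
    by (simp only: nab_mult [OF unit_vec_vecs] Gam_def sum.distrib)
  also have "(\<Sum>j<r. scl (unit_vec r j i) (d (fn_form (s j)))) = d (fn_form (s i))"
  proof -
    have "(\<Sum>j<r. scl (unit_vec r j i) (d (fn_form (s j)))) = (\<Sum>j<r. if j = i then d (fn_form (s j)) else 0)"
      by (intro sum.cong) (auto simp: unit_vec_def)
    then show ?thesis using assms by (simp add: vecs_def sum.delta)
  qed
  finally show ?thesis .
qed

text \<open>Unit vectors need not be sections of \<open>E\<close>, so \<open>nab_form\<close> does
  not apply to them. Written in a local frame \<open>\<beta>\<close> at one point, with rational
  coefficients from the inverse frame matrix, their derivatives become combinations of derivatives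
  of honest sections and of exact forms.\<close>

lemma Gam_props:
  shows "i \<ge> r \<or> l \<ge> r \<Longrightarrow> Gam i l = 0" and "lin1 (Gam i l)"
proof -
  obtain p where p: "p \<in> points X" using points_nonempty by blast
  obtain b b' where b: "\<And>i j. i < r \<Longrightarrow> j < r \<Longrightarrow> (\<Sum>l<r. b i l * b' l j) = (if i = j then 1 else 0)"
    and W: "E p = {s \<in> vecs r. \<exists>c. (\<forall>j. c j \<in> local_ring X p) \<and> s = mat_vec r b c}"
    by (rule frame [OF p], rule that, assumption) simp_all
  define \<beta> where "\<beta> j = mat_vec r b (unit_vec r j)" for j
  have \<beta>: "\<beta> j \<in> E p" for j
    unfolding W mem_Collect_eq \<beta>_def
    by (intro conjI exI [of _ "unit_vec r j"]) (auto simp: vecs_def mat_vec_def unit_vec_def local_ring_0 local_ring_1)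
  have \<beta>v: "\<beta> j \<in> vecs r" for j using E_vecs [OF p \<beta>] .
  have out: "nab (\<beta> j) i = 0" if "i \<ge> r" for i j
    using bundle_form_outside [OF nab_form [OF p \<beta>] p that] by (simp add: fun_eq_iff)
  have lin: "lin1 (nab (\<beta> j) i)" for i j
    using bundle_form_lin1 [OF nab_form [OF p \<beta>] p] by simp
  have u: "unit_vec r l = (\<lambda>i. \<Sum>j<r. b' j l * \<beta> j i)" if "l < r" for l
  proof
    fix i
    show "unit_vec r l i = (\<Sum>j<r. b' j l * \<beta> j i)"
    proof (cases "i < r")
      case True
      have "\<beta> j i = b i j" if "j < r" for j
      proof -
        have "\<beta> j i = (\<Sum>h<r. b i h * unit_vec r j h)"
          unfolding \<beta>_def mat_vec_def using True by simp
        also have "\<dots> = (\<Sum>h<r. if h = j then b i j else 0)"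
          using that by (intro sum.cong) (auto simp: unit_vec_def)
        finally show ?thesis using that by simp
      qed
      then have "(\<Sum>j<r. b' j l * \<beta> j i) = (\<Sum>j<r. b i j * b' j l)"
        by (intro sum.cong) (simp_all add: mult.commute)
      then show ?thesis using b [OF True that] that by (simp add: unit_vec_def)
    next
      case False
      then show ?thesis using that \<beta>v by (simp add: unit_vec_def vecs_def)
    qed
  qed
  have g: "Gam i l = (\<Sum>j<r. scl (b' j l) (nab (\<beta> j) i) + scl (\<beta> j i) (d (fn_form (b' j l))))" if "l < r" for i l
  proof -
    have "Gam i l = (\<Sum>j<r. nab (\<lambda>i. b' j l * \<beta> j i) i)"
      unfolding Gam_def u [OF that] by (rule nab_sum) (use \<beta>v in \<open>auto simp: vecs_def\<close>)
    then show ?thesis by (simp only: nab_mult [OF \<beta>v])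
  qed
  have g0: "Gam i l = 0" if "\<not> l < r" for i l
  proof -
    have "unit_vec r l = (\<lambda>i. 0 :: 'f)" using that by (auto simp: unit_vec_def)
    then show ?thesis by (simp add: Gam_def nab_zero)
  qed
  show "i \<ge> r \<or> l \<ge> r \<Longrightarrow> Gam i l = 0"
  proof (cases "l < r")
    case True
    assume "i \<ge> r \<or> l \<ge> r"
    then have "i \<ge> r" using True by simp
    then show ?thesis using out \<beta>v unfolding g [OF True] by (intro sum.neutral) (simp add: vecs_def)
  qed (use g0 in simp)
  have "lin1 (\<Sum>j\<in>A. scl (b' j l) (nab (\<beta> j) i) + scl (\<beta> j i) (d (fn_form (b' j l))))" for A
  proof (induction A rule: infinite_finite_induct)
    case (insert x A)
    then show ?case unfolding sum.insert [OF insert.hyps] by (intro lin1_add lin1_scl lin lin1_d_fn)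
  qed (simp_all only: sum.infinite sum.empty lin1_zero not_False_eq_True)
  then show "lin1 (Gam i l)" using g g0 lin1_zero by (cases "l < r") simp_all
qed

text \<open>Integrability on the constant frame says column by column that the curvature of
  \<open>Gam\<close> vanishes.\<close>

sublocale flat_matrix S r nab Gam
proof
  show "mpure (ders S) 1 Gam" using Gam_props(2) by (simp add: mpure_def lin1_def)
  show "md S Gam + mw r Gam Gam = 0"
  proof (intro ext)
    fix i l vs
    have "conn_ext S r nab (nab (unit_vec r l)) i vs = 0"
      using ilc unit_vec_vecs by (auto simp: integrable_log_connection_def)
    then show "(md S Gam + mw r Gam Gam) i l vs = 0 i l vs"
      by (simp add: conn_ext_def md_def mw_def sum_fun_apply Gam_def [abs_def] add.commute)
  qed
qed (simp_all add: Gam_def [symmetric] nab_zero Gam_props)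

context
  fixes p assumes p: "p \<in> points X"
begin

lemma End_form_outside: "End_form S r E p q \<Phi> \<Longrightarrow> i \<ge> r \<or> j \<ge> r \<Longrightarrow> \<Phi> i j = 0"
proof (induction rule: End_form.induct)
  case (1 M w)
  then have "M i j = 0" by (auto simp: End_stalk_def)
  then show ?case by (auto simp: fun_eq_iff)
next
  case (2 \<Phi> \<Phi>')
  then have "\<Phi> i j = 0" "\<Phi>' i j = 0" by auto
  then show ?case by (auto simp: fun_eq_iff)
qed

lemma End_form_pure: "End_form S r E p q \<Phi> \<Longrightarrow> mpure V q \<Phi>"
proof (induction rule: End_form.induct)
  case (1 M w)
  then show ?case using pure_scl [OF log_form_pure [OF p]] by (simp add: mpure_def scl_def)
next
  case (2 \<Phi> \<Phi>')
  then show ?case by (intro mpure_add)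
qed

text \<open>For \<open>M \<otimes> w\<close> both mixed terms are \<open>dM \<and> dw\<close>, with
  opposite signs; the form \<open>w\<close> itself has degree at most 1, where \<open>d\<close>
  squares to zero.\<close>

lemma End_form_md_md: "End_form S r E p q \<Phi> \<Longrightarrow> q \<le> 1 \<Longrightarrow> md S (md S \<Phi>) = 0"
proof (induction rule: End_form.induct)
  case (1 M w)
  have "d (d (scl (M i j) w)) = 0" for i j
  proof -
    have "pure V q w" using log_form_pure [OF p 1(2)] .
    then have "d (d (scl (M i j) w)) = wedge (eps (d (fn_form (M i j)))) (d w) + wedge (d (fn_form (M i j))) (d w)"
      by (simp add: d_scl d_add d_wedge [OF pure_d_fn] d_scl [OF pure_d] log_form_d_d [OF p 1(2,3)])
    also have "\<dots> = 0"
      using eps_pure [OF pure_d_fn, of "M i j"] by (simp add: scl_minus_one wedge_minus_left)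
    finally show ?thesis .
  qed
  then show ?case by (simp add: md_def scl_def fun_eq_iff)
next
  case (2 \<Phi> \<Phi>')
  have "md S (md S \<Phi>) = 0" "md S (md S \<Phi>') = 0"
    by (rule 2(3) [OF 2(5)], rule 2(4) [OF 2(5)])
  then show ?case by (simp only: md_add add_0)
qed

lemma End_formI: "M \<in> End_stalk r E p \<Longrightarrow> log_form S p q w \<Longrightarrow> End_form S r E p q (\<lambda>i j. scl (M i j) w)"
  unfolding scl_def by (rule End_form.intros)

lemma End_form_zero: "End_form S r E p q 0"
proof -
  have "(\<lambda>i j. 0) \<in> End_stalk r E p"
    using E_zero [OF p] by (auto simp: End_stalk_def mat_vec_def if_distrib cong: if_cong)
  from End_form.intros(1) [OF this log_form_zero [OF p, of q]] show ?thesis by (simp add: zero_fun_def)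
qed

lemma End_stalk_scale:
  assumes "M \<in> End_stalk r E p" "f \<in> local_ring X p"
  shows "(\<lambda>i j. f * M i j) \<in> End_stalk r E p"
proof -
  have "mat_vec r (\<lambda>i j. f * M i j) s = (\<lambda>i. f * mat_vec r M s i)" for s
    by (auto simp: mat_vec_def sum_distrib_left mult_ac)
  then show ?thesis using assms E_scale [OF p] by (auto simp: End_stalk_def)
qed

lemma End_form_scale:
  assumes "f \<in> local_ring X p"
  shows "End_form S r E p q \<Phi> \<Longrightarrow> End_form S r E p q (\<lambda>i j. scl f (\<Phi> i j))"
proof (induction rule: End_form.induct)
  case (1 M w)
  then show ?case using End_formI [OF End_stalk_scale [OF 1(1) assms] 1(2)] by (simp add: scl_def mult.assoc)
next
  case (2 \<Phi> \<Phi>')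
  then show ?case using End_form.intros(2) [OF 2(3,4)] by (simp add: plus_fun_def scl_def distrib_left)
qed

lemma End_form_minus: "End_form S r E p q \<Phi> \<Longrightarrow> End_form S r E p q (- \<Phi>)"
  using End_form_scale [OF local_ring_minus [OF local_ring_1]] by (simp add: scl_minus_one) (simp add: fun_Compl_def)

lemma End_form_diff: "End_form S r E p q \<Phi> \<Longrightarrow> End_form S r E p q \<Psi> \<Longrightarrow> End_form S r E p q (\<Phi> - \<Psi>)"
  unfolding diff_conv_add_uminus by (intro End_form.intros(2) End_form_minus)

lemma End_form_sum: "(\<And>i. i \<in> A \<Longrightarrow> End_form S r E p q (\<Phi> i)) \<Longrightarrow> End_form S r E p q (\<Sum>i\<in>A. \<Phi> i)"
proof (induction A rule: infinite_finite_induct)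
  case (insert x A)
  then show ?case unfolding sum.insert [OF insert.hyps] by (intro End_form.intros(2)) simp_all
qed (simp_all only: sum.infinite sum.empty End_form_zero not_False_eq_True)

lemma End_form_meps: "End_form S r E p q \<Phi> \<Longrightarrow> End_form S r E p q (meps \<Phi>)"
  using meps_pure [OF End_form_pure] End_form_minus by (metis (full_types))

lemma mat_vec_mult: "mat_vec r (\<lambda>i l. \<Sum>j<r. M i j * N j l) s = mat_vec r M (mat_vec r N s)"
proof
  fix i
  have "(\<Sum>l<r. (\<Sum>j<r. M i j * N j l) * s l) = (\<Sum>j<r. M i j * (\<Sum>l<r. N j l * s l))"
    by (simp add: sum_distrib_left sum_distrib_right mult_ac) (rule sum.swap)
  then show "mat_vec r (\<lambda>i l. \<Sum>j<r. M i j * N j l) s i = mat_vec r M (mat_vec r N s) i"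
    by (simp add: mat_vec_def)
qed

lemma End_form_mw:
  assumes "End_form S r E p q \<Phi>" "End_form S r E p q' \<Psi>"
  shows "End_form S r E p (q + q') (mw r \<Phi> \<Psi>)"
  using assms(1)
proof (induction rule: End_form.induct)
  case (1 M w)
  note M = 1
  show ?case
    using assms(2)
  proof (induction rule: End_form.induct)
    case (1 N w')
    have "mw r (\<lambda>i j. scl (M i j) w) (\<lambda>i j. scl (N i j) w') = (\<lambda>i l. scl (\<Sum>j<r. M i j * N j l) (wedge w w'))"
      by (intro ext) (simp add: mw_def wedge_scl_left wedge_scl_right sum_fun_apply scl_apply sum_distrib_left sum_distrib_right mult_ac)
    moreover have "(\<lambda>i l. \<Sum>j<r. M i j * N j l) \<in> End_stalk r E p"
      using M(1) 1(1) by (auto simp: End_stalk_def mat_vec_mult intro!: sum.neutral)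
    ultimately show ?case
      using End_formI [OF _ log_form_wedge [OF p M(2) 1(2)]] by (simp add: scl_def)
  next
    case (2 \<Psi> \<Psi>')
    then show ?case unfolding mw_add_right by (intro End_form.intros(2))
  qed
next
  case (2 \<Phi> \<Phi>')
  then show ?case unfolding mw_add_left by (intro End_form.intros(2))
qed

lemma End_form_wedge:
  assumes w: "log_form S p q' w"
  shows "End_form S r E p q \<Phi> \<Longrightarrow> End_form S r E p (q + q') (\<lambda>i l. wedge (\<Phi> i l) w)"
proof (induction rule: End_form.induct)
  case (1 M w')
  have "(\<lambda>i l. wedge (scl (M i l) w') w) = (\<lambda>i l. scl (M i l) (wedge w' w))"
    by (simp add: wedge_scl_left)
  then show ?case using End_formI [OF 1(1) log_form_wedge [OF p 1(2) w]] by (simp add: scl_def)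
next
  case (2 \<Phi> \<Phi>')
  then show ?case using End_form.intros(2) [OF 2(3,4)] by (simp add: plus_fun_def wedge_add_left [unfolded plus_fun_def])
qed

lemma fn_form_sum: "fn_form (\<Sum>i\<in>A. f i :: 'f) = (\<Sum>i\<in>A. fn_form (f i))"
  by (induction A rule: infinite_finite_induct)
    (simp_all only: sum.infinite sum.empty sum.insert fn_form_zero fn_form_add not_False_eq_True)

text \<open>
  With \<open>b\<close> a local frame of \<open>E\<close> and \<open>b'\<close> its dual frame,
  \<open>\<nabla> M = \<Sum>\<^sub>j (\<nabla> (M b\<^sub>j) - M \<nabla> b\<^sub>j) \<otimes> b'\<^sub>j\<close>.
\<close>

lemma End_form_nb_fn:
  assumes M: "M \<in> End_stalk r E p"
  shows "End_form S r E p 1 (nbl (\<lambda>i l. fn_form (M i l)))"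
proof -
  obtain b b' where b: "\<And>i j. i < r \<Longrightarrow> j < r \<Longrightarrow> (\<Sum>l<r. b i l * b' l j) = (if i = j then 1 else 0)"
    and b'b: "\<And>i j. i < r \<Longrightarrow> j < r \<Longrightarrow> (\<Sum>l<r. b' i l * b l j) = (if i = j then 1 else 0)"
    and W: "E p = {s \<in> vecs r. \<exists>c. (\<forall>j. c j \<in> local_ring X p) \<and> s = mat_vec r b c}"
    by (rule frame [OF p], rule that, assumption, assumption) simp_all
  define \<beta> where "\<beta> j = mat_vec r b (unit_vec r j)" for j
  have \<beta>: "\<beta> j \<in> E p" for j
    unfolding W mem_Collect_eq \<beta>_def
    by (intro conjI exI [of _ "unit_vec r j"]) (auto simp: vecs_def mat_vec_def unit_vec_def local_ring_0 local_ring_1)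
  have \<beta>v: "\<beta> j \<in> vecs r" for j using E_vecs [OF p \<beta>] .
  have \<beta>_eq: "\<beta> j i = b i j" if "i < r" "j < r" for i j
  proof -
    have "\<beta> j i = (\<Sum>h<r. b i h * unit_vec r j h)"
      unfolding \<beta>_def mat_vec_def using that by simp
    also have "\<dots> = (\<Sum>h<r. if h = j then b i j else 0)"
      using that by (intro sum.cong) (auto simp: unit_vec_def)
    finally show ?thesis using that by simp
  qed
  \<comment> \<open>The dual frame, cut off beyond \<open>r\<close> so that the rank one matrices
    built from it meet the support condition in \<open>End_stalk\<close>.\<close>
  define row where "row j l = (if l < r then b' j l else 0)" for j l
  have row_E: "(\<Sum>l<r. row j l * s l) \<in> local_ring X p" if "s \<in> E p" "j < r" for s j
  proof -
    obtain c where c: "\<forall>j. c j \<in> local_ring X p" "s = mat_vec r b c"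
      using \<open>s \<in> E p\<close> unfolding W mem_Collect_eq by (elim conjE exE)
    have "(\<Sum>l<r. row j l * s l) = (\<Sum>l<r. \<Sum>h<r. b' j l * b l h * c h)"
      by (simp add: row_def c(2) mat_vec_def sum_distrib_left mult.assoc)
    also have "\<dots> = (\<Sum>h<r. (\<Sum>l<r. b' j l * b l h) * c h)"
      by (subst sum.swap) (simp add: sum_distrib_right)
    also have "\<dots> = (\<Sum>h<r. if j = h then c h else 0)"
      using that by (intro sum.cong) (auto simp: b'b)
    finally show ?thesis using c(1) that by simp
  qed
  \<comment> \<open>The endomorphism \<open>s \<otimes> b'\<^sub>j\<close> written between backticks
    as \<open>s i * row j l\<close>: it preserves the stalk because the dual frame takes regular
    values on sections.\<close>
  have rank1: "(\<lambda>i l. s i * row j l) \<in> End_stalk r E p" if s: "s \<in> E p" and j: "j < r" for s j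
  proof -
    have "s i = 0" if "i \<ge> r" for i using E_vecs [OF p s] that by (auto simp: vecs_def)
    moreover have "mat_vec r (\<lambda>i l. s i * row j l) t \<in> E p" if "t \<in> E p" for t
    proof -
      have "mat_vec r (\<lambda>i l. s i * row j l) t = (\<lambda>i. (\<Sum>l<r. row j l * t l) * s i)"
        using E_vecs [OF p s] by (auto simp: mat_vec_def sum_distrib_left vecs_def mult_ac)
      then show ?thesis using E_scale [OF p s row_E [OF that j]] by simp
    qed
    ultimately show ?thesis by (auto simp: End_stalk_def row_def)
  qed
  have bf: "End_form S r E p q (\<lambda>i l. scl (row j l) (\<eta> i))" if "bundle_form S E p q \<eta>" "j < r" for q \<eta> j
    using that(1)
  proof (induction rule: bundle_form.induct)
    case (1 s w)
    have "(\<lambda>i l. scl (row j l) (scl (s i) w)) = (\<lambda>i l. scl (s i * row j l) w)"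
      by (simp add: scl_scl mult.commute)
    then show ?case using End_formI [OF rank1 [OF 1(1) that(2)] 1(2)] by (simp add: scl_def)
  next
    case (2 \<eta> \<eta>')
    then show ?case using End_form.intros(2) [OF 2(3,4)] by (simp add: plus_fun_def scl_def distrib_left)
  next
    case (3 \<eta> \<eta>')
    then have "\<eta> = \<eta>'" by (auto simp: fun_eq_iff)
    then show ?case using 3 by simp
  qed
  have Mb: "bundle_form S E p q (\<lambda>i. \<Sum>k<r. scl (M i k) (\<eta> k))" if "bundle_form S E p q \<eta>" for q \<eta>
    using that
  proof (induction rule: bundle_form.induct)
    case (1 s w)
    have "(\<lambda>i. \<Sum>k<r. scl (M i k) (scl (s k) w)) = (\<lambda>i vs. mat_vec r M s i * w vs)"
    proof (intro ext)
      fix i vs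
      show "(\<Sum>k<r. scl (M i k) (scl (s k) w)) vs = mat_vec r M s i * w vs"
        using M by (auto simp: sum_fun_apply scl_apply mat_vec_def sum_distrib_right End_stalk_def mult.assoc)
    qed
    moreover have "mat_vec r M s \<in> E p" using M 1(1) by (simp add: End_stalk_def)
    ultimately show ?case using bundle_form.intros(1) [OF _ 1(2), of "mat_vec r M s"] by (simp add: scl_def)
  next
    case (2 \<eta> \<eta>')
    have eq: "(\<lambda>i. \<Sum>k<r. scl (M i k) ((\<eta> + \<eta>') k)) = (\<lambda>i. \<Sum>k<r. scl (M i k) (\<eta> k)) + (\<lambda>i. \<Sum>k<r. scl (M i k) (\<eta>' k))"
      by (intro ext) (simp add: scl_add sum.distrib)
    from bundle_form.intros(2) [OF 2(3,4)] show ?case unfolding eq [symmetric] .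
  next
    case (3 \<eta> \<eta>')
    then have "\<eta> = \<eta>'" by (auto simp: fun_eq_iff)
    then show ?case using 3 by simp
  qed
  define \<Delta> where "\<Delta> j i = nab (mat_vec r M (\<beta> j)) i - (\<Sum>k<r. scl (M i k) (nab (\<beta> j) k))" for j i
  define N where "N = nbl (\<lambda>i l. fn_form (M i l))"
  have N: "N i m = d (fn_form (M i m)) + (\<Sum>k<r. scl (M k m) (Gam i k)) - (\<Sum>k<r. scl (M i k) (Gam k m))" for i m
    by (simp add: N_def nb_def md_def mw_def meps_def wedge_fn_left wedge_fn_right)
  \<comment> \<open>The Leibniz terms in which the derivative falls on \<open>\<beta> j\<close>
    occur in both halves of \<open>\<Delta>\<close> and cancel. What remains is linear in
    \<open>\<beta> j\<close> over functions: the matrix \<open>N\<close> applied to it.\<close>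
  have \<Delta>: "\<Delta> j i = (\<Sum>m<r. scl (\<beta> j m) (N i m))" if "i < r" for i j
  proof
    fix vs
    have Mv: "mat_vec r M (\<beta> j) \<in> vecs r" by (simp add: vecs_def mat_vec_def)
    have dM: "d (fn_form (mat_vec r M (\<beta> j) i)) vs = (\<Sum>m<r. M i m * d (fn_form (\<beta> j m)) vs + \<beta> j m * d (fn_form (M i m)) vs)"
      using that by (simp add: mat_vec_def fn_form_sum d_sum d_fn_mult sum_fun_apply scl_apply)
    have 1: "(\<Sum>k<r. mat_vec r M (\<beta> j) k * Gam i k vs) = (\<Sum>m<r. \<beta> j m * (\<Sum>k<r. M k m * Gam i k vs))"
      by (simp add: mat_vec_def sum_distrib_left sum_distrib_right) (subst sum.swap, simp add: mult_ac)
    have 2: "(\<Sum>k<r. M i k * (\<Sum>m<r. \<beta> j m * Gam k m vs)) = (\<Sum>m<r. \<beta> j m * (\<Sum>k<r. M i k * Gam k m vs))"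
      by (simp add: sum_distrib_left) (subst sum.swap, simp add: mult_ac)
    have "\<Delta> j i vs = (\<Sum>k<r. mat_vec r M (\<beta> j) k * Gam i k vs) + d (fn_form (mat_vec r M (\<beta> j) i)) vs
        - ((\<Sum>k<r. M i k * (\<Sum>m<r. \<beta> j m * Gam k m vs)) + (\<Sum>k<r. M i k * d (fn_form (\<beta> j k)) vs))"
      by (simp add: \<Delta>_def nab_expand [OF Mv] nab_expand [OF \<beta>v] sum_fun_apply scl_apply distrib_left sum.distrib)
    also have "\<dots> = (\<Sum>m<r. scl (\<beta> j m) (N i m)) vs"
      unfolding 1 2 dM
      by (simp add: N sum_fun_apply scl_apply distrib_left right_diff_distrib sum.distrib sum_subtractf)
    finally show "\<Delta> j i vs = (\<Sum>m<r. scl (\<beta> j m) (N i m)) vs" .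
  qed
  have \<Delta>_form: "End_form S r E p 1 (\<lambda>i l. scl (row j l) (\<Delta> j i))" if "j < r" for j
  proof -
    have "mat_vec r M (\<beta> j) \<in> E p" using M \<beta> by (simp add: End_stalk_def)
    from End_form_diff [OF bf [OF nab_form [OF p this] that] bf [OF Mb [OF nab_form [OF p \<beta>]] that], of j]
    show ?thesis by (simp add: \<Delta>_def scl_diff) (simp add: fun_diff_def)
  qed
  have "N = (\<Sum>j<r. (\<lambda>i l. scl (row j l) (\<Delta> j i)))"
  proof (intro ext)
    fix i l vs
    have Mo: "M i j = 0" if "i \<ge> r \<or> j \<ge> r" for i j using M that by (auto simp: End_stalk_def)
    show "N i l vs = (\<Sum>j<r. (\<lambda>i l. scl (row j l) (\<Delta> j i))) i l vs"
    proof (cases "i < r \<and> l < r")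
      case True
      have "(\<Sum>j<r. scl (row j l) (\<Delta> j i) vs) = (\<Sum>j<r. \<Sum>m<r. b m j * b' j l * N i m vs)"
        using True by (simp add: \<Delta> scl_apply row_def \<beta>_eq sum_fun_apply sum_distrib_left mult_ac)
      also have "\<dots> = (\<Sum>m<r. (\<Sum>j<r. b m j * b' j l) * N i m vs)"
        by (subst sum.swap) (simp add: sum_distrib_right)
      also have "\<dots> = (\<Sum>m<r. if m = l then N i m vs else 0)"
        using True by (intro sum.cong) (auto simp: b)
      finally show ?thesis using True by (simp add: sum_fun_apply)
    next
      case False
      have "N i l = 0" using False Mo Gam_props(1) unfolding N by (cases "i < r") simp_all
      moreover have "scl (row j l) (\<Delta> j i) = 0" if "j < r" for j
      proof (cases "l < r")
        case True
        then have i: "i \<ge> r" using False by simp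
        have "mat_vec r M (\<beta> j) \<in> E p" using M \<beta> by (simp add: End_stalk_def)
        then have "nab (mat_vec r M (\<beta> j)) i = 0"
          using bundle_form_outside [OF nab_form [OF p] p i] by (simp add: fun_eq_iff)
        then have "\<Delta> j i = 0" using i Mo by (simp add: \<Delta>_def)
        then show ?thesis by simp
      qed (simp add: row_def)
      ultimately show ?thesis by (simp add: sum_fun_apply)
    qed
  qed
  moreover have "End_form S r E p 1 (\<Sum>j<r. (\<lambda>i l. scl (row j l) (\<Delta> j i)))"
    by (rule End_form_sum, rule \<Delta>_form) simp
  ultimately show ?thesis by (simp only: N_def)
qed

text \<open>On a generator the derivative is \<open>\<nabla>M \<and> w + M \<otimes> dw\<close>,
  which reduces everything to matrices of functions, treated in
  \<open>End_form_nb_fn\<close>.\<close>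

lemma End_form_nb:
  "End_form S r E p q \<Phi> \<Longrightarrow> End_form S r E p (Suc q) (nbl \<Phi>)"
proof (induction rule: End_form.induct)
  case (1 M w)
  have pw: "pure V q w" by (rule log_form_pure [OF p 1(2)])
  have g: "wedge (Gam i j) w = wedge (eps w) (Gam i j)" for i j
    using \<Gamma>_pure by (intro wedge_1_comm [of V]) (simp add: mpure_def)
  have eq: "nbl (\<lambda>i j. scl (M i j) w) = (\<lambda>i l. wedge (nbl (\<lambda>i l. fn_form (M i l)) i l) w) + (\<lambda>i l. scl (M i l) (d w))"
    by (intro ext)
      (simp add: nb_def md_def mw_def meps_def d_scl [OF pw] wedge_fn_left wedge_fn_right wedge_scl_left wedge_scl_right
        wedge_add_left wedge_diff_left wedge_sum_left eps_scl g)
  show ?case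
    using End_form.intros(2) [OF End_form_wedge [OF 1(2) End_form_nb_fn [OF 1(1)], simplified] End_formI [OF 1(1) log_form_d [OF p 1(2)]]]
    unfolding eq [symmetric] by (simp only: scl_def)
next
  case (2 \<Phi> \<Phi>')
  then show ?case unfolding nb_add by (intro End_form.intros(2))
qed

end

end

definition sc :: "('k \<Rightarrow> 'f::comm_ring_1) \<Rightarrow> 'k \<Rightarrow> ('i, 'f) cochain \<Rightarrow> ('i, 'f) cochain" where
  "sc h a c = (\<lambda>l i j vs. h a * c l i j vs)"

section \<open>Cochains on a covering\<close>

locale covered_bundle = flat_bundle X D r E nab
  for X :: "('k::field, 'f::field) pvariety" and D :: "(nat \<Rightarrow> 'k) set set"
    and r :: nat and E :: "(nat \<Rightarrow> 'k) \<Rightarrow> (nat \<Rightarrow> 'f) set" and nab :: "('f, 'f) conn" +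
  fixes I :: "'i set" and U :: "'i \<Rightarrow> (nat \<Rightarrow> 'k) set"
  assumes cover: "fine_cover X I U"
begin

abbreviation "C \<equiv> cochains S r E I U"
abbreviation "DD \<equiv> total_d S r nab I"
abbreviation "ks \<equiv> sc (emb X)"

lemma U_points: "\<alpha> \<in> I \<Longrightarrow> U \<alpha> \<subseteq> points X"
  using cover by (auto simp: fine_cover_def)

text \<open>Degree and shape of a cochain component are read off from its membership in a stalk,
  which requires a point in the intersection of the charts. Irreducibility provides one.\<close>

lemma Inter_nonempty:
  assumes "l \<noteq> []" "set l \<subseteq> I"
  obtains p where "p \<in> points X" "p \<in> (\<Inter>\<alpha>\<in>set l. U \<alpha>)"
proof -
  have "zopen X (\<Inter>\<alpha>\<in>set l. U \<alpha>)"
    using assms fine_cover_zopen [OF cover] by (intro Inter_zopen) auto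
  then have "(\<Inter>\<alpha>\<in>set l. U \<alpha>) \<noteq> {}" "(\<Inter>\<alpha>\<in>set l. U \<alpha>) \<subseteq> points X" by (auto simp: zopen_def)
  then show ?thesis using that by blast
qed

lemma Inter_points: "l \<noteq> [] \<Longrightarrow> set l \<subseteq> I \<Longrightarrow> p \<in> (\<Inter>\<alpha>\<in>set l. U \<alpha>) \<Longrightarrow> p \<in> points X"
  using U_points by (cases l) auto

lemma cochainsI:
  assumes "\<And>l p. l \<noteq> [] \<Longrightarrow> set l \<subseteq> I \<Longrightarrow> length l \<le> Suc n \<Longrightarrow> p \<in> points X \<Longrightarrow> p \<in> (\<Inter>\<alpha>\<in>set l. U \<alpha>) \<Longrightarrow>
      End_form S r E p (Suc n - length l) (c l)"
    and "\<And>l. \<not> (l \<noteq> [] \<and> set l \<subseteq> I \<and> length l \<le> Suc n) \<Longrightarrow> c l = 0"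
  shows "c \<in> C n"
  unfolding cochains_def mem_Collect_eq
proof
  show "if l \<noteq> [] \<and> set l \<subseteq> I \<and> length l \<le> Suc n
    then \<forall>p\<in>(\<Inter>\<alpha>\<in>set l. U \<alpha>). End_form S r E p (Suc n - length l) (c l) else c l = 0" for l
    using assms(1) [of l] assms(2) [of l] Inter_points [of l] by (simp del: INT_iff Inter_iff)
qed

lemma cochains_form:
  assumes "c \<in> C n" "p \<in> points X" "p \<in> (\<Inter>\<alpha>\<in>set l. U \<alpha>)"
  shows "End_form S r E p (Suc n - length l) (c l)"
proof (cases "l \<noteq> [] \<and> set l \<subseteq> I \<and> length l \<le> Suc n")
  case True
  have "if l \<noteq> [] \<and> set l \<subseteq> I \<and> length l \<le> Suc n
    then \<forall>p\<in>(\<Inter>\<alpha>\<in>set l. U \<alpha>). End_form S r E p (Suc n - length l) (c l) else c l = 0"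
    using assms(1) unfolding cochains_def mem_Collect_eq by (rule spec)
  then show ?thesis using True assms(3) by simp
next
  case False
  then have "c l = 0" using assms(1) unfolding cochains_def mem_Collect_eq by presburger
  then show ?thesis using End_form_zero [OF assms(2)] by simp
qed

lemma cochains_zero: "c \<in> C n \<Longrightarrow> \<not> (l \<noteq> [] \<and> set l \<subseteq> I \<and> length l \<le> Suc n) \<Longrightarrow> c l = 0"
  unfolding cochains_def mem_Collect_eq by presburger

lemma cochains_coch:
  assumes "c \<in> C n"
  shows "coch V r I n c"
  unfolding coch_def
proof
  fix l
  show "if l \<noteq> [] \<and> set l \<subseteq> I \<and> length l \<le> Suc n
    then mpure V (Suc n - length l) (c l) \<and> (\<forall>i j. i \<ge> r \<or> j \<ge> r \<longrightarrow> c l i j = 0) else c l = 0"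
  proof (cases "l \<noteq> [] \<and> set l \<subseteq> I \<and> length l \<le> Suc n")
    case True
    then obtain p where p: "p \<in> points X" "p \<in> (\<Inter>\<alpha>\<in>set l. U \<alpha>)" using Inter_nonempty by metis
    show ?thesis
      using True End_form_pure [OF p(1) cochains_form [OF assms p]] End_form_outside [OF p(1) cochains_form [OF assms p]]
      by simp
  qed (use cochains_zero [OF assms] in presburger)
qed

lemma cochains_md_md:
  assumes "c \<in> C n" "n \<le> 1"
  shows "md S (md S (c l)) = 0"
proof (cases "l \<noteq> [] \<and> set l \<subseteq> I \<and> length l \<le> Suc n")
  case True
  then obtain p where p: "p \<in> points X" "p \<in> (\<Inter>\<alpha>\<in>set l. U \<alpha>)" using Inter_nonempty by metis
  have "Suc n - length l \<le> 1" using True assms(2) by (cases l) auto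
  then show ?thesis using End_form_md_md [OF p(1) cochains_form [OF assms(1) p]] by simp
qed (use cochains_zero [OF assms(1)] in simp)

lemma cochains_total_d:
  assumes c: "c \<in> C n"
  shows "DD c \<in> C (Suc n)"
proof (rule cochainsI)
  fix l p assume l: "l \<noteq> []" "set l \<subseteq> I" "length l \<le> Suc (Suc n)" and p: "p \<in> points X" "p \<in> (\<Inter>\<alpha>\<in>set l. U \<alpha>)"
  have "End_form S r E p (Suc (Suc n) - length l) (if even m then c (take m l @ drop (Suc m) l) else - c (take m l @ drop (Suc m) l))"
    if "m < length l" for m
  proof -
    have "p \<in> (\<Inter>\<alpha>\<in>set (take m l @ drop (Suc m) l). U \<alpha>)"
      using p(2) by (auto dest: in_set_takeD in_set_dropD)
    from cochains_form [OF c p(1) this] that have "End_form S r E p (Suc (Suc n) - length l) (c (take m l @ drop (Suc m) l))"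
      by (simp add: Suc_diff_le)
    then show ?thesis using End_form_minus [OF p(1)] by simp
  qed
  moreover have "End_form S r E p (Suc (Suc n) - length l) (nbl (c l))"
  proof (cases "length l = Suc (Suc n)")
    case True
    then show ?thesis using cochains_zero [OF c, of l] End_form_zero [OF p(1)] by simp
  next
    case False
    then show ?thesis using l(3) End_form_nb [OF p(1) cochains_form [OF c p]] by (simp add: Suc_diff_le)
  qed
  ultimately show "End_form S r E p (Suc (Suc n) - length l) (DD c l)"
    unfolding total_d_eq [OF cochains_coch [OF c] l(1,2)]
    by (intro End_form.intros(2) End_form_sum [OF p(1)]) (auto intro: End_form_minus [OF p(1)])
next
  fix l assume "\<not> (l \<noteq> [] \<and> set l \<subseteq> I \<and> length l \<le> Suc (Suc n))"
  then show "DD c l = 0" using total_d_outside total_d_long [OF cochains_coch [OF c]] by (metis not_le)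
qed

lemma cochains_cup:
  assumes x: "x \<in> C 1" and y: "y \<in> C 1"
  shows "cup r x y \<in> C 2"
proof (rule cochainsI)
  fix l p assume l: "l \<noteq> []" "set l \<subseteq> I" "length l \<le> Suc 2" and p: "p \<in> points X" "p \<in> (\<Inter>\<alpha>\<in>set l. U \<alpha>)"
  have mepsn: "End_form S r E p q \<Phi> \<Longrightarrow> End_form S r E p q ((meps ^^ n) \<Phi>)" for n q \<Phi>
    by (induction n) (auto intro: End_form_meps [OF p(1)])
  show "End_form S r E p (Suc 2 - length l) (cup r x y l)"
    unfolding cup_def
  proof (rule End_form_sum [OF p(1)])
    fix k assume "k \<in> {..<length l}"
    then have k: "k < length l" by simp
    let ?T = "mw r ((meps ^^ (length l - 1 - k)) (x (take (Suc k) l))) (y (drop k l))"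
    show "End_form S r E p (Suc 2 - length l) ?T"
    \<comment> \<open>Exactly in this case both faces have at most two vertices. Otherwise the
      truncated subtractions in the degrees no longer add up, but then one of the factors is
      zero.\<close>
    proof (cases "k \<le> 1 \<and> length l \<le> k + 2")
      case True
      have "p \<in> (\<Inter>\<alpha>\<in>set (take (Suc k) l). U \<alpha>)" "p \<in> (\<Inter>\<alpha>\<in>set (drop k l). U \<alpha>)"
        using p(2) by (auto dest: in_set_takeD in_set_dropD)
      from End_form_mw [OF p(1) mepsn [OF cochains_form [OF x p(1) this(1)]] cochains_form [OF y p(1) this(2)]]
      have "End_form S r E p ((Suc 1 - length (take (Suc k) l)) + (Suc 1 - length (drop k l))) ?T" .
      moreover have eq: "(Suc 1 - length (take (Suc k) l)) + (Suc 1 - length (drop k l)) = Suc 2 - length l"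
        using True k by auto
      ultimately show ?thesis by (simp only: eq)
    next
      case False
      then consider "k > 1" | "length l > k + 2" by linarith
      then have "x (take (Suc k) l) = 0 \<or> y (drop k l) = 0"
      proof cases
        case 1
        have "x (take (Suc k) l) = 0" by (rule cochains_zero [OF x]) (use k 1 in simp)
        then show ?thesis ..
      next
        case 2
        have "y (drop k l) = 0" by (rule cochains_zero [OF y]) (use 2 in auto)
        then show ?thesis ..
      qed
      then show ?thesis using End_form_zero [OF p(1)] by auto
    qed
  qed
next
  fix l assume "\<not> (l \<noteq> [] \<and> set l \<subseteq> I \<and> length l \<le> Suc 2)"
  then show "cup r x y l = 0" using coch_zero [OF coch_cup [OF cochains_coch [OF x] cochains_coch [OF y]]] by blast
qed

lemma cochains_add: "x \<in> C n \<Longrightarrow> y \<in> C n \<Longrightarrow> x + y \<in> C n"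
proof (rule cochainsI)
  fix l assume "x \<in> C n" "y \<in> C n" "\<not> (l \<noteq> [] \<and> set l \<subseteq> I \<and> length l \<le> Suc n)"
  then have "x l = 0" "y l = 0" using cochains_zero by blast+
  then show "(x + y) l = 0" by (simp only: plus_fun_apply [of x] add_0)
qed (simp only: plus_fun_apply [of x], intro End_form.intros(2) cochains_form)

lemma cochains_0: "0 \<in> C n"
  by (rule cochainsI) (auto intro: End_form_zero)

lemma cochains_scale:
  assumes "x \<in> C n"
  shows "ks a x \<in> C n"
proof (rule cochainsI)
  fix l p assume "p \<in> points X" "p \<in> (\<Inter>\<alpha>\<in>set l. U \<alpha>)"
  then show "End_form S r E p (Suc n - length l) (ks a x l)"
    using End_form_scale [OF _ local_ring_const cochains_form [OF assms]] by (simp add: sc_def scl_def)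
next
  fix l assume "\<not> (l \<noteq> [] \<and> set l \<subseteq> I \<and> length l \<le> Suc n)"
  then have "x l = 0" by (rule cochains_zero [OF assms])
  then show "ks a x l = 0" by (simp add: sc_def fun_eq_iff)
qed

text \<open>In contrast to \<open>d_scl\<close> no homogeneity is assumed: the differential has to
  be linear on the whole vector space of cochain functions before linear algebra can supply global
  sections of it.\<close>

lemma ext_d_const: "d (scl (emb X a) w) = scl (emb X a) (d w)"
proof
  fix vs
  have "cartan (\<lambda>v. v) (scl (emb X a) w) vs = emb X a * cartan (\<lambda>v. v) w vs" if "set vs \<subseteq> V"
    using that
  proof (induction vs arbitrary: w)
    case (Cons v vs)
    then have "v (emb X a * y) = emb X a * v y" for y by (simp add: derivations_def)
    then have "lie (\<lambda>v. v) v (scl (emb X a) w) vs = emb X a * lie (\<lambda>v. v) v w vs"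
      by (simp add: lie_def scl_apply right_diff_distrib sum_distrib_left)
    with Cons show ?case by (simp add: cartan_Cons iota_scl right_diff_distrib)
  qed simp
  then show "d (scl (emb X a) w) vs = scl (emb X a) (d w) vs" by (auto simp: ext_d_def scl_apply)
qed

lemma DD_add: "DD (x + y) = DD x + DD y"
  by (intro ext) (simp add: total_d_def End_nabla_def wedge_add_right d_add distrib_left sum.distrib)

lemma DD_scale: "DD (ks a x) = ks a (DD x)"
proof (intro ext)
  fix l i j vs
  have w: "wedge b (\<lambda>vs. emb X a * w vs) vs = emb X a * wedge b w vs" for b w :: "('f, 'f) dform"
    using wedge_scl_right [of b "emb X a" w] by (simp add: scl_def fun_eq_iff)
  have d: "d (\<lambda>vs. emb X a * w vs) vs = emb X a * d w vs" for w
    using ext_d_const [of a w] by (simp add: scl_def fun_eq_iff)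
  show "DD (ks a x) l i j vs = ks a (DD x) l i j vs"
    by (simp add: total_d_def End_nabla_def sc_def w d distrib_left sum_distrib_left mult_ac)
qed

lemma
  fixes x y :: "('i, 'f) cochain"
  shows cup_scale_left: "cup r (ks a x) y = ks a (cup r x y)"
  and cup_scale_right: "cup r x (ks a y) = ks a (cup r x y)"
proof -
  have m: "(meps ^^ n) (\<lambda>i j. scl c (\<Phi> i j)) = (\<lambda>i j. scl c ((meps ^^ n) \<Phi> i j))"
    for n c and \<Phi> :: "('f, 'f) matform"
    by (induction n) (auto simp: meps_def eps_scl)
  have k: "ks a x l = (\<lambda>i j. scl (emb X a) (x l i j))" for x :: "('i, 'f) cochain" and l
    by (simp add: sc_def scl_def)
  have l: "mw r (\<lambda>i j. scl c (\<Phi> i j)) \<Psi> = (\<lambda>i j. scl c (mw r \<Phi> \<Psi> i j))"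
    "mw r \<Phi> (\<lambda>i j. scl c (\<Psi> i j)) = (\<lambda>i j. scl c (mw r \<Phi> \<Psi> i j))" for c and \<Phi> \<Psi> :: "('f, 'f) matform"
    by (simp_all add: mw_def wedge_scl_left wedge_scl_right scl_sum)
  show "cup r (ks a x) y = ks a (cup r x y)" 
  proof
    fix l
    have "cup r (ks a x) y l = (\<lambda>i j. scl (emb X a) (cup r x y l i j))"
      by (intro ext) (simp add: cup_def k m l sum_fun_apply scl_apply sum_distrib_left)
    then show "cup r (ks a x) y l = ks a (cup r x y) l" by (simp only: k)
  qed
  show "cup r x (ks a y) = ks a (cup r x y)"
  proof
    fix l
    have "cup r x (ks a y) l = (\<lambda>i j. scl (emb X a) (cup r x y l i j))"
      by (intro ext) (simp add: cup_def k m l sum_fun_apply scl_apply sum_distrib_left)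
    then show "cup r x (ks a y) l = ks a (cup r x y) l" by (simp only: k)
  qed
qed

lemma vector_space_ks: "vector_space ks"
  by unfold_locales (simp_all add: sc_def fun_eq_iff h_add h_mult h_one algebra_simps)

lemma DD_DD: "c \<in> C n \<Longrightarrow> n \<le> 1 \<Longrightarrow> DD (DD c) = 0"
  by (rule total_d_total_d [OF cochains_coch _ cochains_md_md])

lemma DD_cup: "x \<in> C 1 \<Longrightarrow> y \<in> C 1 \<Longrightarrow> DD (cup r x y) = cup r (DD x) y - cup r x (DD y)"
  by (intro total_d_cup cochains_coch)

end

section \<open>Solving the Maurer-Cartan equation\<close>

definition splits :: "(nat \<Rightarrow>\<^sub>0 nat) \<Rightarrow> ((nat \<Rightarrow>\<^sub>0 nat) \<times> (nat \<Rightarrow>\<^sub>0 nat)) set" where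
  "splits c = {p. fst p + snd p = c}"

text \<open>The monomials that form a basis of the coordinate ring of
  \<open>W\<^sub>m\<close>.\<close>

definition expo :: "nat \<Rightarrow> nat \<Rightarrow> (nat \<Rightarrow>\<^sub>0 nat) set" where
  "expo N m = {c. Poly_Mapping.keys c \<subseteq> {..<N} \<and> mdeg c \<le> m}"

lemma finite_le_exponent: "finite {a. Poly_Mapping.keys a \<subseteq> A \<and> (\<forall>i. Poly_Mapping.lookup a i \<le> n)}"
  if "finite A" for A :: "nat set" and n :: nat
proof -
  have "inj_on Poly_Mapping.lookup {a. Poly_Mapping.keys a \<subseteq> A \<and> (\<forall>i. Poly_Mapping.lookup a i \<le> n)}"
    by (auto simp: inj_on_def intro: poly_mapping_eqI)
  moreover have "finite {f. \<forall>i. (i \<in> A \<longrightarrow> f i \<in> {..n}) \<and> (i \<notin> A \<longrightarrow> f i = (0::nat))}"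
    using that by (intro finite_set_of_finite_funs) auto
  moreover have "Poly_Mapping.lookup ` {a. Poly_Mapping.keys a \<subseteq> A \<and> (\<forall>i. Poly_Mapping.lookup a i \<le> n)}
      \<subseteq> {f. \<forall>i. (i \<in> A \<longrightarrow> f i \<in> {..n}) \<and> (i \<notin> A \<longrightarrow> f i = (0::nat))}"
    by (auto simp: in_keys_iff)
  ultimately show ?thesis using finite_subset finite_imageD by blast
qed

lemma lookup_le_mdeg: "Poly_Mapping.lookup c i \<le> mdeg c"
proof (cases "i \<in> Poly_Mapping.keys c")
  case True
  then show ?thesis unfolding mdeg_def by (intro member_le_sum) auto
qed (simp add: in_keys_iff)

lemma finite_expo: "finite (expo N m)"
proof (rule finite_subset)
  show "expo N m \<subseteq> {a. Poly_Mapping.keys a \<subseteq> {..<N} \<and> (\<forall>i. Poly_Mapping.lookup a i \<le> m)}"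
    by (auto simp: expo_def intro: order_trans [OF lookup_le_mdeg])
qed (rule finite_le_exponent [OF finite_lessThan])

lemma finite_splits: "finite (splits c)"
proof (rule finite_subset)
  let ?A = "{a. Poly_Mapping.keys a \<subseteq> Poly_Mapping.keys c \<and> (\<forall>i. Poly_Mapping.lookup a i \<le> mdeg c)}"
  have "a \<in> ?A" "b \<in> ?A" if "a + b = c" for a b
    using that trans_le_add1 [OF lookup_le_mdeg [of a]] trans_le_add2 [OF lookup_le_mdeg [of b]]
    by (auto simp: keys_add_nat mdeg_add)
  then show "splits c \<subseteq> ?A \<times> ?A" by (force simp: splits_def)
  show "finite (?A \<times> ?A)" using finite_le_exponent [OF finite_keys] by blast
qed

lemma expo_add: "a + b \<in> expo N m \<Longrightarrow> a \<in> expo N m \<and> b \<in> expo N m"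
  by (auto simp: expo_def keys_add_nat mdeg_add)

lemma mdeg_1: "mdeg c = 1 \<longleftrightarrow> (\<exists>l. c = Poly_Mapping.single l 1)"
proof
  assume c: "mdeg c = 1"
  then have "c \<noteq> 0" by auto
  then obtain l where l: "l \<in> Poly_Mapping.keys c" by (metis ex_in_conv keys_eq_empty)
  have "mdeg c = Poly_Mapping.lookup c l + (\<Sum>i\<in>Poly_Mapping.keys c - {l}. Poly_Mapping.lookup c i)"
    unfolding mdeg_def using l by (simp add: sum.remove)
  moreover have "Poly_Mapping.lookup c l \<noteq> 0" using l by (simp add: in_keys_iff)
  ultimately have 1: "Poly_Mapping.lookup c l = 1" and 2: "(\<Sum>i\<in>Poly_Mapping.keys c - {l}. Poly_Mapping.lookup c i) = 0"
    using c by arith+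
  have "Poly_Mapping.lookup c i = 0" if "i \<noteq> l" for i
  proof (cases "i \<in> Poly_Mapping.keys c")
    case True
    have "\<forall>i\<in>Poly_Mapping.keys c - {l}. Poly_Mapping.lookup c i = 0"
      using 2 by (subst (asm) sum_eq_0_iff) auto
    then show ?thesis using True that by blast
  qed (simp add: in_keys_iff)
  with 1 show "\<exists>l. c = Poly_Mapping.single l 1"
    by (intro exI [of _ l] poly_mapping_eqI) (auto simp: lookup_single when_def)
qed (auto simp: mdeg_def)

lemma sum_splits_assoc:
  "(\<Sum>p\<in>splits c. \<Sum>q\<in>splits (fst p). F (fst q) (snd q) (snd p)) =
   (\<Sum>p\<in>splits c. \<Sum>q\<in>splits (snd p). F (fst p) (fst q) (snd q) :: 'v::comm_monoid_add)"
  unfolding sum.Sigma [OF finite_splits ballI [OF finite_splits]]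
  by (rule sum.reindex_bij_witness
      [where i = "\<lambda>(p, q). ((fst p + fst q, snd q), (fst p, fst q))"
        and j = "\<lambda>(p, q). ((fst q, snd q + snd p), (snd q, snd p))"])
    (auto simp: splits_def add.assoc)

text \<open>The cochain algebra reduced to what the recursion needs. \<open>D\<close> and
  \<open>mul\<close> are total and linear everywhere; the subspaces \<open>C1\<close> and
  \<open>C2\<close> carry the degrees. The sign in \<open>D_mul\<close> is the one for degree
  1.\<close>

locale mc_algebra = vector_space sc
  for sc :: "'k::field \<Rightarrow> 'v::ab_group_add \<Rightarrow> 'v" +
  fixes D :: "'v \<Rightarrow> 'v" and mul :: "'v \<Rightarrow> 'v \<Rightarrow> 'v" and C1 C2 :: "'v set" and N :: nat and z :: "nat \<Rightarrow> 'v"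
  assumes D_add: "D (x + y) = D x + D y" and D_scale: "D (sc a x) = sc a (D x)"
    and C1: "subspace C1" and C2: "subspace C2"
    and D_C1: "x \<in> C1 \<Longrightarrow> D x \<in> C2" and D_D: "x \<in> C1 \<Longrightarrow> D (D x) = 0"
    and mul_add_left: "mul (x + x') y = mul x y + mul x' y"
    and mul_add_right: "mul x (y + y') = mul x y + mul x y'"
    and mul_scale_left: "mul (sc a x) y = sc a (mul x y)"
    and mul_scale_right: "mul x (sc a y) = sc a (mul x y)"
    and mul_assoc: "mul (mul x y) w = mul x (mul y w)"
    and mul_C1: "x \<in> C1 \<Longrightarrow> y \<in> C1 \<Longrightarrow> mul x y \<in> C2"
    and D_mul: "x \<in> C1 \<Longrightarrow> y \<in> C1 \<Longrightarrow> D (mul x y) = mul (D x) y - mul x (D y)"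
    and z_C1: "l < N \<Longrightarrow> z l \<in> C1" and D_z: "l < N \<Longrightarrow> D (z l) = 0"
begin

lemma lin_D: "Vector_Spaces.linear sc sc D"
  unfolding Vector_Spaces.linear_iff using D_add D_scale vector_space_axioms by auto

lemma D_zero [simp]: "D 0 = 0"
  using D_add [of 0 0] by simp

lemma D_minus: "D (- x) = - D x"
  using D_add [of x "- x"] by (simp add: eq_neg_iff_add_eq_0 add.commute)

lemma D_sum: "D (\<Sum>i\<in>A. f i) = (\<Sum>i\<in>A. D (f i))"
  by (induction A rule: infinite_finite_induct) (auto simp: D_add)

lemma mul_zero [simp]: "mul 0 y = 0" "mul x 0 = 0"
  using mul_add_left [of 0 0 y] mul_add_right [of x 0 0] by simp_all

lemma mul_sum_left: "mul (\<Sum>i\<in>A. f i) y = (\<Sum>i\<in>A. mul (f i) y)"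
  and mul_sum_right: "mul x (\<Sum>i\<in>A. f i) = (\<Sum>i\<in>A. mul x (f i))"
  by (induction A rule: infinite_finite_induct) (auto simp: mul_add_left mul_add_right)

definition conv :: "((nat \<Rightarrow>\<^sub>0 nat) \<Rightarrow> 'v) \<Rightarrow> ((nat \<Rightarrow>\<^sub>0 nat) \<Rightarrow> 'v) \<Rightarrow> (nat \<Rightarrow>\<^sub>0 nat) \<Rightarrow> 'v" where
  "conv x y c = (\<Sum>p\<in>splits c. mul (x (fst p)) (y (snd p)))"

lemma conv_assoc: "conv (conv x y) w = conv x (conv y w)"
proof
  show "conv (conv x y) w c = conv x (conv y w) c" for c
    using sum_splits_assoc [where F = "\<lambda>a b e. mul (x a) (mul (y b) (w e))"]
    by (simp add: conv_def mul_sum_left mul_sum_right mul_assoc)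
qed

lemma conv_add_left: "conv (\<lambda>c. x c + x' c) y c = conv x y c + conv x' y c"
  and conv_add_right: "conv x (\<lambda>c. y c + y' c) c = conv x y c + conv x y' c"
  by (simp_all add: conv_def mul_add_left mul_add_right sum.distrib)

text \<open>A functional supported on surviving monomials turns the Cauchy product into a free
  double sum weighted by \<open>la (a + b)\<close>. For fixed \<open>b\<close> this weight is the
  shift of the functional by \<open>b\<close>.\<close>

lemma sum_expo_conv:
  assumes "\<And>c. la c \<noteq> 0 \<Longrightarrow> c \<in> expo N m"
  shows "(\<Sum>c\<in>expo N m. sc (la c) (conv x y c)) = (\<Sum>a\<in>expo N m. \<Sum>b\<in>expo N m. sc (la (a + b)) (mul (x a) (y b)))"
proof -
  let ?C = "expo N m"
  have "(\<Sum>c\<in>?C. sc (la c) (conv x y c)) = (\<Sum>(c, p)\<in>Sigma ?C splits. sc (la (fst p + snd p)) (mul (x (fst p)) (y (snd p))))"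
    unfolding sum.Sigma [OF finite_expo ballI [OF finite_splits], symmetric] conv_def
    by (intro sum.cong refl) (auto simp: scale_sum_right splits_def)
  also have "\<dots> = (\<Sum>p | p \<in> ?C \<times> ?C \<and> fst p + snd p \<in> ?C. sc (la (fst p + snd p)) (mul (x (fst p)) (y (snd p))))"
    by (rule sum.reindex_bij_witness [where i = "\<lambda>p. (fst p + snd p, p)" and j = snd])
      (auto simp: splits_def dest: expo_add)
  also have "\<dots> = (\<Sum>p\<in>?C \<times> ?C. sc (la (fst p + snd p)) (mul (x (fst p)) (y (snd p))))"
    using assms by (intro sum.mono_neutral_left) (auto simp: finite_expo)
  finally show ?thesis by (simp add: sum.cartesian_product split_def)
qed

end

text \<open>Linearity over \<open>k\<close> of the two sections and of the projection is essential:
  it allows them to be exchanged with the pairing against a functional.\<close>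

locale mc_splitting = mc_algebra sc D mul C1 C2 N z
  for sc :: "'k::field \<Rightarrow> 'v::ab_group_add \<Rightarrow> 'v" and D mul C1 C2 N z +
  fixes h0 g \<pi> :: "'v \<Rightarrow> 'v"
  assumes g: "range g \<subseteq> C2" "Vector_Spaces.linear sc sc g" "\<forall>v\<in>D ` C2. D (g v) = v"
    and h0: "range h0 \<subseteq> C1" "Vector_Spaces.linear sc sc h0" "\<forall>v\<in>D ` C1. D (h0 v) = v"
    and \<pi>: "range \<pi> \<subseteq> D ` C1" "Vector_Spaces.linear sc sc \<pi>" "\<forall>v\<in>D ` C1. \<pi> v = v"
begin

text \<open>
  \<open>cl\<close> projects \<open>C2\<close> onto the cocycles, \<open>\<pi>\<close> projects onto the coboundaries; no Hodge theory is
  needed since arbitrary linear sections of \<open>D\<close> serve as homotopies.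
\<close>

definition cl :: "'v \<Rightarrow> 'v" where "cl y = y - g (D y)"

text \<open>Leaving out the pairs with a zero exponent makes the recursion descend in degree; since
  \<open>gam 0\<close> comes out as 0, the omitted products vanish and the sum is the full
  coefficient of the square. The choice operator picks the unique variable of a monomial of degree
  1.\<close>

function gam :: "(nat \<Rightarrow>\<^sub>0 nat) \<Rightarrow> 'v" where
  "gam c = (if \<not> Poly_Mapping.keys c \<subseteq> {..<N} then 0
     else if mdeg c = 1 then z (SOME l. c = Poly_Mapping.single l 1)
     else - h0 (\<pi> (cl (\<Sum>p\<in>{p \<in> splits c. fst p \<noteq> 0 \<and> snd p \<noteq> 0}. mul (gam (fst p)) (gam (snd p))))))"
  by auto
termination
proof (relation "measure mdeg")
  have "mdeg (fst p) < mdeg c \<and> mdeg (snd p) < mdeg c" if "p \<in> {p \<in> splits c. fst p \<noteq> 0 \<and> snd p \<noteq> 0}" for c p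
  proof -
    have "c = fst p + snd p" "mdeg (fst p) \<noteq> 0" "mdeg (snd p) \<noteq> 0"
      using that by (auto simp: splits_def mdeg_eq_0_iff)
    then show ?thesis by (simp add: mdeg_add)
  qed
  then show "\<And>c p. \<not> \<not> Poly_Mapping.keys c \<subseteq> {..<N} \<Longrightarrow> mdeg c \<noteq> 1 \<Longrightarrow>
      p \<in> {p \<in> splits c. fst p \<noteq> 0 \<and> snd p \<noteq> 0} \<Longrightarrow> (fst p, c) \<in> measure mdeg"
    "\<And>c p. \<not> \<not> Poly_Mapping.keys c \<subseteq> {..<N} \<Longrightarrow> mdeg c \<noteq> 1 \<Longrightarrow>
      p \<in> {p \<in> splits c. fst p \<noteq> 0 \<and> snd p \<noteq> 0} \<Longrightarrow> (snd p, c) \<in> measure mdeg"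
    by auto
qed simp

declare gam.simps [simp del]

lemma lin_zero: "Vector_Spaces.linear sc sc f \<Longrightarrow> f 0 = 0"
  unfolding Vector_Spaces.linear_iff by (metis scale_zero_left)

lemma lin_sum: "Vector_Spaces.linear sc sc f \<Longrightarrow> f (\<Sum>i\<in>A. sc (a i) (x i)) = (\<Sum>i\<in>A. sc (a i) (f (x i)))"
  using lin_zero [of f] unfolding Vector_Spaces.linear_iff
  by (induction A rule: infinite_finite_induct) auto

lemma cl_zero [simp]: "cl 0 = 0"
  by (simp add: cl_def lin_zero [OF g(2)])

lemma cl_C2: "y \<in> C2 \<Longrightarrow> cl y \<in> C2"
  using g(1) C2 by (auto simp: cl_def intro: subspace_diff)

lemma D_cl: "y \<in> C2 \<Longrightarrow> D (cl y) = 0"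
  using g(3) D_add [of y "- g (D y)"] by (simp add: cl_def D_minus)

lemma gam_outside: "\<not> Poly_Mapping.keys c \<subseteq> {..<N} \<Longrightarrow> gam c = 0"
  by (simp add: gam.simps)

lemma gam_single: "l < N \<Longrightarrow> gam (Poly_Mapping.single l 1) = z l"
proof -
  assume "l < N"
  moreover have "(SOME l'. Poly_Mapping.single l (1::nat) = Poly_Mapping.single l' 1) = l"
    by (rule some_equality) (auto simp: poly_mapping_eq_iff fun_eq_iff lookup_single when_def split: if_splits)
  ultimately show ?thesis using mdeg_1 [of "Poly_Mapping.single l 1"] by (subst gam.simps) auto
qed

lemma splits_0: "splits 0 = {(0, 0)}"
  by (auto simp: splits_def poly_mapping_eq_iff lookup_add fun_eq_iff plus_poly_mapping.rep_eq)

lemma gam_C1: "gam c \<in> C1"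
proof (cases "Poly_Mapping.keys c \<subseteq> {..<N}")
  case True
  have m: "- h0 y \<in> C1" for y using h0(1) C1 by (auto intro: subspace_neg)
  show ?thesis
  proof (cases "mdeg c = 1")
    case 1: True
    then obtain l where l: "c = Poly_Mapping.single l 1" unfolding mdeg_1 by blast
    then have "l < N" using True by auto
    then show ?thesis using gam_single z_C1 l by simp
  next
    case False
    then show ?thesis using True m by (subst gam.simps) simp
  qed
qed (use gam_outside C1 subspace_0 in auto)

definition q :: "(nat \<Rightarrow>\<^sub>0 nat) \<Rightarrow> 'v" where "q = conv gam gam"

lemma q_outside: "\<not> Poly_Mapping.keys c \<subseteq> {..<N} \<Longrightarrow> q c = 0"
  unfolding q_def conv_def
proof (rule sum.neutral, rule ballI)
  fix p assume c: "\<not> Poly_Mapping.keys c \<subseteq> {..<N}" and p: "p \<in> splits c"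
  then have "\<not> Poly_Mapping.keys (fst p) \<subseteq> {..<N} \<or> \<not> Poly_Mapping.keys (snd p) \<subseteq> {..<N}"
    by (auto simp: splits_def keys_add_nat)
  then show "mul (gam (fst p)) (gam (snd p)) = 0" using gam_outside mul_zero by metis
qed

lemma q_C2: "q c \<in> C2"
  unfolding q_def conv_def by (intro subspace_sum C2 mul_C1 gam_C1)

lemma gam_0 [simp]: "gam 0 = 0"
proof -
  have "{p \<in> splits 0. fst p \<noteq> 0 \<and> snd p \<noteq> 0} = {}" by (auto simp: splits_0)
  then show ?thesis by (subst gam.simps) (simp only: sum.empty cl_zero lin_zero [OF \<pi>(2)] lin_zero [OF h0(2)], simp)
qed

lemma q_low:
  assumes "mdeg c \<le> 1"
  shows "q c = 0"
  unfolding q_def conv_def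
proof (rule sum.neutral, rule ballI)
  fix p assume p: "p \<in> splits c"
  then have "mdeg (fst p) + mdeg (snd p) \<le> 1" using assms by (auto simp: splits_def mdeg_add)
  then have "mdeg (fst p) = 0 \<or> mdeg (snd p) = 0" by linarith
  then have "fst p = 0 \<or> snd p = 0" by (simp add: mdeg_eq_0_iff)
  then show "mul (gam (fst p)) (gam (snd p)) = 0" by auto
qed

lemma D_gam: "D (gam c) = - \<pi> (cl (q c))"
proof (cases "Poly_Mapping.keys c \<subseteq> {..<N} \<and> mdeg c \<noteq> 1")
  case True
  have "(\<Sum>p\<in>{p \<in> splits c. fst p \<noteq> 0 \<and> snd p \<noteq> 0}. mul (gam (fst p)) (gam (snd p))) = q c"
    unfolding q_def conv_def by (rule sum.mono_neutral_left) (auto simp: finite_splits)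
  then have "gam c = - h0 (\<pi> (cl (q c)))" using True by (subst gam.simps) simp
  moreover have "\<pi> (cl (q c)) \<in> D ` C1" using \<pi>(1) by (rule subsetD) simp
  ultimately show ?thesis using h0(3) by (simp only: D_minus)
next
  case False
  then have "q c = 0" using q_outside q_low by (cases "mdeg c = 1") auto
  moreover have "D (gam c) = 0"
  proof (cases "Poly_Mapping.keys c \<subseteq> {..<N}")
    case True
    then obtain l where l: "c = Poly_Mapping.single l 1" using False mdeg_1 by blast
    then have "l < N" using True by auto
    then show ?thesis using gam_single D_z l by simp
  qed (simp add: gam_outside)
  ultimately show ?thesis using lin_zero [OF \<pi>(2)] by simp
qed

definition Om :: "(nat \<Rightarrow>\<^sub>0 nat) \<Rightarrow> 'v" where "Om c = D (gam c) + q c"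

text \<open>The Bianchi identity. Differentiating the square gives the two products with
  \<open>D gam\<close>; completing these to \<open>Om\<close> adds two cubic terms, which cancel by
  associativity.\<close>

lemma D_Om: "D (Om c) = conv Om gam c - conv gam Om c"
proof -
  have 1: "D (Om c) = (\<Sum>p\<in>splits c. mul (D (gam (fst p))) (gam (snd p)) - mul (gam (fst p)) (D (gam (snd p))))"
    by (simp add: Om_def D_add D_D gam_C1 q_def conv_def D_sum D_mul)
  have "conv Om gam c = conv (\<lambda>c. D (gam c)) gam c + conv q gam c"
    "conv gam Om c = conv gam (\<lambda>c. D (gam c)) c + conv gam q c"
    unfolding Om_def [abs_def] by (rule conv_add_left, rule conv_add_right)
  moreover have "conv q gam c = conv gam q c" by (simp add: q_def conv_assoc)
  ultimately show ?thesis unfolding 1 by (simp add: conv_def sum_subtractf)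
qed

text \<open>Splits the defect into the obstruction, which is a cocycle modulo its projection to
  coboundaries, and a remainder that depends on \<open>Om\<close> only through
  \<open>D Om\<close>.\<close>

lemma Om_eq: "Om c = cl (q c) - \<pi> (cl (q c)) + g (D (Om c))"
proof -
  have "D (Om c) = D (q c)" by (simp add: Om_def D_add D_D gam_C1)
  then show ?thesis by (simp add: Om_def D_gam cl_def)
qed

text \<open>Induction on a bound for the degree of the support of \<open>la\<close>. Shifting by a
  nonzero exponent lowers the bound, and only such shifts enter the Bianchi products because
  \<open>gam 0\<close> is zero; so \<open>la\<close> kills \<open>D Om\<close> and with it the
  remainder in \<open>Om_eq\<close>. By \<open>obs\<close> the pairing with the obstruction is a
  coboundary, hence fixed by \<open>\<pi>\<close>, and the other two terms cancel.\<close>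

lemma Om_functional:
  assumes shift: "\<And>la b. la \<in> \<Lambda> \<Longrightarrow> (\<lambda>c. la (c + b)) \<in> \<Lambda>"
    and supp: "\<And>la c. la \<in> \<Lambda> \<Longrightarrow> la c \<noteq> 0 \<Longrightarrow> c \<in> expo N m"
    and obs: "\<And>la. la \<in> \<Lambda> \<Longrightarrow> (\<Sum>c\<in>expo N m. sc (la c) (cl (q c))) \<in> D ` C1"
    and "la \<in> \<Lambda>"
  shows "(\<Sum>c\<in>expo N m. sc (la c) (Om c)) = 0"
proof -
  have "(\<Sum>c\<in>expo N m. sc (la c) (Om c)) = 0" if "la \<in> \<Lambda>" "\<And>c. la c \<noteq> 0 \<Longrightarrow> mdeg c < n" for n la
    using that
  proof (induction n arbitrary: la)
    case 0
    then show ?case by (intro sum.neutral) (metis less_nat_zero_code scale_zero_left)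
  next
    case (Suc n)
    have sh: "(\<Sum>a\<in>expo N m. sc (la (a + b)) (Om a)) = 0" if "b \<noteq> 0" for b
    proof (rule Suc.IH)
      show "(\<lambda>a. la (a + b)) \<in> \<Lambda>" using shift Suc.prems(1) .
      fix a assume "la (a + b) \<noteq> 0"
      then have "mdeg a + mdeg b < Suc n" using Suc.prems(2) by (simp add: mdeg_add [symmetric])
      moreover have "mdeg b \<noteq> 0" using that by (simp add: mdeg_eq_0_iff)
      ultimately show "mdeg a < n" by simp
    qed
    have l: "(\<Sum>c\<in>expo N m. sc (la c) (conv Om gam c)) = 0"
    proof -
      have "(\<Sum>c\<in>expo N m. sc (la c) (conv Om gam c)) = (\<Sum>b\<in>expo N m. mul (\<Sum>a\<in>expo N m. sc (la (a + b)) (Om a)) (gam b))"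
        by (subst sum_expo_conv [OF supp [OF Suc.prems(1)]], assumption, subst sum.swap)
          (simp add: mul_sum_left mul_scale_left)
      also have "\<dots> = 0" by (intro sum.neutral ballI) (metis sh gam_0 mul_zero)
      finally show ?thesis .
    qed
    have r: "(\<Sum>c\<in>expo N m. sc (la c) (conv gam Om c)) = 0"
    proof -
      have "(\<Sum>c\<in>expo N m. sc (la c) (conv gam Om c)) = (\<Sum>b\<in>expo N m. mul (gam b) (\<Sum>a\<in>expo N m. sc (la (a + b)) (Om a)))"
        by (subst sum_expo_conv [OF supp [OF Suc.prems(1)]], assumption)
          (simp add: mul_sum_right mul_scale_right add.commute)
      also have "\<dots> = 0" by (intro sum.neutral ballI) (metis sh gam_0 mul_zero)
      finally show ?thesis .
    qed
    have "(\<Sum>c\<in>expo N m. sc (la c) (D (Om c))) = 0"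
      using l r by (simp add: D_Om scale_right_diff_distrib sum_subtractf)
    then have "g (\<Sum>c\<in>expo N m. sc (la c) (D (Om c))) = 0" using lin_zero [OF g(2)] by simp
    then have gz: "(\<Sum>c\<in>expo N m. sc (la c) (g (D (Om c)))) = 0" by (simp only: lin_sum [OF g(2)])
    have "\<pi> (\<Sum>c\<in>expo N m. sc (la c) (cl (q c))) = (\<Sum>c\<in>expo N m. sc (la c) (cl (q c)))"
      using \<pi>(3) obs [OF Suc.prems(1)] by blast
    then have "(\<Sum>c\<in>expo N m. sc (la c) (cl (q c))) - (\<Sum>c\<in>expo N m. sc (la c) (\<pi> (cl (q c)))) = 0"
      by (simp only: lin_sum [OF \<pi>(2)] diff_self)
    moreover have "(\<Sum>c\<in>expo N m. sc (la c) (Om c)) = (\<Sum>c\<in>expo N m. sc (la c) (cl (q c)))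
        - (\<Sum>c\<in>expo N m. sc (la c) (\<pi> (cl (q c)))) + (\<Sum>c\<in>expo N m. sc (la c) (g (D (Om c))))"
      by (subst Om_eq) (simp only: scale_right_distrib scale_right_diff_distrib sum.distrib sum_subtractf)
    ultimately show ?case using gz by simp
  qed
  from this [of la "Suc m"] show ?thesis using assms(4) supp by (force simp: expo_def)
qed

end

context mc_algebra
begin

text \<open>The order of quantifiers matters: \<open>gam\<close> and \<open>cq\<close> are fixed
  before \<open>m\<close> and the family of functionals, so one power series serves all
  truncations.\<close>

lemma mc_solution:
  obtains gam cq where "gam 0 = 0" "\<And>l. l < N \<Longrightarrow> gam (Poly_Mapping.single l 1) = z l"
    "\<And>c. \<not> Poly_Mapping.keys c \<subseteq> {..<N} \<Longrightarrow> gam c = 0" "\<And>c. gam c \<in> C1"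
    "\<And>c. cq c \<in> C2" "\<And>c. D (cq c) = 0" "\<And>c. \<not> (Poly_Mapping.keys c \<subseteq> {..<N} \<and> mdeg c \<ge> 2) \<Longrightarrow> cq c = 0"
    "\<And>\<Lambda> m la. (\<And>la b. la \<in> \<Lambda> \<Longrightarrow> (\<lambda>c. la (c + b)) \<in> \<Lambda>) \<Longrightarrow> (\<And>la c. la \<in> \<Lambda> \<Longrightarrow> la c \<noteq> 0 \<Longrightarrow> c \<in> expo N m) \<Longrightarrow>
      (\<And>la. la \<in> \<Lambda> \<Longrightarrow> (\<Sum>c\<in>expo N m. sc (la c) (cq c)) \<in> D ` C1) \<Longrightarrow> la \<in> \<Lambda> \<Longrightarrow>
      (\<Sum>c\<in>expo N m. sc (la c) (D (gam c) + conv gam gam c)) = 0"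
proof -
  interpret vector_space_pair sc sc ..
  have lid: "Vector_Spaces.linear sc sc (\<lambda>x. x)"
    unfolding Vector_Spaces.linear_iff using vector_space_axioms by auto
  obtain g where g: "range g \<subseteq> C2" "Vector_Spaces.linear sc sc g" "\<forall>v\<in>D ` C2. D (g v) = v"
    using linear_exists_right_inverse_on [OF lin_D C2] by blast
  obtain h0 where h0: "range h0 \<subseteq> C1" "Vector_Spaces.linear sc sc h0" "\<forall>v\<in>D ` C1. D (h0 v) = v"
    using linear_exists_right_inverse_on [OF lin_D C1] by blast
  have "subspace (D ` C1)" using linear_subspace_image [OF lin_D C1] .
  \<comment> \<open>A right inverse of the identity map on the subspace of coboundaries, with values
    in it, is a linear projection onto it.\<close>
  then obtain \<pi> where \<pi>: "range \<pi> \<subseteq> D ` C1" "Vector_Spaces.linear sc sc \<pi>" "\<forall>v\<in>D ` C1. \<pi> v = v"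
    using linear_exists_right_inverse_on [OF lid, of "D ` C1"] that by (simp only: image_ident) blast
  interpret mc_splitting sc D mul C1 C2 N z h0 g \<pi>
    by (rule mc_splitting.intro [OF mc_algebra_axioms mc_splitting_axioms.intro]) (fact g h0 \<pi>)+
  show ?thesis
  proof (rule that [of gam "\<lambda>c. cl (q c)"])
    show "cl (q c) = 0" if "\<not> (Poly_Mapping.keys c \<subseteq> {..<N} \<and> mdeg c \<ge> 2)" for c
      using that q_outside q_low [of c] by (metis cl_zero not_less_eq_eq numeral_2_eq_2 One_nat_def)
    show "(\<Sum>c\<in>expo N m. sc (la c) (D (gam c) + conv gam gam c)) = 0"
      if "\<And>la b. la \<in> \<Lambda> \<Longrightarrow> (\<lambda>c. la (c + b)) \<in> \<Lambda>" "\<And>la c. la \<in> \<Lambda> \<Longrightarrow> la c \<noteq> 0 \<Longrightarrow> c \<in> expo N m"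
        "\<And>la. la \<in> \<Lambda> \<Longrightarrow> (\<Sum>c\<in>expo N m. sc (la c) (cl (q c))) \<in> D ` C1" "la \<in> \<Lambda>" for \<Lambda> m la
    proof -
      have "(\<Sum>c\<in>expo N m. sc (la c) (Om c)) = 0"
        by (rule Om_functional [of \<Lambda> m la]) (fact that)+
      then show ?thesis by (simp only: Om_def q_def)
    qed
  qed (use gam_0 gam_single gam_outside gam_C1 cl_C2 q_C2 D_cl in \<open>simp_all add: q_def\<close>)
qed

end

text \<open>A basis of \<open>W\<close> stays independent after adding \<open>y\<close>, so the
  values 0 on the basis and 1 at \<open>y\<close> can be prescribed and extended linearly.\<close>

lemma (in vector_space) separating_functional:
  assumes "subspace W" "y \<notin> W"
  obtains \<psi> where "\<And>x x'. \<psi> (x + x') = \<psi> x + \<psi> x'" "\<And>a x. \<psi> (scale a x) = a * \<psi> x"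
    "\<And>w. w \<in> W \<Longrightarrow> \<psi> w = (0 :: 'a)" "\<psi> y = 1"
proof -
  interpret f: vector_space "(*) :: 'a \<Rightarrow> 'a \<Rightarrow> 'a"
    by unfold_locales (auto simp: algebra_simps)
  interpret vector_space_pair scale "(*) :: 'a \<Rightarrow> 'a \<Rightarrow> 'a" ..
  obtain B where B: "B \<subseteq> W" "independent B" "W \<subseteq> span B"
    using maximal_independent_subset [of W] by metis
  have "span B \<subseteq> W" using B(1) assms(1) by (rule span_minimal)
  then have y: "y \<notin> span B" using assms(2) by blast
  then have "independent (insert y B)" using B(2) by (simp add: independent_insertI)
  then obtain \<psi> where \<psi>: "Vector_Spaces.linear scale (*) \<psi>" "\<forall>x\<in>insert y B. \<psi> x = (if x = y then 1 else 0)"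
    using linear_independent_extend [of "insert y B" "\<lambda>x. if x = y then 1 else 0"] by metis
  have lin: "\<psi> (x + x') = \<psi> x + \<psi> x'" "\<psi> (scale a x) = a * \<psi> x" for a x x'
    using \<psi>(1) unfolding Vector_Spaces.linear_iff by auto
  have "\<psi> w = 0" if "w \<in> W" for w
  proof -
    have "w \<in> span B" using that B(3) by blast
    then show ?thesis
    proof (induction rule: span_induct_alt)
      case base
      then show ?case using lin(2) [of 0 0] by simp
    next
      case (step c x w)
      have "x \<noteq> y" using step(1) y span_base by blast
      then have "\<psi> x = 0" using \<psi>(2) step(1) by simp
      then show ?case using step(2) by (simp only: lin mult_zero_right add_0)
    qed
  qed
  then show ?thesis using that [of \<psi>] lin \<psi>(2) by simp
qed

section \<open>Connections over infinitesimal neighbourhoods\<close>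

text \<open>The map on finitely supported functions acts on nonzero values only; the condition at 0
  makes it coefficientwise everywhere.\<close>

lemma lookup_map0: "f 0 = 0 \<Longrightarrow> Poly_Mapping.lookup (Poly_Mapping.map f P) c = f (Poly_Mapping.lookup P c)"
  by (auto simp: Poly_Mapping.map.rep_eq when_def)

lemma map_zero [simp]: "Poly_Mapping.map f 0 = 0"
  by (rule poly_mapping_eqI) (simp add: Poly_Mapping.map.rep_eq)

lemma map0_add:
  assumes "f 0 = 0" "\<And>a b. f (a + b) = f a + f b"
  shows "Poly_Mapping.map f (P + Q) = Poly_Mapping.map f P + Poly_Mapping.map f Q"
  by (rule poly_mapping_eqI) (simp add: lookup_map0 lookup_add assms)

lemma map0_sum:
  assumes "f 0 = 0" "\<And>a b. f (a + b) = f a + f b"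
  shows "Poly_Mapping.map f (\<Sum>i\<in>A. P i) = (\<Sum>i\<in>A. Poly_Mapping.map f (P i))"
  by (rule poly_mapping_eqI) (simp add: lookup_map0 lookup_sum assms sum_comp_morphism [of f, unfolded comp_def, symmetric])

lemma mpoly_mult_induct:
  fixes P Q :: "'a::comm_ring_1 mpoly"
  assumes add: "\<And>P P' Q. R P Q \<Longrightarrow> R P' Q \<Longrightarrow> R (P + P') Q" "\<And>P Q Q'. R P Q \<Longrightarrow> R P Q' \<Longrightarrow> R P (Q + Q')"
    and zero: "\<And>Q. R 0 Q" "\<And>P. R P 0"
    and single: "\<And>a b x y. R (Poly_Mapping.single a x) (Poly_Mapping.single b y)"
  shows "R P Q"
proof -
  have 1: "R (Poly_Mapping.single a x) (\<Sum>c\<in>A. Poly_Mapping.single c (f c))" for a x A f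
    by (induction A rule: infinite_finite_induct) (auto intro: assms)
  have "R (\<Sum>c\<in>A. Poly_Mapping.single c (g c)) (\<Sum>c\<in>B. Poly_Mapping.single c (f c))" for A g B f
    by (induction A rule: infinite_finite_induct) (auto intro: assms 1)
  from this [of "Poly_Mapping.lookup P" "Poly_Mapping.keys P" "Poly_Mapping.lookup Q" "Poly_Mapping.keys Q"]
  show ?thesis by (simp only: poly_mapping_sum_single)
qed

lemma map_leibniz:
  fixes v :: "'f::comm_ring_1 \<Rightarrow> 'f" and P Q :: "'f mpoly"
  assumes "\<And>a b. v (a + b) = v a + v b" "\<And>a b. v (a * b) = a * v b + v a * b"
  shows "Poly_Mapping.map v (P * Q) = P * Poly_Mapping.map v Q + Poly_Mapping.map v P * Q"
proof -
  have [simp]: "v 0 = 0" using assms(1) [of 0 0] by simp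
  show ?thesis
    by (rule mpoly_mult_induct [where P = P and Q = Q and R = "\<lambda>P Q. Poly_Mapping.map v (P * Q) = P * Poly_Mapping.map v Q + Poly_Mapping.map v P * Q"])
      (simp_all add: map0_add assms algebra_simps mult_single single_add)
qed

locale thickening = covered_bundle X D r E nab I U
  for X :: "('k::field, 'f::field) pvariety" and D r E nab and I :: "'i set" and U +
  fixes J :: "'k mpoly set" and N m :: nat
  assumes J_add: "P \<in> J \<Longrightarrow> Q \<in> J \<Longrightarrow> P + Q \<in> J"
    and J_mult: "P \<in> J \<Longrightarrow> Poly_Mapping.single b a * P \<in> J"
    and J_outside: "c \<notin> expo N m \<Longrightarrow> Poly_Mapping.single c a \<in> J"
begin

abbreviation "S' \<equiv> log_space_times X D J"
abbreviation "nl \<equiv> nul S'"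
abbreviation "em \<equiv> Poly_Mapping.map (emb X)"

lemma S'_simps [simp]: "pts S' = points X" "opens S' = Collect (zopen X)" "ders S' = derivations (emb X)"
    "lift S' = Poly_Mapping.map" "base S' = range em"
    "stalk S' p = {P. \<forall>c. Poly_Mapping.lookup P c \<in> local_ring X p}"
    "logeq S' p = Poly_Mapping.single 0 ` logeq S p"
  by (simp_all add: log_space_times_def)

lemma J_0: "0 \<in> J"
proof -
  \<comment> \<open>The power \<open>m + 1\<close> of the variable number 0 lies outside
    \<open>expo N m\<close>; taken with coefficient 0 it shows that \<open>J\<close> contains
    0.\<close>
  have "Poly_Mapping.single 0 (Suc m) \<notin> expo N m" by (simp add: expo_def mdeg_def)
  from J_outside [OF this, of 0] show ?thesis by simp
qed

lemma nl_def: "nl = {\<Sum>j\<in>T. h j * em j | T h. finite T \<and> T \<subseteq> J}"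
  by (simp add: log_space_times_def)

lemma nlI: "P \<in> J \<Longrightarrow> h * em P \<in> nl"
  unfolding nl_def mem_Collect_eq by (intro exI [of _ "{P}"] exI [of _ "\<lambda>_. h"]) simp

lemma nl_0: "0 \<in> nl"
  unfolding nl_def mem_Collect_eq by (intro exI [of _ "{}"]) simp

lemma nl_add: "x \<in> nl \<Longrightarrow> y \<in> nl \<Longrightarrow> x + y \<in> nl"
proof -
  assume "x \<in> nl" "y \<in> nl"
  then obtain T h T' h' where *: "x = (\<Sum>j\<in>T. h j * em j)" "finite T" "T \<subseteq> J" "y = (\<Sum>j\<in>T'. h' j * em j)" "finite T'" "T' \<subseteq> J"
    unfolding nl_def by blast
  have "x = (\<Sum>j\<in>T \<union> T'. (if j \<in> T then h j else 0) * em j)"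
    unfolding *(1) using * by (intro sum.mono_neutral_cong_left) auto
  moreover have "y = (\<Sum>j\<in>T \<union> T'. (if j \<in> T' then h' j else 0) * em j)"
    unfolding *(4) using * by (intro sum.mono_neutral_cong_left) auto
  ultimately have "x + y = (\<Sum>j\<in>T \<union> T'. ((if j \<in> T then h j else 0) + (if j \<in> T' then h' j else 0)) * em j)"
    by (simp only: sum.distrib distrib_right)
  then show ?thesis unfolding nl_def mem_Collect_eq
    by (intro exI [of _ "T \<union> T'"] exI conjI) (use * in auto)
qed

lemma nl_mult: "x \<in> nl \<Longrightarrow> h * x \<in> nl"
proof -
  assume "x \<in> nl"
  then obtain T g where *: "x = (\<Sum>j\<in>T. g j * em j)" "finite T" "T \<subseteq> J"
    unfolding nl_def by blast
  have "h * x = (\<Sum>j\<in>T. (h * g j) * em j)" by (simp add: *(1) sum_distrib_left mult.assoc)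
  then show ?thesis unfolding nl_def mem_Collect_eq
    by (intro exI [of _ T] exI conjI) (use * in auto)
qed

lemma nl_mult_right: "x \<in> nl \<Longrightarrow> x * h \<in> nl"
  using nl_mult [of x h] by (simp add: mult.commute)

lemma nl_minus: "x \<in> nl \<Longrightarrow> - x \<in> nl"
  using nl_mult [of x "- 1"] by simp

lemma nl_diff: "x \<in> nl \<Longrightarrow> y \<in> nl \<Longrightarrow> x - y \<in> nl"
  using nl_add [of x "- y"] nl_minus by simp

lemma nl_sum: "(\<And>i. i \<in> A \<Longrightarrow> x i \<in> nl) \<Longrightarrow> (\<Sum>i\<in>A. x i) \<in> nl"
  by (induction A rule: infinite_finite_induct) (auto intro: nl_add nl_0)

lemma nl_outside: "c \<notin> expo N m \<Longrightarrow> Poly_Mapping.single c a \<in> nl"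
  using nlI [OF J_outside [of c 1], of "Poly_Mapping.single 0 a"] by (simp add: mult_single h_one)

text \<open>Derivations of the function field kill \<open>k\<close>, so they act only on the
  coefficients in front of the generators from \<open>J\<close>, and the extended ideal is stable
  under them.\<close>

lemma nl_map:
  assumes "v \<in> derivations (emb X)" "x \<in> nl"
  shows "Poly_Mapping.map v x \<in> nl"
proof -
  have v: "v (a + b) = v a + v b" "v (a * b) = a * v b + v a * b" "v (emb X c) = 0" for a b c
    using assms(1) by (auto simp: derivations_def)
  have v0: "v 0 = 0" using derivation_zero [OF assms(1)] .
  have "Poly_Mapping.map v (em P) = 0" for P :: "'k mpoly"
    by (rule poly_mapping_eqI) (simp add: lookup_map0 v0 v)
  then have *: "Poly_Mapping.map v (h * em P) = Poly_Mapping.map v h * em P"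
    for h and P :: "'k mpoly"
    by (subst map_leibniz) (simp_all only: v mult_zero_right add_0)
  obtain T g where T: "x = (\<Sum>j\<in>T. g j * em j)" "finite T" "T \<subseteq> J"
    using assms(2) unfolding nl_def by blast
  have "Poly_Mapping.map v x = (\<Sum>j\<in>T. Poly_Mapping.map v (g j) * em j)"
    unfolding T(1) by (subst map0_sum) (simp_all only: v0 v(1) *)
  then show ?thesis using T(3) by (auto intro!: nl_sum nlI)
qed

sublocale th: space_calculus S'
proof
  fix v w a b assume "v \<in> ders S'" "w \<in> ders S'"
  then have v: "v \<in> derivations (emb X)" "w \<in> derivations (emb X)" by simp_all
  have vz: "u 0 = 0" "u (x + y) = u x + u y" "u (x * y) = x * u y + u x * y" "u (x - y) = u x - u y"
    if "u \<in> derivations (emb X)" for u x y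
    using derivation_zero [OF that] derivation_diff [OF that] that by (simp_all add: derivations_def)
  show "lift S' v (a + b) = lift S' v a + lift S' v b"
    by (simp add: map0_add vz v)
  show "lift S' v (a * b) = a * lift S' v b + lift S' v a * b"
    by (simp add: map_leibniz vz v)
  show "brk v w \<in> ders S'" using derivation_brk v by simp
  have "brk v w 0 = 0" using derivation_brk v vz(1) by blast
  then show "lift S' (brk v w) a = lift S' v (lift S' w a) - lift S' w (lift S' v a)"
    by (intro poly_mapping_eqI) (simp add: lookup_map0 vz v lookup_minus, simp add: brk_def)
  show "v (x - y) = v x - v y" for x y using vz v by blast
qed

lemma map_emb_deriv: "v \<in> derivations (emb X) \<Longrightarrow> Poly_Mapping.map v (em P) = 0"
  by (rule poly_mapping_eqI) (simp add: lookup_map0 derivation_zero, simp add: derivations_def)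

text \<open>The form \<open>w\<close> times the monomial with exponent \<open>c\<close>.\<close>

definition sf :: "(nat \<Rightarrow>\<^sub>0 nat) \<Rightarrow> ('f, 'f) dform \<Rightarrow> ('f, 'f mpoly) dform" where
  "sf c w = (\<lambda>vs. Poly_Mapping.single c (w vs))"

lemma sf_add: "sf c (a + b) = sf c a + sf c b"
  by (simp add: sf_def fun_eq_iff single_add)

lemma iota_sf: "iota v (sf c w) = sf c (iota v w)"
  by (simp add: sf_def iota_def)

lemma sgn_single: "(- 1) ^ n * Poly_Mapping.single c a = Poly_Mapping.single c ((- 1) ^ n * (a :: 'f))"
  by (cases "even n") (simp_all add: single_uminus)

lemma eps_sf: "eps (sf c w) = sf c (eps w)"
  by (simp add: sf_def eps_def sgn_single)

lemma wedge_sf: "wedge (sf a x) (sf b y) = sf (a + b) (wedge x y)"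
proof
  show "wedge (sf a x) (sf b y) vs = sf (a + b) (wedge x y) vs" for vs
    by (induction vs arbitrary: x y)
      (simp_all add: wedge_Cons iota_sf eps_sf, simp_all add: sf_def mult_single single_add wedge_Cons)
qed

lemma ext_d_sf: "ext_d S' (sf c w) = sf c (d w)"
proof
  fix vs
  have "cartan Poly_Mapping.map (sf c w) vs = Poly_Mapping.single c (cartan (\<lambda>v. v) w vs)" if "set vs \<subseteq> derivations (emb X)"
    using that
  proof (induction vs arbitrary: w)
    case (Cons v vs)
    then have "v 0 = 0" using derivation_zero [of v "emb X"] by simp
    then have "lie Poly_Mapping.map v (sf c w) vs = Poly_Mapping.single c (lie (\<lambda>v. v) v w vs)"
      by (simp add: lie_def sf_def single_diff)
        (rule poly_mapping_eqI, simp add: lookup_sum lookup_single when_def)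
    with Cons show ?case by (simp add: cartan_Cons iota_sf single_diff)
  qed simp
  then show "ext_d S' (sf c w) vs = sf c (d w) vs" by (auto simp: ext_d_def sf_def)
qed

lemma pure_sf: "pure V q w \<Longrightarrow> pure V q (sf c w)"
  unfolding pure_def sf_def by (metis single_zero)

lemma log_form_sf: "log_form S p q w \<Longrightarrow> log_form S' p q (sf 0 w)"
proof (induction rule: log_form.induct)
  case (1 f)
  then have "log_form S' p 0 (fn_form (Poly_Mapping.single 0 f))"
    by (intro log_form.intros) (auto simp: lookup_single when_def local_ring_0)
  moreover have "fn_form (Poly_Mapping.single 0 f) = sf 0 (fn_form f)"
    by (auto simp: fn_form_def sf_def)
  ultimately show ?case by simp
next
  case (2 q a b)
  then show ?case unfolding sf_add by (intro log_form.intros(2))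
next
  case (3 f q a)
  have "fn_form (Poly_Mapping.single 0 f) = sf 0 (fn_form f)"
    by (auto simp: fn_form_def sf_def)
  then have "wedge (ext_d S' (fn_form (Poly_Mapping.single 0 f))) (sf 0 a) = sf 0 (wedge (d (fn_form f)) a)"
    by (simp add: ext_d_sf wedge_sf)
  moreover have "Poly_Mapping.single 0 f \<in> stalk S' p"
    using 3(1) by (auto simp: lookup_single when_def local_ring_0)
  ultimately show ?case using log_form.intros(3) [OF _ 3(3)] by metis
next
  case (4 z w q a)
  have z: "fn_form (Poly_Mapping.single 0 z) = sf 0 (fn_form z)"
    by (auto simp: fn_form_def sf_def)
  have "log_form S' p (Suc q) (wedge (sf 0 w) (sf 0 a))"
  proof (rule log_form.intros(4) [OF _ _ 4(4)])
    show "Poly_Mapping.single 0 z \<in> logeq S' p" using 4(1) unfolding S'_simps by (rule imageI)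
    show "\<forall>vs. Poly_Mapping.single 0 z * sf 0 w vs = ext_d S' (fn_form (Poly_Mapping.single 0 z)) vs"
      using 4(2) unfolding z ext_d_sf by (simp add: sf_def mult_single)
  qed
  then show ?case by (simp add: wedge_sf)
qed

text \<open>The power series with coefficients \<open>y\<close>, truncated to the monomials that
  survive modulo \<open>(t)^(m+1)\<close>.\<close>

definition ps :: "((nat \<Rightarrow>\<^sub>0 nat) \<Rightarrow> 'f) \<Rightarrow> 'f mpoly" where
  "ps y = (\<Sum>c\<in>expo N m. Poly_Mapping.single c (y c))"

lemma ps_add: "ps (\<lambda>c. x c + y c) = ps x + ps y"
  and ps_diff: "ps (\<lambda>c. x c - y c) = ps x - ps y"
  and ps_minus: "ps (\<lambda>c. - y c) = - ps y"
  and ps_zero [simp]: "ps (\<lambda>c. 0) = 0"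
  by (simp_all add: ps_def single_add single_diff single_uminus sum.distrib sum_subtractf sum_negf)

lemma ps_sum: "ps (\<lambda>c. \<Sum>i\<in>A. y i c) = (\<Sum>i\<in>A. ps (y i))"
  by (induction A rule: infinite_finite_induct) (simp_all add: ps_add)

lemma ps_scale: "ps (\<lambda>c. a * y c) = Poly_Mapping.single 0 a * ps y"
  by (simp add: ps_def sum_distrib_left mult_single)

lemma map_ps: "v \<in> derivations (emb X) \<Longrightarrow> Poly_Mapping.map v (ps y) = ps (\<lambda>c. v (y c))"
  unfolding ps_def using derivation_zero by (subst map0_sum) (auto simp: derivations_def)

text \<open>The two expressions differ by products of surviving monomials whose exponents leave
  \<open>expo N m\<close>, and these lie in the ideal.\<close>

lemma ps_convolution:
  "(\<Sum>a\<in>expo N m. \<Sum>b\<in>expo N m. Poly_Mapping.single (a + b) (F a b))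
    - ps (\<lambda>c. \<Sum>p\<in>splits c. F (fst p) (snd p)) \<in> nl"
proof -
  let ?C = "expo N m"
  let ?g = "\<lambda>p. Poly_Mapping.single (fst p + snd p) (F (fst p) (snd p))"
  let ?L = "\<Sum>a\<in>?C. \<Sum>b\<in>?C. Poly_Mapping.single (a + b) (F a b)"
  have "?L = (\<Sum>p\<in>?C \<times> ?C. ?g p)"
    by (simp add: sum.cartesian_product split_def)
  also have "\<dots> = (\<Sum>p\<in>?C \<times> ?C \<inter> {p. fst p + snd p \<in> ?C}. ?g p) + (\<Sum>p\<in>?C \<times> ?C - {p. fst p + snd p \<in> ?C}. ?g p)"
    by (rule sum.Int_Diff) (simp add: finite_expo)
  also have "(\<Sum>p\<in>?C \<times> ?C \<inter> {p. fst p + snd p \<in> ?C}. ?g p) = (\<Sum>(c, p)\<in>Sigma ?C splits. ?g p)"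
    by (rule sum.reindex_bij_witness [where i = snd and j = "\<lambda>p. (fst p + snd p, p)"])
      (auto simp: splits_def dest: expo_add)
  also have "\<dots> = ps (\<lambda>c. \<Sum>p\<in>splits c. F (fst p) (snd p))"
    unfolding sum.Sigma [OF finite_expo ballI [OF finite_splits], symmetric] ps_def
  proof (intro sum.cong refl)
    fix c
    have "(\<Sum>p\<in>splits c. ?g p) = (\<Sum>p\<in>splits c. Poly_Mapping.single c (F (fst p) (snd p)))"
      by (intro sum.cong) (auto simp: splits_def)
    also have "\<dots> = Poly_Mapping.single c (\<Sum>p\<in>splits c. F (fst p) (snd p))"
      by (rule poly_mapping_eqI) (simp add: lookup_sum lookup_single when_def)
    finally show "(\<Sum>p\<in>splits c. ?g p) = Poly_Mapping.single c (\<Sum>p\<in>splits c. F (fst p) (snd p))" .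
  qed
  finally have "?L - ps (\<lambda>c. \<Sum>p\<in>splits c. F (fst p) (snd p)) = (\<Sum>p\<in>?C \<times> ?C - {p. fst p + snd p \<in> ?C}. ?g p)"
    by simp
  also have "\<dots> \<in> nl" by (intro nl_sum nl_outside) auto
  finally show ?thesis .
qed

lemma ps_mult: "ps x * ps y - ps (\<lambda>c. \<Sum>p\<in>splits c. x (fst p) * y (snd p)) \<in> nl"
  using ps_convolution [of "\<lambda>a b. x a * y b"] by (simp add: ps_def sum_product mult_single)

text \<open>
  A functional on \<open>k[t]\<close> that vanishes on \<open>J\<close> is recorded by its values on the monomials. These
  functionals detect membership in \<open>J \<otimes> K\<close>, \<open>K\<close> the function field.
\<close>

definition annih :: "((nat \<Rightarrow>\<^sub>0 nat) \<Rightarrow> 'k) set" where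
  "annih = {\<lambda>c. \<psi> (Poly_Mapping.single c 1) | \<psi>.
     (\<forall>P Q. \<psi> (P + Q) = \<psi> P + \<psi> Q) \<and> (\<forall>a P. \<psi> (Poly_Mapping.single 0 a * P) = a * \<psi> P) \<and> (\<forall>P\<in>J. \<psi> P = 0)}"

text \<open>The transpose of multiplication by a monomial; it preserves the annihilator because
  \<open>J\<close> is an ideal.\<close>

lemma annih_shift: "la \<in> annih \<Longrightarrow> (\<lambda>c. la (c + b)) \<in> annih"
proof -
  assume "la \<in> annih"
  then obtain \<psi> where \<psi>: "la = (\<lambda>c. \<psi> (Poly_Mapping.single c 1))" "\<And>P Q. \<psi> (P + Q) = \<psi> P + \<psi> Q"
    "\<And>a P. \<psi> (Poly_Mapping.single 0 a * P) = a * \<psi> P" "\<And>P. P \<in> J \<Longrightarrow> \<psi> P = 0"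
    unfolding annih_def by blast
  have "(\<lambda>c. la (c + b)) = (\<lambda>c. \<psi> (Poly_Mapping.single b 1 * Poly_Mapping.single c 1))"
    by (simp add: \<psi>(1) mult_single add.commute)
  then show ?thesis unfolding annih_def mem_Collect_eq
    by (intro exI [of _ "\<lambda>P. \<psi> (Poly_Mapping.single b 1 * P)"])
      (simp add: distrib_left \<psi>(2,4) J_mult \<psi>(3) mult.left_commute [of _ "Poly_Mapping.single 0 _"])
qed

lemma annih_supp: "la \<in> annih \<Longrightarrow> la c \<noteq> 0 \<Longrightarrow> c \<in> expo N m"
  using J_outside unfolding annih_def by blast

lemma functional_expo:
  assumes "\<And>P Q. \<psi> (P + Q) = \<psi> P + \<psi> Q" "\<And>a P. \<psi> (Poly_Mapping.single 0 a * P) = a * (\<psi> P :: 'k)"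
  shows "\<psi> (\<Sum>c\<in>A. Poly_Mapping.single c (a c)) = (\<Sum>c\<in>A. a c * \<psi> (Poly_Mapping.single c 1))"
proof -
  have "\<psi> 0 = 0" using assms(2) [of 0 0] by simp
  moreover have "\<psi> (Poly_Mapping.single c x) = x * \<psi> (Poly_Mapping.single c 1)" for c x
    using assms(2) [of x "Poly_Mapping.single c 1"] by (simp add: mult_single)
  ultimately have z: "\<psi> 0 = 0" and m: "\<And>c x. \<psi> (Poly_Mapping.single c x) = x * \<psi> (Poly_Mapping.single c 1)" .
  show ?thesis
    by (induction A rule: infinite_finite_induct)
      (simp_all only: sum.infinite sum.empty sum.insert not_False_eq_True z assms(1) m [of _ "a _"])
qed

text \<open>The functionals are \<open>k\<close>-valued but the coefficients lie in the function
  field. Expanding the finitely many coefficients in a basis \<open>B\<close> of their span over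
  \<open>k\<close> writes the series as a sum of elements \<open>b\<close> times polynomials
  \<open>qq b\<close> over \<open>k\<close>. Independence of \<open>B\<close> passes the hypothesis
  on to each \<open>qq b\<close>, and if some \<open>qq b\<close> were outside \<open>J\<close>, a
  separating functional would contradict it.\<close>

lemma ps_nl:
  assumes "\<And>la. la \<in> annih \<Longrightarrow> (\<Sum>c\<in>expo N m. emb X (la c) * y c) = 0"
  shows "ps y \<in> nl"
proof -
  interpret K: vector_space "\<lambda>a x. emb X a * x"
    by unfold_locales (simp_all add: h_add h_mult h_one algebra_simps)
  interpret P: vector_space "\<lambda>a P. Poly_Mapping.single 0 a * (P :: 'k mpoly)"
    by unfold_locales (simp_all add: algebra_simps single_add mult_single flip: mult.assoc)
  have J: "P.subspace J"
    unfolding P.subspace_def using J_0 J_add J_mult [of _ 0] by simp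
  obtain B where B: "B \<subseteq> y ` expo N m" "K.independent B" "y ` expo N m \<subseteq> K.span B"
    using K.maximal_independent_subset [of "y ` expo N m"] by metis
  have fB: "finite B" using B(1) finite_expo finite_subset by blast
  define rp where "rp c b = K.representation B (y c) b" for c b
  have rp: "y c = (\<Sum>b\<in>B. emb X (rp c b) * b)" if "c \<in> expo N m" for c
    using K.sum_representation_eq [OF B(2) _ fB subset_refl, of "y c"] B(3) that by (auto simp: rp_def)
  define qq where "qq b = (\<Sum>c\<in>expo N m. Poly_Mapping.single c (rp c b))" for b
  have "qq b \<in> J" if "b \<in> B" for b
  proof (rule ccontr)
    assume "qq b \<notin> J"
    then obtain \<psi> where \<psi>: "\<And>P Q. \<psi> (P + Q) = \<psi> P + \<psi> Q" "\<And>a P. \<psi> (Poly_Mapping.single 0 a * P) = a * \<psi> P"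
      "\<And>P. P \<in> J \<Longrightarrow> \<psi> P = 0" "\<psi> (qq b) = 1"
      by (rule P.separating_functional [OF J]) (rule that; assumption)
    define la where "la c = \<psi> (Poly_Mapping.single c 1)" for c
    have "la \<in> annih" unfolding annih_def la_def [abs_def] mem_Collect_eq
      by (rule exI [of _ \<psi>]) (simp add: \<psi>(1-3))
    then have "0 = (\<Sum>c\<in>expo N m. emb X (la c) * y c)" using assms by simp
    also have "\<dots> = (\<Sum>c\<in>expo N m. \<Sum>b\<in>B. emb X (la c * rp c b) * b)"
    proof (intro sum.cong refl)
      fix c assume "c \<in> expo N m"
      then show "emb X (la c) * y c = (\<Sum>b\<in>B. emb X (la c * rp c b) * b)"
        by (subst rp) (simp_all only: sum_distrib_left h_mult mult.assoc)
    qed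
    also have "\<dots> = (\<Sum>b\<in>B. emb X (\<Sum>c\<in>expo N m. la c * rp c b) * b)"
      by (subst sum.swap) (simp only: h_sum sum_distrib_right)
    finally have "(\<Sum>b\<in>B. emb X (\<Sum>c\<in>expo N m. la c * rp c b) * b) = 0" by simp
    then have "(\<Sum>c\<in>expo N m. la c * rp c b) = 0"
      by (rule K.independentD [OF B(2) fB subset_refl _ that])
    then have "\<psi> (qq b) = 0"
      unfolding qq_def functional_expo [OF \<psi>(1,2)] by (simp add: la_def mult.commute)
    then show False using \<psi>(4) by simp
  qed
  moreover have "ps y = (\<Sum>b\<in>B. Poly_Mapping.single 0 b * em (qq b))"
  proof -
    have "ps y = (\<Sum>c\<in>expo N m. \<Sum>b\<in>B. Poly_Mapping.single 0 b * Poly_Mapping.single c (emb X (rp c b)))"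
      unfolding ps_def
    proof (intro sum.cong refl)
      fix c assume "c \<in> expo N m"
      then have "Poly_Mapping.single c (y c) = Poly_Mapping.single c (\<Sum>b\<in>B. b * emb X (rp c b))"
        using rp by (simp add: mult.commute)
      also have "\<dots> = (\<Sum>b\<in>B. Poly_Mapping.single 0 b * Poly_Mapping.single c (emb X (rp c b)))"
        by (rule poly_mapping_eqI) (simp add: lookup_sum lookup_single when_def mult_single)
      finally show "Poly_Mapping.single c (y c) = (\<Sum>b\<in>B. Poly_Mapping.single 0 b * Poly_Mapping.single c (emb X (rp c b)))" .
    qed
    also have "\<dots> = (\<Sum>b\<in>B. Poly_Mapping.single 0 b * em (qq b))"
      by (subst sum.swap) (simp add: qq_def sum_distrib_left map0_sum h_add)
    finally show ?thesis .
  qed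
  ultimately show ?thesis by (auto intro: nl_sum nlI)
qed

end

context thickening
begin

lemma mat_vec_nl: "(\<And>i. s i - s' i \<in> nl) \<Longrightarrow> mat_vec r M s i - mat_vec r M s' i \<in> nl"
  by (simp add: mat_vec_def nl_0 sum_subtractf [symmetric] right_diff_distrib [symmetric] nl_sum nl_mult)

lemma fn_form_apply_nl: "f \<in> nl \<Longrightarrow> ext_d S' (fn_form f) vs \<in> nl"
proof (cases "ext_d S' (fn_form f) vs = 0")
  case False
  assume f: "f \<in> nl"
  have "length vs = Suc 0 \<and> set vs \<subseteq> ders S'"
    using False th.pure_d_fn [of f] unfolding pure_def by blast
  then obtain v where v: "vs = [v]" "v \<in> derivations (emb X)" by (cases vs) auto
  then show ?thesis using f nl_map by (simp add: th.d_fn_apply)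
qed (simp add: nl_0)

end

section \<open>Gluing data from a Maurer-Cartan solution\<close>

locale mc_thickening = thickening X D r E nab I U J N m
  for X :: "('k::field, 'f::field) pvariety" and D r E nab and I :: "'i set" and U J N m +
  fixes gam :: "(nat \<Rightarrow>\<^sub>0 nat) \<Rightarrow> ('i, 'f) cochain" and a0 :: 'i
  assumes gam_C1: "gam c \<in> C 1" and gam_0: "gam 0 = 0" and a0: "a0 \<in> I"
    and mc: "la \<in> annih \<Longrightarrow> (\<Sum>c\<in>expo N m. ks (la c) (DD (gam c) + (\<Sum>p\<in>splits c. cup r (gam (fst p)) (gam (snd p))))) = 0"
begin

definition cc :: "(nat \<Rightarrow>\<^sub>0 nat) \<Rightarrow> ('i, 'f) cochain" where
  "cc c = DD (gam c) + (\<Sum>p\<in>splits c. cup r (gam (fst p)) (gam (snd p)))"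

text \<open>Here the Maurer-Cartan equation, known only after pairing with functionals, becomes a
  congruence for each matrix entry and each list of arguments. The three relations for
  \<open>K\<close> and \<open>T\<close> below are its components.\<close>

lemma ps_cc: "ps (\<lambda>c. cc c l i j vs) \<in> nl"
proof (rule ps_nl)
  fix la assume "la \<in> annih"
  then have "(\<Sum>c\<in>expo N m. ks (la c) (cc c)) l i j vs = 0" unfolding cc_def by (subst mc) simp_all
  then show "(\<Sum>c\<in>expo N m. emb X (la c) * cc c l i j vs) = 0"
    by (simp add: sum_fun_apply sc_def)
qed

lemma gam_coch: "coch V r I 1 (gam c)"
  by (rule cochains_coch [OF gam_C1])

lemma gam_outside: "i \<ge> r \<or> j \<ge> r \<Longrightarrow> gam c l i j vs = 0"
  using coch_outside [OF gam_coch] by simp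

definition G :: "'i list \<Rightarrow> ('f, 'f mpoly) matform" where
  "G l i j vs = ps (\<lambda>c. gam c l i j vs)"

text \<open>
  The component of \<open>\<Sum>\<^sub>c gam\<^sub>c t\<^sup>c\<close> in Cech degree 1 deforms the transition matrices (to \<open>T\<close>), the
  component in degree 0 the connection matrices of the charts (to \<open>K\<close>).
\<close>

definition T :: "'i \<Rightarrow> 'i \<Rightarrow> nat \<Rightarrow> nat \<Rightarrow> 'f mpoly" where
  "T \<alpha> \<beta> i j = (if i = j then 1 else 0) + G [\<alpha>, \<beta>] i j []"

definition K :: "'i \<Rightarrow> ('f, 'f mpoly) matform" where
  "K \<alpha> i j = sf 0 (Gam i j) + G [\<alpha>] i j"

lemma G_outside: "i \<ge> r \<or> j \<ge> r \<Longrightarrow> G l i j vs = 0"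
  by (simp add: G_def gam_outside)

lemma G_pure: "pure V (Suc 1 - length l) (G l i j)"
  unfolding pure_def
proof (intro allI impI)
  fix vs assume *: "G l i j vs \<noteq> 0"
  have "\<exists>c. gam c l i j vs \<noteq> 0"
  proof (rule ccontr)
    assume "\<nexists>c. gam c l i j vs \<noteq> 0"
    then have "(\<lambda>c. gam c l i j vs) = (\<lambda>c. 0)" by simp
    with * show False unfolding G_def by simp
  qed
  then obtain c where c: "gam c l i j vs \<noteq> 0" ..
  have "pure V (Suc 1 - length l) (gam c l i j)"
    using coch_pure [OF gam_coch] unfolding mpure_def by blast
  then show "length vs = Suc 1 - length l \<and> set vs \<subseteq> V"
    using c unfolding pure_def by blast
qed

lemma K_pure: "pure V 1 (K \<alpha> i j)"
  unfolding K_def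
proof (rule pure_add)
  show "pure V 1 (sf 0 (Gam i j))" using \<Gamma>_pure by (intro pure_sf) (simp add: mpure_def)
  show "pure V 1 (G [\<alpha>] i j)" using G_pure [of "[\<alpha>]" i j] by simp
qed

lemma K_outside: "i \<ge> r \<or> j \<ge> r \<Longrightarrow> K \<alpha> i j vs = 0"
  using Gam_props(1) [of i j] by (simp add: K_def G_outside sf_def)

text \<open>A truncated series of forms, kept as a form so that wedge and differential apply to it
  as a whole; evaluation turns it into \<open>ps\<close>.\<close>

definition pf :: "((nat \<Rightarrow>\<^sub>0 nat) \<Rightarrow> ('f, 'f) dform) \<Rightarrow> ('f, 'f mpoly) dform" where
  "pf y = (\<Sum>c\<in>expo N m. sf c (y c))"

lemma pf_apply: "pf y vs = ps (\<lambda>c. y c vs)"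
  by (simp add: pf_def ps_def sum_fun_apply sf_def)

lemma G_pf: "G l i j = pf (\<lambda>c. gam c l i j)"
  by (simp add: fun_eq_iff pf_apply G_def)

lemma wedge_pf_pf: "wedge (pf x) (pf y) vs - ps (\<lambda>c. \<Sum>p\<in>splits c. wedge (x (fst p)) (y (snd p)) vs) \<in> nl"
proof -
  have "wedge (pf x) (pf y) vs = (\<Sum>a\<in>expo N m. \<Sum>b\<in>expo N m. Poly_Mapping.single (a + b) (wedge (x a) (y b) vs))"
    by (simp add: pf_def wedge_sum_left wedge_sum_right wedge_sf sum_fun_apply) (subst sum.swap, simp add: sf_def)
  then show ?thesis using ps_convolution [of "\<lambda>a b. wedge (x a) (y b) vs"] by simp
qed

text \<open>The component of the Maurer-Cartan equation on one index. The part of the curvature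
  without \<open>gam\<close> is the curvature of \<open>Gam\<close> and vanishes; what remains is
  \<open>cc\<close> up to truncation.\<close>

lemma K_flat:
  assumes "\<alpha> \<in> I"
  shows "(md S' (K \<alpha>) + mw r (K \<alpha>) (K \<alpha>)) i l vs \<in> nl"
proof -
  let ?g = "\<lambda>i j c. gam c [\<alpha>] i j"
  have 1: "md S' (K \<alpha>) i l vs = Poly_Mapping.single 0 (md S Gam i l vs) + ps (\<lambda>c. md S (gam c [\<alpha>]) i l vs)"
  proof -
    have "md S' (K \<alpha>) i l = sf 0 (d (Gam i l)) + pf (\<lambda>c. d (?g i l c))"
      by (simp add: md_def K_def G_pf th.d_add ext_d_sf) (simp add: pf_def th.d_sum ext_d_sf)
    then show ?thesis by (simp add: pf_apply md_def) (simp add: sf_def)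
  qed
  have 2: "wedge (K \<alpha> i j) (K \<alpha> j l) vs = Poly_Mapping.single 0 (wedge (Gam i j) (Gam j l) vs)
      + ps (\<lambda>c. wedge (Gam i j) (?g j l c) vs) + ps (\<lambda>c. wedge (?g i j c) (Gam j l) vs)
      + wedge (pf (?g i j)) (pf (?g j l)) vs" for j
  proof -
    have "wedge (sf 0 (Gam i j)) (pf (?g j l)) = pf (\<lambda>c. wedge (Gam i j) (?g j l c))"
      "wedge (pf (?g i j)) (sf 0 (Gam j l)) = pf (\<lambda>c. wedge (?g i j c) (Gam j l))"
      by (simp_all add: pf_def wedge_sum_left wedge_sum_right wedge_sf)
    then show ?thesis
      by (simp add: K_def G_pf wedge_add_left wedge_add_right wedge_sf) (simp add: sf_def pf_apply algebra_simps)
  qed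
  have 3: "mw r (K \<alpha>) (K \<alpha>) i l vs = Poly_Mapping.single 0 (mw r Gam Gam i l vs)
      + ps (\<lambda>c. mw r Gam (gam c [\<alpha>]) i l vs) + ps (\<lambda>c. mw r (gam c [\<alpha>]) Gam i l vs)
      + (\<Sum>j<r. wedge (pf (?g i j)) (pf (?g j l)) vs)"
    by (simp add: mw_def sum_fun_apply 2 sum.distrib ps_sum)
      (rule poly_mapping_eqI, simp add: lookup_sum lookup_single when_def)
  have 4: "(\<Sum>j<r. wedge (pf (?g i j)) (pf (?g j l)) vs) -
      ps (\<lambda>c. \<Sum>p\<in>splits c. mw r (gam (fst p) [\<alpha>]) (gam (snd p) [\<alpha>]) i l vs) \<in> nl"
  proof -
    have "ps (\<lambda>c. \<Sum>p\<in>splits c. mw r (gam (fst p) [\<alpha>]) (gam (snd p) [\<alpha>]) i l vs)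
      = (\<Sum>j<r. ps (\<lambda>c. \<Sum>p\<in>splits c. wedge (?g i j (fst p)) (?g j l (snd p)) vs))"
      unfolding ps_sum [symmetric] mw_def sum_fun_apply by (subst sum.swap) simp
    then show ?thesis unfolding sum_subtractf [symmetric]
      by (simp only: sum_subtractf [symmetric]) (intro nl_sum wedge_pf_pf)
  qed
  have 5: "cc c [\<alpha>] i l vs = md S (gam c [\<alpha>]) i l vs + mw r Gam (gam c [\<alpha>]) i l vs + mw r (gam c [\<alpha>]) Gam i l vs
      + (\<Sum>p\<in>splits c. mw r (gam (fst p) [\<alpha>]) (gam (snd p) [\<alpha>]) i l vs)" for c
  proof -
    have "meps (gam c [\<alpha>]) = - gam c [\<alpha>]" using meps_pure [OF coch_pure [OF gam_coch, of "[\<alpha>]" c]] by simp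
    then show ?thesis using assms
      by (simp add: cc_def total_d_1 [OF gam_coch] nb_def mw_minus_left sum_fun_apply cup_1)
  qed
  have "(md S Gam + mw r Gam Gam) i l vs = 0" using flat by simp
  then have "Poly_Mapping.single 0 (md S Gam i l vs) + Poly_Mapping.single 0 (mw r Gam Gam i l vs) = (0 :: 'f mpoly)"
    by (simp add: single_add [symmetric])
  then have "(md S' (K \<alpha>) + mw r (K \<alpha>) (K \<alpha>)) i l vs = ps (\<lambda>c. cc c [\<alpha>] i l vs)
     + ((\<Sum>j<r. wedge (pf (?g i j)) (pf (?g j l)) vs) -
      ps (\<lambda>c. \<Sum>p\<in>splits c. mw r (gam (fst p) [\<alpha>]) (gam (snd p) [\<alpha>]) i l vs))"
    unfolding plus_fun_apply 1 3 5 ps_add by (simp add: algebra_simps)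
  then show ?thesis using nl_add [OF ps_cc 4] by simp
qed

lemma gam_fn: "gam c [\<alpha>, \<beta>] i j = fn_form (gam c [\<alpha>, \<beta>] i j [])"
  using coch_pure [OF gam_coch, of "[\<alpha>, \<beta>]" c] by (intro pure_0_imp [of V]) (simp add: mpure_def)

text \<open>The component on two indices: the change of frame rule
  \<open>T K\<^sub>\<beta> = K\<^sub>\<alpha> T + dT\<close>, evaluated on a derivation.\<close>

lemma T_K:
  assumes \<alpha>: "\<alpha> \<in> I" "\<beta> \<in> I" and v: "v \<in> derivations (emb X)" and i: "i < r" "l < r"
  shows "(\<Sum>j<r. T \<alpha> \<beta> i j * K \<beta> j l [v]) - (\<Sum>j<r. K \<alpha> i j [v] * T \<alpha> \<beta> j l)
    - Poly_Mapping.map v (T \<alpha> \<beta> i l) \<in> nl"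
proof -
  let ?t = "\<lambda>i j c. gam c [\<alpha>, \<beta>] i j []"
  let ?x = "\<lambda>i j c. gam c [\<alpha>] i j [v]" and ?y = "\<lambda>i j c. gam c [\<beta>] i j [v]"
  let ?G = "\<lambda>i j. Poly_Mapping.single 0 (Gam i j [v])"
  have w1: "mw r \<Phi> (gam c [\<alpha>, \<beta>]) i l [v] = (\<Sum>j<r. \<Phi> i j [v] * ?t j l c)" for \<Phi> c i l
    unfolding mw_def by (subst gam_fn) (simp add: wedge_fn_right sum_fun_apply scl_apply mult.commute)
  have w2: "mw r (gam c [\<alpha>, \<beta>]) \<Phi> i l [v] = (\<Sum>j<r. ?t i j c * \<Phi> j l [v])" for \<Phi> c i l
    unfolding mw_def by (subst gam_fn) (simp add: wedge_fn_left sum_fun_apply scl_apply)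
  have dt: "d (gam c [\<alpha>, \<beta>] i l) [v] = v (?t i l c)" for c
    using v by (subst gam_fn) (simp add: d_fn_apply)
  have e: "meps (gam c [\<alpha>, \<beta>]) = gam c [\<alpha>, \<beta>]" "meps (gam c [\<alpha>]) = - gam c [\<alpha>]" for c
    using meps_pure [OF coch_pure [OF gam_coch, of "[\<alpha>, \<beta>]" c]] meps_pure [OF coch_pure [OF gam_coch, of "[\<alpha>]" c]]
    by simp_all
  have cc: "cc c [\<alpha>, \<beta>] i l [v] = ?y i l c - ?x i l c - v (?t i l c) - (\<Sum>j<r. Gam i j [v] * ?t j l c)
      + (\<Sum>j<r. ?t i j c * Gam j l [v])
      - (\<Sum>j<r. \<Sum>p\<in>splits c. ?x i j (fst p) * ?t j l (snd p)) + (\<Sum>j<r. \<Sum>p\<in>splits c. ?t i j (fst p) * ?y j l (snd p))" for c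
  proof -
    have "(\<Sum>p\<in>splits c. cup r (gam (fst p)) (gam (snd p))) [\<alpha>, \<beta>] i l [v]
      = (\<Sum>p\<in>splits c. - (\<Sum>j<r. ?x i j (fst p) * ?t j l (snd p)) + (\<Sum>j<r. ?t i j (fst p) * ?y j l (snd p)))"
      by (simp add: sum_fun_apply cup_2 e mw_minus_left w1 w2)
    also have "\<dots> = - (\<Sum>j<r. \<Sum>p\<in>splits c. ?x i j (fst p) * ?t j l (snd p)) + (\<Sum>j<r. \<Sum>p\<in>splits c. ?t i j (fst p) * ?y j l (snd p))"
      by (simp add: sum_subtractf sum.swap [where A = "splits c"])
    finally show ?thesis using \<alpha>
      by (simp add: cc_def total_d_2 [OF gam_coch] nb_def md_def dt w1 w2 e)
  qed
  have p: "(\<Sum>j<r. ps (?x i j) * ps (?t j l)) - (\<Sum>j<r. ps (\<lambda>c. \<Sum>p\<in>splits c. ?x i j (fst p) * ?t j l (snd p))) \<in> nl"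
    "(\<Sum>j<r. ps (?t i j) * ps (?y j l)) - (\<Sum>j<r. ps (\<lambda>c. \<Sum>p\<in>splits c. ?t i j (fst p) * ?y j l (snd p))) \<in> nl"
    unfolding sum_subtractf [symmetric] by (intro nl_sum ps_mult)+
  have m: "Poly_Mapping.map v (T \<alpha> \<beta> i l) = ps (\<lambda>c. v (?t i l c))"
  proof -
    have "Poly_Mapping.map v (T \<alpha> \<beta> i l) = lift S' v (if i = l then 1 else 0) + lift S' v (G [\<alpha>, \<beta>] i l [])"
      unfolding T_def using th.lift_add [of v] v by simp
    then show ?thesis using v th.lift_one [of v] by (simp add: G_def map_ps)
  qed
  have s1: "(\<Sum>j<r. T \<alpha> \<beta> i j * K \<beta> j l [v]) = ?G i l + ps (?y i l) + (\<Sum>j<r. ps (?t i j) * ?G j l) + (\<Sum>j<r. ps (?t i j) * ps (?y j l))"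
  proof -
    have "(\<Sum>j<r. T \<alpha> \<beta> i j * K \<beta> j l [v]) = (\<Sum>j<r. (if i = j then K \<beta> j l [v] else 0)) + (\<Sum>j<r. ps (?t i j) * (?G j l + ps (?y j l)))"
      unfolding sum.distrib [symmetric] by (intro sum.cong refl) (simp add: T_def K_def G_def sf_def distrib_right)
    then show ?thesis using i by (simp add: distrib_left sum.distrib K_def G_def sf_def)
  qed
  have s2: "(\<Sum>j<r. K \<alpha> i j [v] * T \<alpha> \<beta> j l) = ?G i l + ps (?x i l) + (\<Sum>j<r. ?G i j * ps (?t j l)) + (\<Sum>j<r. ps (?x i j) * ps (?t j l))"
  proof -
    have "(\<Sum>j<r. K \<alpha> i j [v] * T \<alpha> \<beta> j l) = (\<Sum>j<r. (if j = l then K \<alpha> i j [v] else 0)) + (\<Sum>j<r. (?G i j + ps (?x i j)) * ps (?t j l))"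
      unfolding sum.distrib [symmetric] by (intro sum.cong refl) (simp add: T_def K_def G_def sf_def distrib_left)
    then show ?thesis using i by (simp add: distrib_right sum.distrib K_def G_def sf_def)
  qed
  have "ps (\<lambda>c. cc c [\<alpha>, \<beta>] i l [v]) = ps (?y i l) - ps (?x i l) - ps (\<lambda>c. v (?t i l c)) - (\<Sum>j<r. ?G i j * ps (?t j l))
      + (\<Sum>j<r. ps (?t i j) * ?G j l) - (\<Sum>j<r. ps (\<lambda>c. \<Sum>p\<in>splits c. ?x i j (fst p) * ?t j l (snd p)))
      + (\<Sum>j<r. ps (\<lambda>c. \<Sum>p\<in>splits c. ?t i j (fst p) * ?y j l (snd p)))"
    unfolding cc ps_add ps_diff
    by (simp add: ps_sum [of _ "{..<r}"] ps_scale mult.commute [of _ "Gam _ _ [v]"] mult.commute [of _ "Poly_Mapping.single 0 _"])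
  then have "(\<Sum>j<r. T \<alpha> \<beta> i j * K \<beta> j l [v]) - (\<Sum>j<r. K \<alpha> i j [v] * T \<alpha> \<beta> j l) - Poly_Mapping.map v (T \<alpha> \<beta> i l)
    = ps (\<lambda>c. cc c [\<alpha>, \<beta>] i l [v])
     - ((\<Sum>j<r. ps (?x i j) * ps (?t j l)) - (\<Sum>j<r. ps (\<lambda>c. \<Sum>p\<in>splits c. ?x i j (fst p) * ?t j l (snd p))))
     + ((\<Sum>j<r. ps (?t i j) * ps (?y j l)) - (\<Sum>j<r. ps (\<lambda>c. \<Sum>p\<in>splits c. ?t i j (fst p) * ?y j l (snd p))))"
    unfolding s1 s2 m by (simp add: algebra_simps)
  then show ?thesis using nl_add [OF nl_diff [OF ps_cc p(1)] p(2)] by simp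
qed

text \<open>The component on three indices: the cocycle condition for the transition matrices.
  Cochains of degree 1 have no component there, so no derivative term appears.\<close>

lemma T_T:
  assumes \<alpha>: "\<alpha> \<in> I" "\<beta> \<in> I" "\<gamma> \<in> I" and i: "i < r" "l < r"
  shows "(\<Sum>j<r. T \<alpha> \<beta> i j * T \<beta> \<gamma> j l) - T \<alpha> \<gamma> i l \<in> nl"
proof -
  let ?t = "\<lambda>i j c. gam c [\<alpha>, \<beta>] i j []" and ?u = "\<lambda>i j c. gam c [\<beta>, \<gamma>] i j []" and ?w = "\<lambda>i j c. gam c [\<alpha>, \<gamma>] i j []"
  have z: "gam c [\<alpha>, \<beta>, \<gamma>] = 0" for c using coch_zero [OF gam_coch] by simp
  have e: "meps (gam c [\<alpha>, \<beta>]) = gam c [\<alpha>, \<beta>]" for c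
    using meps_pure [OF coch_pure [OF gam_coch, of "[\<alpha>, \<beta>]" c]] by simp
  have cc: "cc c [\<alpha>, \<beta>, \<gamma>] i l [] = ?u i l c - ?w i l c + ?t i l c + (\<Sum>j<r. \<Sum>p\<in>splits c. ?t i j (fst p) * ?u j l (snd p))" for c
    using \<alpha> by (simp add: cc_def total_d_3 [OF gam_coch] z sum_fun_apply cup_3 e mw_def sum.swap [where A = "splits c"])
  have p: "(\<Sum>j<r. ps (?t i j) * ps (?u j l)) - (\<Sum>j<r. ps (\<lambda>c. \<Sum>p\<in>splits c. ?t i j (fst p) * ?u j l (snd p))) \<in> nl"
    unfolding sum_subtractf [symmetric] by (intro nl_sum ps_mult)
  have s: "(\<Sum>j<r. T \<alpha> \<beta> i j * T \<beta> \<gamma> j l) = (if i = l then 1 else 0) + ps (?u i l) + ps (?t i l) + (\<Sum>j<r. ps (?t i j) * ps (?u j l))"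
  proof -
    have "(\<Sum>j<r. T \<alpha> \<beta> i j * T \<beta> \<gamma> j l) = (\<Sum>j<r. (if i = j then T \<beta> \<gamma> j l else 0)) + (\<Sum>j<r. (if j = l then ps (?t i j) else 0))
        + (\<Sum>j<r. ps (?t i j) * ps (?u j l))"
      unfolding sum.distrib [symmetric] by (intro sum.cong refl) (simp add: T_def G_def algebra_simps)
    then show ?thesis using i by (simp add: T_def G_def)
  qed
  have "(\<Sum>j<r. T \<alpha> \<beta> i j * T \<beta> \<gamma> j l) - T \<alpha> \<gamma> i l = ps (\<lambda>c. cc c [\<alpha>, \<beta>, \<gamma>] i l [])
    + ((\<Sum>j<r. ps (?t i j) * ps (?u j l)) - (\<Sum>j<r. ps (\<lambda>c. \<Sum>p\<in>splits c. ?t i j (fst p) * ?u j l (snd p))))"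
    unfolding s cc ps_add ps_diff ps_sum by (simp add: T_def G_def algebra_simps)
  then show ?thesis using nl_add [OF ps_cc p] by simp
qed

lemma low_degree_nl:
  assumes "P - Q \<in> nl" "\<And>c. Poly_Mapping.lookup Q c \<noteq> 0 \<Longrightarrow> mdeg c > m"
  shows "P \<in> nl"
proof -
  have "Q = (\<Sum>c\<in>Poly_Mapping.keys Q. Poly_Mapping.single c (Poly_Mapping.lookup Q c))"
    by (simp only: poly_mapping_sum_single)
  also have "\<dots> \<in> nl"
    by (intro nl_sum nl_outside) (use assms(2) in \<open>force simp: expo_def in_keys_iff\<close>)
  finally have "Q \<in> nl" .
  from nl_add [OF assms(1) this] show ?thesis by simp
qed

text \<open>
  \<open>T \<alpha> \<alpha>\<close> is idempotent modulo \<open>nl\<close>, and unipotent, hence congruent to \<open>1\<close>: the relation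
  \<open>x \<equiv> - x\<^sup>2\<close> for \<open>x = T \<alpha> \<alpha> - 1\<close> pushes \<open>x\<close> into all powers of the maximal ideal.
\<close>

lemma T_refl:
  assumes \<alpha>: "\<alpha> \<in> I" and i: "i < r" "l < r"
  shows "T \<alpha> \<alpha> i l - (if i = l then 1 else 0) \<in> nl"
proof -
  define x where "x i l = G [\<alpha>, \<alpha>] i l []" for i l
  have xx: "x i l + (\<Sum>j<r. x i j * x j l) \<in> nl" if "i < r" "l < r" for i l
  proof -
    have "(\<Sum>j<r. T \<alpha> \<alpha> i j * T \<alpha> \<alpha> j l) = (\<Sum>j<r. (if i = j then T \<alpha> \<alpha> j l else 0)) + (\<Sum>j<r. (if j = l then x i j else 0))
        + (\<Sum>j<r. x i j * x j l)"
      unfolding sum.distrib [symmetric] by (intro sum.cong refl) (simp add: T_def x_def algebra_simps)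
    then have "(\<Sum>j<r. T \<alpha> \<alpha> i j * T \<alpha> \<alpha> j l) - T \<alpha> \<alpha> i l = x i l + (\<Sum>j<r. x i j * x j l)"
      using that by simp
    then show ?thesis using T_T [OF \<alpha> \<alpha> \<alpha> that] by simp
  qed
  have "\<exists>Q. \<forall>i<r. \<forall>l<r. x i l - Q i l \<in> nl \<and> (\<forall>c. Poly_Mapping.lookup (Q i l) c \<noteq> 0 \<longrightarrow> mdeg c > n)" for n
  proof (induction n)
    case 0
    have "mdeg c > 0" if "Poly_Mapping.lookup (x i l) c \<noteq> 0" for i l c
    proof (rule ccontr)
      assume "\<not> mdeg c > 0"
      then have "c = 0" by (simp add: mdeg_eq_0_iff)
      then have "Poly_Mapping.lookup (x i l) c = 0"
        by (auto simp: x_def G_def ps_def lookup_sum lookup_single when_def gam_0 intro!: sum.neutral)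
      then show False using that by simp
    qed
    then show ?case by (intro exI [of _ x]) (simp add: nl_0)
  next
    case (Suc n)
    then obtain Q where Q: "\<And>i l. i < r \<Longrightarrow> l < r \<Longrightarrow> x i l - Q i l \<in> nl"
      "\<And>i l c. i < r \<Longrightarrow> l < r \<Longrightarrow> Poly_Mapping.lookup (Q i l) c \<noteq> 0 \<Longrightarrow> mdeg c > n" by blast
    show ?case
    \<comment> \<open>From \<open>x \<equiv> - x\<^sup>2\<close> and \<open>x \<equiv> Q\<close>
      follows \<open>x \<equiv> - Q\<^sup>2\<close>, and a product of two terms of degree above
      \<open>n\<close> has degree at least \<open>2 n + 2\<close>.\<close>
    proof (intro exI [of _ "\<lambda>i l. - (\<Sum>j<r. Q i j * Q j l)"] allI impI conjI)
      fix i l assume i: "i < r" "l < r"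
      have "x i l - - (\<Sum>j<r. Q i j * Q j l) = (x i l + (\<Sum>j<r. x i j * x j l))
          - (\<Sum>j<r. (x i j - Q i j) * x j l + Q i j * (x j l - Q j l))"
        by (simp add: algebra_simps sum.distrib sum_subtractf)
      also have "\<dots> \<in> nl"
      proof (rule nl_diff [OF xx [OF i] nl_sum])
        fix j assume "j \<in> {..<r}"
        then show "(x i j - Q i j) * x j l + Q i j * (x j l - Q j l) \<in> nl"
          using nl_add [OF nl_mult_right [OF Q(1) [of i j]] nl_mult [OF Q(1) [of j l]]] i by simp
      qed
      finally show "x i l - - (\<Sum>j<r. Q i j * Q j l) \<in> nl" .
      fix c assume "Poly_Mapping.lookup (- (\<Sum>j<r. Q i j * Q j l)) c \<noteq> 0"
      then have "(\<Sum>j<r. Poly_Mapping.lookup (Q i j * Q j l) c) \<noteq> 0" by (simp add: lookup_sum)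
      then obtain j where j: "j < r" "Poly_Mapping.lookup (Q i j * Q j l) c \<noteq> 0"
        by (rule sum.not_neutral_contains_not_neutral) auto
      then obtain a b where ab: "c = a + b" "a \<in> Poly_Mapping.keys (Q i j)" "b \<in> Poly_Mapping.keys (Q j l)"
        using Poly_Mapping.keys_mult [of "Q i j" "Q j l"] by (auto simp: in_keys_iff)
      then have "mdeg a > n" "mdeg b > n" using Q(2) i j(1) by (auto simp: in_keys_iff)
      then show "mdeg c > Suc n" by (simp add: ab(1) mdeg_add)
    qed
  qed
  from this [of m] obtain Q where "x i l - Q i l \<in> nl" "\<And>c. Poly_Mapping.lookup (Q i l) c \<noteq> 0 \<Longrightarrow> mdeg c > m"
    using i by blast
  then have "x i l \<in> nl" by (rule low_degree_nl)
  then show ?thesis by (simp add: T_def x_def)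
qed

section \<open>The glued bundle and its connection\<close>

definition PE :: "(nat \<Rightarrow> 'k) \<Rightarrow> (nat \<Rightarrow> 'f mpoly) set" where
  "PE p = {u \<in> vecs r. \<forall>c. (\<lambda>i. Poly_Mapping.lookup (u i) c) \<in> E p}"

text \<open>
  The deformed bundle is realised inside the constant sheaf of columns of functions by means of
  the chart \<open>a0\<close>, which need not contain \<open>p\<close>.
\<close>

definition Em :: "(nat \<Rightarrow> 'k) \<Rightarrow> (nat \<Rightarrow> 'f mpoly) set" where
  "Em p = {s \<in> vecs r. \<exists>\<alpha>\<in>I. p \<in> U \<alpha> \<and> (\<exists>u\<in>PE p. \<forall>i. s i - mat_vec r (T a0 \<alpha>) u i \<in> nl)}"

definition nabm :: "('f, 'f mpoly) conn" where
  "nabm s i vs = (\<Sum>j<r. K a0 i j vs * s j) + ext_d S' (fn_form (s i)) vs"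

lemma mat_vec_vecs: "mat_vec r M s \<in> vecs r"
  by (simp add: mat_vec_def vecs_def)

lemma mat_vec_sum: "mat_vec r M (\<lambda>i. \<Sum>c\<in>A. u c i) = (\<lambda>i. \<Sum>c\<in>A. mat_vec r M (u c) i)"
proof
  fix i
  show "mat_vec r M (\<lambda>i. \<Sum>c\<in>A. u c i) i = (\<Sum>c\<in>A. mat_vec r M (u c) i)"
    by (simp add: mat_vec_def sum_distrib_left) (rule impI, rule sum.swap)
qed

lemma fn_form_sum': "fn_form (\<Sum>i\<in>A. f i :: 'f mpoly) = (\<Sum>i\<in>A. fn_form (f i))"
  by (induction A rule: infinite_finite_induct)
    (simp_all only: sum.infinite sum.empty sum.insert fn_form_zero fn_form_add not_False_eq_True)

context
  fixes p assumes p: "p \<in> points X"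
begin

lemma PE_sum:
  assumes "\<And>c. c \<in> A \<Longrightarrow> u c \<in> PE p"
  shows "(\<lambda>i. \<Sum>c\<in>A. u c i) \<in> PE p"
  unfolding PE_def mem_Collect_eq
proof (intro conjI allI)
  show "(\<lambda>i. \<Sum>c\<in>A. u c i) \<in> vecs r"
    using assms by (auto simp: PE_def vecs_def intro!: sum.neutral)
  show "(\<lambda>i. Poly_Mapping.lookup (\<Sum>c\<in>A. u c i) e) \<in> E p" for e
    unfolding lookup_sum using assms by (intro E_sum [OF p]) (simp add: PE_def)
qed

lemma PE_single:
  assumes "s \<in> E p"
  shows "(\<lambda>i. Poly_Mapping.single c (s i)) \<in> PE p"
  unfolding PE_def mem_Collect_eq
proof (intro conjI allI)
  show "(\<lambda>i. Poly_Mapping.single c (s i)) \<in> vecs r"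
    using E_vecs [OF p assms] by (simp add: vecs_def)
  show "(\<lambda>i. Poly_Mapping.lookup (Poly_Mapping.single c (s i)) e) \<in> E p" for e
    using assms E_zero [OF p] by (cases "c = e") (simp_all add: lookup_single)
qed

lemma PE_vecs: "u \<in> PE p \<Longrightarrow> u \<in> vecs r"
  by (simp add: PE_def)

lemma PE_expand:
  assumes "u \<in> PE p"
  obtains A where "finite A" "u = (\<lambda>i. \<Sum>c\<in>A. Poly_Mapping.single c (Poly_Mapping.lookup (u i) c))"
    "\<And>c. (\<lambda>i. Poly_Mapping.lookup (u i) c) \<in> E p"
proof
  let ?A = "\<Union>i<r. Poly_Mapping.keys (u i)"
  show "finite ?A" by simp
  show "u = (\<lambda>i. \<Sum>c\<in>?A. Poly_Mapping.single c (Poly_Mapping.lookup (u i) c))"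
  proof
    fix i
    have "u i = (\<Sum>c\<in>Poly_Mapping.keys (u i). Poly_Mapping.single c (Poly_Mapping.lookup (u i) c))"
      by (simp only: poly_mapping_sum_single)
    also have "\<dots> = (\<Sum>c\<in>?A. Poly_Mapping.single c (Poly_Mapping.lookup (u i) c))"
    proof (cases "i < r")
      case True
      then show ?thesis by (intro sum.mono_neutral_left) (auto simp: in_keys_iff)
    next
      case False
      then have "u i = 0" using assms by (simp add: PE_def vecs_def)
      then show ?thesis by simp
    qed
    finally show "u i = (\<Sum>c\<in>?A. Poly_Mapping.single c (Poly_Mapping.lookup (u i) c))" .
  qed
  show "(\<lambda>i. Poly_Mapping.lookup (u i) c) \<in> E p" for c using assms by (simp add: PE_def)
qed

lemma End_form_0_stalk: "End_form S r E p q \<Phi> \<Longrightarrow> q = 0 \<Longrightarrow> (\<lambda>i j. \<Phi> i j []) \<in> End_stalk r E p"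
proof (induction rule: End_form.induct)
  case (1 M w)
  have "w [] \<in> local_ring X p"
    using 1(2,3)
  proof (induction rule: log_form.induct)
    case (2 q a b) then show ?case using local_ring_add [OF p] by simp
  qed (simp_all add: fn_form_def)
  from End_stalk_scale [OF p 1(1) this] show ?case by (simp add: mult.commute)
next
  case (2 \<Phi> \<Phi>')
  let ?M = "\<lambda>i j. \<Phi> i j []" and ?N = "\<lambda>i j. \<Phi>' i j []"
  have M: "?M \<in> End_stalk r E p" "?N \<in> End_stalk r E p" using 2 by auto
  have "mat_vec r (\<lambda>i j. ?M i j + ?N i j) s = mat_vec r ?M s + mat_vec r ?N s" for s
    by (auto simp: mat_vec_def distrib_right sum.distrib fun_eq_iff)
  then have "(\<lambda>i j. ?M i j + ?N i j) \<in> End_stalk r E p"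
    using M E_add [OF p] unfolding End_stalk_def by simp
  then show ?case by simp
qed

text \<open>At a point of both charts every coefficient of \<open>T \<alpha> \<beta>\<close> is an
  endomorphism of the stalk of \<open>E\<close>, being the degree 0 part of a cochain.\<close>

lemma PE_T:
  assumes "\<alpha> \<in> I" "\<beta> \<in> I" "p \<in> U \<alpha>" "p \<in> U \<beta>" and u: "u \<in> PE p"
  shows "mat_vec r (T \<alpha> \<beta>) u \<in> PE p"
proof -
  obtain A where A: "finite A" "u = (\<lambda>i. \<Sum>c\<in>A. Poly_Mapping.single c (Poly_Mapping.lookup (u i) c))"
    "\<And>c. (\<lambda>i. Poly_Mapping.lookup (u i) c) \<in> E p" using PE_expand [OF u] by blast
  let ?M = "\<lambda>c i j. gam c [\<alpha>, \<beta>] i j []"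
  have M: "?M c \<in> End_stalk r E p" for c
    using cochains_form [OF gam_C1 p, of "[\<alpha>, \<beta>]" c] assms(3,4) by (intro End_form_0_stalk) simp_all
  have "mat_vec r (T \<alpha> \<beta>) (\<lambda>i. Poly_Mapping.single c (s i)) \<in> PE p" if s: "s \<in> E p" for c s
  proof -
    \<comment> \<open>The index \<open>None\<close> stands for the identity summand of
      \<open>T\<close>, the others for the coefficients of \<open>G\<close>; this makes a single sum
      to which \<open>PE_sum\<close> applies.\<close>
    have "mat_vec r (T \<alpha> \<beta>) (\<lambda>i. Poly_Mapping.single c (s i)) =
        (\<lambda>i. \<Sum>e\<in>insert None (Some ` expo N m). case e of None \<Rightarrow> Poly_Mapping.single c (s i)
          | Some e \<Rightarrow> Poly_Mapping.single (e + c) (mat_vec r (?M e) s i))"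
    proof
      fix i
      have "(\<Sum>j<r. (if i = j then 1 else 0) * Poly_Mapping.single c (s j)) = (\<Sum>j<r. if i = j then Poly_Mapping.single c (s j) else 0)"
        by (intro sum.cong) auto
      then have 1: "i < r \<Longrightarrow> (\<Sum>j<r. (if i = j then 1 else 0) * Poly_Mapping.single c (s j)) = Poly_Mapping.single c (s i)"
        by simp
      have 2: "(\<Sum>j<r. G [\<alpha>, \<beta>] i j [] * Poly_Mapping.single c (s j)) = (\<Sum>e\<in>expo N m. Poly_Mapping.single (e + c) (\<Sum>j<r. ?M e i j * s j))"
      proof -
        have "(\<Sum>j<r. G [\<alpha>, \<beta>] i j [] * Poly_Mapping.single c (s j)) = (\<Sum>e\<in>expo N m. \<Sum>j<r. Poly_Mapping.single (e + c) (?M e i j * s j))"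
          by (simp add: G_def ps_def sum_distrib_right mult_single) (rule sum.swap)
        also have "\<dots> = (\<Sum>e\<in>expo N m. Poly_Mapping.single (e + c) (\<Sum>j<r. ?M e i j * s j))"
          by (intro sum.cong refl poly_mapping_eqI) (simp add: lookup_sum lookup_single when_def)
        finally show ?thesis .
      qed
      show "mat_vec r (T \<alpha> \<beta>) (\<lambda>i. Poly_Mapping.single c (s i)) i = (\<Sum>e\<in>insert None (Some ` expo N m).
          case e of None \<Rightarrow> Poly_Mapping.single c (s i) | Some e \<Rightarrow> Poly_Mapping.single (e + c) (mat_vec r (?M e) s i))"
        using E_vecs [OF p s]
        by (simp add: finite_expo sum.reindex mat_vec_def T_def distrib_right sum.distrib 1 2)
          (simp add: vecs_def)
    qed
    also have "\<dots> \<in> PE p"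
    proof (rule PE_sum)
      fix e assume "e \<in> insert None (Some ` expo N m)"
      show "(\<lambda>i. case e of None \<Rightarrow> Poly_Mapping.single c (s i)
          | Some e \<Rightarrow> Poly_Mapping.single (e + c) (mat_vec r (?M e) s i)) \<in> PE p"
        using PE_single [OF s] PE_single [of "mat_vec r (?M _) s"] M s
        by (cases e) (auto simp: End_stalk_def)
    qed
    finally show ?thesis .
  qed
  then have "mat_vec r (T \<alpha> \<beta>) (\<lambda>i. \<Sum>c\<in>A. Poly_Mapping.single c (Poly_Mapping.lookup (u i) c)) \<in> PE p"
    unfolding mat_vec_sum using A(3) by (intro PE_sum) blast
  then show ?thesis using A(2) by (simp only: A(2) [symmetric])
qed

lemma T_T_vec:
  assumes "\<alpha> \<in> I" "\<beta> \<in> I" "\<gamma> \<in> I"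
  shows "mat_vec r (T \<alpha> \<gamma>) u i - mat_vec r (T \<alpha> \<beta>) (mat_vec r (T \<beta> \<gamma>) u) i \<in> nl"
proof (cases "i < r")
  case True
  have "mat_vec r (T \<alpha> \<beta>) (mat_vec r (T \<beta> \<gamma>) u) i = (\<Sum>j<r. \<Sum>l<r. T \<alpha> \<beta> i j * T \<beta> \<gamma> j l * u l)"
    using True by (simp add: mat_vec_def sum_distrib_left mult.assoc)
  also have "\<dots> = (\<Sum>l<r. (\<Sum>j<r. T \<alpha> \<beta> i j * T \<beta> \<gamma> j l) * u l)"
    by (subst sum.swap) (simp add: sum_distrib_right)
  finally have "mat_vec r (T \<alpha> \<gamma>) u i - mat_vec r (T \<alpha> \<beta>) (mat_vec r (T \<beta> \<gamma>) u) i
      = (\<Sum>l<r. - (((\<Sum>j<r. T \<alpha> \<beta> i j * T \<beta> \<gamma> j l) - T \<alpha> \<gamma> i l) * u l))"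
    using True by (simp add: mat_vec_def sum_subtractf [symmetric] left_diff_distrib)
  also have "\<dots> \<in> nl"
    using T_T [OF assms True] by (intro nl_sum nl_minus nl_mult_right) simp
  finally show ?thesis .
qed (simp add: mat_vec_def nl_0)

text \<open>The stalk does not depend on the chart around \<open>p\<close>: passing from \<beta> to
  \<alpha> replaces \<open>u\<close> by \<open>T \<alpha> \<beta>\<close> applied to
  \<open>u\<close>, which stays in the pulled back stalk, and the cocycle condition absorbs the
  change.\<close>

lemma Em_iff:
  assumes "\<alpha> \<in> I" "p \<in> U \<alpha>"
  shows "s \<in> Em p \<longleftrightarrow> s \<in> vecs r \<and> (\<exists>u\<in>PE p. \<forall>i. s i - mat_vec r (T a0 \<alpha>) u i \<in> nl)"
proof
  assume "s \<in> Em p"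
  then obtain \<beta> u where s: "s \<in> vecs r" and \<beta>: "\<beta> \<in> I" "p \<in> U \<beta>" and u: "u \<in> PE p" "\<And>i. s i - mat_vec r (T a0 \<beta>) u i \<in> nl"
    unfolding Em_def by blast
  have "s i - mat_vec r (T a0 \<alpha>) (mat_vec r (T \<alpha> \<beta>) u) i \<in> nl" for i
    using nl_add [OF u(2) [of i] T_T_vec [OF a0 assms(1) \<beta>(1), of u i]] by simp
  then show "s \<in> vecs r \<and> (\<exists>u\<in>PE p. \<forall>i. s i - mat_vec r (T a0 \<alpha>) u i \<in> nl)"
    using s PE_T [OF assms(1) \<beta>(1) assms(2) \<beta>(2) u(1)] by blast
qed (use assms in \<open>auto simp: Em_def\<close>)

end

definition mm :: "(nat \<Rightarrow> nat \<Rightarrow> 'f mpoly) \<Rightarrow> (nat \<Rightarrow> nat \<Rightarrow> 'f mpoly) \<Rightarrow> nat \<Rightarrow> nat \<Rightarrow> 'f mpoly" where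
  "mm A B i j = (\<Sum>h<r. A i h * B h j)"

lemma mm_assoc: "mm (mm A B) M = mm A (mm B M)"
proof (intro ext)
  fix i j
  have "mm (mm A B) M i j = (\<Sum>h<r. \<Sum>k<r. A i k * B k h * M h j)"
    by (simp add: mm_def sum_distrib_right)
  also have "\<dots> = mm A (mm B M) i j"
    by (subst sum.swap) (simp add: mm_def sum_distrib_left mult.assoc)
  finally show "mm (mm A B) M i j = mm A (mm B M) i j" .
qed

lemma mat_vec_mm: "mat_vec r (mm A B) s = mat_vec r A (mat_vec r B s)"
proof
  fix i
  have "(\<Sum>j<r. mm A B i j * s j) = (\<Sum>j<r. \<Sum>h<r. A i h * B h j * s j)"
    by (simp add: mm_def sum_distrib_right)
  also have "\<dots> = (\<Sum>h<r. A i h * (\<Sum>j<r. B h j * s j))"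
    by (subst sum.swap) (simp add: sum_distrib_left mult.assoc)
  finally show "mat_vec r (mm A B) s i = mat_vec r A (mat_vec r B s) i"
    by (simp add: mat_vec_def)
qed

definition idm :: "nat \<Rightarrow> nat \<Rightarrow> 'f mpoly" where
  "idm i j = (if i = j then 1 else 0)"

lemma mm_idm_left: "i < r \<Longrightarrow> mm idm A i j = A i j"
  unfolding mm_def idm_def by (simp add: if_distrib [of "\<lambda>x. x * _"] cong: if_cong)

lemma mat_vec_idm:
  assumes "s \<in> vecs r" "\<And>i j. i < r \<Longrightarrow> j < r \<Longrightarrow> M i j = idm i j"
  shows "mat_vec r M s = s"
proof
  fix i
  have "(\<Sum>j<r. M i j * s j) = (\<Sum>j<r. if i = j then s j else 0)" if "i < r"
    using that assms(2) by (intro sum.cong) (auto simp: idm_def)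
  then show "mat_vec r M s i = s i" using assms(1) by (simp add: mat_vec_def vecs_def)
qed

lemma cover_point:
  assumes "p \<in> points X"
  obtains \<alpha> where "\<alpha> \<in> I" "p \<in> U \<alpha>"
  using cover assms unfolding fine_cover_def by blast

lemma lookup_single_mult: "Poly_Mapping.lookup (Poly_Mapping.single 0 a * P) c = a * Poly_Mapping.lookup (P :: 'f mpoly) c"
  unfolding mult_map_scale_conv_mult [symmetric] by (simp add: lookup_map0)

text \<open>A frame \<open>b\<close> of \<open>E\<close> near \<open>p\<close> is carried into the
  chart \<open>a0\<close> by \<open>T a0 \<alpha>\<close>; the inverse is \<open>b'\<close> times
  \<open>T \<alpha> a0\<close>. The relations \<open>T_T\<close> and \<open>T_refl\<close> make
  these inverse over the generic ring, although \<open>p\<close> need not lie in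
  \<open>U a0\<close>.\<close>

lemma vector_bundle_Em: "vector_bundle S' r Em"
  unfolding vector_bundle_def
proof
  fix p assume "p \<in> pts S'"
  then have p: "p \<in> points X" by simp
  then obtain \<alpha> where \<alpha>: "\<alpha> \<in> I" "p \<in> U \<alpha>" by (rule cover_point)
  show "\<exists>W'\<in>opens S'. p \<in> W' \<and> (\<exists>b b'. mat_inverses S' r b b' \<and>
      (\<forall>y\<in>W'. Em y = {s \<in> vecs r. \<exists>c. (\<forall>j. c j \<in> stalk S' y) \<and> (\<forall>i. s i - mat_vec r b c i \<in> nul S')}))"
  proof (rule frame [OF p])
  fix W b b' assume W: "zopen X W" "p \<in> W"
    and bb': "\<And>i j. i < r \<Longrightarrow> j < r \<Longrightarrow> (\<Sum>l<r. b i l * b' l j) = (if i = j then 1 else 0)"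
    and b'b: "\<And>i j. i < r \<Longrightarrow> j < r \<Longrightarrow> (\<Sum>l<r. b' i l * b l j) = (if i = j then 1 else 0)"
    and EW: "\<And>y. y \<in> W \<Longrightarrow> E y = {s \<in> vecs r. \<exists>c. (\<forall>j. c j \<in> local_ring X y) \<and> s = mat_vec r b c}"
  let ?B = "\<lambda>i j. Poly_Mapping.single 0 (b i j)" and ?B' = "\<lambda>i j. Poly_Mapping.single 0 (b' i j)"
  have s0: "(\<Sum>l<r. Poly_Mapping.single 0 (f l)) = Poly_Mapping.single 0 (\<Sum>l<r. f l)" for f :: "nat \<Rightarrow> 'f"
    by (rule poly_mapping_eqI) (simp add: lookup_sum lookup_single when_def)
  have BB': "mm ?B ?B' i j = idm i j" "mm ?B' ?B i j = idm i j" if "i < r" "j < r" for i j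
    using bb' [OF that] b'b [OF that] by (simp_all add: mm_def idm_def mult_single s0)
  let ?A = "mm (T a0 \<alpha>) ?B" and ?A' = "mm ?B' (T \<alpha> a0)"
  have "mat_inverses S' r ?A ?A'"
    unfolding mat_inverses_def
  proof (intro allI impI conjI)
    fix i j assume i: "i < r" "j < r"
    have "mm ?A ?A' = mm (T a0 \<alpha>) (mm (mm ?B ?B') (T \<alpha> a0))" by (simp add: mm_assoc)
    moreover have "mm (mm ?B ?B') (T \<alpha> a0) h j = T \<alpha> a0 h j" if "h < r" for h
    proof -
      have "mm (mm ?B ?B') (T \<alpha> a0) h j = mm idm (T \<alpha> a0) h j"
        unfolding mm_def [of "mm _ _"] mm_def [of idm] using that BB' by (intro sum.cong) simp_all
      then show ?thesis using mm_idm_left that by simp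
    qed
    ultimately have "mm ?A ?A' i j = mm (T a0 \<alpha>) (T \<alpha> a0) i j"
      by (simp add: mm_def [of "T a0 \<alpha>"])
    then have "mm ?A ?A' i j - (if i = j then 1 else 0)
      = (mm (T a0 \<alpha>) (T \<alpha> a0) i j - T a0 a0 i j) + (T a0 a0 i j - (if i = j then 1 else 0))" by simp
    also have "\<dots> \<in> nl" using nl_add [OF T_T [OF a0 \<alpha>(1) a0 i] T_refl [OF a0 i]] by (simp add: mm_def)
    finally show "(\<Sum>l<r. ?A i l * ?A' l j) - (if i = j then 1 else 0) \<in> nl" by (simp add: mm_def [of ?A])
    let ?R = "mm (T \<alpha> a0) (T a0 \<alpha>)"
    have R: "?R h k - idm h k \<in> nl" if "h < r" "k < r" for h k
      using nl_add [OF T_T [OF \<alpha>(1) a0 \<alpha>(1) that] T_refl [OF \<alpha>(1) that]] by (simp add: mm_def idm_def)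
    have "mm ?A' ?A i j = mm ?B' (mm ?R ?B) i j" by (simp add: mm_assoc)
    moreover have "mm ?B' (mm ?R ?B) i j - mm ?B' (mm idm ?B) i j
        = (\<Sum>h<r. ?B' i h * (\<Sum>k<r. (?R h k - idm h k) * ?B k j))"
      by (simp add: mm_def [of ?B'] mm_def [of ?R] mm_def [of idm] sum_subtractf right_diff_distrib left_diff_distrib)
    moreover have "\<dots> \<in> nl" using R by (intro nl_sum nl_mult nl_mult_right) simp
    moreover have "mm ?B' (mm idm ?B) i j = idm i j"
      using BB' [OF i] by (simp add: mm_def [of ?B'] mm_idm_left)
    ultimately show "(\<Sum>l<r. ?A' i l * ?A l j) - (if i = j then 1 else 0) \<in> nl"
      by (simp add: mm_def [of ?A'] idm_def)
  qed
  moreover have "Em y = {s \<in> vecs r. \<exists>c. (\<forall>j. c j \<in> stalk S' y) \<and> (\<forall>i. s i - mat_vec r ?A c i \<in> nl)}"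
    if y: "y \<in> W \<inter> U \<alpha>" for y
  proof -
    have yX: "y \<in> points X" using y U_points [OF \<alpha>(1)] by blast
    have Ey: "E y = {s \<in> vecs r. \<exists>c. (\<forall>j. c j \<in> local_ring X y) \<and> s = mat_vec r b c}" using EW y by blast
    have lk: "Poly_Mapping.lookup (mat_vec r (\<lambda>i j. Poly_Mapping.single 0 (M i j)) u i) e
        = mat_vec r M (\<lambda>j. Poly_Mapping.lookup (u j) e) i" for M :: "nat \<Rightarrow> nat \<Rightarrow> 'f" and u :: "nat \<Rightarrow> 'f mpoly" and i e
      by (simp add: mat_vec_def lookup_sum lookup_single_mult)
    have 1: "\<exists>c. (\<forall>j. c j \<in> stalk S' y) \<and> u = mat_vec r ?B c" if u: "u \<in> PE y" for u
    proof (intro exI [of _ "mat_vec r ?B' u"] conjI allI)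
      fix j
      have "mat_vec r b' (\<lambda>h. Poly_Mapping.lookup (u h) e) j \<in> local_ring X y" for e
      proof (cases "j < r")
        case True
        have "(\<lambda>h. Poly_Mapping.lookup (u h) e) \<in> E y" using u by (simp add: PE_def)
        then obtain c where c: "\<forall>j. c j \<in> local_ring X y" "(\<lambda>h. Poly_Mapping.lookup (u h) e) = mat_vec r b c"
          unfolding Ey mem_Collect_eq by (elim conjE exE)
        have "mat_vec r b' (mat_vec r b c) j = (\<Sum>h<r. \<Sum>k<r. b' j h * b h k * c k)"
          using True by (simp add: mat_vec_def sum_distrib_left mult.assoc)
        also have "\<dots> = (\<Sum>k<r. (\<Sum>h<r. b' j h * b h k) * c k)"
          by (subst sum.swap) (simp add: sum_distrib_right)
        also have "\<dots> = (\<Sum>k<r. if j = k then c k else 0)"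
          using True by (intro sum.cong) (auto simp: b'b)
        finally show ?thesis using c True by simp
      qed (simp add: mat_vec_def local_ring_0)
      then show "mat_vec r ?B' u j \<in> stalk S' y" by (simp add: lk)
      show "u = mat_vec r ?B (mat_vec r ?B' u)"
        unfolding mat_vec_mm [symmetric] by (rule mat_vec_idm [symmetric]) (use u BB' in \<open>auto simp: PE_def\<close>)
    qed
    have 2: "mat_vec r ?B c \<in> PE y" if "\<forall>j. c j \<in> stalk S' y" for c
      unfolding PE_def mem_Collect_eq lk Ey
      using that by (intro conjI allI mat_vec_vecs exI [of _ "\<lambda>j. Poly_Mapping.lookup (c j) _"])
        (auto simp: mat_vec_def vecs_def)
    show ?thesis
    proof (intro set_eqI iffI)
      fix s assume "s \<in> Em y"
      then obtain u where s: "s \<in> vecs r" and u: "u \<in> PE y" "\<And>i. s i - mat_vec r (T a0 \<alpha>) u i \<in> nl"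
        using Em_iff [OF yX \<alpha>(1)] y by blast
      obtain c where "\<forall>j. c j \<in> stalk S' y" "u = mat_vec r ?B c" using 1 [OF u(1)] by blast
      then show "s \<in> {s \<in> vecs r. \<exists>c. (\<forall>j. c j \<in> stalk S' y) \<and> (\<forall>i. s i - mat_vec r ?A c i \<in> nl)}"
        using s u(2) by (auto simp: mat_vec_mm)
    next
      fix s assume "s \<in> {s \<in> vecs r. \<exists>c. (\<forall>j. c j \<in> stalk S' y) \<and> (\<forall>i. s i - mat_vec r ?A c i \<in> nl)}"
      then obtain c where "s \<in> vecs r" "\<forall>j. c j \<in> stalk S' y" "\<forall>i. s i - mat_vec r ?A c i \<in> nl" by blast
      then show "s \<in> Em y" using Em_iff [OF yX \<alpha>(1)] y 2 by (auto simp: mat_vec_mm)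
    qed
  qed
  ultimately show ?thesis
    using W \<alpha> zopen_inter [OF W(1) fine_cover_zopen [OF cover \<alpha>(1)]]
    by (intro bexI [of _ "W \<inter> U \<alpha>"] conjI exI [of _ ?A] exI [of _ ?A']) auto
  qed
qed

lemma nabm_form: "nabm s i = (\<Sum>j<r. scl (s j) (K a0 i j)) + ext_d S' (fn_form (s i))"
  by (rule ext) (simp add: nabm_def sum_fun_apply scl_apply mult.commute)

lemma nabm_nl: "(\<And>i. s i \<in> nl) \<Longrightarrow> nabm s i vs \<in> nl"
  unfolding nabm_def by (intro nl_add nl_sum nl_mult fn_form_apply_nl)

lemma nabm_add: "nabm (s + s') i vs = nabm s i vs + nabm s' i vs"
  by (simp add: nabm_def distrib_left sum.distrib fn_form_add th.d_add)

lemma nabm_cong: "(\<And>i. s i - s' i \<in> nl) \<Longrightarrow> nabm s i vs - nabm s' i vs \<in> nl"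
  using nabm_nl [of "s - s'" i vs] nabm_add [of "s - s'" s' i vs] by simp

lemma nabm_mult: "nabm (\<lambda>j. f * s j) i vs = f * nabm s i vs + s i * ext_d S' (fn_form f) vs"
  by (simp add: nabm_def th.d_fn_mult scl_apply distrib_left sum_distrib_left mult_ac)

lemma nabm_outside: "s \<in> vecs r \<Longrightarrow> i \<ge> r \<Longrightarrow> nabm s i vs = 0"
  by (simp add: nabm_def K_outside vecs_def)

lemma ext_d_em: "ext_d S' (fn_form (em P)) vs = 0"
proof -
  have "ext_d S' (fn_form (em P)) = 0"
  proof (rule th.pure_1_eqI)
    show "ext_d S' (fn_form (em P)) [v] = 0 [v]" if "v \<in> ders S'" for v
      using that map_emb_deriv [of v P] by (simp add: th.d_fn_apply)
  qed (simp only: One_nat_def th.pure_d_fn, rule pure_zero)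
  then show ?thesis by simp
qed

text \<open>\<open>T\<close> intertwines the connection \<open>nabm\<close> with the connection of the chart \<open>\<alpha>\<close>.\<close>

lemma nabm_T:
  assumes \<alpha>: "\<alpha> \<in> I" and i: "i < r"
  shows "nabm (mat_vec r (T a0 \<alpha>) u) i vs
    - (\<Sum>h<r. T a0 \<alpha> i h * ((\<Sum>j<r. K \<alpha> h j vs * u j) + ext_d S' (fn_form (u h)) vs)) \<in> nl"
proof (cases "length vs = 1 \<and> set vs \<subseteq> derivations (emb X)")
  case True
  then obtain v where v: "vs = [v]" "v \<in> derivations (emb X)" by (cases vs) auto
  let ?T = "T a0 \<alpha>"
  have m: "ext_d S' (fn_form f) vs = Poly_Mapping.map v f" for f using v by (simp add: th.d_fn_apply)
  have add: "Poly_Mapping.map v (\<Sum>j\<in>A. f j) = (\<Sum>j\<in>A. Poly_Mapping.map v (f j))"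
    for A :: "nat set" and f :: "nat \<Rightarrow> 'f mpoly"
    using th.d_sum [of "\<lambda>j. fn_form (f j)" A] unfolding m [symmetric] fn_form_sum' by (simp add: sum_fun_apply)
  have mul: "Poly_Mapping.map v (f * g) = f * Poly_Mapping.map v g + Poly_Mapping.map v f * g" for f g :: "'f mpoly"
    using th.lift_mult [of v f g] v by simp
  have 1: "nabm (mat_vec r ?T u) i vs = (\<Sum>j<r. (\<Sum>h<r. K a0 i h vs * ?T h j) * u j)
      + (\<Sum>j<r. ?T i j * Poly_Mapping.map v (u j)) + (\<Sum>j<r. Poly_Mapping.map v (?T i j) * u j)"
  proof -
    have "(\<Sum>h<r. K a0 i h vs * mat_vec r ?T u h) = (\<Sum>h<r. \<Sum>j<r. K a0 i h vs * ?T h j * u j)"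
      by (simp add: mat_vec_def sum_distrib_left mult.assoc)
    also have "\<dots> = (\<Sum>j<r. (\<Sum>h<r. K a0 i h vs * ?T h j) * u j)"
      by (subst sum.swap) (simp add: sum_distrib_right)
    finally show ?thesis using i by (simp add: nabm_def m mat_vec_def add mul sum.distrib add.assoc)
  qed
  have 2: "(\<Sum>h<r. ?T i h * ((\<Sum>j<r. K \<alpha> h j vs * u j) + ext_d S' (fn_form (u h)) vs))
     = (\<Sum>j<r. (\<Sum>h<r. ?T i h * K \<alpha> h j vs) * u j) + (\<Sum>j<r. ?T i j * Poly_Mapping.map v (u j))"
  proof -
    have "(\<Sum>h<r. ?T i h * (\<Sum>j<r. K \<alpha> h j vs * u j)) = (\<Sum>j<r. (\<Sum>h<r. ?T i h * K \<alpha> h j vs) * u j)"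
      by (simp add: sum_distrib_left sum_distrib_right mult.assoc) (rule sum.swap)
    then show ?thesis by (simp add: m distrib_left sum.distrib)
  qed
  have "nabm (mat_vec r ?T u) i vs - (\<Sum>h<r. ?T i h * ((\<Sum>j<r. K \<alpha> h j vs * u j) + ext_d S' (fn_form (u h)) vs))
    = (\<Sum>j<r. - (((\<Sum>h<r. ?T i h * K \<alpha> h j vs) - (\<Sum>h<r. K a0 i h vs * ?T h j) - Poly_Mapping.map v (?T i j)) * u j))"
    unfolding 1 2 by (simp add: sum.distrib sum_subtractf left_diff_distrib algebra_simps)
  also have "\<dots> \<in> nl"
    unfolding v(1) using T_K [OF a0 \<alpha> v(2) i] by (intro nl_sum nl_minus nl_mult_right) simp
  finally show ?thesis .
next
  case False
  then have "K \<beta> h j vs = 0" for \<beta> h j using K_pure [of \<beta> h j] unfolding pure_def by auto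
  moreover have "ext_d S' (fn_form f) vs = 0" for f
    using False th.pure_d_fn [of f] unfolding pure_def by auto
  ultimately show ?thesis by (simp add: nabm_def nl_0)
qed

text \<open>Transports bundle-valued forms from \<open>X\<close> to the deformed bundle one monomial
  at a time, which is how the derivative of a section is recognised as logarithmic.\<close>

lemma bundle_form_T:
  assumes \<alpha>: "\<alpha> \<in> I" "p \<in> U \<alpha>" and p: "p \<in> points X"
  shows "bundle_form S E p q \<xi> \<Longrightarrow>
    bundle_form S' Em p q (\<lambda>i vs. mat_vec r (T a0 \<alpha>) (\<lambda>h. Poly_Mapping.single c (\<xi> h vs)) i)"
proof (induction rule: bundle_form.induct)
  case (1 s w)
  let ?s = "mat_vec r (T a0 \<alpha>) (\<lambda>h. Poly_Mapping.single c (s h))"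
  have "?s \<in> Em p"
    unfolding Em_iff [OF p \<alpha>]
    by (intro conjI mat_vec_vecs bexI [OF _ PE_single [OF p 1(1), of c]] allI) (simp add: nl_0)
  then have "bundle_form S' Em p q (\<lambda>i vs. ?s i * sf 0 w vs)"
    using bundle_form.intros(1) [of ?s Em p S' q "sf 0 w"] log_form_sf [OF 1(2)] by blast
  moreover have "Poly_Mapping.single c (s h * w vs) = Poly_Mapping.single c (s h) * sf 0 w vs" for h vs
    by (simp add: sf_def mult_single)
  then have "mat_vec r (T a0 \<alpha>) (\<lambda>h. Poly_Mapping.single c (s h * w vs)) i = ?s i * sf 0 w vs" for i vs
    by (simp add: mat_vec_def sum_distrib_right mult.assoc)
  ultimately show ?case by simp
next
  case (2 \<eta> \<eta>')
  have "mat_vec r (T a0 \<alpha>) (\<lambda>h. Poly_Mapping.single c ((\<eta> + \<eta>') h vs)) i = mat_vec r (T a0 \<alpha>) (\<lambda>h. Poly_Mapping.single c (\<eta> h vs)) i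
      + mat_vec r (T a0 \<alpha>) (\<lambda>h. Poly_Mapping.single c (\<eta>' h vs)) i" for i vs
    by (simp add: mat_vec_def single_add distrib_left sum.distrib)
  with bundle_form.intros(2) [OF 2(3,4)] show ?case by (simp add: plus_fun_def)
next
  case (3 \<eta> \<eta>')
  then have "\<eta> = \<eta>'" by (auto simp: fun_eq_iff)
  then show ?case using 3 by simp
qed

lemma bundle_form_zero:
  assumes p: "p \<in> points X"
  shows "bundle_form S' Em p q 0"
proof -
  obtain \<alpha> where \<alpha>: "\<alpha> \<in> I" "p \<in> U \<alpha>" using p by (rule cover_point)
  have "bundle_form S E p q (\<lambda>i vs. 0 * 0)"
    using bundle_form.intros(1) [of "\<lambda>i. 0" E p S q 0] E_zero [OF p] log_form_zero [OF p] by simp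
  from bundle_form_T [OF \<alpha> p this, of 0] show ?thesis by (simp add: mat_vec_def zero_fun_def if_distrib cong: if_cong)
qed

lemma bundle_form_sum:
  "p \<in> points X \<Longrightarrow> (\<And>c. c \<in> A \<Longrightarrow> bundle_form S' Em p q (\<eta> c)) \<Longrightarrow> bundle_form S' Em p q (\<Sum>c\<in>A. \<eta> c)"
proof (induction A rule: infinite_finite_induct)
  case (insert x A)
  then show ?case unfolding sum.insert [OF insert.hyps] by (intro bundle_form.intros(2)) simp_all
qed (simp_all only: sum.infinite sum.empty bundle_form_zero not_False_eq_True)

lemma bundle_form_End:
  assumes p: "p \<in> points X" and s: "s \<in> E p"
  shows "End_form S r E p q \<Phi> \<Longrightarrow> bundle_form S E p q (\<lambda>i vs. \<Sum>j<r. \<Phi> i j vs * s j)"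
proof (induction rule: End_form.induct)
  case (1 M w)
  have "(\<Sum>j<r. M i j * w vs * s j) = mat_vec r M s i * w vs" for i vs
    using 1(1) by (auto simp: mat_vec_def End_stalk_def sum_distrib_left sum_distrib_right mult_ac)
  moreover have "mat_vec r M s \<in> E p" using 1(1) s by (simp add: End_stalk_def)
  ultimately show ?case using bundle_form.intros(1) [OF _ 1(2), of "mat_vec r M s"] by simp
next
  case (2 \<Phi> \<Phi>')
  show ?case using bundle_form.intros(2) [OF 2(3,4)] by (simp add: plus_fun_def distrib_right sum.distrib)
qed

text \<open>In a chart \<alpha> around \<open>p\<close> write the section as
  \<open>T a0 \<alpha>\<close> applied to a polynomial \<open>u\<close> with coefficients in
  \<open>E\<close>. By \<open>nabm_T\<close> its derivative is the image of the derivative of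
  \<open>u\<close> in that chart. This consists of the terms \<open>nab (w c)\<close>, logarithmic
  by assumption, and of endomorphism-valued logarithmic forms \<open>gam e [\<alpha>]\<close>
  applied to sections.\<close>

lemma nabm_bundle_form:
  assumes p: "p \<in> points X" and s: "s \<in> Em p"
  shows "bundle_form S' Em p 1 (nabm s)"
proof -
  obtain \<alpha> where \<alpha>: "\<alpha> \<in> I" "p \<in> U \<alpha>" using p by (rule cover_point)
  obtain u where sv: "s \<in> vecs r" and u: "u \<in> PE p" and su: "\<And>i. s i - mat_vec r (T a0 \<alpha>) u i \<in> nl"
    using s Em_iff [OF p \<alpha>] by blast
  obtain A where A: "finite A" "u = (\<lambda>i. \<Sum>c\<in>A. Poly_Mapping.single c (Poly_Mapping.lookup (u i) c))"
    "\<And>c. (\<lambda>i. Poly_Mapping.lookup (u i) c) \<in> E p" using PE_expand [OF p u] by blast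
  define w where "w c i = Poly_Mapping.lookup (u i) c" for c i
  have w: "w c \<in> E p" for c using A(3) by (simp add: w_def [abs_def])
  have u_eq: "u h = (\<Sum>c\<in>A. Poly_Mapping.single c (w c h))" for h
    using A(2) unfolding w_def by meson
  let ?t = "\<lambda>c \<xi> i vs. mat_vec r (T a0 \<alpha>) (\<lambda>h. Poly_Mapping.single c (\<xi> h vs)) i"
  let ?\<phi> = "\<lambda>c e h vs. \<Sum>j<r. gam e [\<alpha>] h j vs * w c j"
  define \<zeta> where "\<zeta> = (\<Sum>c\<in>A. ?t c (nab (w c))) + (\<Sum>c\<in>A. \<Sum>e\<in>expo N m. ?t (e + c) (?\<phi> c e))"
  have "bundle_form S E p 1 (?\<phi> c e)" for c e
    using cochains_form [OF gam_C1 p, of "[\<alpha>]" e] \<alpha>(2) by (intro bundle_form_End [OF p w]) simp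
  then have bf: "bundle_form S' Em p 1 \<zeta>"
    unfolding \<zeta>_def by (intro bundle_form.intros(2) bundle_form_sum [OF p] bundle_form_T [OF \<alpha> p] nab_form [OF p w])
  have "nabm s i vs - \<zeta> i vs \<in> nl" for i vs
  proof (cases "i < r")
    case True
    let ?\<eta> = "\<lambda>h. (\<Sum>j<r. K \<alpha> h j vs * u j) + ext_d S' (fn_form (u h)) vs"
    have \<eta>: "?\<eta> h = (\<Sum>c\<in>A. Poly_Mapping.single c (nab (w c) h vs)) + (\<Sum>c\<in>A. \<Sum>e\<in>expo N m. Poly_Mapping.single (e + c) (?\<phi> c e h vs))" for h
    proof -
      have s1: "(\<Sum>j<r. Poly_Mapping.single a (f j)) = Poly_Mapping.single a (\<Sum>j<r. f j)" for f :: "nat \<Rightarrow> 'f" and a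
        by (rule poly_mapping_eqI) (simp add: lookup_sum lookup_single when_def)
      have "fn_form (u h) = (\<Sum>c\<in>A. sf c (fn_form (w c h)))"
        by (rule ext) (simp add: u_eq sum_fun_apply sf_def fn_form_def)
      then have "ext_d S' (fn_form (u h)) vs = (\<Sum>c\<in>A. Poly_Mapping.single c (d (fn_form (w c h)) vs))"
        by (simp add: th.d_sum ext_d_sf sum_fun_apply) (simp add: sf_def)
      moreover have "(\<Sum>j<r. K \<alpha> h j vs * u j) = (\<Sum>c\<in>A. Poly_Mapping.single c (\<Sum>j<r. w c j * Gam h j vs))
          + (\<Sum>c\<in>A. \<Sum>e\<in>expo N m. Poly_Mapping.single (e + c) (?\<phi> c e h vs))"
      proof -
        have "(\<Sum>j<r. K \<alpha> h j vs * u j) = (\<Sum>j<r. \<Sum>c\<in>A. K \<alpha> h j vs * Poly_Mapping.single c (w c j))"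
          by (simp only: u_eq sum_distrib_left)
        also have "\<dots> = (\<Sum>c\<in>A. \<Sum>j<r. K \<alpha> h j vs * Poly_Mapping.single c (w c j))"
          by (rule sum.swap)
        also have "\<dots> = (\<Sum>c\<in>A. Poly_Mapping.single c (\<Sum>j<r. w c j * Gam h j vs)
            + (\<Sum>e\<in>expo N m. Poly_Mapping.single (e + c) (?\<phi> c e h vs)))"
        proof (rule sum.cong [OF refl])
          fix c
          have comm: "Gam h j vs * w c j = w c j * Gam h j vs" for j by (rule mult.commute)
          have "(\<Sum>j<r. K \<alpha> h j vs * Poly_Mapping.single c (w c j)) = (\<Sum>j<r. Poly_Mapping.single c (w c j * Gam h j vs))
            + (\<Sum>j<r. \<Sum>e\<in>expo N m. Poly_Mapping.single (e + c) (gam e [\<alpha>] h j vs * w c j))"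
            by (simp add: K_def sf_def G_def ps_def distrib_right sum.distrib sum_distrib_right mult_single comm)
          also have "(\<Sum>j<r. \<Sum>e\<in>expo N m. Poly_Mapping.single (e + c) (gam e [\<alpha>] h j vs * w c j))
            = (\<Sum>e\<in>expo N m. Poly_Mapping.single (e + c) (?\<phi> c e h vs))"
            by (subst sum.swap) (simp only: s1)
          finally show "(\<Sum>j<r. K \<alpha> h j vs * Poly_Mapping.single c (w c j)) = Poly_Mapping.single c (\<Sum>j<r. w c j * Gam h j vs)
            + (\<Sum>e\<in>expo N m. Poly_Mapping.single (e + c) (?\<phi> c e h vs))" by (simp only: s1)
        qed
        finally show ?thesis by (simp only: sum.distrib)
      qed
      ultimately show ?thesis
        by (simp add: nab_expand [OF E_vecs [OF p w]] sum_fun_apply scl_apply single_add sum.distrib)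
    qed
    have "(\<Sum>h<r. T a0 \<alpha> i h * ?\<eta> h) = mat_vec r (T a0 \<alpha>) ?\<eta> i" using True by (simp add: mat_vec_def)
    also have "\<dots> = \<zeta> i vs"
    proof -
      have "mat_vec r (T a0 \<alpha>) (\<lambda>h. x h + y h) i = mat_vec r (T a0 \<alpha>) x i + mat_vec r (T a0 \<alpha>) y i" for x y
        by (simp add: mat_vec_def distrib_left sum.distrib)
      then show ?thesis unfolding \<eta> \<zeta>_def by (simp add: mat_vec_sum sum_fun_apply)
    qed
    finally have "nabm (mat_vec r (T a0 \<alpha>) u) i vs - \<zeta> i vs \<in> nl" using nabm_T [OF \<alpha>(1) True, of u vs] by simp
    from nl_add [OF nabm_cong [of s _ i vs, OF su] this] show ?thesis by simp
  next
    case False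
    then have "\<zeta> i vs = 0" by (simp add: \<zeta>_def sum_fun_apply mat_vec_def)
    then show ?thesis using nabm_outside [OF sv] False by (simp add: nl_0)
  qed
  then show ?thesis by (intro bundle_form.intros(3) [OF bf] allI)
qed

lemma connection_nabm: "connection S' r Em nabm"
  unfolding connection_def
proof (intro conjI ballI allI impI)
  fix s :: "nat \<Rightarrow> 'f mpoly" and i vs assume "\<forall>i. s i \<in> nl"
  then show "nabm s i vs \<in> nl" by (intro nabm_nl) simp
next
  fix s s' :: "nat \<Rightarrow> 'f mpoly" and i vs
  show "nabm (s + s') i vs - (nabm s i vs + nabm s' i vs) \<in> nl" by (simp add: nabm_add nl_0)
next
  fix c and s :: "nat \<Rightarrow> 'f mpoly" and i vs assume "c \<in> base S'"
  then obtain P where "c = em P" by auto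
  then show "nabm (\<lambda>j. c * s j) i vs - c * nabm s i vs \<in> nl" by (simp add: nabm_mult ext_d_em nl_0)
next
  fix f and s :: "nat \<Rightarrow> 'f mpoly" and i vs
  show "nabm (\<lambda>j. f * s j) i vs - (f * nabm s i vs + s i * ext_d S' (fn_form f) vs) \<in> nl"
    by (simp add: nabm_mult nl_0)
qed (rule nabm_bundle_form, simp_all)

lemma nabm_unit: "j < r \<Longrightarrow> nabm (unit_vec r j) i = K a0 i j"
proof
  fix vs assume j: "j < r"
  have "(\<Sum>h<r. K a0 i h vs * unit_vec r j h) = (\<Sum>h<r. if h = j then K a0 i h vs else 0)"
    using j by (intro sum.cong) (auto simp: unit_vec_def)
  moreover have "ext_d S' (fn_form (unit_vec r j i :: 'f mpoly)) = 0"
    by (cases "i = j \<and> j < r") (simp_all add: unit_vec_def)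
  ultimately show "nabm (unit_vec r j) i vs = K a0 i j vs" using j by (simp add: nabm_def)
qed

text \<open>The double derivatives of the entries of \<open>s\<close> vanish and the mixed terms
  cancel, since the connection matrix anticommutes with exact 1-forms. What remains is the curvature
  of \<open>K a0\<close> applied to \<open>s\<close>.\<close>

lemma integrable_nabm: "conn_ext S' r nabm (nabm s) i vs \<in> nl"
proof -
  have Kp: "pure (ders S') 1 (K a0 i j)" for i j using K_pure by simp
  have comm: "wedge (K a0 i j) (ext_d S' (fn_form f)) = - wedge (ext_d S' (fn_form f)) (K a0 i j)" for i j f
  proof -
    have "eps (ext_d S' (fn_form f)) = - ext_d S' (fn_form f)"
      using eps_pure [OF th.pure_d_fn, of f] by (simp add: scl_minus_one)
    then show ?thesis using wedge_1_comm [OF Kp, of i j "ext_d S' (fn_form f)"] by (simp add: wedge_minus_left)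
  qed
  have "conn_ext S' r nabm (nabm s) i = (\<Sum>j<r. wedge (K a0 i j) (nabm s j)) + ext_d S' (nabm s i)"
    by (rule ext) (simp add: conn_ext_def nabm_unit sum_fun_apply)
  also have "(\<Sum>j<r. wedge (K a0 i j) (nabm s j)) = (\<Sum>l<r. scl (s l) (mw r (K a0) (K a0) i l))
      - (\<Sum>j<r. wedge (ext_d S' (fn_form (s j))) (K a0 i j))"
  proof -
    have "(\<Sum>j<r. wedge (K a0 i j) (nabm s j)) = (\<Sum>j<r. \<Sum>l<r. scl (s l) (wedge (K a0 i j) (K a0 j l)))
        - (\<Sum>j<r. wedge (ext_d S' (fn_form (s j))) (K a0 i j))"
      by (simp add: nabm_form wedge_add_right wedge_sum_right wedge_scl_right comm sum_subtractf)
    then show ?thesis by (subst (asm) sum.swap) (simp add: mw_def scl_sum)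
  qed
  also have "ext_d S' (nabm s i) = (\<Sum>j<r. wedge (ext_d S' (fn_form (s j))) (K a0 i j)) + (\<Sum>l<r. scl (s l) (md S' (K a0) i l))"
    by (simp add: nabm_form th.d_add th.d_sum th.d_scl [OF Kp] sum.distrib md_def)
  finally have "conn_ext S' r nabm (nabm s) i = (\<Sum>l<r. scl (s l) ((md S' (K a0) + mw r (K a0) (K a0)) i l))"
    by (simp add: scl_add sum.distrib) (simp add: fun_eq_iff add.commute)
  then have "conn_ext S' r nabm (nabm s) i vs = (\<Sum>l<r. s l * (md S' (K a0) + mw r (K a0) (K a0)) i l vs)"
    by (simp only: sum_fun_apply scl_apply)
  then show ?thesis using K_flat [OF a0] by (simp add: nl_sum nl_mult)
qed

lemma integrable_log_connection_nabm: "integrable_log_connection S' r Em nabm"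
  unfolding integrable_log_connection_def
  using vector_bundle_Em connection_nabm integrable_nabm by blast

end

section \<open>Comparison with the universal first order deformation\<close>

lemma expo_1: "expo N 1 = insert 0 ((\<lambda>l. Poly_Mapping.single l 1) ` {..<N})"
proof (intro set_eqI iffI)
  fix c assume c: "c \<in> expo N 1"
  then consider "mdeg c = 0" | "mdeg c = 1" by (force simp: expo_def)
  then show "c \<in> insert 0 ((\<lambda>l. Poly_Mapping.single l 1) ` {..<N})"
  proof cases
    case 1
    then show ?thesis by (simp add: mdeg_eq_0_iff)
  next
    case 2
    then obtain l where l: "c = Poly_Mapping.single l 1" unfolding mdeg_1 by blast
    then have "l < N" using c by (simp add: expo_def)
    then show ?thesis using l by blast
  qed
qed (auto simp: expo_def mdeg_def)

context mc_thickening
begin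

text \<open>Puts the coefficientwise pullback into the form of \<open>nabm\<close>, so that in the
  chart \<open>a0\<close> the two connections differ exactly by the matrix
  \<open>G [a0]\<close>.\<close>

lemma pull_conn_expand:
  assumes s: "s \<in> vecs r"
  shows "pull_conn r nab s i vs = (\<Sum>j<r. Poly_Mapping.single 0 (Gam i j vs) * s j) + ext_d S' (fn_form (s i)) vs"
proof -
  let ?A = "\<Union>j<r. Poly_Mapping.keys (s j)"
  let ?w = "\<lambda>c j. Poly_Mapping.lookup (s j) c"
  have wv: "?w c \<in> vecs r" for c using s by (simp add: vecs_def)
  have s_eq: "s h = (\<Sum>c\<in>?A. Poly_Mapping.single c (?w c h))" for h
  proof -
    have "s h = (\<Sum>c\<in>Poly_Mapping.keys (s h). Poly_Mapping.single c (?w c h))"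
      by (simp only: poly_mapping_sum_single)
    also have "\<dots> = (\<Sum>c\<in>?A. Poly_Mapping.single c (?w c h))"
    proof (cases "h < r")
      case True
      then show ?thesis by (intro sum.mono_neutral_left) (auto simp: in_keys_iff)
    next
      case False
      then have "s h = 0" using s by (simp add: vecs_def)
      then show ?thesis by simp
    qed
    finally show ?thesis .
  qed
  have s1: "(\<Sum>j<r. Poly_Mapping.single a (f j)) = Poly_Mapping.single a (\<Sum>j<r. f j)" for f :: "nat \<Rightarrow> 'f" and a
    by (rule poly_mapping_eqI) (simp add: lookup_sum lookup_single when_def)
  have "fn_form (s i) = (\<Sum>c\<in>?A. sf c (fn_form (?w c i)))"
  proof
    fix us
    show "fn_form (s i) us = (\<Sum>c\<in>?A. sf c (fn_form (?w c i))) us"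
      using s_eq [of i] by (simp add: sum_fun_apply sf_def fn_form_def)
  qed
  then have e: "ext_d S' (fn_form (s i)) vs = (\<Sum>c\<in>?A. Poly_Mapping.single c (d (fn_form (?w c i)) vs))"
    by (simp add: th.d_sum ext_d_sf sum_fun_apply) (simp add: sf_def)
  have "(\<Sum>j<r. Poly_Mapping.single 0 (Gam i j vs) * s j)
      = (\<Sum>j<r. \<Sum>c\<in>?A. Poly_Mapping.single c (?w c j * Gam i j vs))"
  proof (rule sum.cong [OF refl])
    fix j
    have "Poly_Mapping.single 0 (Gam i j vs) * s j = Poly_Mapping.single 0 (Gam i j vs) * (\<Sum>c\<in>?A. Poly_Mapping.single c (?w c j))"
      using s_eq [of j] by simp
    then show "Poly_Mapping.single 0 (Gam i j vs) * s j = (\<Sum>c\<in>?A. Poly_Mapping.single c (?w c j * Gam i j vs))"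
      by (simp add: sum_distrib_left mult_single mult.commute [of "Gam i j vs"] del: S'_simps)
  qed
  also have "\<dots> = (\<Sum>c\<in>?A. Poly_Mapping.single c (\<Sum>j<r. ?w c j * Gam i j vs))"
    by (subst sum.swap) (simp only: s1)
  finally show ?thesis
    by (simp add: pull_conn_def nab_expand [OF wv] e sum_fun_apply scl_apply single_add sum.distrib)
qed

text \<open>Since \<open>Em\<close> is written in the chart \<open>a0\<close>, the comparison map is
  an inverse \<open>\<theta>'\<close> of the trivialisation \<open>\<theta> a0\<close> of
  \<open>E1\<close>. At another point one uses a chart \<alpha> around it: modulo quadratic terms
  \<open>T a0 \<alpha>\<close> is the given gluing automorphism, so \<open>\<theta> a0\<close>
  agrees with \<open>T a0 \<alpha>\<close> after \<open>\<theta> \<alpha>\<close>, and the latter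
  maps \<open>E1\<close> onto the pullback of \<open>E\<close>.\<close>

lemma first_order_restriction:
  assumes th1: "thickening X D r E nab I U J1 N 1" and J1: "J \<subseteq> J1" and m: "m \<ge> 1"
    and gam_z: "\<And>l. l < N \<Longrightarrow> gam (Poly_Mapping.single l 1) = z l"
    and def1: "first_order_deformation (log_space_times X D J1) r E nab I U N z E1 nab1"
  shows "\<exists>\<theta>. conn_iso (log_space_times X D J1) r (points X) (restrict_bundle (log_space_times X D J1) r Em) nabm E1 nab1 \<theta>"
proof -
  interpret o: thickening X D r E nab I U J1 N 1 by (rule th1)
  let ?S1 = "log_space_times X D J1"
  let ?n1 = "nul ?S1"
  have nl: "x \<in> ?n1" if "x \<in> nl" for x
    using that J1 unfolding nl_def o.nl_def by blast
  \<comment> \<open>Modulo the ideal of \<open>W\<^sub>1\<close> the linear part survives; there is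
    no constant term by \<open>gam_0\<close>, and the linear coefficients are the chosen cocycles by
    \<open>gam_z\<close>.\<close>
  have G_lin: "G l i j vs - lin_poly N (\<lambda>k. z k l i j vs) \<in> ?n1" for l i j vs
  proof -
    have sub: "expo N 1 \<subseteq> expo N m" using m by (auto simp: expo_def)
    have "G l i j vs = (\<Sum>c\<in>expo N 1. Poly_Mapping.single c (gam c l i j vs)) + (\<Sum>c\<in>expo N m - expo N 1. Poly_Mapping.single c (gam c l i j vs))"
      unfolding G_def ps_def by (simp add: sum.subset_diff [OF sub finite_expo] add.commute)
    moreover have "(\<Sum>c\<in>expo N 1. Poly_Mapping.single c (gam c l i j vs)) = lin_poly N (\<lambda>k. z k l i j vs)"
    proof -
      have "inj_on (\<lambda>l. Poly_Mapping.single l (1::nat)) {..<N}"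
        by (auto simp: inj_on_def poly_mapping_eq_iff fun_eq_iff lookup_single when_def split: if_splits)
      moreover have "0 \<notin> (\<lambda>l. Poly_Mapping.single l (1::nat)) ` {..<N}"
        by (auto dest!: arg_cong [where f = mdeg] simp: mdeg_def)
      ultimately show ?thesis
        unfolding expo_1 lin_poly_def by (simp add: gam_0 sum.reindex) (use gam_z in simp)
    qed
    ultimately have "G l i j vs - lin_poly N (\<lambda>k. z k l i j vs) = (\<Sum>c\<in>expo N m - expo N 1. Poly_Mapping.single c (gam c l i j vs))"
      by simp
    also have "\<dots> \<in> ?n1" by (intro o.nl_sum o.nl_outside) simp
    finally show ?thesis .
  qed
  obtain \<theta> where iso: "\<And>\<alpha>. \<alpha> \<in> I \<Longrightarrow> conn_iso ?S1 r (U \<alpha>) E1 nab1 (pull_bundle ?S1 r E)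
              (\<lambda>s i vs. pull_conn r nab s i vs + (\<Sum>j<r. lin_poly N (\<lambda>l. z l [\<alpha>] i j vs) * s j)) (\<theta> \<alpha>)"
    and gl: "\<And>\<alpha> \<beta> i j. \<alpha> \<in> I \<Longrightarrow> \<beta> \<in> I \<Longrightarrow> i < r \<Longrightarrow> j < r \<Longrightarrow>
        \<theta> \<alpha> i j - (\<theta> \<beta> i j + (\<Sum>h<r. lin_poly N (\<lambda>l. z l [\<alpha>, \<beta>] i h []) * \<theta> \<beta> h j)) \<in> ?n1"
    using def1 unfolding first_order_deformation_def by (elim conjE exE) blast
  obtain \<theta>' where inv: "mat_inverses ?S1 r (\<theta> a0) \<theta>'"
    using iso [OF a0] unfolding conn_iso_def by blast
  define eqv where "eqv s s' \<longleftrightarrow> (\<forall>i. s i - s' i \<in> ?n1)" for s s' :: "nat \<Rightarrow> 'f mpoly"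
  have eqv_sym: "eqv s' s" if "eqv s s'" for s s'
    using that o.nl_minus unfolding eqv_def by (metis minus_diff_eq)
  have eqv_trans [trans]: "eqv s s''" if "eqv s s'" "eqv s' s''" for s s' s''
    unfolding eqv_def
  proof
    fix i show "s i - s'' i \<in> ?n1" using o.nl_add [of "s i - s' i" "s' i - s'' i"] that by (simp add: eqv_def)
  qed
  have eqv_mat: "eqv (mat_vec r M s) (mat_vec r M s')" if "eqv s s'" for M s s'
    using that o.mat_vec_nl unfolding eqv_def by blast
  have eqv_M: "eqv (mat_vec r M s) (mat_vec r M' s)" if "\<And>i j. i < r \<Longrightarrow> j < r \<Longrightarrow> M i j - M' i j \<in> ?n1" for M M' s
    unfolding eqv_def
  proof
    fix i
    have "(\<Sum>j<r. M i j * s j) - (\<Sum>j<r. M' i j * s j) = (\<Sum>j<r. (M i j - M' i j) * s j)"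
      by (simp add: sum_subtractf left_diff_distrib)
    moreover have "i < r \<Longrightarrow> (\<Sum>j<r. (M i j - M' i j) * s j) \<in> ?n1"
      using that by (intro o.nl_sum o.nl_mult_right) simp
    ultimately show "mat_vec r M s i - mat_vec r M' s i \<in> ?n1" by (simp add: mat_vec_def o.nl_0)
  qed
  have inv_vec: "eqv (mat_vec r (\<theta> a0) (mat_vec r \<theta>' s)) s" "eqv (mat_vec r \<theta>' (mat_vec r (\<theta> a0) s)) s" if "s \<in> vecs r" for s
  proof -
    have "eqv (mat_vec r (mm (\<theta> a0) \<theta>') s) (mat_vec r idm s)" "eqv (mat_vec r (mm \<theta>' (\<theta> a0)) s) (mat_vec r idm s)"
      using inv by (intro eqv_M; simp add: mat_inverses_def mm_def idm_def)+
    moreover have "mat_vec r idm s = s" by (rule mat_vec_idm [OF that]) simp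
    ultimately show "eqv (mat_vec r (\<theta> a0) (mat_vec r \<theta>' s)) s" "eqv (mat_vec r \<theta>' (mat_vec r (\<theta> a0) s)) s"
      by (simp_all add: mat_vec_mm)
  qed
  have T\<theta>: "eqv (mat_vec r (\<theta> a0) s) (mat_vec r (T a0 \<alpha>) (mat_vec r (\<theta> \<alpha>) s))" if "\<alpha> \<in> I" for \<alpha> s
    unfolding mat_vec_mm [symmetric]
  proof (rule eqv_M)
    fix i j assume i: "i < r" "j < r"
    let ?l = "\<lambda>h. lin_poly N (\<lambda>l. z l [a0, \<alpha>] i h [])"
    have "mm (T a0 \<alpha>) (\<theta> \<alpha>) i j = (\<Sum>h<r. if i = h then \<theta> \<alpha> h j else 0) + (\<Sum>h<r. G [a0, \<alpha>] i h [] * \<theta> \<alpha> h j)"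
      unfolding mm_def sum.distrib [symmetric] by (intro sum.cong refl) (simp add: T_def distrib_right)
    then have "\<theta> a0 i j - mm (T a0 \<alpha>) (\<theta> \<alpha>) i j = (\<theta> a0 i j - (\<theta> \<alpha> i j + (\<Sum>h<r. ?l h * \<theta> \<alpha> h j)))
        - (\<Sum>h<r. (G [a0, \<alpha>] i h [] - ?l h) * \<theta> \<alpha> h j)"
      using i by (simp add: left_diff_distrib sum_subtractf)
    also have "\<dots> \<in> ?n1"
      by (rule o.nl_diff [OF gl [OF a0 that i] o.nl_sum]) (rule o.nl_mult_right [OF G_lin])
    finally show "\<theta> a0 i j - mm (T a0 \<alpha>) (\<theta> \<alpha>) i j \<in> ?n1" .
  qed
  have pull: "pull_bundle ?S1 r E p = {s \<in> vecs r. \<exists>u\<in>PE p. eqv s u}" for p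
    by (auto simp: pull_bundle_def PE_def eqv_def)
  have T_inv: "eqv (mat_vec r (T \<alpha> a0) (mat_vec r (T a0 \<alpha>) u)) u" if "\<alpha> \<in> I" "u \<in> vecs r" for \<alpha> u
  proof -
    have "eqv (mat_vec r (mm (T \<alpha> a0) (T a0 \<alpha>)) u) (mat_vec r idm u)"
    proof (rule eqv_M)
      fix i j assume i: "i < r" "j < r"
      have "mm (T \<alpha> a0) (T a0 \<alpha>) i j - idm i j \<in> nl"
        using nl_add [OF T_T [OF that(1) a0 that(1) i] T_refl [OF that(1) i]] by (simp add: mm_def idm_def)
      then show "mm (T \<alpha> a0) (T a0 \<alpha>) i j - idm i j \<in> ?n1" by (rule nl)
    qed
    moreover have "mat_vec r idm u = u" by (rule mat_vec_idm [OF that(2)]) simp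
    ultimately show ?thesis by (simp add: mat_vec_mm)
  qed
  have "conn_iso ?S1 r (points X) (restrict_bundle ?S1 r Em) nabm E1 nab1 \<theta>'"
    unfolding conn_iso_def
  proof (intro conjI ballI allI impI)
    show "\<exists>\<theta>''. mat_inverses ?S1 r \<theta>' \<theta>''" using inv unfolding mat_inverses_def by blast
  next
    fix p and s :: "nat \<Rightarrow> 'f mpoly" assume p: "p \<in> points X" and s: "s \<in> vecs r"
    obtain \<alpha> where \<alpha>: "\<alpha> \<in> I" "p \<in> U \<alpha>" using p by (rule cover_point)
    define u where "u = mat_vec r (\<theta> \<alpha>) (mat_vec r \<theta>' s)"
    have uv: "u \<in> vecs r" by (simp add: u_def mat_vec_vecs)
    have E1: "mat_vec r \<theta>' s \<in> E1 p \<longleftrightarrow> u \<in> pull_bundle ?S1 r E p"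
      using iso [OF \<alpha>(1)] \<alpha>(2) mat_vec_vecs unfolding conn_iso_def u_def by blast
    have sT: "eqv s (mat_vec r (T a0 \<alpha>) u)"
      unfolding u_def using eqv_trans [OF eqv_sym [OF inv_vec(1) [OF s]] T\<theta> [OF \<alpha>(1)]] .
    show "s \<in> restrict_bundle ?S1 r Em p \<longleftrightarrow> mat_vec r \<theta>' s \<in> E1 p"
      unfolding E1
    proof
      assume "s \<in> restrict_bundle ?S1 r Em p"
      then obtain s' where s': "s' \<in> Em p" "eqv s s'" by (auto simp: restrict_bundle_def eqv_def)
      then obtain u' where u': "u' \<in> PE p" "\<And>i. s' i - mat_vec r (T a0 \<alpha>) u' i \<in> nl"
        using Em_iff [OF p \<alpha>] by blast
      have "eqv s' (mat_vec r (T a0 \<alpha>) u')" using u'(2) nl by (simp add: eqv_def)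
      then have "eqv (mat_vec r (T a0 \<alpha>) u) (mat_vec r (T a0 \<alpha>) u')"
        using eqv_trans eqv_sym sT s'(2) by blast
      then have "eqv (mat_vec r (T \<alpha> a0) (mat_vec r (T a0 \<alpha>) u)) (mat_vec r (T \<alpha> a0) (mat_vec r (T a0 \<alpha>) u'))"
        by (rule eqv_mat)
      then have "eqv u u'"
        using eqv_trans [OF eqv_sym [OF T_inv [OF \<alpha>(1) uv]]] eqv_trans [OF _ T_inv [OF \<alpha>(1) PE_vecs [OF p u'(1)]]] by blast
      then show "u \<in> pull_bundle ?S1 r E p" unfolding pull using uv u'(1) by blast
    next
      assume "u \<in> pull_bundle ?S1 r E p"
      then obtain u' where u': "u' \<in> PE p" "eqv u u'" unfolding pull by blast
      have "mat_vec r (T a0 \<alpha>) u' \<in> Em p"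
        unfolding Em_iff [OF p \<alpha>] by (intro conjI mat_vec_vecs bexI [OF _ u'(1)]) (simp add: nl_0)
      moreover have "eqv s (mat_vec r (T a0 \<alpha>) u')"
        using eqv_trans [OF sT eqv_mat [OF u'(2)]] .
      ultimately show "s \<in> restrict_bundle ?S1 r Em p"
        using s unfolding restrict_bundle_def eqv_def by blast
    qed
  next
    fix s :: "nat \<Rightarrow> 'f mpoly" and i vs assume s: "s \<in> vecs r" and i: "i < r"
    let ?u = "mat_vec r \<theta>' s"
    \<comment> \<open>The differential involves only derivations and their lift, so it is the same
      over both thickenings.\<close>
    have ext: "ext_d ?S1 = ext_d S'" by (intro ext) (simp add: ext_d_def)
    have nabm1: "nabm w k vs \<in> ?n1" if "\<And>i. w i \<in> ?n1" for w k
    proof -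
      have "ext_d S' (fn_form (w k)) vs \<in> ?n1" using o.fn_form_apply_nl [OF that] by (simp add: ext)
      then show ?thesis unfolding nabm_def using that by (intro o.nl_add o.nl_sum o.nl_mult)
    qed
    have h: "nabm s k vs - (\<Sum>j<r. \<theta> a0 k j * nab1 ?u j vs) \<in> ?n1" if k: "k < r" for k
    proof -
      let ?w = "mat_vec r (\<theta> a0) ?u"
      have wv: "?w \<in> vecs r" by (rule mat_vec_vecs)
      have 1: "(pull_conn r nab ?w k vs + (\<Sum>j<r. lin_poly N (\<lambda>l. z l [a0] k j vs) * ?w j)) - (\<Sum>j<r. \<theta> a0 k j * nab1 ?u j vs) \<in> ?n1"
      proof -
        have "\<forall>s\<in>vecs r. \<forall>i<r. \<forall>vs. (pull_conn r nab (mat_vec r (\<theta> a0) s) i vs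
            + (\<Sum>j<r. lin_poly N (\<lambda>l. z l [a0] i j vs) * mat_vec r (\<theta> a0) s j)) - (\<Sum>j<r. \<theta> a0 i j * nab1 s j vs) \<in> ?n1"
          using iso [OF a0] unfolding conn_iso_def by (elim conjE)
        from this [rule_format, OF mat_vec_vecs k] show ?thesis .
      qed
      have "nabm ?w k vs - (pull_conn r nab ?w k vs + (\<Sum>j<r. lin_poly N (\<lambda>l. z l [a0] k j vs) * ?w j))
          = (\<Sum>j<r. (G [a0] k j vs - lin_poly N (\<lambda>l. z l [a0] k j vs)) * ?w j)"
        by (simp add: nabm_def pull_conn_expand [OF wv] K_def sf_def distrib_right left_diff_distrib sum.distrib sum_subtractf)
      also have "\<dots> \<in> ?n1" using G_lin by (intro o.nl_sum o.nl_mult_right)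
      finally have 2: "nabm ?w k vs - (pull_conn r nab ?w k vs + (\<Sum>j<r. lin_poly N (\<lambda>l. z l [a0] k j vs) * ?w j)) \<in> ?n1" .
      have 3: "nabm s k vs - nabm ?w k vs \<in> ?n1"
        using nabm1 [of "s - ?w" k] nabm_add [of "s - ?w" ?w k vs] eqv_sym [OF inv_vec(1) [OF s]] by (simp add: eqv_def)
      from o.nl_add [OF 3 o.nl_add [OF 2 1]] show ?thesis by simp
    qed
    \<comment> \<open>Relation \<open>h\<close> expresses \<open>nabm s\<close> through
      \<open>\<theta> a0\<close> and has to be inverted. The inverse relation \<open>inv_vec\<close>
      needs a vector in \<open>vecs r\<close>, so the components beyond \<open>r\<close> are cut off
      first.\<close>
    have nv: "eqv (mat_vec r \<theta>' (mat_vec r (\<theta> a0) (\<lambda>j. if j < r then nab1 ?u j vs else 0))) (\<lambda>j. if j < r then nab1 ?u j vs else 0)"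
      by (rule inv_vec(2)) (simp add: vecs_def)
    have "eqv (mat_vec r \<theta>' (mat_vec r (\<theta> a0) (\<lambda>j. if j < r then nab1 ?u j vs else 0))) (mat_vec r \<theta>' (\<lambda>j. if j < r then nabm s j vs else 0))"
    proof (rule eqv_mat)
      have "(\<Sum>j<r. \<theta> a0 k j * (if j < r then nab1 ?u j vs else 0)) = (\<Sum>j<r. \<theta> a0 k j * nab1 ?u j vs)" for k
        by (intro sum.cong) auto
      then have "eqv (\<lambda>j. if j < r then nabm s j vs else 0) (mat_vec r (\<theta> a0) (\<lambda>j. if j < r then nab1 ?u j vs else 0))"
        using h by (simp add: eqv_def mat_vec_def o.nl_0)
      then show "eqv (mat_vec r (\<theta> a0) (\<lambda>j. if j < r then nab1 ?u j vs else 0)) (\<lambda>j. if j < r then nabm s j vs else 0)"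
        by (rule eqv_sym)
    qed
    then have "eqv (\<lambda>j. if j < r then nab1 ?u j vs else 0) (mat_vec r \<theta>' (\<lambda>j. if j < r then nabm s j vs else 0))"
      using eqv_trans [OF eqv_sym [OF nv]] by blast
    then have "(if i < r then nab1 ?u i vs else 0) - mat_vec r \<theta>' (\<lambda>j. if j < r then nabm s j vs else 0) i \<in> ?n1"
      unfolding eqv_def by (rule spec)
    moreover have "mat_vec r \<theta>' (\<lambda>j. if j < r then nabm s j vs else 0) i = (\<Sum>j<r. \<theta>' i j * nabm s j vs)"
      using i by (simp add: mat_vec_def)
    ultimately show "nab1 ?u i vs - (\<Sum>j<r. \<theta>' i j * nabm s j vs) \<in> ?n1" using i by simp
  qed
  then show ?thesis by (rule exI [of _ \<theta>'])
qed

end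

section \<open>Ideals of power series\<close>

lemma lookup_mult_splits:
  fixes P Q :: "'a::comm_ring_1 mpoly"
  shows "Poly_Mapping.lookup (P * Q) c = (\<Sum>p\<in>splits c. Poly_Mapping.lookup P (fst p) * Poly_Mapping.lookup Q (snd p))"
proof (rule mpoly_mult_induct [where P = P and Q = Q and R = "\<lambda>P Q. Poly_Mapping.lookup (P * Q) c
    = (\<Sum>p\<in>splits c. Poly_Mapping.lookup P (fst p) * Poly_Mapping.lookup Q (snd p))"])
  fix a b and x y :: 'a
  have "(\<Sum>p\<in>splits c. Poly_Mapping.lookup (Poly_Mapping.single a x) (fst p) * Poly_Mapping.lookup (Poly_Mapping.single b y) (snd p))
      = (\<Sum>p\<in>splits c. if p = (a, b) then x * y else 0)"
    by (intro sum.cong) (auto simp: lookup_single when_def)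
  then show "Poly_Mapping.lookup (Poly_Mapping.single a x * Poly_Mapping.single b y) c
      = (\<Sum>p\<in>splits c. Poly_Mapping.lookup (Poly_Mapping.single a x) (fst p) * Poly_Mapping.lookup (Poly_Mapping.single b y) (snd p))"
    by (simp add: mult_single lookup_single when_def finite_splits) (simp add: splits_def)
qed (simp_all add: lookup_add distrib_left distrib_right sum.distrib)

lemma series_mult_splits: "series_mult g h c = (\<Sum>p\<in>splits c. g (fst p) * h (snd p))"
  unfolding series_mult_def splits_def by (intro sum.cong) auto

lemma series_mult_assoc: "series_mult (series_mult g h) k = series_mult g (series_mult h k)"
  using sum_splits_assoc [where F = "\<lambda>a b c. g a * h b * k c"]
  by (simp add: fun_eq_iff series_mult_splits sum_distrib_left sum_distrib_right mult.assoc)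

lemma series_mult_add_left: "series_mult (g + g') h = series_mult g h + series_mult g' h"
  and series_mult_add_right: "series_mult g (h + h') = series_mult g h + series_mult g h'"
  and series_mult_zero [simp]: "series_mult 0 h = 0" "series_mult g 0 = 0"
  by (simp_all add: fun_eq_iff series_mult_splits distrib_left distrib_right sum.distrib)

lemma series_mult_sum_right: "series_mult g (\<Sum>i\<in>A. h i) = (\<Sum>i\<in>A. series_mult g (h i))"
  by (induction A rule: infinite_finite_induct)
    (simp_all only: sum.infinite sum.empty sum.insert series_mult_zero series_mult_add_right not_False_eq_True)

definition mono_series :: "(nat \<Rightarrow>\<^sub>0 nat) \<Rightarrow> 'k \<Rightarrow> (nat \<Rightarrow>\<^sub>0 nat) \<Rightarrow> 'k::comm_ring_1" where
  "mono_series b a = (\<lambda>c. if c = b then a else 0)"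

lemma mono_series_power_series: "Poly_Mapping.keys b \<subseteq> {..<N} \<Longrightarrow> mono_series b a \<in> power_series N"
  by (auto simp: mono_series_def power_series_def)

lemma series_mult_one: "series_mult (mono_series 0 1) g = g"
proof
  fix c
  have "series_mult (mono_series 0 1) g c = (\<Sum>p\<in>splits c. if p = (0, c) then g c else 0)"
    unfolding series_mult_splits by (intro sum.cong) (auto simp: mono_series_def splits_def)
  then show "series_mult (mono_series 0 1) g c = g c"
    by (simp add: finite_splits) (simp add: splits_def)
qed

lemma power_series_mult:
  assumes "g \<in> power_series N" "h \<in> power_series N"
  shows "series_mult g h \<in> power_series N"
  unfolding power_series_def mem_Collect_eq series_mult_splits
proof (intro allI impI sum.neutral ballI)
  fix c p assume "\<not> Poly_Mapping.keys c \<subseteq> {..<N}" "p \<in> splits c"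
  then have "\<not> Poly_Mapping.keys (fst p) \<subseteq> {..<N} \<or> \<not> Poly_Mapping.keys (snd p) \<subseteq> {..<N}"
    by (auto simp: splits_def keys_add_nat)
  then have "g (fst p) = 0 \<or> h (snd p) = 0" using assms unfolding power_series_def by blast
  then show "g (fst p) * h (snd p) = 0" by auto
qed

lemma power_series_add: "g \<in> power_series N \<Longrightarrow> h \<in> power_series N \<Longrightarrow> g + h \<in> power_series N"
  and power_series_zero: "(0 :: (nat \<Rightarrow>\<^sub>0 nat) \<Rightarrow> 'k::comm_ring_1) \<in> power_series N"
  for g h :: "(nat \<Rightarrow>\<^sub>0 nat) \<Rightarrow> 'k::comm_ring_1"
  by (simp_all add: power_series_def)

lemma series_ideal_zero: "0 \<in> series_ideal N GG"
  unfolding series_ideal_def mem_Collect_eq by (intro exI [of _ "{}"] exI [of _ "\<lambda>_. 0"]) (simp add: power_series_zero)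

lemma series_ideal_gen: "g \<in> GG \<Longrightarrow> g \<in> series_ideal N GG"
  unfolding series_ideal_def mem_Collect_eq
  by (intro exI [of _ "{g}"] exI [of _ "\<lambda>_. mono_series 0 1"])
    (simp add: series_mult_one mono_series_power_series)

lemma series_ideal_add:
  assumes "x \<in> series_ideal N GG" "y \<in> series_ideal N GG"
  shows "x + y \<in> series_ideal N GG"
proof -
  obtain T h where T: "x = (\<Sum>g\<in>T. series_mult (h g) g)" "finite T" "T \<subseteq> GG" "\<forall>g\<in>T. h g \<in> power_series N"
    using assms(1) unfolding series_ideal_def by blast
  obtain T' h' where T': "y = (\<Sum>g\<in>T'. series_mult (h' g) g)" "finite T'" "T' \<subseteq> GG" "\<forall>g\<in>T'. h' g \<in> power_series N"
    using assms(2) unfolding series_ideal_def by blast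
  define e e' where "e g = (if g \<in> T then h g else 0)" and "e' g = (if g \<in> T' then h' g else 0)" for g
  have "x = (\<Sum>g\<in>T \<union> T'. series_mult (e g) g)"
    unfolding T(1) e_def using T(2) T'(2) by (intro sum.mono_neutral_cong_left) (auto simp: zero_fun_def [symmetric])
  moreover have "y = (\<Sum>g\<in>T \<union> T'. series_mult (e' g) g)"
    unfolding T'(1) e'_def using T(2) T'(2) by (intro sum.mono_neutral_cong_left) (auto simp: zero_fun_def [symmetric])
  ultimately have "x + y = (\<Sum>g\<in>T \<union> T'. series_mult (e g + e' g) g)"
    by (simp only: sum.distrib series_mult_add_left)
  moreover have "\<forall>g\<in>T \<union> T'. e g + e' g \<in> power_series N"
    using T(4) T'(4) by (auto simp: e_def e'_def intro!: power_series_add power_series_zero)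
  ultimately show ?thesis
    unfolding series_ideal_def mem_Collect_eq using T T'
    by (intro exI [of _ "T \<union> T'"] exI [of _ "\<lambda>g. e g + e' g"]) simp
qed

lemma series_ideal_mult:
  assumes "x \<in> series_ideal N GG" "k \<in> power_series N"
  shows "series_mult k x \<in> series_ideal N GG"
proof -
  obtain T h where T: "x = (\<Sum>g\<in>T. series_mult (h g) g)" "finite T" "T \<subseteq> GG" "\<forall>g\<in>T. h g \<in> power_series N"
    using assms(1) unfolding series_ideal_def by blast
  have "series_mult k x = (\<Sum>g\<in>T. series_mult (series_mult k (h g)) g)"
    unfolding T(1) series_mult_sum_right by (simp add: series_mult_assoc)
  then show ?thesis
    unfolding series_ideal_def mem_Collect_eq using T assms(2)
    by (intro exI [of _ T] exI [of _ "\<lambda>g. series_mult k (h g)"]) (simp add: power_series_mult)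
qed

lemma nbhd_ideal_expo: "nbhd_ideal N m Idl = {P. \<exists>g\<in>Idl. \<forall>c\<in>expo N m. Poly_Mapping.lookup P c = g c}"
  by (auto simp: nbhd_ideal_def expo_def)

text \<open>An ideal of power series yields an ideal of polynomials because coefficients of a
  product at exponents in \<open>expo N m\<close> depend only on coefficients at exponents in
  \<open>expo N m\<close>.\<close>

lemma (in covered_bundle) thickening_nbhd:
  assumes Idl: "0 \<in> Idl" "\<And>g h. g \<in> Idl \<Longrightarrow> h \<in> Idl \<Longrightarrow> g + h \<in> Idl"
    "\<And>g k. g \<in> Idl \<Longrightarrow> k \<in> power_series N \<Longrightarrow> series_mult k g \<in> Idl"
  shows "thickening X D r E nab I U (nbhd_ideal N m Idl) N m"
proof unfold_locales
  fix P Q assume "P \<in> nbhd_ideal N m Idl" "Q \<in> nbhd_ideal N m Idl"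
  then obtain g h where "g \<in> Idl" "h \<in> Idl" "\<forall>c\<in>expo N m. Poly_Mapping.lookup P c = g c" "\<forall>c\<in>expo N m. Poly_Mapping.lookup Q c = h c"
    unfolding nbhd_ideal_expo by blast
  then show "P + Q \<in> nbhd_ideal N m Idl"
    unfolding nbhd_ideal_expo mem_Collect_eq using Idl(2) by (intro bexI [of _ "g + h"]) (simp_all add: lookup_add)
next
  fix P b a assume "P \<in> nbhd_ideal N m Idl"
  then obtain g where g: "g \<in> Idl" "\<forall>c\<in>expo N m. Poly_Mapping.lookup P c = g c"
    unfolding nbhd_ideal_expo by blast
  have s: "snd p \<in> expo N m" "fst p \<in> expo N m" if "c \<in> expo N m" "p \<in> splits c" for c p
    using that expo_add [of "fst p" "snd p"] by (auto simp: splits_def)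
  show "Poly_Mapping.single b a * P \<in> nbhd_ideal N m Idl"
  proof (cases "Poly_Mapping.keys b \<subseteq> {..<N}")
    case True
    have "Poly_Mapping.lookup (Poly_Mapping.single b a * P) c = series_mult (mono_series b a) g c" if "c \<in> expo N m" for c
      unfolding lookup_mult_splits series_mult_splits
      using s [OF that] g(2) by (intro sum.cong) (auto simp: lookup_single when_def mono_series_def)
    then show ?thesis
      unfolding nbhd_ideal_expo mem_Collect_eq using Idl(3) [OF g(1) mono_series_power_series [OF True]]
      by (intro bexI [of _ "series_mult (mono_series b a) g"]) simp_all
  next
    case False
    have "Poly_Mapping.lookup (Poly_Mapping.single b a * P) c = 0" if "c \<in> expo N m" for c
      unfolding lookup_mult_splits
    proof (intro sum.neutral ballI)
      fix p assume "p \<in> splits c"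
      then have "fst p \<in> expo N m" by (rule s(2) [OF that])
      then have "b \<noteq> fst p" using False by (auto simp: expo_def)
      then show "Poly_Mapping.lookup (Poly_Mapping.single b a) (fst p) * Poly_Mapping.lookup P (snd p) = 0"
        by (simp add: lookup_single)
    qed
    then show ?thesis
      unfolding nbhd_ideal_expo mem_Collect_eq using Idl(1) by (intro bexI [of _ 0]) simp_all
  qed
next
  fix c and a :: 'k assume "c \<notin> expo N m"
  then have "\<forall>e\<in>expo N m. Poly_Mapping.lookup (Poly_Mapping.single c a) e = 0"
    by (auto simp: lookup_single when_def)
  then show "Poly_Mapping.single c a \<in> nbhd_ideal N m Idl"
    unfolding nbhd_ideal_expo mem_Collect_eq using Idl(1) by (intro bexI [of _ 0]) simp_all
qed

section \<open>The Kuranishi series\<close>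

lemma in_coset_iff: "v \<in> {x} + B \<longleftrightarrow> (\<exists>b\<in>B. v = x + b)"
  by (auto simp: set_plus_def)

context covered_bundle
begin

lemma subspace_C: "module.subspace ks (C n)"
proof -
  interpret vector_space ks by (rule vector_space_ks)
  show ?thesis unfolding subspace_def using cochains_add cochains_scale cochains_0 by blast
qed

lemma coboundaries_Suc: "coboundaries S r E nab I U (Suc n) = DD ` C n"
  by (simp add: coboundaries_def)

text \<open>A functional \<open>\<psi>\<close> that vanishes on coboundaries is constant on classes,
  so evaluating it at a chosen representative gives a well-defined \<open>\<phi>\<close>. Both are
  returned: \<open>\<phi>\<close> is what enters the ideal, while \<open>\<psi>\<close> can be moved
  through sums of cochains.\<close>

lemma class_functional:
  assumes y: "y \<in> cocycles S r E nab I U 2" "y \<notin> DD ` C 1"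
  obtains \<phi> \<psi> where
    "\<phi> \<in> class_functionals (emb X) (coboundaries S r E nab I U 2) (hypercoh S r E nab I U 2)"
    "\<And>x. x \<in> cocycles S r E nab I U 2 \<Longrightarrow> \<phi> ({x} + coboundaries S r E nab I U 2) = \<psi> x"
    "\<And>x x'. \<psi> (x + x') = \<psi> x + \<psi> x'" "\<And>a x. \<psi> (ks a x) = a * \<psi> x" "\<psi> y = 1"
proof -
  interpret vector_space ks by (rule vector_space_ks)
  let ?B = "coboundaries S r E nab I U 2" and ?H = "hypercoh S r E nab I U 2"
  have B: "?B = DD ` C 1" using coboundaries_Suc [of 1] by (simp add: numeral_2_eq_2)
  have sub: "subspace (DD ` C 1)"
    unfolding subspace_def
  proof (intro conjI ballI allI)
    have "DD (ks 0 0) = ks 0 (DD 0)" by (rule DD_scale)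
    then have "DD 0 = 0" by simp
    then show "0 \<in> DD ` C 1" using cochains_0 by (metis imageI)
    fix x x' a assume "x \<in> DD ` C 1" "x' \<in> DD ` C 1"
    then obtain w w' where w: "w \<in> C 1" "x = DD w" "w' \<in> C 1" "x' = DD w'" by blast
    show "x + x' \<in> DD ` C 1" using DD_add [of w w'] cochains_add [OF w(1,3)] w(2,4) by (metis imageI)
    show "ks a x \<in> DD ` C 1" using DD_scale [of a w] cochains_scale [OF w(1)] w(2) by (metis imageI)
  qed
  obtain \<psi> where \<psi>: "\<And>x x'. \<psi> (x + x') = \<psi> x + \<psi> x'" "\<And>a x. \<psi> (ks a x) = a * \<psi> x"
    "\<And>w. w \<in> DD ` C 1 \<Longrightarrow> \<psi> w = 0" "\<psi> y = 1"
    by (rule separating_functional [OF sub y(2)]) (rule that; assumption)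
  define \<phi> where "\<phi> w = \<psi> (SOME x. x \<in> w)" for w
  have \<phi>: "\<phi> w = k" if "x \<in> w" "\<And>x. x \<in> w \<Longrightarrow> \<psi> x = k" for w x k
    unfolding \<phi>_def using that by (metis someI)
  have B0: "0 \<in> ?B" unfolding B using sub by (rule subspace_0)
  have val: "\<psi> v = \<psi> x" if v: "v \<in> {x} + ?B" for v x
  proof -
    obtain b where "v = x + b" "b \<in> ?B" using v unfolding in_coset_iff by blast
    then show ?thesis using \<psi>(1,3) B by simp
  qed
  have mem: "x \<in> {x} + ?B" for x using set_plus_intro [of x "{x}" 0 ?B] B0 by simp
  have cls: "\<phi> ({x} + ?B) = \<psi> x" for x by (rule \<phi> [OF mem]) (rule val)
  have "\<phi> \<in> class_functionals (emb X) ?B ?H"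
    unfolding class_functionals_def mem_Collect_eq
  proof (intro conjI ballI allI)
    fix w w' assume "w \<in> ?H" "w' \<in> ?H"
    then obtain x x' where w: "w = {x} + ?B" "w' = {x'} + ?B" unfolding hypercoh_def by blast
    have "\<phi> (w + w') = \<psi> x + \<psi> x'"
    proof (rule \<phi>)
      show "x + x' \<in> w + w'" unfolding w using mem by (intro set_plus_intro)
      fix v assume "v \<in> w + w'"
      then obtain s t where "v = s + t" "s \<in> w" "t \<in> w'" unfolding set_plus_def by blast
      then show "\<psi> v = \<psi> x + \<psi> x'" using \<psi>(1) val unfolding w by simp
    qed
    then show "\<phi> (w + w') = \<phi> w + \<phi> w'" unfolding w cls .
  next
    fix a w assume "w \<in> ?H"
    then obtain x where w: "w = {x} + ?B" unfolding hypercoh_def by blast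
    have cs: "class_scale (emb X) ?B a w = ks a ` w + ?B"
      by (simp add: class_scale_def sc_def [abs_def])
    have "\<phi> (class_scale (emb X) ?B a w) = a * \<psi> x"
      unfolding cs
    proof (rule \<phi>)
      show "ks a x + 0 \<in> ks a ` w + ?B" unfolding w using mem B0 by (intro set_plus_intro imageI)
      fix v assume "v \<in> ks a ` w + ?B"
      then obtain s t where "v = ks a s + t" "s \<in> w" "t \<in> ?B" unfolding set_plus_def by blast
      then show "\<psi> v = a * \<psi> x" using \<psi>(1-3) val B unfolding w by simp
    qed
    then show "\<phi> (class_scale (emb X) ?B a w) = a * \<phi> w" unfolding w cls .
  qed
  then show ?thesis using that [of \<phi> \<psi>] cls \<psi> by blast
qed

end

theorem theorem4p8:
  fixes X :: "('k::alg_closed_field, 'f::field) pvariety"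
    and D :: "(nat \<Rightarrow> 'k) set set"
    and r :: nat
    and E :: "(nat \<Rightarrow> 'k) \<Rightarrow> (nat \<Rightarrow> 'f) set"
    and nab :: "('f, 'f) conn"
    and I :: "'i set"
    and U :: "'i \<Rightarrow> (nat \<Rightarrow> 'k) set"
    and N :: nat
    and \<delta> :: "nat \<Rightarrow> ('i, 'f) cochain set"
    and z :: "nat \<Rightarrow> ('i, 'f) cochain"
    and E1 :: "(nat \<Rightarrow> 'k) \<Rightarrow> (nat \<Rightarrow> 'f mpoly) set"
    and nab1 :: "('f, 'f mpoly) conn"
  defines "S \<equiv> log_space X D"
  defines "H \<equiv> hypercoh S r E nab I U"
    and "B \<equiv> coboundaries S r E nab I U"
  assumes "projective_variety X" and "smooth X"
    and "snc_divisor X D"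
    and "integrable_log_connection S r E nab"
    and "fine_cover X I U"
    and "class_basis (emb X) (B 1) (H 1) N \<delta>"
    and "\<forall>l<N. z l \<in> \<delta> l"
    and "first_order_deformation (log_space_times X D (nbhd_ideal N 1 {0}))
           r E nab I U N z E1 nab1"
  shows "\<exists>f :: (nat \<Rightarrow>\<^sub>0 nat) \<Rightarrow> ('i, 'f) cochain set.
     (\<forall>c. f c \<in> H 2) \<and>
     (\<forall>c. f c \<noteq> B 2 \<longrightarrow> Poly_Mapping.keys c \<subseteq> {..<N} \<and> mdeg c \<ge> 2) \<and>
     (let Id = series_ideal N {\<phi> \<circ> f | \<phi>. \<phi> \<in> class_functionals (emb X) (B 2) (H 2)}
      in \<forall>m\<ge>2. \<exists>Em nabm.
           integrable_log_connection (log_space_times X D (nbhd_ideal N m Id)) r Em nabm \<and>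
           (\<exists>\<theta>. conn_iso (log_space_times X D (nbhd_ideal N 1 {0})) r (points X)
                  (restrict_bundle (log_space_times X D (nbhd_ideal N 1 {0})) r Em) nabm
                  E1 nab1 \<theta>))"
proof -
  interpret cb: covered_bundle X D r E nab I U
    using assms(4,6-8) unfolding S_def by unfold_locales
  let ?C = "cochains (log_space X D) r E I U" and ?DD = "total_d (log_space X D) r nab I" and ?ks = "sc (emb X)"
  have HB: "H = hypercoh (log_space X D) r E nab I U" "B = coboundaries (log_space X D) r E nab I U"
    by (simp_all add: H_def B_def S_def)
  have B2: "B 2 = ?DD ` ?C 1" using cb.coboundaries_Suc [of 1] by (simp add: HB numeral_2_eq_2)
  \<comment> \<open>Every member of a class is a cocycle plus a coboundary, so any chosen
    representative of the basis class may start the recursion.\<close>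
  have z: "z l \<in> ?C 1 \<and> ?DD (z l) = 0" if "l < N" for l
  proof -
    have "\<delta> l \<in> H 1" "z l \<in> \<delta> l" using assms(9,10) that by (auto simp: class_basis_def)
    then obtain x where x: "x \<in> cocycles (log_space X D) r E nab I U 1" "z l \<in> {x} + B 1"
      unfolding HB hypercoh_def by blast
    have "B 1 = ?DD ` ?C 0" using cb.coboundaries_Suc [of 0] by (simp add: HB)
    then have "\<exists>b\<in>?DD ` ?C 0. z l = x + b" using x(2) by (simp only: in_coset_iff)
    then obtain y where y: "y \<in> ?C 0" "z l = x + ?DD y" by (elim bexE imageE) simp
    have "?DD y \<in> ?C 1" using cb.cochains_total_d [OF y(1)] by simp
    then show ?thesis using x(1) y cb.DD_DD [OF y(1)] by (simp add: cocycles_def cb.cochains_add cb.DD_add)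
  qed
  interpret mc: mc_algebra ?ks ?DD "cup r" "?C 1" "?C 2" N z
  proof (intro mc_algebra.intro cb.vector_space_ks mc_algebra_axioms.intro)
    fix x y w :: "('i, 'f) cochain" and a l
    show "?DD (x + y) = ?DD x + ?DD y" by (rule cb.DD_add)
    show "?DD (?ks a x) = ?ks a (?DD x)" by (rule cb.DD_scale)
    show "module.subspace ?ks (?C 1)" "module.subspace ?ks (?C 2)" by (rule cb.subspace_C)+
    show "?DD x \<in> ?C 2" if "x \<in> ?C 1" using cb.cochains_total_d [OF that] by (simp add: numeral_2_eq_2)
    show "?DD (?DD x) = 0" if "x \<in> ?C 1" using cb.DD_DD [OF that] by simp
    show "cup r (x + y) w = cup r x w + cup r y w" by (rule cup_add_left)
    show "cup r x (y + w) = cup r x y + cup r x w" by (rule cup_add_right)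
    show "cup r (?ks a x) y = ?ks a (cup r x y)" by (rule cb.cup_scale_left)
    show "cup r x (?ks a y) = ?ks a (cup r x y)" by (rule cb.cup_scale_right)
    show "cup r (cup r x y) w = cup r x (cup r y w)" by (rule cup_assoc)
    show "cup r x y \<in> ?C 2" if "x \<in> ?C 1" "y \<in> ?C 1" using that by (rule cb.cochains_cup)
    show "?DD (cup r x y) = cup r (?DD x) y - cup r x (?DD y)" if "x \<in> ?C 1" "y \<in> ?C 1"
      using that by (rule cb.DD_cup)
    show "z l \<in> ?C 1" "?DD (z l) = 0" if "l < N" using z [OF that] by auto
  qed
  show ?thesis
  proof (rule mc.mc_solution)
    fix gam cq
    assume gam: "gam 0 = 0" "\<And>l. l < N \<Longrightarrow> gam (Poly_Mapping.single l 1) = z l"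
      "\<And>c. \<not> Poly_Mapping.keys c \<subseteq> {..<N} \<Longrightarrow> gam c = 0" "\<And>c. gam c \<in> ?C 1"
      and cq: "\<And>c. cq c \<in> ?C 2" "\<And>c. ?DD (cq c) = 0"
        "\<And>c. \<not> (Poly_Mapping.keys c \<subseteq> {..<N} \<and> mdeg c \<ge> 2) \<Longrightarrow> cq c = 0"
      and sol: "\<And>\<Lambda> m la. (\<And>la b. la \<in> \<Lambda> \<Longrightarrow> (\<lambda>c. la (c + b)) \<in> \<Lambda>) \<Longrightarrow> (\<And>la c. la \<in> \<Lambda> \<Longrightarrow> la c \<noteq> 0 \<Longrightarrow> c \<in> expo N m) \<Longrightarrow>
        (\<And>la. la \<in> \<Lambda> \<Longrightarrow> (\<Sum>c\<in>expo N m. ?ks (la c) (cq c)) \<in> ?DD ` ?C 1) \<Longrightarrow> la \<in> \<Lambda> \<Longrightarrow>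
        (\<Sum>c\<in>expo N m. ?ks (la c) (?DD (gam c) + mc.conv gam gam c)) = 0"
    have cocyc: "cq c \<in> cocycles (log_space X D) r E nab I U 2" for c
      using cq(1,2) by (simp add: cocycles_def)
    have B0: "{0} + B 2 = B 2" by (simp add: set_plus_def)
    define f where "f c = {cq c} + B 2" for c
    have f_low: "f c = B 2" if "\<not> (Poly_Mapping.keys c \<subseteq> {..<N} \<and> mdeg c \<ge> 2)" for c
      using cq(3) [OF that] by (simp only: f_def B0)
    define GG where "GG = {\<phi> \<circ> f | \<phi>. \<phi> \<in> class_functionals (emb X) (B 2) (H 2)}"
    define Idl where "Idl = series_ideal N GG"
    have f_H: "f c \<in> H 2" for c
      using cocyc [of c] unfolding HB hypercoh_def f_def by blast
    have B2H: "B 2 \<in> H 2"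
      using f_H [of 0] f_low [of 0] by simp
    \<comment> \<open>The zero class is 0 times itself, so homogeneity forces the value 0
      there.\<close>
    have \<phi>_B: "\<phi> (B 2) = 0" if "\<phi> \<in> class_functionals (emb X) (B 2) (H 2)" for \<phi>
    proof -
      have "(\<lambda>z l i j vs. emb X 0 * z l i j vs) ` B 2 = {0}"
        using B2 cb.cochains_0 [of 1] by (auto simp: zero_fun_def)
      then have "class_scale (emb X) (B 2) 0 (B 2) = B 2" by (simp add: class_scale_def B0)
      moreover have "\<phi> (class_scale (emb X) (B 2) 0 (B 2)) = 0 * \<phi> (B 2)"
        using that B2H unfolding class_functionals_def by blast
      ultimately show ?thesis by simp
    qed
    have GG_low: "g b = 0" if g: "g \<in> GG" "mdeg b \<le> 1" for g b
    proof -
      obtain \<phi> where \<phi>: "g = \<phi> \<circ> f" "\<phi> \<in> class_functionals (emb X) (B 2) (H 2)"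
        using g(1) unfolding GG_def by blast
      have "f b = B 2" by (rule f_low) (use g(2) in simp)
      then show ?thesis using \<phi>_B [OF \<phi>(2)] \<phi>(1) by simp
    qed
    \<comment> \<open>The generators start in degree 2 and multiplication cannot lower degrees; this
      gives the inclusion of \<open>W\<^sub>1\<close> in \<open>V\<^sub>m\<close>.\<close>
    have Id_low: "g c = 0" if g: "g \<in> Idl" "mdeg c \<le> 1" for g c
    proof -
      obtain T h where T: "g = (\<Sum>g\<in>T. series_mult (h g) g)" "T \<subseteq> GG"
        using g(1) unfolding Idl_def series_ideal_def by blast
      have "series_mult (h g') g' c = 0" if "g' \<in> T" for g'
        unfolding series_mult_splits
      proof (intro sum.neutral ballI)
        fix p assume "p \<in> splits c"
        then have "mdeg (snd p) \<le> 1" using \<open>mdeg c \<le> 1\<close> by (auto simp: splits_def mdeg_add)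
        then show "h g' (fst p) * g' (snd p) = 0" using GG_low T(2) that by auto
      qed
      then show ?thesis unfolding T(1) sum_fun_apply by (intro sum.neutral) simp
    qed
    have main: "\<exists>Em nabm. integrable_log_connection (log_space_times X D (nbhd_ideal N m Idl)) r Em nabm \<and>
             (\<exists>\<theta>. conn_iso (log_space_times X D (nbhd_ideal N 1 {0})) r (points X)
                    (restrict_bundle (log_space_times X D (nbhd_ideal N 1 {0})) r Em) nabm
                    E1 nab1 \<theta>)" if m: "m \<ge> 2" for m
    proof -
      let ?J = "nbhd_ideal N m Idl" and ?J1 = "nbhd_ideal N 1 {0} :: 'k mpoly set"
      interpret th: thickening X D r E nab I U ?J N m
        unfolding Idl_def by (intro cb.thickening_nbhd series_ideal_zero series_ideal_add series_ideal_mult)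
      have th1: "thickening X D r E nab I U ?J1 N 1"
        by (intro cb.thickening_nbhd) simp_all
      obtain p where "p \<in> points X" using cb.points_nonempty by blast
      then obtain a0 where a0: "a0 \<in> I" using assms(8) unfolding fine_cover_def by blast
      \<comment> \<open>If the paired obstruction were not a coboundary, some \<open>\<psi>\<close>
        vanishing on coboundaries would take the value 1 on it. The truncation \<open>?P\<close> of
        the corresponding generator \<open>\<phi> \<circ> f\<close> lies in \<open>?J\<close>, so
        the functional behind \<open>la\<close> kills it; but its value on \<open>?P\<close> is
        again \<open>\<psi>\<close> of the paired obstruction.\<close>
      have obs: "(\<Sum>c\<in>expo N m. ?ks (la c) (cq c)) \<in> ?DD ` ?C 1" if la: "la \<in> th.annih" for la
      proof (rule ccontr)
        let ?y = "\<Sum>c\<in>expo N m. ?ks (la c) (cq c)"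
        assume yn: "?y \<notin> ?DD ` ?C 1"
        have yc: "?y \<in> cocycles (log_space X D) r E nab I U 2"
          unfolding cocycles_def mem_Collect_eq
        proof
          show "?y \<in> ?C 2" by (intro mc.subspace_sum mc.C2 mc.subspace_scale cq(1))
          show "?DD ?y = 0"
            unfolding mc.D_sum mc.D_scale cq(2) by (intro sum.neutral ballI) simp
        qed
        show False
        proof (rule cb.class_functional [OF yc yn])
          fix \<phi> \<psi>
          assume \<phi>0: "\<phi> \<in> class_functionals (emb X) (coboundaries (log_space X D) r E nab I U 2) (hypercoh (log_space X D) r E nab I U 2)"
            "\<And>x. x \<in> cocycles (log_space X D) r E nab I U 2 \<Longrightarrow> \<phi> ({x} + coboundaries (log_space X D) r E nab I U 2) = \<psi> x"
            and \<psi>: "\<And>x x'. \<psi> (x + x') = \<psi> x + \<psi> x'" "\<And>a x. \<psi> (?ks a x) = a * \<psi> x" "\<psi> ?y = 1"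
          note \<phi> = \<phi>0 [folded HB]
          have \<phi>f: "(\<phi> \<circ> f) c = \<psi> (cq c)" for c using \<phi>(2) [OF cocyc] by (simp add: f_def)
          let ?P = "\<Sum>c\<in>expo N m. Poly_Mapping.single c (\<psi> (cq c))"
          have "\<phi> \<circ> f \<in> Idl" unfolding Idl_def using \<phi>(1) by (intro series_ideal_gen) (auto simp: GG_def)
          moreover have "Poly_Mapping.lookup ?P c = (\<phi> \<circ> f) c" if "c \<in> expo N m" for c
            using that by (simp only: \<phi>f) (simp add: lookup_sum lookup_single when_def finite_expo)
          ultimately have "?P \<in> ?J" unfolding nbhd_ideal_expo by blast
          moreover obtain \<chi> where \<chi>: "la = (\<lambda>c. \<chi> (Poly_Mapping.single c 1))" "\<And>P Q. \<chi> (P + Q) = \<chi> P + \<chi> Q"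
            "\<And>a P. \<chi> (Poly_Mapping.single 0 a * P) = a * \<chi> P" "\<And>P. P \<in> ?J \<Longrightarrow> \<chi> P = 0"
            using la unfolding th.annih_def by blast
          ultimately have "0 = (\<Sum>c\<in>expo N m. \<psi> (cq c) * la c)"
            using th.functional_expo [OF \<chi>(2,3), of "\<lambda>c. \<psi> (cq c)" "expo N m"] by (simp add: \<chi>(1))
          moreover have "\<psi> ?y = (\<Sum>c\<in>expo N m. la c * \<psi> (cq c))"
          proof -
            have "\<psi> 0 = 0" using \<psi>(2) [of 0 0] by simp
            then have "\<psi> (\<Sum>c\<in>A. ?ks (la c) (cq c)) = (\<Sum>c\<in>A. la c * \<psi> (cq c))" for A
              by (induction A rule: infinite_finite_induct)
                (simp_all only: sum.infinite sum.empty sum.insert not_False_eq_True \<psi>(1,2))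
            then show ?thesis .
        qed
        ultimately show False using \<psi>(3) by (simp add: mult.commute)
        qed
      qed
      \<comment> \<open>The family of functionals in \<open>sol\<close> is taken to be the whole
        annihilator of \<open>?J\<close>, which is closed under shifts and supported on
        \<open>expo N m\<close>.\<close>
      interpret mt: mc_thickening X D r E nab I U ?J N m gam a0
      proof unfold_locales
        fix la assume "la \<in> th.annih"
        then show "(\<Sum>c\<in>expo N m. ?ks (la c) (?DD (gam c) + (\<Sum>p\<in>splits c. cup r (gam (fst p)) (gam (snd p))))) = 0"
          using sol [of th.annih m la, OF th.annih_shift th.annih_supp obs] unfolding mc.conv_def by simp
      qed (use gam a0 in auto)
      have "?J \<subseteq> ?J1"
      proof
        fix P assume "P \<in> ?J"
        then obtain g where g: "g \<in> Idl" "\<forall>c\<in>expo N m. Poly_Mapping.lookup P c = g c" unfolding nbhd_ideal_expo by blast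
        have "Poly_Mapping.lookup P c = 0" if "c \<in> expo N 1" for c
          using g(2) Id_low [OF g(1), of c] that m by (auto simp: expo_def)
        then show "P \<in> ?J1" unfolding nbhd_ideal_expo by simp
      qed
      then have "\<exists>\<theta>. conn_iso (log_space_times X D ?J1) r (points X)
          (restrict_bundle (log_space_times X D ?J1) r mt.Em) mt.nabm E1 nab1 \<theta>"
        using m gam(2) assms(11) by (intro mt.first_order_restriction [OF th1, where z = z]) simp_all
      then show ?thesis using mt.integrable_log_connection_nabm by blast
    qed
    show ?thesis
      unfolding Let_def
    proof (intro exI [of _ f] conjI allI impI)
      show "f c \<in> H 2" for c by (rule f_H)
      show "Poly_Mapping.keys c \<subseteq> {..<N}" "2 \<le> mdeg c" if "f c \<noteq> B 2" for c
        using f_low [of c] that by blast+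
    qed (rule main [unfolded Idl_def GG_def])
  qed
qed

end
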